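(* Consider the high-dimensional linear model with independent covariates described in the context, with limiting ratio $p/n\to\kappa$, noise variance $\sigma^2$ and $\sqrt n\beta_j$ i.i.d. with the law of $B_0\sim\gamma\delta_0+(1-\gamma)\pi_1$. For Lebesgue-almost-every $q\in(0,1)$, the knockoffs procedure at level $q$ with $\tilde{\mathbf X}$ an i.i.d. copy of $\mathbf X$ and antisymmetric function $f(x,y)=x-y$ has the following one-sided effective $\pi_\mu$ with respect to the AdaPT procedure at level $q$: 1. With the marginal covariance statistic, the effective $\pi_\mu$ is the distribution of $\dfrac{1}{\sqrt{2(\sigma^2+\kappa\mathbb E[B_0^2])}}\,B_0$. 2. With the OLS statistic, assuming $\kappa<1/2$, the effective $\pi_\mu$ is the distribution of $\dfrac{\sqrt{1-2\kappa}}{\sqrt{2\sigma^2}}\,B_0$.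
   Context: **Model.** For each $n$, $p=p_n$ with $p/n\to\kappa\in(0,\infty)$; $\mathbf X\in\mathbb R^{n\times p}$ has i.i.d. $\mathcal N(0,1)$ entries; $\mathbf Y=\mathbf X\beta+\varepsilon$ with $\varepsilon\sim\mathcal N(0,\sigma^2I_n)$ independent of $\mathbf X$, $\sigma^2>0$ fixed; $\sqrt n\beta_j$ are i.i.d. $\gamma\delta_0+(1-\gamma)\pi_1$, where $\gamma\in(0,1)$ and $\pi_1$ are fixed, $\pi_1$ has bounded support and no mass at $0$, and $\beta$ is independent of $(\mathbf X,\varepsilon)$. $B_0$ denotes a random variable with law $\gamma\delta_0+(1-\gamma)\pi_1$. Variable $j$ is null if $\beta_j=0$. **Knockoffs procedure.** $\tilde{\mathbf X}$ is an i.i.d. copy of $\mathbf X$, independent of $(\mathbf X,\mathbf Y)$. From statistics $T_j,\tilde T_j$ compute $W_j=f(T_j,\tilde T_j)$, $j=1,\dots,p$. The selected set is $\hat S=\{j:W_j\ge\hat w\}$, where $$\hat w=\min\Big\{w>0:\frac{1+|\{j:W_j\le-w\}|}{|\{j:W_j\ge w\}|}\le q\Big\},$$ the minimum being over $w\in\{|W_j|:W_j\ne0,\ 1\le j\le p\}$ (nothing is selected if no such $w$ exists). Marginal covariance statistic: $T_j=n^{-1}\mathbf X_j^\top\mathbf Y$, $\tilde T_j=n^{-1}\tilde{\mathbf X}_j^\top\mathbf Y$ (columns). OLS statistic: $T_j=\hat\beta_j$, $\tilde T_j=\hat\beta_{j+p}$, where $\hat\beta\in\mathbb R^{2p}$ is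 the least squares coefficient of $\mathbf Y$ on $[\mathbf X,\tilde{\mathbf X}]$. **AdaPT at level $q$** applied to $p_1,\dots,p_p$ rejects all $j$ with $p_j\le\hat t$, where $\hat t=\max\{t\in[0,1]:\ (1+\#\{j:p_j\ge1-t\})/\#\{j:p_j\le t\}\le q\}$ (read as a supremum if not attained; no rejections if the set is empty). **FDP and realized power.** For a selected set $\hat S$ and the set $S_0$ of nulls, $\mathrm{FDP}=|\hat S\cap S_0|/\max(|\hat S|,1)$; the realized power is the proportion of non-nulls that are selected. **Effective $\pi_\mu$.** For a multiple testing procedure $\mathcal P$ taking $p$-values as input, let $\mathcal P(\pi_\mu)$ be the procedure applying $\mathcal P$ to $p$-values in the independent normal means model: for $j=1,\dots,p$, $\mu_j$ i.i.d. $\pi_\mu$, $\varepsilon_j$ i.i.d. $\mathcal N(0,1)$ independent of the $\mu_j$'s, $\mathrm{pval}_j=1-\Phi(\mu_j+\varepsilon_j)$, with index $j$ null when $\mu_j=0$ ($\Phi$ is the CDF of $\mathcal N(0,1)$). A variable selection procedure has one-sided effective $\pi_\mu$ with respect to $\mathcal P$ if, as $p\to\infty$, (a) its realized power converges in probability to the same constant that the realized power of $\mathcal P(\pi_\mu)$ converges in probability to; and (b) when this asymptotic realized power is positive, its FDP converges in probability to the same constant that the FDP of $\mathcal P(\pi_\mu)$ converges in probability to.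
   Formalization: With t over all of [0,1] the claim fails for some intervals of q (AdaPT may pick t>1/2, knockoffs cannot). Proved: the claim for AdaPT with t in [0,1/2], and for t in [0,1] whenever AdaPT's admissible thresholds are at most 1/2 with probability tending to 1. *)

theory Defs
  imports "HOL-Probability.Probability"
begin

text \<open>
  Variables and hypotheses are indexed by \<open>{..<p}\<close>, observations by \<open>{..<n}\<close>. Matrices and vectors
  are functions whose entries outside the index range are irrelevant.
\<close>

section \<open>Convergence in probability\<close>

text \<open>The variables may live on different probability spaces. Measurability is part of the notion,
  because \<^const>\<open>measure\<close> returns 0 on non-measurable sets.\<close>

definition converges_in_prob ::
    "(nat \<Rightarrow> 'a measure) \<Rightarrow> (nat \<Rightarrow> 'a \<Rightarrow> real) \<Rightarrow> real \<Rightarrow> bool" where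
  "converges_in_prob M Z c \<longleftrightarrow>
     (\<forall>\<^sub>F n in sequentially. Z n \<in> borel_measurable (M n)) \<and>
     (\<forall>e>0. (\<lambda>n. measure (M n) {\<omega> \<in> space (M n). \<bar>Z n \<omega> - c\<bar> > e}) \<longlonglongrightarrow> 0)"

section \<open>Performance of a selected set\<close>

definition fdp :: "nat set \<Rightarrow> nat set \<Rightarrow> real" where
  "fdp S S0 = real (card (S \<inter> S0)) / real (max (card S) 1)"

text \<open>If there are no non-nulls, this is 0 by the convention for division by zero.\<close>

definition realized_power :: "nat \<Rightarrow> nat set \<Rightarrow> nat set \<Rightarrow> real" where
  "realized_power p S S0 = real (card (S \<inter> ({..<p} - S0))) / real (card ({..<p} - S0))"

section \<open>Multiple testing procedures and AdaPT\<close>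

type_synonym testing_procedure = "nat \<Rightarrow> (nat \<Rightarrow> real) \<Rightarrow> nat set"

text \<open>The conjunct requiring a \<open>p\<close>-value below \<open>t\<close> excludes a zero denominator.\<close>

definition adapt_admissible :: "real \<Rightarrow> real \<Rightarrow> nat \<Rightarrow> (nat \<Rightarrow> real) \<Rightarrow> real set" where
  "adapt_admissible tmax q m pv =
     {t \<in> {0..tmax}. (\<exists>j<m. pv j \<le> t) \<and>
        (1 + real (card {j. j < m \<and> pv j \<ge> 1 - t})) / real (card {j. j < m \<and> pv j \<le> t}) \<le> q}"

text \<open>
  AdaPT with threshold range \<open>[0, tmax]\<close>. The mirror estimate counts \<open>p\<close>-values in \<open>[1 - t, 1]\<close> to
  estimate the number of nulls in \<open>[0, t]\<close>; these regions overlap when \<open>t > 1/2\<close>. The range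
  \<open>tmax = 1/2\<close> corresponds to the knockoff filter, whose thresholds \<open>w > 0\<close> match
  \<open>t = 1 - \<Phi>(w) < 1/2\<close>; the range \<open>tmax = 1\<close> is the unrestricted one.
\<close>

definition adapt :: "real \<Rightarrow> real \<Rightarrow> testing_procedure" where
  "adapt tmax q m pv =
     {j. j < m \<and> adapt_admissible tmax q m pv \<noteq> {} \<and> pv j \<le> Sup (adapt_admissible tmax q m pv)}"

section \<open>The normal means model and effective \<open>\<pi>\<^sub>\<mu>\<close>\<close>

text \<open>The \<open>j\<close>-th coordinate of a sample point is the pair \<open>(\<mu>\<^sub>j, \<epsilon>\<^sub>j)\<close>.\<close>

definition normal_means :: "real measure \<Rightarrow> nat \<Rightarrow> (nat \<Rightarrow> real \<times> real) measure" where
  "normal_means pi_mu m = PiM {..<m} (\<lambda>_. pi_mu \<Otimes>\<^sub>M std_normal_distribution)"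

definition means_pval :: "(nat \<Rightarrow> real \<times> real) \<Rightarrow> nat \<Rightarrow> real" where
  "means_pval \<omega> j = 1 - cdf std_normal_distribution (fst (\<omega> j) + snd (\<omega> j))"

definition means_nulls :: "nat \<Rightarrow> (nat \<Rightarrow> real \<times> real) \<Rightarrow> nat set" where
  "means_nulls m \<omega> = {j. j < m \<and> fst (\<omega> j) = 0}"

text \<open>
  \<open>Shat n \<omega>\<close> and \<open>S0 n \<omega>\<close> are the selected set and the set of nulls of a variable selection problem
  with \<open>p n\<close> variables on the probability space \<open>M n\<close>.
\<close>

definition one_sided_effective ::
    "(nat \<Rightarrow> 'a measure) \<Rightarrow> (nat \<Rightarrow> nat) \<Rightarrow> (nat \<Rightarrow> 'a \<Rightarrow> nat set) \<Rightarrow> (nat \<Rightarrow> 'a \<Rightarrow> nat set) \<Rightarrow>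
     testing_procedure \<Rightarrow> real measure \<Rightarrow> bool" where
  "one_sided_effective M p Shat S0 P pi_mu \<longleftrightarrow>
     (\<exists>c. converges_in_prob M (\<lambda>n \<omega>. realized_power (p n) (Shat n \<omega>) (S0 n \<omega>)) c \<and>
          converges_in_prob (normal_means pi_mu)
            (\<lambda>m \<omega>. realized_power m (P m (means_pval \<omega>)) (means_nulls m \<omega>)) c \<and>
          (c > 0 \<longrightarrow>
            (\<exists>d. converges_in_prob M (\<lambda>n \<omega>. fdp (Shat n \<omega>) (S0 n \<omega>)) d \<and>
                 converges_in_prob (normal_means pi_mu)
                   (\<lambda>m \<omega>. fdp (P m (means_pval \<omega>)) (means_nulls m \<omega>)) d)))"

text \<open>With probability tending to 1, unrestricted AdaPT makes no use of thresholds above \<open>1/2\<close>.\<close>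

definition adapt_le_half :: "real \<Rightarrow> real measure \<Rightarrow> bool" where
  "adapt_le_half q pi_mu \<longleftrightarrow>
     (\<lambda>m. measure (normal_means pi_mu m)
        {\<omega> \<in> space (normal_means pi_mu m). adapt_admissible 1 q m (means_pval \<omega>) \<subseteq> {0..1/2}})
     \<longlonglongrightarrow> 1"

section \<open>The knockoffs procedure\<close>

definition knockoff_thresholds :: "real \<Rightarrow> nat \<Rightarrow> (nat \<Rightarrow> real) \<Rightarrow> real set" where
  "knockoff_thresholds q p W =
     {w \<in> {\<bar>W j\<bar> | j. j < p \<and> W j \<noteq> 0}. (\<exists>j<p. W j \<ge> w) \<and>
        (1 + real (card {j. j < p \<and> W j \<le> - w})) / real (card {j. j < p \<and> W j \<ge> w}) \<le> q}"

definition knockoff_filter :: "real \<Rightarrow> nat \<Rightarrow> (nat \<Rightarrow> real) \<Rightarrow> nat set" where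
  "knockoff_filter q p W =
     {j. j < p \<and> knockoff_thresholds q p W \<noteq> {} \<and> W j \<ge> Min (knockoff_thresholds q p W)}"

text \<open>A statistic maps \<open>n\<close>, \<open>p\<close>, the design, its knockoff copy and the response to the pair of
  families \<open>(T, T~)\<close>.\<close>

type_synonym knockoff_statistic =
  "nat \<Rightarrow> nat \<Rightarrow> (nat \<Rightarrow> nat \<Rightarrow> real) \<Rightarrow> (nat \<Rightarrow> nat \<Rightarrow> real) \<Rightarrow> (nat \<Rightarrow> real) \<Rightarrow>
   (nat \<Rightarrow> real) \<times> (nat \<Rightarrow> real)"

definition knockoffs ::
    "knockoff_statistic \<Rightarrow> (real \<Rightarrow> real \<Rightarrow> real) \<Rightarrow> real \<Rightarrow> nat \<Rightarrow> nat \<Rightarrow>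
     (nat \<Rightarrow> nat \<Rightarrow> real) \<Rightarrow> (nat \<Rightarrow> nat \<Rightarrow> real) \<Rightarrow> (nat \<Rightarrow> real) \<Rightarrow> nat set" where
  "knockoffs stat f q n p X Xt y =
     (let (T, Tt) = stat n p X Xt y in knockoff_filter q p (\<lambda>j. f (T j) (Tt j)))"

definition marginal_cov_stat :: knockoff_statistic where
  "marginal_cov_stat n p X Xt y =
     (\<lambda>j. (\<Sum>i<n. X i j * y i) / real n, \<lambda>j. (\<Sum>i<n. Xt i j * y i) / real n)"

definition rss :: "nat \<Rightarrow> nat \<Rightarrow> (nat \<Rightarrow> nat \<Rightarrow> real) \<Rightarrow> (nat \<Rightarrow> real) \<Rightarrow> (nat \<Rightarrow> real) \<Rightarrow> real" where
  "rss n d A y b = (\<Sum>i<n. (y i - (\<Sum>k<d. A i k * b k))\<^sup>2)"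

definition is_least_squares ::
    "nat \<Rightarrow> nat \<Rightarrow> (nat \<Rightarrow> nat \<Rightarrow> real) \<Rightarrow> (nat \<Rightarrow> real) \<Rightarrow> (nat \<Rightarrow> real) \<Rightarrow> bool" where
  "is_least_squares n d A y b \<longleftrightarrow> (\<forall>k\<ge>d. b k = 0) \<and> (\<forall>b'. rss n d A y b \<le> rss n d A y b')"

text \<open>The value 0 in the rank-deficient case is a convention; a Gaussian design with
  \<open>d \<le> n\<close> has full column rank almost surely.\<close>

definition least_squares ::
    "nat \<Rightarrow> nat \<Rightarrow> (nat \<Rightarrow> nat \<Rightarrow> real) \<Rightarrow> (nat \<Rightarrow> real) \<Rightarrow> nat \<Rightarrow> real" where
  "least_squares n d A y =
     (if \<exists>!b. is_least_squares n d A y b then THE b. is_least_squares n d A y b else (\<lambda>_. 0))"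

definition ols_stat :: knockoff_statistic where
  "ols_stat n p X Xt y =
     (let b = least_squares n (2 * p) (\<lambda>i k. if k < p then X i k else Xt i (k - p)) y
      in (\<lambda>j. b j, \<lambda>j. b (j + p)))"

section \<open>The linear model\<close>

definition spike_slab :: "real \<Rightarrow> real measure \<Rightarrow> real measure" where
  "spike_slab g pi1 =
     measure_pmf (bernoulli_pmf g) \<bind> (\<lambda>spike. if spike then return borel 0 else pi1)"

lemma emeasure_spike_slab:
  assumes "0 \<le> g" "g \<le> 1" "prob_space pi1" "sets pi1 = sets borel" "A \<in> sets borel"
  shows "emeasure (spike_slab g pi1) A = ennreal g * indicator A 0 + ennreal (1 - g) * emeasure pi1 A"
proof -
  have s: "(\<lambda>spike. if spike then return borel 0 else pi1)
      \<in> measurable (measure_pmf (bernoulli_pmf g)) (subprob_algebra (borel :: real measure))"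
    using assms by (auto simp: space_subprob_algebra prob_space_imp_subprob_space prob_space_return)
  have "emeasure (spike_slab g pi1) A =
      (\<integral>\<^sup>+ b. emeasure (if b then return borel 0 else pi1) A \<partial>measure_pmf (bernoulli_pmf g))"
    unfolding spike_slab_def by (rule emeasure_bind[OF _ s assms(5)]) simp
  also have "\<dots> = ennreal g * indicator A 0 + ennreal (1 - g) * emeasure pi1 A"
    using assms by (simp add: mult.commute)
  finally show ?thesis .
qed

text \<open>
  \<open>X \<omega>\<close> and \<open>Xt \<omega>\<close> are the \<open>n \<times> p\<close> design and its knockoff copy. All scalar entries of the
  design, the knockoff copy, the noise and the coefficients are jointly independent, hence so are
  the four blocks; \<open>nu\<close> is the common law of the \<open>sqrt n * beta\<^sub>j\<close>.
\<close>

locale knockoff_linear_model = prob_space M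
  for M :: "'a measure" +
  fixes n p :: nat
    and X Xt :: "'a \<Rightarrow> nat \<Rightarrow> nat \<Rightarrow> real"
    and eps beta :: "'a \<Rightarrow> nat \<Rightarrow> real"
    and sigma :: real
    and nu :: "real measure"
  assumes independent:
      "indep_vars (\<lambda>_. borel)
         (case_sum (\<lambda>(i, j) \<omega>. X \<omega> i j)
           (case_sum (\<lambda>(i, j) \<omega>. Xt \<omega> i j)
             (case_sum (\<lambda>i \<omega>. eps \<omega> i) (\<lambda>j \<omega>. beta \<omega> j))))
         (({..<n} \<times> {..<p}) <+> (({..<n} \<times> {..<p}) <+> ({..<n} <+> {..<p})))"
    and design: "\<lbrakk>i < n; j < p\<rbrakk> \<Longrightarrow> distributed M lborel (\<lambda>\<omega>. X \<omega> i j) std_normal_density"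
    and knockoff: "\<lbrakk>i < n; j < p\<rbrakk> \<Longrightarrow> distributed M lborel (\<lambda>\<omega>. Xt \<omega> i j) std_normal_density"
    and noise: "i < n \<Longrightarrow> distributed M lborel (\<lambda>\<omega>. eps \<omega> i) (normal_density 0 sigma)"
    and coefficients: "j < p \<Longrightarrow> distr M borel (\<lambda>\<omega>. sqrt (real n) * beta \<omega> j) = nu"

definition response ::
    "nat \<Rightarrow> (nat \<Rightarrow> nat \<Rightarrow> real) \<Rightarrow> (nat \<Rightarrow> real) \<Rightarrow> (nat \<Rightarrow> real) \<Rightarrow> nat \<Rightarrow> real" where
  "response p X beta eps i = (\<Sum>j<p. X i j * beta j) + eps i"

definition nulls :: "nat \<Rightarrow> (nat \<Rightarrow> real) \<Rightarrow> nat set" where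
  "nulls p beta = {j. j < p \<and> beta j = 0}"

end

theory Submission
  imports Defs
begin

text \<open>
  For two distinct variables \<open>j\<close> and \<open>k\<close>, the rescaled statistics \<open>s * sqrt n * W\<^sub>j\<close> and
  \<open>s * sqrt n * W\<^sub>k\<close> differ by a term that vanishes in probability from \<open>\<mu>\<^sub>j + h\<^sub>j\<close> and \<open>\<mu>\<^sub>k + h\<^sub>k\<close>,
  where the pairs \<open>(\<mu>\<^sub>j, h\<^sub>j)\<close> and \<open>(\<mu>\<^sub>k, h\<^sub>k)\<close> are independent with law \<open>\<pi>\<^sub>\<mu> \<times> N(0, 1)\<close>. By Chebyshev's
  inequality this pairwise statement already yields a law of large numbers for the numbers of nulls
  and non-nulls with \<open>W \<ge> w\<close>. The normal means model has the same limits, and the knockoff filter and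
  AdaPT are the same threshold rule, expressed in \<open>w\<close> and in \<open>t = 1 - \<Phi>(w)\<close>. Hence their thresholds
  have the same limit, unless the limiting ratio touches the level \<open>q\<close> without crossing it.

  The normal variable \<open>h\<^sub>j\<close> is the projection of the difference of column \<open>j\<close> and its knockoff copy,
  divided by \<open>sqrt 2\<close>, on a unit vector independent of the columns \<open>j\<close>, \<open>k\<close> and their copies. For the
  marginal covariance statistic this vector is the normalized response without the contributions of
  \<open>j\<close> and \<open>k\<close>. For least squares it is the normalized projection of the noise to the complement of the
  other \<open>2p - 4\<close> columns: after this projection the normal equations for the four remaining
  coefficients have a matrix close to \<open>n - 2p + 4\<close> times the identity.
\<close>

section \<open>Events of probability tending to one\<close>

text \<open>The statistics of different variables share one response and are dependent, which is why
  the proof handles two variables at a time. A linear form in independent standard normals with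
  coefficients of norm 1 is standard normal whatever the coefficients are. Conditioning on the unit
  vector therefore gives the exact joint law of the two projections, independent of each other and
  of the two means, without a central limit theorem. The constants come from normalization. The
  difference of two independent columns has variance 2 per entry; the response without two
  contributions has mean square tending to \<open>sigma\<^sup>2 + kappa * m2\<close>, where
  \<open>m2\<close> is the second moment of the coefficient law; and the complement of
  \<open>2 * p - 4\<close> columns has a dimension of order \<open>(1 - 2 * kappa) * n\<close>.
  AdaPT is compared on \<open>t \<le> 1/2\<close>, where positive thresholds correspond to levels
  \<open>w \<ge> 0\<close>. The unrestricted range is reduced to this one on the event that no
  admissible threshold exceeds 1/2. The levels excluded from "almost every \<open>q\<close>" are
  those at which a continuous ratio attains its minimum over an interval with rational
  endpoint.\<close>

text \<open>The exceptional set \<open>N\<close> spares measurability proofs for \<open>Q\<close>.\<close>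

definition whp :: "(nat \<Rightarrow> 'a measure) \<Rightarrow> (nat \<Rightarrow> 'a \<Rightarrow> bool) \<Rightarrow> bool" where
  "whp M Q \<longleftrightarrow> (\<forall>e>0. \<forall>\<^sub>F n in sequentially.
     \<exists>N\<in>sets (M n). measure (M n) N \<le> e \<and> (\<forall>\<omega>\<in>space (M n) - N. Q n \<omega>))"

text \<open>Convergence in probability without a measurability condition on \<open>Y\<close>, so
  that limits can be combined freely; \<open>converges_in_probI\<close> returns to the official
  notion.\<close>

definition cprob :: "(nat \<Rightarrow> 'a measure) \<Rightarrow> (nat \<Rightarrow> 'a \<Rightarrow> real) \<Rightarrow> real \<Rightarrow> bool" where
  "cprob M Y c \<longleftrightarrow> (\<forall>e>0. whp M (\<lambda>n \<omega>. \<bar>Y n \<omega> - c\<bar> < e))"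

text \<open>Stochastic boundedness, the condition on the second factor in Slutsky's lemma
  \<open>cprob_mult_tight\<close>.\<close>

definition tight_seq :: "(nat \<Rightarrow> 'a measure) \<Rightarrow> (nat \<Rightarrow> 'a \<Rightarrow> real) \<Rightarrow> bool" where
  "tight_seq M Y \<longleftrightarrow> (\<forall>e>0. \<exists>K>0. \<forall>\<^sub>F n in sequentially.
     \<exists>N\<in>sets (M n). measure (M n) N \<le> e \<and> (\<forall>\<omega>\<in>space (M n) - N. \<bar>Y n \<omega>\<bar> \<le> K))"

text \<open>Only eventual, because the linear model is specified for
  \<open>n \<ge> 1\<close>.\<close>

locale prob_seq =
  fixes M :: "nat \<Rightarrow> 'a measure"
  assumes ev_prob: "\<forall>\<^sub>F n in sequentially. prob_space (M n)"
begin

lemma whp_mp: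
  assumes "whp M Q" "\<forall>\<^sub>F n in sequentially. \<forall>\<omega>\<in>space (M n). Q n \<omega> \<longrightarrow> Q' n \<omega>"
  shows "whp M Q'"
  unfolding whp_def
proof (intro allI impI)
  fix e :: real assume "e > 0"
  then have "\<forall>\<^sub>F n in sequentially.
     \<exists>N\<in>sets (M n). measure (M n) N \<le> e \<and> (\<forall>\<omega>\<in>space (M n) - N. Q n \<omega>)"
    using assms(1) by (simp add: whp_def)
  then show "\<forall>\<^sub>F n in sequentially.
     \<exists>N\<in>sets (M n). measure (M n) N \<le> e \<and> (\<forall>\<omega>\<in>space (M n) - N. Q' n \<omega>)"
    using assms(2) by eventually_elim blast
qed

lemma whp_mono: "whp M Q \<Longrightarrow> (\<And>n \<omega>. Q n \<omega> \<Longrightarrow> Q' n \<omega>) \<Longrightarrow> whp M Q'"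
  by (erule whp_mp) auto

lemma whp_conj:
  assumes "whp M Q" "whp M R"
  shows "whp M (\<lambda>n \<omega>. Q n \<omega> \<and> R n \<omega>)"
  unfolding whp_def
proof (intro allI impI)
  fix e :: real assume "e > 0"
  then have e: "e/2 > 0" by simp
  have "\<forall>\<^sub>F n in sequentially.
     \<exists>N\<in>sets (M n). measure (M n) N \<le> e/2 \<and> (\<forall>\<omega>\<in>space (M n) - N. Q n \<omega>)"
    using assms(1) e unfolding whp_def by blast
  moreover have "\<forall>\<^sub>F n in sequentially.
     \<exists>N\<in>sets (M n). measure (M n) N \<le> e/2 \<and> (\<forall>\<omega>\<in>space (M n) - N. R n \<omega>)"
    using assms(2) e unfolding whp_def by blast
  ultimately show "\<forall>\<^sub>F n in sequentially.
     \<exists>N\<in>sets (M n). measure (M n) N \<le> e \<and> (\<forall>\<omega>\<in>space (M n) - N. Q n \<omega> \<and> R n \<omega>)"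
    using ev_prob
  proof eventually_elim
    case (elim n)
    then interpret prob_space "M n" by simp
    from elim(1) obtain N1 where N1: "N1 \<in> sets (M n)" "measure (M n) N1 \<le> e/2"
      "\<forall>\<omega>\<in>space (M n) - N1. Q n \<omega>" by blast
    from elim(2) obtain N2 where N2: "N2 \<in> sets (M n)" "measure (M n) N2 \<le> e/2"
      "\<forall>\<omega>\<in>space (M n) - N2. R n \<omega>" by blast
    have "measure (M n) (N1 \<union> N2) \<le> e"
      using measure_Un_le[of N1 "M n" N2] N1(1,2) N2(1,2) by simp
    with N1 N2 show ?case by (intro bexI[of _ "N1 \<union> N2"]) auto
  qed
qed

lemma whp_always:
  assumes "\<forall>\<^sub>F n in sequentially. \<forall>\<omega>\<in>space (M n). Q n \<omega>"
  shows "whp M Q"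
  unfolding whp_def
proof (intro allI impI)
  fix e :: real assume "e > 0"
  show "\<forall>\<^sub>F n in sequentially.
     \<exists>N\<in>sets (M n). measure (M n) N \<le> e \<and> (\<forall>\<omega>\<in>space (M n) - N. Q n \<omega>)"
    using assms by eventually_elim (use \<open>e > 0\<close> in \<open>auto intro!: bexI[of _ "{}"]\<close>)
qed

lemma whp_AE:
  assumes "\<forall>\<^sub>F n in sequentially. AE \<omega> in M n. Q n \<omega>"
  shows "whp M Q"
  unfolding whp_def
proof (intro allI impI)
  fix e :: real assume "e > 0"
  show "\<forall>\<^sub>F n in sequentially.
     \<exists>N\<in>sets (M n). measure (M n) N \<le> e \<and> (\<forall>\<omega>\<in>space (M n) - N. Q n \<omega>)"
    using assms
  proof eventually_elim
    case (elim n)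
    then obtain N where "{\<omega> \<in> space (M n). \<not> Q n \<omega>} \<subseteq> N" "emeasure (M n) N = 0" "N \<in> sets (M n)"
      by (auto elim!: AE_E)
    then show ?case using \<open>e > 0\<close> by (intro bexI[of _ N]) (auto simp: measure_def)
  qed
qed

lemma whpI_bound:
  assumes "\<forall>\<^sub>F n in sequentially. {\<omega>\<in>space (M n). \<not> Q n \<omega>} \<in> sets (M n)"
    and "\<forall>\<^sub>F n in sequentially. measure (M n) {\<omega>\<in>space (M n). \<not> Q n \<omega>} \<le> b n"
    and "b \<longlonglongrightarrow> 0"
  shows "whp M Q"
  unfolding whp_def
proof (intro allI impI)
  fix e :: real assume "e > 0"
  with assms(3) have "\<forall>\<^sub>F n in sequentially. b n < e"
    by (rule order_tendstoD)
  with assms(1,2) show "\<forall>\<^sub>F n in sequentially.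
     \<exists>N\<in>sets (M n). measure (M n) N \<le> e \<and> (\<forall>\<omega>\<in>space (M n) - N. Q n \<omega>)"
  proof eventually_elim
    case (elim n)
    then show ?case by (intro bexI[of _ "{\<omega>\<in>space (M n). \<not> Q n \<omega>}"]) auto
  qed
qed

lemma whp_measure_tendsto_0:
  assumes "whp M Q" "\<forall>\<^sub>F n in sequentially. {\<omega>\<in>space (M n). \<not> Q n \<omega>} \<in> sets (M n)"
  shows "(\<lambda>n. measure (M n) {\<omega>\<in>space (M n). \<not> Q n \<omega>}) \<longlonglongrightarrow> 0"
proof (rule order_tendstoI)
  fix a :: real assume "a < 0"
  then show "\<forall>\<^sub>F n in sequentially. a < measure (M n) {\<omega>\<in>space (M n). \<not> Q n \<omega>}"
    by (intro always_eventually allI) (meson less_le_trans measure_nonneg)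
next
  fix a :: real assume a: "a > 0"
  then have "a/2 > 0" by simp
  then have "\<forall>\<^sub>F n in sequentially.
     \<exists>N\<in>sets (M n). measure (M n) N \<le> a/2 \<and> (\<forall>\<omega>\<in>space (M n) - N. Q n \<omega>)"
    using assms(1) unfolding whp_def by blast
  then show "\<forall>\<^sub>F n in sequentially. measure (M n) {\<omega>\<in>space (M n). \<not> Q n \<omega>} < a"
    using assms(2) ev_prob
  proof eventually_elim
    case (elim n)
    then interpret prob_space "M n" by simp
    from elim obtain N where N: "N\<in>sets (M n)" "measure (M n) N \<le> a/2"
      "\<forall>\<omega>\<in>space (M n) - N. Q n \<omega>" by blast
    have "measure (M n) {\<omega>\<in>space (M n). \<not> Q n \<omega>} \<le> measure (M n) N"
      using N by (intro finite_measure_mono) auto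
    with N(2) a show ?case by linarith
  qed
qed

lemma cprob_cong:
  assumes "cprob M Y c" "whp M (\<lambda>n \<omega>. Y n \<omega> = Y' n \<omega>)"
  shows "cprob M Y' c"
  unfolding cprob_def
proof (intro allI impI)
  fix e :: real assume "e > 0"
  then have "whp M (\<lambda>n \<omega>. \<bar>Y n \<omega> - c\<bar> < e)" using assms(1) by (simp add: cprob_def)
  from whp_conj[OF this assms(2)] show "whp M (\<lambda>n \<omega>. \<bar>Y' n \<omega> - c\<bar> < e)"
    by (rule whp_mono) auto
qed

lemma cprob_cong':
  assumes "cprob M Y c" "\<forall>\<^sub>F n in sequentially. \<forall>\<omega>\<in>space (M n). Y n \<omega> = Y' n \<omega>"
  shows "cprob M Y' c"
  using assms by (intro cprob_cong[OF assms(1)] whp_always) auto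

lemma cprob_tendsto:
  assumes "a \<longlonglongrightarrow> c"
  shows "cprob M (\<lambda>n \<omega>. a n) c"
  unfolding cprob_def
proof (intro allI impI whp_always)
  fix e :: real assume "e > 0"
  with assms have "\<forall>\<^sub>F n in sequentially. dist (a n) c < e" by (rule tendstoD)
  then show "\<forall>\<^sub>F n in sequentially. \<forall>\<omega>\<in>space (M n). \<bar>a n - c\<bar> < e"
    by eventually_elim (simp add: dist_real_def)
qed

lemma cprob_const: "cprob M (\<lambda>n \<omega>. c) c"
  by (rule cprob_tendsto) simp

lemma cprob_abs_le:
  assumes "cprob M Y 0" "whp M (\<lambda>n \<omega>. \<bar>Y' n \<omega>\<bar> \<le> \<bar>Y n \<omega>\<bar>)"
  shows "cprob M Y' 0"
  unfolding cprob_def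
proof (intro allI impI)
  fix e :: real assume "e > 0"
  then have "whp M (\<lambda>n \<omega>. \<bar>Y n \<omega> - 0\<bar> < e)" using assms(1) by (simp add: cprob_def)
  from whp_conj[OF this assms(2)] show "whp M (\<lambda>n \<omega>. \<bar>Y' n \<omega> - 0\<bar> < e)"
    by (rule whp_mono) auto
qed

lemma cprob_add:
  assumes "cprob M Y c" "cprob M Z d"
  shows "cprob M (\<lambda>n \<omega>. Y n \<omega> + Z n \<omega>) (c + d)"
  unfolding cprob_def
proof (intro allI impI)
  fix e :: real assume "e > 0"
  then have "e/2 > 0" by simp
  with assms have "whp M (\<lambda>n \<omega>. \<bar>Y n \<omega> - c\<bar> < e/2)" "whp M (\<lambda>n \<omega>. \<bar>Z n \<omega> - d\<bar> < e/2)"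
    unfolding cprob_def by blast+
  from whp_conj[OF this] show "whp M (\<lambda>n \<omega>. \<bar>Y n \<omega> + Z n \<omega> - (c + d)\<bar> < e)"
    by (rule whp_mono) linarith
qed

lemma cprob_cmult:
  assumes "cprob M Y c"
  shows "cprob M (\<lambda>n \<omega>. a * Y n \<omega>) (a * c)"
proof (cases "a = 0")
  case True
  then show ?thesis using cprob_const[of 0] by simp
next
  case False
  show ?thesis unfolding cprob_def
  proof (intro allI impI)
    fix e :: real assume "e > 0"
    then have "e/\<bar>a\<bar> > 0" using False by simp
    with assms have "whp M (\<lambda>n \<omega>. \<bar>Y n \<omega> - c\<bar> < e/\<bar>a\<bar>)"
      unfolding cprob_def by blast
    then show "whp M (\<lambda>n \<omega>. \<bar>a * Y n \<omega> - a * c\<bar> < e)"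
    proof (rule whp_mono)
      fix n \<omega> assume "\<bar>Y n \<omega> - c\<bar> < e/\<bar>a\<bar>"
      then have "\<bar>a\<bar> * \<bar>Y n \<omega> - c\<bar> < e" using False by (simp add: pos_less_divide_eq mult.commute)
      then show "\<bar>a * Y n \<omega> - a * c\<bar> < e" by (simp add: abs_mult[symmetric] right_diff_distrib)
    qed
  qed
qed

lemma cprob_diff:
  assumes "cprob M Y c" "cprob M Z d"
  shows "cprob M (\<lambda>n \<omega>. Y n \<omega> - Z n \<omega>) (c - d)"
  using cprob_add[OF assms(1) cprob_cmult[OF assms(2), of "-1"]] by simp

lemma cprob_isCont:
  assumes "cprob M Y c" "isCont f c"
  shows "cprob M (\<lambda>n \<omega>. f (Y n \<omega>)) (f c)"
  unfolding cprob_def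
proof (intro allI impI)
  fix e :: real assume "e > 0"
  with assms(2) obtain d where d: "d > 0" "\<And>x. \<bar>x - c\<bar> < d \<Longrightarrow> \<bar>f x - f c\<bar> < e"
    unfolding continuous_at_eps_delta dist_real_def by blast
  have "whp M (\<lambda>n \<omega>. \<bar>Y n \<omega> - c\<bar> < d)" using assms(1) d(1) by (simp add: cprob_def)
  then show "whp M (\<lambda>n \<omega>. \<bar>f (Y n \<omega>) - f c\<bar> < e)"
    by (rule whp_mono) (rule d(2))
qed

lemma tight_bounded:
  assumes "whp M (\<lambda>n \<omega>. \<bar>Y n \<omega>\<bar> \<le> K)"
  shows "tight_seq M Y"
  unfolding tight_seq_def
proof (intro allI impI)
  fix e :: real assume "e > 0"
  with whp_mono[OF assms, of "\<lambda>n \<omega>. \<bar>Y n \<omega>\<bar> \<le> max K 1"]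
  have "\<forall>\<^sub>F n in sequentially.
     \<exists>N\<in>sets (M n). measure (M n) N \<le> e \<and> (\<forall>\<omega>\<in>space (M n) - N. \<bar>Y n \<omega>\<bar> \<le> max K 1)"
    by (auto simp: whp_def)
  then show "\<exists>K>0. \<forall>\<^sub>F n in sequentially.
     \<exists>N\<in>sets (M n). measure (M n) N \<le> e \<and> (\<forall>\<omega>\<in>space (M n) - N. \<bar>Y n \<omega>\<bar> \<le> K)"
    by (intro exI[of _ "max K 1"]) auto
qed

lemma cprob_tight:
  assumes "cprob M Y c"
  shows "tight_seq M Y"
proof (rule tight_bounded)
  have "whp M (\<lambda>n \<omega>. \<bar>Y n \<omega> - c\<bar> < 1)" using assms by (simp add: cprob_def)
  then show "whp M (\<lambda>n \<omega>. \<bar>Y n \<omega>\<bar> \<le> \<bar>c\<bar> + 1)"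
    by (rule whp_mono) linarith
qed

text \<open>Slutsky's lemma: \<open>K\<close> is chosen first, from the tightness of
  \<open>Z\<close>, and then \<open>Y\<close> is made smaller than \<open>e/K\<close>; each factor
  spends half of the probability.\<close>

lemma cprob_mult_tight:
  assumes "cprob M Y 0" "tight_seq M Z"
  shows "cprob M (\<lambda>n \<omega>. Y n \<omega> * Z n \<omega>) 0"
  unfolding cprob_def whp_def
proof (intro allI impI)
  fix e d :: real assume ed: "e > 0" "d > 0"
  then have d2: "d/2 > 0" by simp
  from assms(2) d2 obtain K where K: "K > 0" "\<forall>\<^sub>F n in sequentially.
     \<exists>N\<in>sets (M n). measure (M n) N \<le> d/2 \<and> (\<forall>\<omega>\<in>space (M n) - N. \<bar>Z n \<omega>\<bar> \<le> K)"
    unfolding tight_seq_def by blast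
  have "e/K > 0" using ed K by simp
  with assms(1) d2 have "\<forall>\<^sub>F n in sequentially.
     \<exists>N\<in>sets (M n). measure (M n) N \<le> d/2 \<and> (\<forall>\<omega>\<in>space (M n) - N. \<bar>Y n \<omega> - 0\<bar> < e/K)"
    unfolding cprob_def whp_def by blast
  with K(2) ev_prob show "\<forall>\<^sub>F n in sequentially.
     \<exists>N\<in>sets (M n). measure (M n) N \<le> d \<and> (\<forall>\<omega>\<in>space (M n) - N. \<bar>Y n \<omega> * Z n \<omega> - 0\<bar> < e)"
  proof eventually_elim
    case (elim n)
    then interpret prob_space "M n" by simp
    from elim(1) obtain N1 where N1: "N1 \<in> sets (M n)" "measure (M n) N1 \<le> d/2"
      "\<forall>\<omega>\<in>space (M n) - N1. \<bar>Z n \<omega>\<bar> \<le> K" by blast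
    from elim(3) obtain N2 where N2: "N2 \<in> sets (M n)" "measure (M n) N2 \<le> d/2"
      "\<forall>\<omega>\<in>space (M n) - N2. \<bar>Y n \<omega> - 0\<bar> < e/K" by blast
    have "measure (M n) (N1 \<union> N2) \<le> d"
      using measure_Un_le[of N1 "M n" N2] N1(1,2) N2(1,2) by simp
    moreover have "\<bar>Y n \<omega> * Z n \<omega> - 0\<bar> < e" if "\<omega> \<in> space (M n) - (N1 \<union> N2)" for \<omega>
    proof -
      have "\<bar>Y n \<omega>\<bar> * \<bar>Z n \<omega>\<bar> \<le> \<bar>Y n \<omega>\<bar> * K"
        using N1(3) that by (intro mult_left_mono) auto
      also have "\<dots> < e/K * K"
        using N2(3) that K(1) by (intro mult_strict_right_mono) auto
      finally show ?thesis using K(1) by (simp add: abs_mult)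
    qed
    ultimately show ?case using N1(1) N2(1) by (intro bexI[of _ "N1 \<union> N2"]) auto
  qed
qed

lemma cprob_mult:
  assumes "cprob M Y c" "cprob M Z d"
  shows "cprob M (\<lambda>n \<omega>. Y n \<omega> * Z n \<omega>) (c * d)"
proof -
  have "cprob M (\<lambda>n \<omega>. (Y n \<omega> - c) * Z n \<omega> + c * Z n \<omega>) (0 + c * d)"
    using cprob_diff[OF assms(1) cprob_const[of c]] assms(2)
    by (intro cprob_add cprob_mult_tight cprob_tight cprob_cmult) auto
  then show ?thesis by (simp add: algebra_simps)
qed

lemma cprob_sum:
  assumes "finite F" "\<And>x. x \<in> F \<Longrightarrow> cprob M (Y x) (c x)"
  shows "cprob M (\<lambda>n \<omega>. \<Sum>x\<in>F. Y x n \<omega>) (\<Sum>x\<in>F. c x)"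
  using assms
proof (induction F rule: finite_induct)
  case empty
  then show ?case using cprob_const[of 0] by simp
next
  case (insert x F)
  then show ?case using cprob_add[of "Y x" "c x" "\<lambda>n \<omega>. \<Sum>x\<in>F. Y x n \<omega>"] by simp
qed

lemma tight_second_moment:
  assumes "\<forall>\<^sub>F n in sequentially. Y n \<in> borel_measurable (M n)"
    and "\<forall>\<^sub>F n in sequentially. integrable (M n) (\<lambda>\<omega>. (Y n \<omega>)\<^sup>2)"
    and "\<forall>\<^sub>F n in sequentially. (\<integral>\<omega>. (Y n \<omega>)\<^sup>2 \<partial>M n) \<le> V"
  shows "tight_seq M Y"
  unfolding tight_seq_def
proof (intro allI impI)
  fix e :: real assume "e > 0"
  \<comment> \<open>Chebyshev's inequality leaves probability at most
    \<open>V / K\<^sup>2 \<le> e\<close>. Taking \<open>\<bar>V\<bar> + 1\<close> keeps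
    \<open>K\<close> positive whatever the sign of \<open>V\<close>.\<close>
  define K where "K = sqrt ((\<bar>V\<bar> + 1) / e)"
  have K: "K > 0" "K\<^sup>2 = (\<bar>V\<bar> + 1) / e" using \<open>e > 0\<close> by (auto simp: K_def)
  have "\<forall>\<^sub>F n in sequentially.
     \<exists>N\<in>sets (M n). measure (M n) N \<le> e \<and> (\<forall>\<omega>\<in>space (M n) - N. \<bar>Y n \<omega>\<bar> \<le> K)"
    using assms ev_prob
  proof eventually_elim
    case (elim n)
    then interpret prob_space "M n" by simp
    have [measurable]: "Y n \<in> borel_measurable (M n)" by fact
    have "measure (M n) {\<omega>\<in>space (M n). K\<^sup>2 \<le> (Y n \<omega>)\<^sup>2} \<le> (\<integral>\<omega>. (Y n \<omega>)\<^sup>2 \<partial>M n) / K\<^sup>2"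
      using integral_Markov_inequality_measure[OF elim(2), of "space (M n)" "K\<^sup>2"] K(1) by simp
    also have "\<dots> \<le> (\<bar>V\<bar> + 1) / K\<^sup>2"
      using elim(3) by (intro divide_right_mono) auto
    also have "\<dots> = e" using K \<open>e > 0\<close> by simp
    finally have "measure (M n) {\<omega>\<in>space (M n). K\<^sup>2 \<le> (Y n \<omega>)\<^sup>2} \<le> e" .
    moreover have "\<bar>y\<bar> \<le> K" if "\<not> K\<^sup>2 \<le> y\<^sup>2" for y
      using that K(1) abs_le_square_iff[of K y] by auto
    ultimately show ?case by (intro bexI[of _ "{\<omega>\<in>space (M n). K\<^sup>2 \<le> (Y n \<omega>)\<^sup>2}"]) auto
  qed
  with K(1) show "\<exists>K>0. \<forall>\<^sub>F n in sequentially.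
     \<exists>N\<in>sets (M n). measure (M n) N \<le> e \<and> (\<forall>\<omega>\<in>space (M n) - N. \<bar>Y n \<omega>\<bar> \<le> K)" by blast
qed

lemma whp_Markov:
  assumes "\<forall>\<^sub>F n in sequentially. Y n \<in> borel_measurable (M n)"
    and "\<forall>\<^sub>F n in sequentially. integrable (M n) (\<lambda>\<omega>. (Y n \<omega> - c)\<^sup>2)"
    and "\<forall>\<^sub>F n in sequentially. (\<integral>\<omega>. (Y n \<omega> - c)\<^sup>2 \<partial>M n) \<le> b n" "b \<longlonglongrightarrow> 0"
  shows "cprob M Y c"
  unfolding cprob_def
proof (intro allI impI)
  fix e :: real assume "e > 0"
  show "whp M (\<lambda>n \<omega>. \<bar>Y n \<omega> - c\<bar> < e)"
  proof (rule whpI_bound)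
    show "\<forall>\<^sub>F n in sequentially. {\<omega> \<in> space (M n). \<not> \<bar>Y n \<omega> - c\<bar> < e} \<in> sets (M n)"
      using assms(1) by eventually_elim measurable
    show "\<forall>\<^sub>F n in sequentially. measure (M n) {\<omega> \<in> space (M n). \<not> \<bar>Y n \<omega> - c\<bar> < e} \<le> b n / e\<^sup>2"
      using assms(1-3) ev_prob
    proof eventually_elim
      case (elim n)
      then interpret prob_space "M n" by simp
      have [measurable]: "Y n \<in> borel_measurable (M n)" by fact
      have eq: "\<not> \<bar>x\<bar> < e \<longleftrightarrow> e\<^sup>2 \<le> x\<^sup>2" for x
        using \<open>e > 0\<close> by (metis abs_le_square_iff abs_of_pos not_less)
      have "measure (M n) {\<omega>\<in>space (M n). e\<^sup>2 \<le> (Y n \<omega> - c)\<^sup>2} \<le> (\<integral>\<omega>. (Y n \<omega> - c)\<^sup>2 \<partial>M n) / e\<^sup>2"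
        using integral_Markov_inequality_measure[OF elim(2), of "space (M n)" "e\<^sup>2"] \<open>e > 0\<close> by simp
      also have "\<dots> \<le> b n / e\<^sup>2"
        using elim(3) by (intro divide_right_mono) auto
      finally show ?case by (simp only: eq)
    qed
    show "(\<lambda>n. b n / e\<^sup>2) \<longlonglongrightarrow> 0" using tendsto_divide[OF assms(4) tendsto_const[of "e\<^sup>2"]] \<open>e > 0\<close> by simp
  qed
qed

lemma converges_in_probI:
  assumes "cprob M Y c" "\<forall>\<^sub>F n in sequentially. Y n \<in> borel_measurable (M n)"
  shows "converges_in_prob M Y c"
  unfolding converges_in_prob_def
proof (intro conjI allI impI assms(2))
  fix e :: real assume "e > 0"
  have "whp M (\<lambda>n \<omega>. \<bar>Y n \<omega> - c\<bar> \<le> e)"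
    using assms(1) \<open>e > 0\<close> unfolding cprob_def by (blast intro: whp_mono less_imp_le)
  then have "(\<lambda>n. measure (M n) {\<omega>\<in>space (M n). \<not> \<bar>Y n \<omega> - c\<bar> \<le> e}) \<longlonglongrightarrow> 0"
    by (rule whp_measure_tendsto_0) (use assms(2) in eventually_elim, measurable)
  then show "(\<lambda>n. measure (M n) {\<omega>\<in>space (M n). \<bar>Y n \<omega> - c\<bar> > e}) \<longlonglongrightarrow> 0"
    by (simp add: not_le)
qed

text \<open>A weak law without independence. The mean square error of the average is a double sum
  over pairs: the diagonal contributes \<open>O(1 / p n)\<close> by the bound \<open>C\<close>, and
  off the diagonal only the uniform convergence of the pair moments to \<open>a\<^sup>2\<close> is
  needed.\<close>

lemma lln_pairs:
  fixes Y :: "nat \<Rightarrow> nat \<Rightarrow> 'a \<Rightarrow> real"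
  assumes p: "filterlim p at_top sequentially"
    and meas: "\<forall>\<^sub>F n in sequentially. \<forall>j<p n. Y n j \<in> borel_measurable (M n)"
    and bnd: "\<forall>\<^sub>F n in sequentially. \<forall>j<p n. AE \<omega> in M n. \<bar>Y n j \<omega>\<bar> \<le> C"
    and m1: "\<And>e. e > 0 \<Longrightarrow> \<forall>\<^sub>F n in sequentially. \<forall>j<p n. \<bar>(\<integral>\<omega>. Y n j \<omega> \<partial>M n) - a\<bar> \<le> e"
    and m2: "\<And>e. e > 0 \<Longrightarrow> \<forall>\<^sub>F n in sequentially. \<forall>j<p n. \<forall>k<p n. j \<noteq> k \<longrightarrow>
        \<bar>(\<integral>\<omega>. Y n j \<omega> * Y n k \<omega> \<partial>M n) - a\<^sup>2\<bar> \<le> e"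
  shows "cprob M (\<lambda>n \<omega>. (\<Sum>j<p n. Y n j \<omega>) / real (p n)) a"
proof -
  define S where "S n \<omega> = (\<Sum>j<p n. Y n j \<omega>) / real (p n)" for n \<omega>
  have key: "\<forall>\<^sub>F n in sequentially. S n \<in> borel_measurable (M n) \<and> integrable (M n) (\<lambda>\<omega>. (S n \<omega> - a)\<^sup>2)
     \<and> (\<integral>\<omega>. (S n \<omega> - a)\<^sup>2 \<partial>M n) \<le> (C\<^sup>2 + a\<^sup>2) / real (p n) + e + 2 * \<bar>a\<bar> * e" if "e > 0" for e
    using meas bnd m1[OF that] m2[OF that] ev_prob filterlim_at_top[THEN iffD1, OF p, rule_format, of 1]
  proof eventually_elim
    case (elim n)
    then interpret prob_space "M n" by simp
    have mY[measurable]: "Y n j \<in> borel_measurable (M n)" if "j < p n" for j using elim(1) that by blast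
    have bY: "AE \<omega> in M n. \<bar>Y n j \<omega>\<bar> \<le> C" if "j < p n" for j using elim(2) that by blast
    have p0: "real (p n) > 0" using elim(6) by simp
    have iY: "integrable (M n) (Y n j)" if "j < p n" for j
      using bY[OF that] mY[OF that] by (intro integrable_const_bound[of _ C]) auto
    have bYY: "AE \<omega> in M n. \<bar>Y n j \<omega> * Y n k \<omega>\<bar> \<le> C\<^sup>2" if "j < p n" "k < p n" for j k
      using bY[OF that(1)] bY[OF that(2)]
      by eventually_elim (auto simp: abs_mult power2_eq_square intro!: mult_mono)
    have iYY: "integrable (M n) (\<lambda>\<omega>. Y n j \<omega> * Y n k \<omega>)" if "j < p n" "k < p n" for j k
      using bYY[OF that] mY[OF that(1)] mY[OF that(2)] by (intro integrable_const_bound[of _ "C\<^sup>2"]) auto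
    have mS: "S n \<in> borel_measurable (M n)"
      unfolding S_def by (intro borel_measurable_divide borel_measurable_sum) auto
    have eq: "(S n \<omega> - a)\<^sup>2 = (\<Sum>j<p n. \<Sum>k<p n. Y n j \<omega> * Y n k \<omega>) / (real (p n))\<^sup>2
        - 2 * a / real (p n) * (\<Sum>j<p n. Y n j \<omega>) + a\<^sup>2" for \<omega>
      unfolding sum_product[symmetric] S_def using p0 by (simp add: power2_eq_square field_simps)
    have i1: "integrable (M n) (\<lambda>\<omega>. \<Sum>j<p n. \<Sum>k<p n. Y n j \<omega> * Y n k \<omega>)"
      using iYY by (auto intro!: Bochner_Integration.integrable_sum)
    have i2: "integrable (M n) (\<lambda>\<omega>. \<Sum>j<p n. Y n j \<omega>)"
      using iY by (auto intro!: Bochner_Integration.integrable_sum)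
    have int: "integrable (M n) (\<lambda>\<omega>. (S n \<omega> - a)\<^sup>2)"
      unfolding eq
      by (intro Bochner_Integration.integrable_add Bochner_Integration.integrable_diff
          integrable_mult_right integrable_divide i1 i2) simp
    have "(\<integral>\<omega>. (S n \<omega> - a)\<^sup>2 \<partial>M n) = (\<Sum>j<p n. \<Sum>k<p n. \<integral>\<omega>. Y n j \<omega> * Y n k \<omega> \<partial>M n) / (real (p n))\<^sup>2
        - 2 * a / real (p n) * (\<Sum>j<p n. \<integral>\<omega>. Y n j \<omega> \<partial>M n) + a\<^sup>2"
    proof -
      have "(\<integral>\<omega>. (S n \<omega> - a)\<^sup>2 \<partial>M n) = (\<integral>\<omega>. (\<Sum>j<p n. \<Sum>k<p n. Y n j \<omega> * Y n k \<omega>) \<partial>M n) / (real (p n))\<^sup>2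
        - 2 * a / real (p n) * (\<integral>\<omega>. (\<Sum>j<p n. Y n j \<omega>) \<partial>M n) + a\<^sup>2"
        unfolding eq using i1 i2 by (simp add: prob_space)
      moreover have "(\<integral>\<omega>. (\<Sum>j<p n. \<Sum>k<p n. Y n j \<omega> * Y n k \<omega>) \<partial>M n)
          = (\<Sum>j<p n. \<Sum>k<p n. \<integral>\<omega>. Y n j \<omega> * Y n k \<omega> \<partial>M n)"
      proof -
        have "(\<integral>\<omega>. (\<Sum>j<p n. \<Sum>k<p n. Y n j \<omega> * Y n k \<omega>) \<partial>M n)
            = (\<Sum>j<p n. \<integral>\<omega>. (\<Sum>k<p n. Y n j \<omega> * Y n k \<omega>) \<partial>M n)"
          using iYY by (intro Bochner_Integration.integral_sum Bochner_Integration.integrable_sum) auto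
        also have "\<dots> = (\<Sum>j<p n. \<Sum>k<p n. \<integral>\<omega>. Y n j \<omega> * Y n k \<omega> \<partial>M n)"
          using iYY by (intro sum.cong refl Bochner_Integration.integral_sum) auto
        finally show ?thesis .
      qed
      moreover have "(\<integral>\<omega>. (\<Sum>j<p n. Y n j \<omega>) \<partial>M n) = (\<Sum>j<p n. \<integral>\<omega>. Y n j \<omega> \<partial>M n)"
        using iY by (intro Bochner_Integration.integral_sum) auto
      ultimately show ?thesis by simp
    qed
    \<comment> \<open>The constant \<open>a\<^sup>2\<close> is distributed over the sums:
      subtracting \<open>a\<^sup>2\<close> from each pair moment and \<open>a\<close> from each mean
      changes the total by \<open>- a\<^sup>2 + 2 * a\<^sup>2\<close>.\<close>
    also have "\<dots> = (\<Sum>j<p n. \<Sum>k<p n. (\<integral>\<omega>. Y n j \<omega> * Y n k \<omega> \<partial>M n) - a\<^sup>2) / (real (p n))\<^sup>2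
        - 2 * a / real (p n) * (\<Sum>j<p n. (\<integral>\<omega>. Y n j \<omega> \<partial>M n) - a)"
      using p0 by (simp add: sum_subtractf field_simps power2_eq_square)
    also have "\<dots> \<le> ((C\<^sup>2 + a\<^sup>2) / real (p n) + e) + 2 * \<bar>a\<bar> * e"
    proof -
      have row: "(\<Sum>k<p n. (\<integral>\<omega>. Y n j \<omega> * Y n k \<omega> \<partial>M n) - a\<^sup>2) \<le> (C\<^sup>2 + a\<^sup>2) + real (p n) * e" if j: "j < p n" for j
      proof -
        have "(\<Sum>k<p n. (\<integral>\<omega>. Y n j \<omega> * Y n k \<omega> \<partial>M n) - a\<^sup>2) \<le> (\<Sum>k<p n. (if k = j then C\<^sup>2 + a\<^sup>2 else 0) + e)"
        proof (rule sum_mono)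
          fix k assume "k \<in> {..<p n}"
          then have k: "k < p n" by simp
          show "(\<integral>\<omega>. Y n j \<omega> * Y n k \<omega> \<partial>M n) - a\<^sup>2 \<le> (if k = j then C\<^sup>2 + a\<^sup>2 else 0) + e"
          proof (cases "k = j")
            case True
            have "(\<integral>\<omega>. Y n j \<omega> * Y n k \<omega> \<partial>M n) \<le> (\<integral>\<omega>. C\<^sup>2 \<partial>M n)"
              using bYY[OF j k] iYY[OF j k] by (intro integral_mono_AE) auto
            also have "\<dots> = C\<^sup>2" by (simp add: prob_space)
            finally show ?thesis using True \<open>e > 0\<close> zero_le_power2[of a] unfolding if_P[OF True] by linarith
          next
            case False
            then show ?thesis using elim(4) j k by fastforce
          qed
        qed
        also have "\<dots> = (C\<^sup>2 + a\<^sup>2) + real (p n) * e"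
          using j by (simp add: sum.distrib)
        finally show ?thesis .
      qed
      have "(\<Sum>j<p n. \<Sum>k<p n. (\<integral>\<omega>. Y n j \<omega> * Y n k \<omega> \<partial>M n) - a\<^sup>2)
          \<le> (\<Sum>j<p n. (C\<^sup>2 + a\<^sup>2) + real (p n) * e)"
        using row by (intro sum_mono) auto
      then have A: "(\<Sum>j<p n. \<Sum>k<p n. (\<integral>\<omega>. Y n j \<omega> * Y n k \<omega> \<partial>M n) - a\<^sup>2) / (real (p n))\<^sup>2
          \<le> (\<Sum>j<p n. (C\<^sup>2 + a\<^sup>2) + real (p n) * e) / (real (p n))\<^sup>2"
        by (intro divide_right_mono) auto
      also have "\<dots> = (C\<^sup>2 + a\<^sup>2) / real (p n) + e"
        using p0 by (simp add: field_simps power2_eq_square)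
      finally have A: "(\<Sum>j<p n. \<Sum>k<p n. (\<integral>\<omega>. Y n j \<omega> * Y n k \<omega> \<partial>M n) - a\<^sup>2) / (real (p n))\<^sup>2
          \<le> (C\<^sup>2 + a\<^sup>2) / real (p n) + e" .
      have "\<bar>\<Sum>j<p n. (\<integral>\<omega>. Y n j \<omega> \<partial>M n) - a\<bar> \<le> (\<Sum>j<p n. \<bar>(\<integral>\<omega>. Y n j \<omega> \<partial>M n) - a\<bar>)"
        by (rule sum_abs)
      also have "\<dots> \<le> (\<Sum>j<p n. e)" using elim(3) by (intro sum_mono) auto
      finally have B: "\<bar>\<Sum>j<p n. (\<integral>\<omega>. Y n j \<omega> \<partial>M n) - a\<bar> \<le> real (p n) * e" by simp
      have "- (2 * a / real (p n) * (\<Sum>j<p n. (\<integral>\<omega>. Y n j \<omega> \<partial>M n) - a)) \<le>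
          \<bar>2 * a / real (p n)\<bar> * \<bar>\<Sum>j<p n. (\<integral>\<omega>. Y n j \<omega> \<partial>M n) - a\<bar>"
        by (metis abs_ge_minus_self abs_mult)
      also have "\<dots> \<le> \<bar>2 * a / real (p n)\<bar> * (real (p n) * e)"
        by (intro mult_left_mono B) auto
      also have "\<dots> = 2 * \<bar>a\<bar> * e" using p0 by (simp add: abs_mult)
      finally show ?thesis using A by linarith
    qed
    finally show ?case using mS int by simp
  qed
  have k1: "\<forall>\<^sub>F n in sequentially. S n \<in> borel_measurable (M n)"
    using key[OF zero_less_one] by eventually_elim blast
  have k2: "\<forall>\<^sub>F n in sequentially. integrable (M n) (\<lambda>\<omega>. (S n \<omega> - a)\<^sup>2)"
    using key[OF zero_less_one] by eventually_elim blast
  have k3: "(\<lambda>n. \<integral>\<omega>. (S n \<omega> - a)\<^sup>2 \<partial>M n) \<longlonglongrightarrow> 0"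
  proof (rule order_tendstoI)
    fix y :: real assume "y < 0"
    then show "\<forall>\<^sub>F n in sequentially. y < (\<integral>\<omega>. (S n \<omega> - a)\<^sup>2 \<partial>M n)"
      by (intro always_eventually allI less_le_trans[OF _ integral_nonneg_AE]) auto
  next
    fix y :: real assume y: "y > 0"
    \<comment> \<open>Half of \<open>y\<close> goes to the terms with \<open>e\<close>, the other
      half to the diagonal.\<close>
    define e where "e = y / (2 * (1 + 2 * \<bar>a\<bar>))"
    have e: "e > 0" "e + 2 * \<bar>a\<bar> * e = y / 2"
    proof -
      show "e > 0" using y by (simp add: e_def add_pos_nonneg)
      have "e + 2 * \<bar>a\<bar> * e = e * (1 + 2 * \<bar>a\<bar>)" by (simp add: algebra_simps)
      also have "\<dots> = y / 2"
        using abs_ge_zero[of a] by (simp add: e_def del: abs_ge_zero) (simp add: field_simps add_pos_nonneg)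
      finally show "e + 2 * \<bar>a\<bar> * e = y / 2" .
    qed
    have "filterlim (\<lambda>n. real (p n)) at_top sequentially"
      using p filterlim_real_sequentially filterlim_compose by blast
    then have "(\<lambda>n. (C\<^sup>2 + a\<^sup>2) / real (p n)) \<longlonglongrightarrow> 0"
      by (intro tendsto_divide_0[OF tendsto_const] filterlim_at_top_imp_at_infinity)
    then have "\<forall>\<^sub>F n in sequentially. (C\<^sup>2 + a\<^sup>2) / real (p n) < y / 2"
      by (rule order_tendstoD) (use y in simp)
    with key[OF e(1)] show "\<forall>\<^sub>F n in sequentially. (\<integral>\<omega>. (S n \<omega> - a)\<^sup>2 \<partial>M n) < y"
      by eventually_elim (use e(2) in linarith)
  qed
  show ?thesis
    using whp_Markov[OF k1 k2 _ k3] by (simp add: S_def)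
qed

end

section \<open>The standard normal distribution\<close>

abbreviation "Nm \<equiv> std_normal_distribution"

lemma prob_space_Nm: "prob_space Nm"
  by (intro prob_space_normal_density) simp

lemma sets_Nm[measurable_cong]: "sets Nm = sets borel" by simp

interpretation Nm: real_distribution Nm
  by (rule real_dist_normal_dist)

lemma std_normal_density_le_1: "std_normal_density x \<le> 1"
proof -
  have "1 \<le> sqrt (2 * pi)" using pi_ge_two by (intro real_le_rsqrt) simp
  then have "1 / sqrt (2*pi) * exp (-x\<^sup>2/2) \<le> 1 * 1"
    by (intro mult_mono) auto
  then show ?thesis by (simp add: std_normal_density_def)
qed

text \<open>The density is at most 1. This anti-concentration bound later turns a small error in a
  statistic into a small error in a probability.\<close>

lemma Nm_interval_le:
  assumes "d \<ge> 0"
  shows "measure Nm {x. \<bar>x - w\<bar> \<le> d} \<le> 2 * d"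
proof -
  have eq: "{x. \<bar>x - w\<bar> \<le> d} = {w - d..w + d}" by auto
  have "emeasure Nm {w-d..w+d} = (\<integral>\<^sup>+x. ennreal (std_normal_density x) * indicator {w-d..w+d} x \<partial>lborel)"
    by (rule emeasure_density) auto
  also have "\<dots> \<le> (\<integral>\<^sup>+x. indicator {w-d..w+d} x \<partial>lborel)"
    by (intro nn_integral_mono) (auto simp: indicator_def std_normal_density_le_1)
  also have "\<dots> = ennreal (2 * d)" using assms by simp
  finally show ?thesis unfolding eq measure_def
    using assms by (simp add: enn2real_leI)
qed

lemma Nm_atom: "measure Nm {x} = 0"
  using Nm_interval_le[of 0 x] by (simp add: measure_le_0_iff)

text \<open>The density is positive everywhere. This makes \<open>Phi\<close> strictly increasing,
  and keeps the limiting proportion of selected nulls away from 0.\<close>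

lemma Nm_interval_pos:
  assumes "a < b"
  shows "measure Nm {a<..<b} > 0"
proof -
  have "emeasure Nm {a<..<b} \<noteq> 0"
  proof
    assume "emeasure Nm {a<..<b} = 0"
    then have "{a<..<b} \<in> null_sets Nm" by auto
    then have "AE x in lborel. x \<in> {a<..<b} \<longrightarrow> ennreal (std_normal_density x) = 0"
      by (subst (asm) null_sets_density_iff) auto
    then have "AE x in lborel. x \<notin> {a<..<b}"
      by eventually_elim (use normal_density_pos[of 1 0] in \<open>auto simp: ennreal_eq_0_iff simp flip: not_less\<close>)
    then have "emeasure lborel {a<..<b} = 0"
      by (subst (asm) AE_iff_measurable[of "{a<..<b}"]) auto
    then show False using assms by simp
  qed
  then show ?thesis
    by (simp add: Nm.emeasure_eq_measure zero_less_measure_iff)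
qed

lemma distr_uminus_Nm: "distr Nm borel uminus = Nm"
proof -
  have "distributed Nm lborel (\<lambda>x. x) (normal_density 0 1)"
    by (auto simp: distributed_def distr_id2 distr_cong sets_Nm)
  then have "distributed Nm lborel (\<lambda>x. 0 + (-1) * x) (normal_density (0 + (-1) * 0) (\<bar>-1\<bar> * 1))"
    by (intro Nm.normal_density_affine) auto
  then have "distr Nm lborel uminus = density lborel (normal_density 0 1)"
    by (auto simp: distributed_def)
  then show ?thesis by (simp cong: distr_cong)
qed

abbreviation "Phi \<equiv> cdf Nm"

lemma Phi_less: assumes "a < b" shows "Phi a < Phi b"
proof -
  have "0 < measure Nm {a<..<b}" by (rule Nm_interval_pos) fact
  also have "\<dots> \<le> measure Nm {a<..b}" by (intro Nm.finite_measure_mono) auto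
  also have "\<dots> = Phi b - Phi a" using Nm.cdf_diff_eq[OF assms] by simp
  finally show ?thesis by simp
qed

lemma Phi_less_iff: "Phi a < Phi b \<longleftrightarrow> a < b"
  by (metis Phi_less linorder_cases order_less_asym order_less_irrefl)

lemma Phi_le_iff: "Phi a \<le> Phi b \<longleftrightarrow> a \<le> b"
  using Phi_less_iff[of b a] by (simp add: not_less[symmetric])

text \<open>Symmetry together with the absence of atoms. It turns the mirror region
  \<open>pv j \<ge> 1 - t\<close> of AdaPT into \<open>Z j \<le> - w\<close>.\<close>

lemma Phi_uminus: "Phi (-x) = 1 - Phi x"
proof -
  have "Phi (-x) = measure (distr Nm borel uminus) {..-x}" by (simp add: cdf_def distr_uminus_Nm)
  also have "\<dots> = measure Nm {x..}"
    by (subst measure_distr) (auto intro!: arg_cong[where f="measure Nm"])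
  also have "{x..} = {x} \<union> {x<..}" by auto
  also have "measure Nm ({x} \<union> {x<..}) = measure Nm {x} + measure Nm {x<..}"
    by (intro Nm.finite_measure_Union) auto
  also have "\<dots> = measure Nm {x<..}" by (simp add: Nm_atom)
  also have "{x<..} = space Nm - {..x}" by auto
  also have "measure Nm (space Nm - {..x}) = 1 - Phi x"
    by (subst Nm.prob_compl) (auto simp: cdf_def)
  finally show ?thesis .
qed

lemma Phi_0: "Phi 0 = 1/2"
  using Phi_uminus[of 0] by simp

lemma isCont_Phi: "isCont Phi x"
  by (simp add: Nm.isCont_cdf Nm_atom)

section \<open>Selection rules\<close>

text \<open>The condition shared by \<open>knockoff_thresholds\<close> and
  \<open>adapt_admissible\<close>, with \<open>w\<close> an arbitrary real instead of one of the
  values \<open>\<bar>W j\<bar>\<close>.\<close>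

definition good_level :: "real \<Rightarrow> nat \<Rightarrow> (nat \<Rightarrow> real) \<Rightarrow> real \<Rightarrow> bool" where
  "good_level q p Z w \<longleftrightarrow> (\<exists>j<p. Z j \<ge> w) \<and>
     (1 + real (card {j. j < p \<and> Z j \<le> - w})) / real (card {j. j < p \<and> Z j \<ge> w}) \<le> q"

text \<open>An enclosure of the selected set that suits both an attained minimum and a supremum. The
  second clause asks \<open>w > 0\<close> because the knockoff filter has no threshold at 0; the
  third includes \<open>w = 0\<close> because AdaPT may use \<open>t = 1/2\<close>.\<close>

definition threshold_rule :: "real \<Rightarrow> nat \<Rightarrow> (nat \<Rightarrow> real) \<Rightarrow> nat set \<Rightarrow> bool" where
  "threshold_rule q p Z S \<longleftrightarrow> S \<subseteq> {j. j < p \<and> Z j \<ge> 0} \<and>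
     (\<forall>w>0. good_level q p Z w \<longrightarrow> {j. j < p \<and> Z j \<ge> w} \<subseteq> S) \<and>
     (\<forall>v\<ge>0. (\<forall>w\<in>{0..v}. \<not> good_level q p Z w) \<longrightarrow> S \<subseteq> {j. j < p \<and> Z j \<ge> v})"

lemma finite_knockoff_thresholds: "finite (knockoff_thresholds q p W)"
proof (rule finite_subset)
  show "knockoff_thresholds q p W \<subseteq> (\<lambda>j. \<bar>W j\<bar>) ` {..<p}"
    by (auto simp: knockoff_thresholds_def)
qed simp

text \<open>A factor \<open>c > 0\<close> rescales the levels and leaves the selection alone. This
  permits replacing \<open>W\<close> by a normalized statistic with a limit law.\<close>

lemma threshold_rule_knockoff_filter:
  assumes c: "c > 0"
  shows "threshold_rule q p (\<lambda>j. c * W j) (knockoff_filter q p W)"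
proof -
  let ?T = "knockoff_thresholds q p W"
  have scale: "good_level q p (\<lambda>j. c * W j) (c * w) \<longleftrightarrow> good_level q p W w" for w
  proof -
    have "c * W j \<le> - (c * w) \<longleftrightarrow> W j \<le> - w" "c * w \<le> c * W j \<longleftrightarrow> w \<le> W j" for j
      using mult_le_cancel_left_pos[OF c, of "W j" "- w"] c by simp_all
    then show ?thesis by (simp only: good_level_def)
  qed
  have Tgood: "good_level q p W w \<and> w > 0" if "w \<in> ?T" for w
    using that by (auto simp: knockoff_thresholds_def good_level_def)
  have Min_mem: "Min ?T \<in> ?T" if "?T \<noteq> {}"
    using Min_in[OF finite_knockoff_thresholds that] .
  show ?thesis unfolding threshold_rule_def
  proof (intro conjI allI impI)
    show "knockoff_filter q p W \<subseteq> {j. j < p \<and> 0 \<le> c * W j}"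
      using Min_mem Tgood c by (fastforce simp: knockoff_filter_def)
  next
    fix w :: real assume w: "w > 0" "good_level q p (\<lambda>j. c * W j) w"
    define w0 where "w0 = w / c"
    have w0: "w0 > 0" "c * w0 = w" using c w by (auto simp: w0_def)
    have g: "good_level q p W w0" using scale[of w0] w w0 by simp
    \<comment> \<open>A good level is raised to the next value of some
      \<open>\<bar>W j\<bar>\<close>. Neither count changes on the way, so this value is an
      admissible threshold with the same selection.\<close>
    define A where "A = {\<bar>W j\<bar> | j. j < p \<and> \<bar>W j\<bar> \<ge> w0}"
    have finA: "finite A" unfolding A_def by (rule finite_subset[of _ "(\<lambda>j. \<bar>W j\<bar>) ` {..<p}"]) auto
    have Ane: "A \<noteq> {}" using g by (force simp: A_def good_level_def)
    define w' where "w' = Min A"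
    have w'A: "w' \<in> A" using Min_in[OF finA Ane] by (simp add: w'_def)
    have w'le: "w' \<le> \<bar>W j\<bar>" if "j < p" "\<bar>W j\<bar> \<ge> w0" for j
      unfolding w'_def using finA that by (intro Min_le) (auto simp: A_def)
    have w'ge: "w' \<ge> w0" using w'A by (auto simp: A_def)
    have e1: "W j \<ge> w' \<longleftrightarrow> W j \<ge> w0" if "j < p" for j
      using w'le[OF that] w'ge w0 by force
    have e2: "W j \<le> - w' \<longleftrightarrow> W j \<le> - w0" if "j < p" for j
      using w'le[OF that] w'ge w0 by force
    have "w' \<in> ?T"
      using g w'A w0 e1 e2 by (auto simp: knockoff_thresholds_def good_level_def A_def cong: conj_cong)
    then have ne: "?T \<noteq> {}" and "Min ?T \<le> w'"
      using finite_knockoff_thresholds[of q p W] by (auto intro: Min_le)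
    then show "{j. j < p \<and> w \<le> c * W j} \<subseteq> knockoff_filter q p W"
      using e1 w0 c by (fastforce simp: knockoff_filter_def)
  next
    fix v :: real assume v: "v \<ge> 0" "\<forall>w\<in>{0..v}. \<not> good_level q p (\<lambda>j. c * W j) w"
    have "v < c * w" if "w \<in> ?T" for w
      using Tgood[OF that] v(2)[rule_format, of "c * w"] c by (force simp: scale)
    with Min_mem have "v < c * Min ?T" if "?T \<noteq> {}" using that by blast
    then show "knockoff_filter q p W \<subseteq> {j. j < p \<and> v \<le> c * W j}"
      using mult_left_mono[OF _ less_imp_le[OF c], of "Min ?T"] by (fastforce simp: knockoff_filter_def)
  qed
qed

text \<open>The map \<open>t = 1 - Phi w\<close> reverses the order and takes the levels
  \<open>w \<ge> 0\<close> onto \<open>0 < t \<le> 1/2\<close>.\<close>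

lemma threshold_rule_adapt:
  "threshold_rule q m (\<lambda>j. fst (\<omega> j) + snd (\<omega> j)) (adapt (1/2) q m (means_pval \<omega>))"
proof -
  define Z where "Z j = fst (\<omega> j) + snd (\<omega> j)" for j
  have pv: "means_pval \<omega> = (\<lambda>j. 1 - Phi (Z j))" by (simp add: means_pval_def Z_def fun_eq_iff)
  let ?A = "adapt_admissible (1/2) q m (means_pval \<omega>)"
  have adm: "1 - Phi w \<in> ?A \<longleftrightarrow> good_level q m Z w" if "w \<ge> 0" for w
  proof -
    have "1 - Phi w \<in> {0..1/2}" using that Phi_le_iff[of 0 w] Nm.cdf_bounded_prob[of w] by (simp add: Phi_0)
    moreover have "Phi (Z j) \<le> 1 - Phi w \<longleftrightarrow> Z j \<le> - w" for j
      using Phi_le_iff[of "Z j" "- w"] by (auto simp: Phi_uminus)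
    moreover have "1 - Phi (Z j) \<le> 1 - Phi w \<longleftrightarrow> Z j \<ge> w" for j
      using Phi_le_iff[of w "Z j"] by auto
    ultimately show ?thesis by (simp add: adapt_admissible_def good_level_def pv)
  qed
  have bdd: "bdd_above ?A" by (rule bdd_aboveI[of _ "1/2"]) (auto simp: adapt_admissible_def)
  show ?thesis unfolding threshold_rule_def Z_def[symmetric]
  proof (intro conjI allI impI)
    show "adapt (1/2) q m (means_pval \<omega>) \<subseteq> {j. j < m \<and> 0 \<le> Z j}"
    proof (clarsimp simp: adapt_def)
      fix j assume "?A \<noteq> {}" "means_pval \<omega> j \<le> Sup ?A"
      moreover have "Sup ?A \<le> 1/2" using \<open>?A \<noteq> {}\<close>
        by (intro cSup_least) (auto simp: adapt_admissible_def)
      ultimately have "Phi 0 \<le> Phi (Z j)" by (simp add: pv Phi_0)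
      then show "0 \<le> Z j" by (simp add: Phi_le_iff)
    qed
  next
    fix w :: real assume w: "w > 0" "good_level q m Z w"
    then have A: "1 - Phi w \<in> ?A" using adm[of w] by simp
    then have "1 - Phi w \<le> Sup ?A" using bdd by (rule cSup_upper)
    then have "1 - Phi (Z j) \<le> Sup ?A" if "w \<le> Z j" for j
      using that Phi_le_iff[of w "Z j"] by linarith
    then show "{j. j < m \<and> w \<le> Z j} \<subseteq> adapt (1/2) q m (means_pval \<omega>)"
      using A by (auto simp: adapt_def pv)
  next
    fix v :: real assume v: "v \<ge> 0" "\<forall>w\<in>{0..v}. \<not> good_level q m Z w"
    \<comment> \<open>A larger admissible \<open>t\<close> would be \<open>1 - Phi w\<close> with
      \<open>0 \<le> w \<le> v\<close> by the intermediate value theorem. The threshold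
      \<open>t = 0\<close>, which corresponds to no \<open>w\<close>, satisfies the bound
      trivially.\<close>
    have "t \<le> 1 - Phi v" if t: "t \<in> ?A" for t
    proof (rule ccontr)
      assume "\<not> t \<le> 1 - Phi v"
      moreover have "t \<le> 1/2" using t by (simp add: adapt_admissible_def)
      ultimately have "Phi 0 \<le> 1 - t" "1 - t \<le> Phi v" by (auto simp: Phi_0)
      then have "\<exists>w\<ge>0. w \<le> v \<and> Phi w = 1 - t"
        using v(1) by (intro IVT) (auto simp: isCont_Phi)
      then obtain w where w: "0 \<le> w" "w \<le> v" "t = 1 - Phi w" by auto
      then show False using adm[of w] t v(2) by auto
    qed
    then have "Sup ?A \<le> 1 - Phi v" if "?A \<noteq> {}" using that by (intro cSup_least) auto
    then have "v \<le> Z j" if "?A \<noteq> {}" "means_pval \<omega> j \<le> Sup ?A" for j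
      using that Phi_le_iff[of v "Z j"] by (fastforce simp: pv)
    then show "adapt (1/2) q m (means_pval \<omega>) \<subseteq> {j. j < m \<and> v \<le> Z j}"
      by (auto simp: adapt_def)
  qed
qed

section \<open>Measurability of the performance measures\<close>

lemma card_real_sum: "real (card {j. j < p \<and> P j}) = (\<Sum>j<(p::nat). if P j then 1 else 0)"
proof -
  have "{j. j < p \<and> P j} = {j \<in> {..<p}. P j}" by auto
  then show ?thesis by (simp add: sum.If_cases Int_def)
qed

lemma measurable_card:
  assumes "\<And>j. j < p \<Longrightarrow> Measurable.pred M (\<lambda>\<omega>. P j \<omega>)"
  shows "(\<lambda>\<omega>. real (card {j. j < (p::nat) \<and> P j \<omega>})) \<in> borel_measurable M"
  unfolding card_real_sum using assms by (intro borel_measurable_sum) auto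

lemma measurable_card_total[measurable]:
  assumes [measurable]: "\<And>j. Measurable.pred M (\<lambda>\<omega>. P j \<omega>)"
  shows "(\<lambda>\<omega>. real (card {j. j < (p::nat) \<and> P j \<omega>})) \<in> borel_measurable M"
  using assms by (rule measurable_card)

lemma measurable_fdp:
  assumes "\<And>j. j < p \<Longrightarrow> Measurable.pred M (\<lambda>\<omega>. j \<in> S \<omega>)" "\<And>j. j < p \<Longrightarrow> Measurable.pred M (\<lambda>\<omega>. j \<in> S0 \<omega>)"
    and "\<And>\<omega>. S \<omega> \<subseteq> {..<p}"
  shows "(\<lambda>\<omega>. fdp (S \<omega>) (S0 \<omega>)) \<in> borel_measurable M"
proof -
  have "fdp (S \<omega>) (S0 \<omega>) = real (card {j. j < p \<and> (j \<in> S \<omega> \<and> j \<in> S0 \<omega>)}) /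
      max (real (card {j. j < p \<and> j \<in> S \<omega>})) 1" for \<omega>
  proof -
    have "S \<omega> \<inter> S0 \<omega> = {j. j < p \<and> (j \<in> S \<omega> \<and> j \<in> S0 \<omega>)}" "S \<omega> = {j. j < p \<and> j \<in> S \<omega>}"
      using assms(3)[of \<omega>] by auto
    then show ?thesis unfolding fdp_def by (simp add: of_nat_max)
  qed
  then show ?thesis using assms(1,2)
    by (simp only:) (intro borel_measurable_divide borel_measurable_max borel_measurable_const measurable_card pred_intros_logic)
qed

lemma measurable_realized_power:
  assumes "\<And>j. j < p \<Longrightarrow> Measurable.pred M (\<lambda>\<omega>. j \<in> S \<omega>)" "\<And>j. j < p \<Longrightarrow> Measurable.pred M (\<lambda>\<omega>. j \<in> S0 \<omega>)"
  shows "(\<lambda>\<omega>. realized_power p (S \<omega>) (S0 \<omega>)) \<in> borel_measurable M"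
proof -
  have "realized_power p (S \<omega>) (S0 \<omega>) = real (card {j. j < p \<and> (j \<in> S \<omega> \<and> j \<notin> S0 \<omega>)}) /
      real (card {j. j < p \<and> j \<notin> S0 \<omega>})" for \<omega>
  proof -
    have "S \<omega> \<inter> ({..<p} - S0 \<omega>) = {j. j < p \<and> (j \<in> S \<omega> \<and> j \<notin> S0 \<omega>)}"
      "{..<p} - S0 \<omega> = {j. j < p \<and> j \<notin> S0 \<omega>}" by auto
    then show ?thesis by (simp only: realized_power_def)
  qed
  then show ?thesis using assms
    by (simp only:) (intro borel_measurable_divide measurable_card pred_intros_logic)
qed

text \<open>Lying above the minimum of a finite set means lying above one of its elements. So
  membership becomes a finite disjunction over the candidates
  \<open>\<bar>V l\<bar>\<close>.\<close>

lemma measurable_knockoff_filter: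
  assumes W: "\<And>j. j < p \<Longrightarrow> (\<lambda>\<omega>. W \<omega> j) \<in> borel_measurable M" and j: "j < p"
  shows "Measurable.pred M (\<lambda>\<omega>. j \<in> knockoff_filter q p (W \<omega>))"
proof -
  \<comment> \<open>Entries beyond \<open>p\<close> are not known to be measurable; setting them to
    0 makes every coordinate measurable without changing the selection.\<close>
  define V where "V \<omega> j = (if j < p then W \<omega> j else 0)" for \<omega> j
  have [measurable]: "(\<lambda>\<omega>. V \<omega> j) \<in> borel_measurable M" for j
    using W by (cases "j < p") (simp_all add: V_def)
  have VW: "knockoff_filter q p (W \<omega>) = knockoff_filter q p (V \<omega>)" for \<omega>
  proof -
    have "knockoff_thresholds q p (W \<omega>) = knockoff_thresholds q p (V \<omega>)"
      unfolding knockoff_thresholds_def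
      by (intro Collect_cong conj_cong) (auto simp: V_def cong: conj_cong)
    then show ?thesis by (auto simp: knockoff_filter_def V_def)
  qed
  have "j \<in> knockoff_filter q p V \<longleftrightarrow> (\<exists>l\<in>{..<p}. V l \<noteq> 0 \<and> (\<exists>i\<in>{..<p}. V i \<ge> \<bar>V l\<bar>) \<and>
      (1 + real (card {j. j < p \<and> V j \<le> - \<bar>V l\<bar>})) / real (card {j. j < p \<and> V j \<ge> \<bar>V l\<bar>}) \<le> q \<and> \<bar>V l\<bar> \<le> V j)" for V
  proof -
    let ?T = "knockoff_thresholds q p V"
    have "j \<in> knockoff_filter q p V \<longleftrightarrow> (\<exists>w\<in>?T. w \<le> V j)"
      using j Min_le_iff[OF finite_knockoff_thresholds, of q p V "V j"] by (auto simp: knockoff_filter_def)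
    also have "\<dots> \<longleftrightarrow> (\<exists>l\<in>{..<p}. V l \<noteq> 0 \<and> (\<exists>i\<in>{..<p}. V i \<ge> \<bar>V l\<bar>) \<and>
      (1 + real (card {j. j < p \<and> V j \<le> - \<bar>V l\<bar>})) / real (card {j. j < p \<and> V j \<ge> \<bar>V l\<bar>}) \<le> q \<and> \<bar>V l\<bar> \<le> V j)"
      unfolding knockoff_thresholds_def by auto
    finally show ?thesis .
  qed
  then show ?thesis unfolding VW by simp
qed

text \<open>Both counts are right-continuous step functions of the threshold, so rational thresholds
  and the right endpoint suffice.\<close>

lemma adapt_admissible_rational:
  assumes t: "t \<in> adapt_admissible tmax q m pv" "s < t"
  shows "\<exists>r\<in>\<rat> \<union> {tmax}. r \<in> adapt_admissible tmax q m pv \<and> s < r"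
proof (cases "t = tmax")
  case True
  then show ?thesis using t by blast
next
  case False
  have tt: "0 \<le> t" "t < tmax" using t False by (auto simp: adapt_admissible_def)
  have "eventually (\<lambda>r. (pv j \<le> r \<longleftrightarrow> pv j \<le> t) \<and> (pv j \<ge> 1 - r \<longleftrightarrow> pv j \<ge> 1 - t)) (at_right t)" for j
  proof (intro eventually_conj)
    show "\<forall>\<^sub>F r in at_right t. (pv j \<le> r) = (pv j \<le> t)"
    proof (cases "pv j \<le> t")
      case True
      then show ?thesis by (auto simp: eventually_at_filter)
    next
      case False
      then have "\<forall>\<^sub>F r in at_right t. r \<in> {t<..<pv j}" by (intro eventually_at_right_real) auto
      then show ?thesis by eventually_elim (use False in auto)
    qed
    show "\<forall>\<^sub>F r in at_right t. (pv j \<ge> 1 - r) = (pv j \<ge> 1 - t)"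
    proof (cases "pv j \<ge> 1 - t")
      case True
      then show ?thesis by (auto simp: eventually_at_filter)
    next
      case False
      then have "\<forall>\<^sub>F r in at_right t. r \<in> {t<..<1 - pv j}" by (intro eventually_at_right_real) auto
      then show ?thesis by eventually_elim (use False in auto)
    qed
  qed
  then have "\<forall>\<^sub>F r in at_right t. \<forall>j\<in>{..<m}. (pv j \<le> r \<longleftrightarrow> pv j \<le> t) \<and> (pv j \<ge> 1 - r \<longleftrightarrow> pv j \<ge> 1 - t)"
    by (intro eventually_ball_finite) auto
  then obtain b where b: "b > t" "\<And>r j. t < r \<Longrightarrow> r < b \<Longrightarrow> j < m \<Longrightarrow>
      (pv j \<le> r \<longleftrightarrow> pv j \<le> t) \<and> (pv j \<ge> 1 - r \<longleftrightarrow> pv j \<ge> 1 - t)"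
    unfolding eventually_at_right_field by auto
  obtain r where r: "r \<in> \<rat>" "t < r" "r < min b tmax"
    using Rats_dense_in_real[of t "min b tmax"] b(1) tt by auto
  have "r \<in> adapt_admissible tmax q m pv"
    using t(1) b(2)[of r] r tt unfolding adapt_admissible_def by (auto cong: conj_cong)
  then show ?thesis using r t(2) by (intro bexI[of _ r]) auto
qed

text \<open>The supremum runs over an uncountable set, but by
  \<open>adapt_admissible_rational\<close> countably many thresholds approach it. The slack
  \<open>1 / real (Suc k)\<close> is there because the supremum may fail to be admissible, the
  mirror count being able to jump there.\<close>

lemma measurable_adapt:
  assumes pv: "\<And>j. j < m \<Longrightarrow> (\<lambda>\<omega>. pv \<omega> j) \<in> borel_measurable M" and j: "j < m"
  shows "Measurable.pred M (\<lambda>\<omega>. j \<in> adapt tmax q m (pv \<omega>))"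
proof -
  define U where "U \<omega> j = (if j < m then pv \<omega> j else 0)" for \<omega> j
  have [measurable]: "(\<lambda>\<omega>. U \<omega> j) \<in> borel_measurable M" for j
    using pv by (cases "j < m") (simp_all add: U_def)
  have Upv: "adapt tmax q m (pv \<omega>) = adapt tmax q m (U \<omega>)" for \<omega>
    by (simp add: adapt_def adapt_admissible_def U_def cong: conj_cong)
  define D where "D = \<rat> \<union> {tmax}"
  have D: "countable D" by (auto simp: D_def countable_rat)
  let ?A = "\<lambda>V. adapt_admissible tmax q m V"
  have eq: "j \<in> adapt tmax q m V \<longleftrightarrow> (\<forall>k. \<exists>r\<in>D. r \<in> ?A V \<and> V j - 1 / real (Suc k) < r)" (is "?L = ?R") for V
  proof -
    have bdd: "bdd_above (?A V)" by (rule bdd_aboveI[of _ tmax]) (auto simp: adapt_admissible_def)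
    show ?thesis
    proof
      assume L: ?L
      then have ne: "?A V \<noteq> {}" and le: "V j \<le> Sup (?A V)" by (auto simp: adapt_def)
      show ?R
      proof
        fix k
        have "V j - 1 / real (Suc k) < Sup (?A V)" using le by (simp add: less_le_trans[rotated])
        then obtain t where "t \<in> ?A V" "V j - 1 / real (Suc k) < t"
          using less_cSup_iff[OF ne bdd] by auto
        then show "\<exists>r\<in>D. r \<in> ?A V \<and> V j - 1 / real (Suc k) < r"
          unfolding D_def by (rule adapt_admissible_rational)
      qed
    next
      assume R: ?R
      have "V j \<le> Sup (?A V) + e" if "e > 0" for e
      proof -
        obtain k where k: "1 / real (Suc k) < e" using \<open>e > 0\<close> by (rule nat_approx_posE)
        from R obtain r where r: "r \<in> ?A V" "V j - 1 / real (Suc k) < r" by blast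
        have "r \<le> Sup (?A V)" by (rule cSup_upper[OF r(1) bdd])
        then show ?thesis using k r by linarith
      qed
      then have "V j \<le> Sup (?A V)" by (rule field_le_epsilon)
      then show ?L using R j by (auto simp: adapt_def)
    qed
  qed
  have [measurable]: "Measurable.pred M (\<lambda>\<omega>. r \<in> ?A (U \<omega>))" for r
  proof -
    have "r \<in> ?A V \<longleftrightarrow> r \<in> {0..tmax} \<and> (\<exists>j\<in>{..<m}. V j \<le> r) \<and>
        (1 + real (card {j. j < m \<and> V j \<ge> 1 - r})) / real (card {j. j < m \<and> V j \<le> r}) \<le> q" for V
      by (auto simp: adapt_admissible_def)
    then show ?thesis by simp
  qed
  have "Measurable.pred M (\<lambda>\<omega>. \<exists>r\<in>D. r \<in> ?A (U \<omega>) \<and> U \<omega> j - 1 / real (Suc k) < r)" for k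
    using D by (intro measurable_pred_countable) measurable
  then show ?thesis unfolding Upv eq by measurable
qed

section \<open>Limits of false discovery proportion and power\<close>

text \<open>\<open>G0 w\<close>, \<open>G1 w\<close> and \<open>H w\<close> are the limiting proportions of nulls with \<open>Z \<ge> w\<close>, of non-nulls with
  \<open>Z \<ge> w\<close> and of all variables with \<open>Z \<le> - w\<close>; \<open>r1\<close> is the limiting proportion of non-nulls.\<close>

locale limit_profile =
  fixes G0 G1 H :: "real \<Rightarrow> real" and r1 :: real
  assumes contG0: "continuous_on {0..} G0" and contG1: "continuous_on {0..} G1"
    and contH: "continuous_on {0..} H"
    and G0_pos: "w \<ge> 0 \<Longrightarrow> G0 w > 0" and G1_nonneg: "w \<ge> 0 \<Longrightarrow> G1 w \<ge> 0"
    and G1_lim: "(G1 \<longlongrightarrow> 0) at_top" and r1_pos: "r1 > 0"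
begin

definition phi :: "real \<Rightarrow> real" where "phi w = H w / (G0 w + G1 w)"

text \<open>The limit of the random thresholds. It has this meaning only under
  \<open>crosses q\<close>; otherwise the infimum is over the empty set.\<close>

definition tau :: "real \<Rightarrow> real" where "tau q = Inf {w. 0 \<le> w \<and> phi w \<le> q}"

definition crosses :: "real \<Rightarrow> bool" where "crosses q \<longleftrightarrow> (\<exists>w\<ge>0. phi w \<le> q)"

definition power_lim :: "real \<Rightarrow> real" where
  "power_lim q = (if crosses q then G1 (tau q) / r1 else 0)"

definition fdp_lim :: "real \<Rightarrow> real" where
  "fdp_lim q = G0 (tau q) / (G0 (tau q) + G1 (tau q))"

text \<open>A level at which \<open>phi\<close> touches \<open>q\<close> for the first time without going below it right
  afterwards is the minimum of \<open>phi\<close> over an interval with rational right endpoint. So there are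
  only countably many such levels.\<close>

definition touching_levels :: "real set" where
  "touching_levels = (\<lambda>r. Inf (phi ` {0..r})) ` \<rat>"

lemma countable_touching_levels: "countable touching_levels"
  unfolding touching_levels_def by (intro countable_image countable_rat)

lemma G_pos: "w \<ge> 0 \<Longrightarrow> G0 w + G1 w > 0"
  using G0_pos[of w] G1_nonneg[of w] by simp

lemma cont_phi: "continuous_on {0..} phi"
  unfolding phi_def
  using G_pos by (intro continuous_intros contG0 contG1 contH) force

lemma phi_less_iff: "w \<ge> 0 \<Longrightarrow> phi w < q \<longleftrightarrow> H w < q * (G0 w + G1 w)"
  using G_pos[of w] by (simp add: phi_def divide_less_eq)

lemma phi_greater_iff: "w \<ge> 0 \<Longrightarrow> q < phi w \<longleftrightarrow> q * (G0 w + G1 w) < H w"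
  using G_pos[of w] by (simp add: phi_def less_divide_eq)

lemma tau_nonneg: "crosses q \<Longrightarrow> tau q \<ge> 0"
  unfolding tau_def crosses_def by (intro cInf_greatest) auto

lemma before_tau: "0 \<le> w \<Longrightarrow> w < tau q \<Longrightarrow> q < phi w"
proof (rule ccontr)
  assume w: "0 \<le> w" "w < tau q" "\<not> q < phi w"
  have "tau q \<le> w" unfolding tau_def
    by (rule cInf_lower) (use w in \<open>auto intro!: bdd_belowI[of _ 0]\<close>)
  with w(2) show False by simp
qed

lemma phi_tau_le: assumes "crosses q" shows "phi (tau q) \<le> q"
proof -
  define A where "A = {w. 0 \<le> w \<and> phi w \<le> q}"
  have "closed ({0..} \<inter> phi -` {..q})"
    by (rule continuous_closed_preimage[OF cont_phi]) auto
  moreover have "{0..} \<inter> phi -` {..q} = A" by (auto simp: A_def)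
  ultimately have "closed A" by simp
  moreover have "A \<noteq> {}" using assms by (auto simp: crosses_def A_def)
  moreover have "bdd_below A" by (rule bdd_belowI[of _ 0]) (auto simp: A_def)
  ultimately have "Inf A \<in> A" by (intro closed_contains_Inf)
  then show ?thesis by (simp add: tau_def A_def)
qed

lemma cont_eps:
  assumes "continuous_on {0..} (f :: real \<Rightarrow> real)" "x \<ge> 0" "e > 0"
  obtains d where "d > 0" "\<And>y. y \<ge> 0 \<Longrightarrow> \<bar>y - x\<bar> < d \<Longrightarrow> \<bar>f y - f x\<bar> < e"
proof -
  have "\<forall>x\<in>{0..}. \<forall>e>0. \<exists>d>0. \<forall>y\<in>{0..}. dist y x < d \<longrightarrow> dist (f y) (f x) < e"
    using assms(1) by (simp add: continuous_on_iff)
  then obtain d where "d > 0" "\<forall>y\<in>{0..}. dist y x < d \<longrightarrow> dist (f y) (f x) < e"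
    using assms(2,3) by (meson atLeast_iff)
  then show thesis by (intro that[of d]) (auto simp: dist_real_def)
qed

text \<open>The minimum of \<open>phi\<close> over \<open>{0..r}\<close>, with \<open>r\<close>
  rational just after \<open>tau q\<close>, is at most \<open>q\<close>, and it differs from
  \<open>q\<close> since \<open>q\<close> is not a touching level. Hence \<open>phi\<close> is below
  \<open>q\<close> somewhere, and by \<open>before_tau\<close> not before
  \<open>tau q\<close>.\<close>

lemma after_tau:
  assumes "crosses q" "q \<notin> touching_levels" "d > 0"
  obtains w where "tau q < w" "w < tau q + d" "phi w < q"
proof -
  have t0: "tau q \<ge> 0" by (rule tau_nonneg) fact
  obtain r where r: "r \<in> \<rat>" "tau q < r" "r < tau q + d"
    using Rats_dense_in_real[of "tau q" "tau q + d"] assms(3) by auto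
  have sub: "continuous_on {0..r} phi" by (rule continuous_on_subset[OF cont_phi]) auto
  have bdd: "bdd_below (phi ` {0..r})"
    using compact_continuous_image[OF sub compact_Icc] by (intro bounded_imp_bdd_below compact_imp_bounded)
  have "Inf (phi ` {0..r}) \<le> phi (tau q)"
    using t0 r by (intro cInf_lower bdd) auto
  then have "Inf (phi ` {0..r}) \<le> q" using phi_tau_le[OF assms(1)] by simp
  moreover have "Inf (phi ` {0..r}) \<noteq> q" using assms(2) r(1) by (auto simp: touching_levels_def)
  ultimately have "Inf (phi ` {0..r}) < q" by simp
  then obtain w where w: "w \<in> {0..r}" "phi w < q"
    using cInf_less_iff[OF _ bdd, of q] t0 r by auto
  have "w \<ge> tau q" using before_tau[of w q] w by force
  show thesis
  proof (cases "w = tau q")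
    case False
    then show ?thesis using that[of w] w \<open>w \<ge> tau q\<close> r by auto
  next
    case True
    \<comment> \<open>Here \<open>phi\<close> is below \<open>q\<close> already at its first
      crossing, as can happen at 0; by continuity it stays below a little to the right.\<close>
    obtain c where c: "c > 0" "\<And>y. y \<ge> 0 \<Longrightarrow> \<bar>y - tau q\<bar> < c \<Longrightarrow> \<bar>phi y - phi (tau q)\<bar> < q - phi w"
      using cont_eps[OF cont_phi t0, of "q - phi w"] w by auto
    define y where "y = tau q + min c d / 2"
    have "\<bar>phi y - phi (tau q)\<bar> < q - phi w"
      using c(1) assms(3) t0 by (intro c(2)) (auto simp: y_def)
    then have "phi y < q" using True by (simp add: abs_less_iff)
    then show ?thesis using that[of y] c(1) assms(3) by (auto simp: y_def min_def split: if_splits)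
  qed
qed

end

text \<open>The limits are assumed at each fixed level only. Uniformity over levels is recovered
  from the monotonicity of the counts and the continuity of the profile.\<close>

locale empirical_limits = prob_seq M + limit_profile G0 G1 H r1
  for M :: "nat \<Rightarrow> 'a measure" and G0 G1 H :: "real \<Rightarrow> real" and r1 :: real +
  fixes p :: "nat \<Rightarrow> nat" and Z :: "nat \<Rightarrow> 'a \<Rightarrow> nat \<Rightarrow> real" and S0 :: "nat \<Rightarrow> 'a \<Rightarrow> nat set"
  assumes p: "filterlim p at_top sequentially"
    and lim0: "w \<ge> 0 \<Longrightarrow>
      cprob M (\<lambda>n \<omega>. real (card {j. j < p n \<and> (j \<in> S0 n \<omega> \<and> w \<le> Z n \<omega> j)}) / real (p n)) (G0 w)"
    and lim1: "w \<ge> 0 \<Longrightarrow>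
      cprob M (\<lambda>n \<omega>. real (card {j. j < p n \<and> (j \<notin> S0 n \<omega> \<and> w \<le> Z n \<omega> j)}) / real (p n)) (G1 w)"
    and limH: "w \<ge> 0 \<Longrightarrow>
      cprob M (\<lambda>n \<omega>. real (card {j. j < p n \<and> Z n \<omega> j \<le> - w}) / real (p n)) (H w)"
    and limr: "cprob M (\<lambda>n \<omega>. real (card {j. j < p n \<and> j \<notin> S0 n \<omega>}) / real (p n)) r1"
begin

lemma p_real: "filterlim (\<lambda>n. real (p n)) at_top sequentially"
  using p filterlim_real_sequentially filterlim_compose by blast

lemma p_pos: "\<forall>\<^sub>F n in sequentially. p n > 0"
  using filterlim_at_top[THEN iffD1, OF p, rule_format, of 1] by eventually_elim simp

lemma card_split:
  "card {j. j < (m::nat) \<and> P j} = card {j. j < m \<and> (Q j \<and> P j)} + card {j. j < m \<and> (\<not> Q j \<and> P j)}"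
proof -
  have "{j. j < m \<and> P j} = {j. j < m \<and> (Q j \<and> P j)} \<union> {j. j < m \<and> (\<not> Q j \<and> P j)}" by auto
  then show ?thesis by (simp only:) (rule card_Un_disjoint, auto)
qed

lemma limG:
  assumes "w \<ge> 0"
  shows "cprob M (\<lambda>n \<omega>. real (card {j. j < p n \<and> w \<le> Z n \<omega> j}) / real (p n)) (G0 w + G1 w)"
  using cprob_add[OF lim0[OF assms] lim1[OF assms]]
  by (simp add: add_divide_distrib[symmetric] card_split[where Q="\<lambda>j. j \<in> S0 _ _", symmetric] flip: of_nat_add)

lemma inverse_p: "(\<lambda>n. 1 / real (p n)) \<longlonglongrightarrow> 0"
  by (intro tendsto_divide_0[OF tendsto_const] filterlim_at_top_imp_at_infinity p_real)

text \<open>Multiplied out, the defining inequality is linear in the counts. After division by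
  \<open>p n\<close> the added 1 vanishes, and the strict inequality in the limit leaves room for
  the fluctuations.\<close>

lemma whp_good:
  assumes w: "w \<ge> 0" "phi w < q"
  shows "whp M (\<lambda>n \<omega>. good_level q (p n) (Z n \<omega>) w)"
proof -
  let ?D = "\<lambda>n \<omega>. real (card {j. j < p n \<and> Z n \<omega> j \<le> - w})"
  let ?U = "\<lambda>n \<omega>. real (card {j. j < p n \<and> w \<le> Z n \<omega> j})"
  have "cprob M (\<lambda>n \<omega>. 1 / real (p n) + ?D n \<omega> / real (p n) - q * (?U n \<omega> / real (p n))) (0 + H w - q * (G0 w + G1 w))"
    by (intro cprob_diff cprob_add cprob_cmult limG limH cprob_tendsto inverse_p w)
  moreover have "q * (G0 w + G1 w) - H w > 0" using w phi_less_iff by simp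
  ultimately have "whp M (\<lambda>n \<omega>. \<bar>1 / real (p n) + ?D n \<omega> / real (p n) - q * (?U n \<omega> / real (p n)) - (0 + H w - q * (G0 w + G1 w))\<bar> < q * (G0 w + G1 w) - H w)"
    unfolding cprob_def by blast
  then show ?thesis
  proof (rule whp_mp)
    show "\<forall>\<^sub>F n in sequentially. \<forall>\<omega>\<in>space (M n). \<bar>1 / real (p n) + ?D n \<omega> / real (p n) - q * (?U n \<omega> / real (p n)) - (0 + H w - q * (G0 w + G1 w))\<bar> < q * (G0 w + G1 w) - H w
        \<longrightarrow> good_level q (p n) (Z n \<omega>) w"
      using p_pos
    proof (eventually_elim, intro ballI impI)
      fix n \<omega>
      assume p0: "p n > 0" and "\<bar>1 / real (p n) + ?D n \<omega> / real (p n) - q * (?U n \<omega> / real (p n)) - (0 + H w - q * (G0 w + G1 w))\<bar> < q * (G0 w + G1 w) - H w"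
      then have "1 / real (p n) + ?D n \<omega> / real (p n) - q * (?U n \<omega> / real (p n)) < 0" by linarith
      then have "(1 + ?D n \<omega> - q * ?U n \<omega>) / real (p n) < 0"
        by (simp add: add_divide_distrib diff_divide_distrib)
      then have lt: "1 + ?D n \<omega> < q * ?U n \<omega>" using p0 by (simp add: divide_less_0_iff)
      \<comment> \<open>The added 1 also excludes a zero denominator: it would give
        \<open>1 + ?D n \<omega> < 0\<close>.\<close>
      have U: "?U n \<omega> > 0"
      proof (rule ccontr)
        assume "\<not> ?U n \<omega> > 0"
        then have "?U n \<omega> = 0" by simp
        then have "q * ?U n \<omega> = 0" by simp
        moreover have "1 + ?D n \<omega> > 0" by (simp add: add_pos_nonneg)
        ultimately show False using lt by linarith
      qed
      then have "{j. j < p n \<and> w \<le> Z n \<omega> j} \<noteq> {}" by (metis card.empty less_irrefl of_nat_0)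
      moreover have "(1 + ?D n \<omega>) / ?U n \<omega> \<le> q" using U lt by (simp add: divide_le_eq)
      ultimately show "good_level q (p n) (Z n \<omega>) w" unfolding good_level_def by blast
    qed
  qed
qed

text \<open>Both counts decrease in the level. Comparing the mirror count at \<open>b\<close> with
  the selection count at \<open>a\<close> therefore excludes all levels of \<open>{a..b}\<close> at
  once.\<close>

lemma whp_not_good_local:
  assumes ab: "0 \<le> a" "a \<le> b" "q * (G0 a + G1 a) < H b"
  shows "whp M (\<lambda>n \<omega>. \<forall>w\<in>{a..b}. \<not> good_level q (p n) (Z n \<omega>) w)"
proof (cases "q \<ge> 0")
  case q: True
  let ?D = "\<lambda>w n \<omega>. real (card {j. j < p n \<and> Z n \<omega> j \<le> - w})"
  let ?U = "\<lambda>w n \<omega>. real (card {j. j < p n \<and> w \<le> Z n \<omega> j})"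
  have "cprob M (\<lambda>n \<omega>. ?D b n \<omega> / real (p n) - q * (?U a n \<omega> / real (p n))) (H b - q * (G0 a + G1 a))"
    using ab by (intro cprob_diff cprob_cmult limG limH) auto
  moreover have "H b - q * (G0 a + G1 a) > 0" using ab by simp
  ultimately have "whp M (\<lambda>n \<omega>. \<bar>?D b n \<omega> / real (p n) - q * (?U a n \<omega> / real (p n)) - (H b - q * (G0 a + G1 a))\<bar> < H b - q * (G0 a + G1 a))"
    unfolding cprob_def by blast
  then show ?thesis
  proof (rule whp_mono, intro ballI notI)
    fix n \<omega> w
    assume "\<bar>?D b n \<omega> / real (p n) - q * (?U a n \<omega> / real (p n)) - (H b - q * (G0 a + G1 a))\<bar> < H b - q * (G0 a + G1 a)"
      and w: "w \<in> {a..b}" and g: "good_level q (p n) (Z n \<omega>) w"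
    then have "0 < (?D b n \<omega> - q * ?U a n \<omega>) / real (p n)"
      by (simp add: diff_divide_distrib)
    then have lt: "q * ?U a n \<omega> < ?D b n \<omega>" by (simp add: zero_less_divide_iff)
    have "?D b n \<omega> \<le> ?D w n \<omega>" using w by (intro of_nat_mono card_mono) auto
    moreover have "?U w n \<omega> \<le> ?U a n \<omega>" using w by (intro of_nat_mono card_mono) auto
    then have "q * ?U w n \<omega> \<le> q * ?U a n \<omega>" using q by (rule mult_left_mono)
    ultimately have lt: "q * ?U w n \<omega> < 1 + ?D w n \<omega>" using lt by linarith
    have "{j. j < p n \<and> w \<le> Z n \<omega> j} \<noteq> {}" using g by (auto simp: good_level_def)
    then have "?U w n \<omega> > 0" by (simp add: card_gt_0_iff)
    then have "q < (1 + ?D w n \<omega>) / ?U w n \<omega>" using lt by (simp add: less_divide_eq)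
    then show False using g by (simp add: good_level_def)
  qed
next
  case False
  have "\<not> good_level q m V w" for m V w
  proof
    assume "good_level q m V w"
    then have "(1 + real (card {j. j < m \<and> V j \<le> - w})) / real (card {j. j < m \<and> V j \<ge> w}) \<le> q"
      by (simp add: good_level_def)
    moreover have "0 \<le> (1 + real (card {j. j < m \<and> V j \<le> - w})) / real (card {j. j < m \<and> V j \<ge> w})"
      by simp
    ultimately show False using False by linarith
  qed
  then show ?thesis by (intro whp_always) auto
qed

text \<open>Compactness of \<open>{0..v}\<close>: by continuity each point has a neighbourhood to
  which \<open>whp_not_good_local\<close> applies, and finitely many such intervals are joined by
  \<open>whp_conj\<close>.\<close>

lemma whp_not_good:
  assumes "v \<ge> 0" "\<And>w. 0 \<le> w \<Longrightarrow> w \<le> v \<Longrightarrow> q < phi w"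
  shows "whp M (\<lambda>n \<omega>. \<forall>w\<in>{0..v}. \<not> good_level q (p n) (Z n \<omega>) w)"
proof -
  \<comment> \<open>Neighbourhoods of 0 may begin below 0, where the profile is not controlled;
    hence the guard \<open>0 \<le> a\<close>.\<close>
  define P where "P a b \<longleftrightarrow> (0 \<le> a \<longrightarrow> whp M (\<lambda>n \<omega>. \<forall>w\<in>{a..b}. \<not> good_level q (p n) (Z n \<omega>) w))" for a b
  have "P 0 v" using assms(1)
  proof (induction rule: Bolzano)
    case (trans a b c)
    show ?case unfolding P_def
    proof
      assume a: "0 \<le> a"
      have "whp M (\<lambda>n \<omega>. (\<forall>w\<in>{a..b}. \<not> good_level q (p n) (Z n \<omega>) w) \<and> (\<forall>w\<in>{b..c}. \<not> good_level q (p n) (Z n \<omega>) w))"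
        using trans a by (intro whp_conj) (auto simp: P_def)
      then show "whp M (\<lambda>n \<omega>. \<forall>w\<in>{a..c}. \<not> good_level q (p n) (Z n \<omega>) w)"
        by (rule whp_mono) (meson atLeastAtMost_iff linorder_linear)
    qed
  next
    case (local x)
    define e where "e = (H x - q * (G0 x + G1 x)) / 2"
    have x: "x \<ge> 0" and e: "e > 0" using local assms(2)[of x] phi_greater_iff[of x q] by (auto simp: e_def)
    have c: "continuous_on {0..} (\<lambda>w. q * (G0 w + G1 w))" by (intro continuous_intros contG0 contG1)
    obtain d1 where d1: "d1 > 0" "\<And>y. y \<ge> 0 \<Longrightarrow> \<bar>y - x\<bar> < d1 \<Longrightarrow> \<bar>q * (G0 y + G1 y) - q * (G0 x + G1 x)\<bar> < e"
      using cont_eps[OF c x e] by auto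
    obtain d2 where d2: "d2 > 0" "\<And>y. y \<ge> 0 \<Longrightarrow> \<bar>y - x\<bar> < d2 \<Longrightarrow> \<bar>H y - H x\<bar> < e"
      using cont_eps[OF contH x e] by auto
    show ?case
    proof (intro exI[of _ "min d1 d2"] conjI allI impI)
      show "0 < min d1 d2" using d1 d2 by simp
      fix a b assume ab: "a \<le> x \<and> x \<le> b \<and> b - a < min d1 d2"
      show "P a b" unfolding P_def
      proof
        assume a: "0 \<le> a"
        have "\<bar>q * (G0 a + G1 a) - q * (G0 x + G1 x)\<bar> < e" using ab a by (intro d1(2)) auto
        moreover have "\<bar>H b - H x\<bar> < e" using ab a by (intro d2(2)) auto
        ultimately have "q * (G0 a + G1 a) < H b" unfolding e_def by argo
        with a ab show "whp M (\<lambda>n \<omega>. \<forall>w\<in>{a..b}. \<not> good_level q (p n) (Z n \<omega>) w)"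
          by (intro whp_not_good_local) auto
      qed
    qed
  qed
  then show ?thesis by (simp add: P_def)
qed

context
  fixes q :: real and S :: "nat \<Rightarrow> 'a \<Rightarrow> nat set"
  assumes q: "q \<notin> touching_levels"
    and rule: "\<And>n \<omega>. threshold_rule q (p n) (Z n \<omega>) (S n \<omega>)"
begin

lemma S_less: "j \<in> S n \<omega> \<Longrightarrow> j < p n" and S_nonneg: "S n \<omega> \<subseteq> {j. j < p n \<and> 0 \<le> Z n \<omega> j}"
  using rule[of n \<omega>] by (auto simp: threshold_rule_def)

lemma whp_upper:
  assumes "v \<ge> 0" "\<And>w. 0 \<le> w \<Longrightarrow> w \<le> v \<Longrightarrow> q < phi w"
  shows "whp M (\<lambda>n \<omega>. S n \<omega> \<subseteq> {j. j < p n \<and> v \<le> Z n \<omega> j})"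
  by (rule whp_mono[OF whp_not_good[OF assms]])
    (use assms(1) rule in \<open>auto simp: threshold_rule_def\<close>)

text \<open>Two deterministic levels on either side of \<open>tau q\<close>, so close to it that the
  profile hardly changes: no level up to \<open>v\<close> is good, and \<open>w\<close> is.\<close>

lemma sandwich:
  assumes "crosses q" "e > 0"
  obtains v w where "0 \<le> v" "0 \<le> w" "\<bar>G0 v - G0 (tau q)\<bar> < e" "\<bar>G0 w - G0 (tau q)\<bar> < e"
    "\<bar>G1 v - G1 (tau q)\<bar> < e" "\<bar>G1 w - G1 (tau q)\<bar> < e"
    "whp M (\<lambda>n \<omega>. {j. j < p n \<and> w \<le> Z n \<omega> j} \<subseteq> S n \<omega> \<and> S n \<omega> \<subseteq> {j. j < p n \<and> v \<le> Z n \<omega> j})"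
proof -
  have t0: "tau q \<ge> 0" by (rule tau_nonneg) fact
  obtain d1 where d1: "d1 > 0" "\<And>y. y \<ge> 0 \<Longrightarrow> \<bar>y - tau q\<bar> < d1 \<Longrightarrow> \<bar>G0 y - G0 (tau q)\<bar> < e"
    using cont_eps[OF contG0 t0 assms(2)] by auto
  obtain d2 where d2: "d2 > 0" "\<And>y. y \<ge> 0 \<Longrightarrow> \<bar>y - tau q\<bar> < d2 \<Longrightarrow> \<bar>G1 y - G1 (tau q)\<bar> < e"
    using cont_eps[OF contG1 t0 assms(2)] by auto
  define d where "d = min d1 d2"
  have d: "d > 0" using d1 d2 by (simp add: d_def)
  obtain w where w: "tau q < w" "w < tau q + d" "phi w < q"
    using after_tau[OF assms(1) q d] by blast
  \<comment> \<open>For \<open>tau q\<close> close to 0 this is 0, and the upper enclosure reduces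
    to \<open>S_nonneg\<close>.\<close>
  define v where "v = max 0 (tau q - d / 2)"
  have v: "v \<ge> 0" "\<bar>v - tau q\<bar> < d" using t0 d by (auto simp: v_def)
  have "whp M (\<lambda>n \<omega>. S n \<omega> \<subseteq> {j. j < p n \<and> v \<le> Z n \<omega> j})"
  proof (cases "tau q - d / 2 \<le> 0")
    case True
    then show ?thesis using S_nonneg by (intro whp_always) (auto simp: v_def)
  next
    case False
    then show ?thesis using d by (intro whp_upper before_tau) (auto simp: v_def)
  qed
  moreover have "whp M (\<lambda>n \<omega>. {j. j < p n \<and> w \<le> Z n \<omega> j} \<subseteq> S n \<omega>)"
    by (rule whp_mono[OF whp_good[of w q]]) (use t0 w rule in \<open>auto simp: threshold_rule_def\<close>)
  ultimately have "whp M (\<lambda>n \<omega>. {j. j < p n \<and> w \<le> Z n \<omega> j} \<subseteq> S n \<omega> \<and> S n \<omega> \<subseteq> {j. j < p n \<and> v \<le> Z n \<omega> j})"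
    by (intro whp_conj)
  then show thesis
    using that[of v w] v w t0 d1(2)[of v] d1(2)[of w] d2(2)[of v] d2(2)[of w] by (auto simp: d_def)
qed

lemma squeeze:
  assumes "crosses q"
    and lim: "\<And>w. w \<ge> 0 \<Longrightarrow> cprob M (\<lambda>n \<omega>. real (card {j. j < p n \<and> (Q n \<omega> j \<and> w \<le> Z n \<omega> j)}) / real (p n)) (G w)"
    and G: "G = G0 \<or> G = G1"
  shows "cprob M (\<lambda>n \<omega>. real (card {j. j < p n \<and> (Q n \<omega> j \<and> j \<in> S n \<omega>)}) / real (p n)) (G (tau q))"
  unfolding cprob_def
proof (intro allI impI)
  fix e :: real assume "e > 0"
  then have e2: "e/2 > 0" by simp
  obtain v w where vw0: "0 \<le> v" "0 \<le> w" "\<bar>G0 v - G0 (tau q)\<bar> < e/2" "\<bar>G0 w - G0 (tau q)\<bar> < e/2"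
    "\<bar>G1 v - G1 (tau q)\<bar> < e/2" "\<bar>G1 w - G1 (tau q)\<bar> < e/2"
    and sw: "whp M (\<lambda>n \<omega>. {j. j < p n \<and> w \<le> Z n \<omega> j} \<subseteq> S n \<omega> \<and> S n \<omega> \<subseteq> {j. j < p n \<and> v \<le> Z n \<omega> j})"
    by (rule sandwich[OF assms(1) e2])
  have vw: "0 \<le> v" "0 \<le> w" "\<bar>G v - G (tau q)\<bar> < e/2" "\<bar>G w - G (tau q)\<bar> < e/2"
    using vw0 G by auto
  let ?N = "\<lambda>w n \<omega>. real (card {j. j < p n \<and> (Q n \<omega> j \<and> w \<le> Z n \<omega> j)}) / real (p n)"
  have "whp M (\<lambda>n \<omega>. \<bar>?N w n \<omega> - G w\<bar> < e/2)" "whp M (\<lambda>n \<omega>. \<bar>?N v n \<omega> - G v\<bar> < e/2)"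
    using lim vw e2 unfolding cprob_def by blast+
  from whp_conj[OF sw whp_conj[OF this]]
  show "whp M (\<lambda>n \<omega>. \<bar>real (card {j. j < p n \<and> (Q n \<omega> j \<and> j \<in> S n \<omega>)}) / real (p n) - G (tau q)\<bar> < e)"
  proof (rule whp_mono)
    fix n \<omega>
    let ?C = "real (card {j. j < p n \<and> (Q n \<omega> j \<and> j \<in> S n \<omega>)}) / real (p n)"
    assume A: "({j. j < p n \<and> w \<le> Z n \<omega> j} \<subseteq> S n \<omega> \<and> S n \<omega> \<subseteq> {j. j < p n \<and> v \<le> Z n \<omega> j}) \<and>
        \<bar>?N w n \<omega> - G w\<bar> < e/2 \<and> \<bar>?N v n \<omega> - G v\<bar> < e/2"
    have "?N w n \<omega> \<le> ?C"
      using A by (intro divide_right_mono of_nat_mono card_mono) auto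
    moreover have "?C \<le> ?N v n \<omega>"
      using A by (intro divide_right_mono of_nat_mono card_mono) auto
    moreover have "\<bar>?N w n \<omega> - G w\<bar> < e/2" "\<bar>?N v n \<omega> - G v\<bar> < e/2" using A by auto
    ultimately show "\<bar>?C - G (tau q)\<bar> < e" using vw(3,4) by linarith
  qed
qed

text \<open>If \<open>phi\<close> stays above \<open>q\<close>, no level up to any fixed
  \<open>K\<close> is good. The selection then lies in the tail beyond \<open>K\<close>, where
  \<open>G1 K\<close> is arbitrarily small.\<close>

lemma limS1:
  "cprob M (\<lambda>n \<omega>. real (card {j. j < p n \<and> (j \<notin> S0 n \<omega> \<and> j \<in> S n \<omega>)}) / real (p n))
     (if crosses q then G1 (tau q) else 0)"
proof (cases "crosses q")
  case True
  then show ?thesis using squeeze[OF True lim1] by simp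
next
  case False
  then have nf: "q < phi w" if "0 \<le> w" for w
    using that unfolding crosses_def by (meson not_le)
  have "cprob M (\<lambda>n \<omega>. real (card {j. j < p n \<and> (j \<notin> S0 n \<omega> \<and> j \<in> S n \<omega>)}) / real (p n)) 0"
    unfolding cprob_def
  proof (intro allI impI)
    fix e :: real assume "e > 0"
    then have "e/2 > 0" by simp
    with G1_lim have "\<forall>\<^sub>F w in at_top. dist (G1 w) 0 < e/2" by (rule tendstoD)
    then have "\<forall>\<^sub>F w in at_top. \<bar>G1 w\<bar> < e/2 \<and> w \<ge> 0"
      using eventually_ge_at_top[of 0] by eventually_elim simp
    then have "\<exists>K. \<bar>G1 K\<bar> < e/2 \<and> K \<ge> 0"
      by (rule eventually_happens'[rotated]) simp
    then obtain K where K: "\<bar>G1 K\<bar> < e/2" "K \<ge> 0" by blast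
    have "whp M (\<lambda>n \<omega>. S n \<omega> \<subseteq> {j. j < p n \<and> K \<le> Z n \<omega> j})"
      using K nf by (intro whp_upper) auto
    moreover have "whp M (\<lambda>n \<omega>. \<bar>real (card {j. j < p n \<and> (j \<notin> S0 n \<omega> \<and> K \<le> Z n \<omega> j)}) / real (p n) - G1 K\<bar> < e/2)"
      using lim1[OF K(2)] \<open>e/2 > 0\<close> unfolding cprob_def by blast
    ultimately show "whp M (\<lambda>n \<omega>. \<bar>real (card {j. j < p n \<and> (j \<notin> S0 n \<omega> \<and> j \<in> S n \<omega>)}) / real (p n) - 0\<bar> < e)"
    proof (rule whp_mono[OF whp_conj])
      fix n \<omega>
      let ?C = "real (card {j. j < p n \<and> (j \<notin> S0 n \<omega> \<and> j \<in> S n \<omega>)}) / real (p n)"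
      let ?N = "real (card {j. j < p n \<and> (j \<notin> S0 n \<omega> \<and> K \<le> Z n \<omega> j)}) / real (p n)"
      assume A: "S n \<omega> \<subseteq> {j. j < p n \<and> K \<le> Z n \<omega> j} \<and> \<bar>?N - G1 K\<bar> < e/2"
      have "?C \<le> ?N" using A by (intro divide_right_mono of_nat_mono card_mono) auto
      moreover have "?C \<ge> 0" by simp
      moreover have "\<bar>?N - G1 K\<bar> < e/2" using A by auto
      ultimately show "\<bar>?C - 0\<bar> < e" using K by linarith
    qed
  qed
  then show ?thesis using False by simp
qed

lemma power_limit:
  "cprob M (\<lambda>n \<omega>. realized_power (p n) (S n \<omega>) (S0 n \<omega>)) (power_lim q)"
proof -
  have inv: "cprob M (\<lambda>n \<omega>. inverse (real (card {j. j < p n \<and> j \<notin> S0 n \<omega>}) / real (p n))) (inverse r1)"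
    using r1_pos by (intro cprob_isCont[OF limr] DERIV_isCont[OF DERIV_inverse]) simp
  have pl: "(if crosses q then G1 (tau q) else 0) * inverse r1 = power_lim q"
    by (simp add: power_lim_def divide_inverse)
  have "cprob M (\<lambda>n \<omega>. real (card {j. j < p n \<and> (j \<notin> S0 n \<omega> \<and> j \<in> S n \<omega>)}) / real (p n) *
      inverse (real (card {j. j < p n \<and> j \<notin> S0 n \<omega>}) / real (p n))) (power_lim q)"
    using cprob_mult[OF limS1 inv] unfolding pl .
  then show ?thesis
  proof (rule cprob_cong')
    show "\<forall>\<^sub>F n in sequentially. \<forall>\<omega>\<in>space (M n).
      real (card {j. j < p n \<and> (j \<notin> S0 n \<omega> \<and> j \<in> S n \<omega>)}) / real (p n) *
      inverse (real (card {j. j < p n \<and> j \<notin> S0 n \<omega>}) / real (p n)) = realized_power (p n) (S n \<omega>) (S0 n \<omega>)"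
      using p_pos
    proof (eventually_elim, intro ballI)
      fix n \<omega> assume p0: "p n > 0"
      have "S n \<omega> \<inter> ({..<p n} - S0 n \<omega>) = {j. j < p n \<and> (j \<notin> S0 n \<omega> \<and> j \<in> S n \<omega>)}"
        "{..<p n} - S0 n \<omega> = {j. j < p n \<and> j \<notin> S0 n \<omega>}" by auto
      then show "real (card {j. j < p n \<and> (j \<notin> S0 n \<omega> \<and> j \<in> S n \<omega>)}) / real (p n) *
        inverse (real (card {j. j < p n \<and> j \<notin> S0 n \<omega>}) / real (p n)) = realized_power (p n) (S n \<omega>) (S0 n \<omega>)"
        using p0 by (simp add: realized_power_def)
    qed
  qed
qed

lemma fdp_limit:
  assumes cr: "crosses q"
  shows "cprob M (\<lambda>n \<omega>. fdp (S n \<omega>) (S0 n \<omega>)) (fdp_lim q)"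
proof -
  let ?t = "tau q"
  have t0: "?t \<ge> 0" by (rule tau_nonneg) fact
  let ?A = "\<lambda>n \<omega>. real (card {j. j < p n \<and> (j \<in> S0 n \<omega> \<and> j \<in> S n \<omega>)}) / real (p n)"
  have A: "cprob M ?A (G0 ?t)"
    using squeeze[OF cr lim0] by simp
  have "cprob M (\<lambda>n \<omega>. ?A n \<omega> + real (card {j. j < p n \<and> (j \<notin> S0 n \<omega> \<and> j \<in> S n \<omega>)}) / real (p n)) (G0 ?t + G1 ?t)"
    using cprob_add[OF A limS1] cr by simp
  then have B: "cprob M (\<lambda>n \<omega>. real (card (S n \<omega>)) / real (p n)) (G0 ?t + G1 ?t)"
  proof (rule cprob_cong')
    have "card (S n \<omega>) = card {j. j < p n \<and> (j \<in> S0 n \<omega> \<and> j \<in> S n \<omega>)} + card {j. j < p n \<and> (j \<notin> S0 n \<omega> \<and> j \<in> S n \<omega>)}" for n \<omega>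
    proof -
      have "S n \<omega> = {j. j < p n \<and> j \<in> S n \<omega>}" by (auto dest: S_less)
      then have "card (S n \<omega>) = card {j. j < p n \<and> j \<in> S n \<omega>}" by simp
      also note card_split[of "p n" "\<lambda>j. j \<in> S n \<omega>" "\<lambda>j. j \<in> S0 n \<omega>"]
      finally show ?thesis .
    qed
    then show "\<forall>\<^sub>F n in sequentially. \<forall>\<omega>\<in>space (M n). ?A n \<omega> +
        real (card {j. j < p n \<and> (j \<notin> S0 n \<omega> \<and> j \<in> S n \<omega>)}) / real (p n) = real (card (S n \<omega>)) / real (p n)"
      by (simp add: add_divide_distrib)
  qed
  have "cprob M (\<lambda>n \<omega>. inverse (real (card (S n \<omega>)) / real (p n))) (inverse (G0 ?t + G1 ?t))"
    using G_pos[OF t0] by (intro cprob_isCont[OF B] DERIV_isCont[OF DERIV_inverse]) simp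
  from cprob_mult[OF A this]
  have "cprob M (\<lambda>n \<omega>. ?A n \<omega> * inverse (real (card (S n \<omega>)) / real (p n))) (fdp_lim q)"
    by (simp add: fdp_lim_def divide_inverse)
  then show ?thesis
  proof (rule cprob_cong)
    \<comment> \<open>The maximum with 1 in \<open>fdp\<close> has no effect on this event, because
      the selected proportion is close to a positive limit.\<close>
    have "whp M (\<lambda>n \<omega>. \<bar>real (card (S n \<omega>)) / real (p n) - (G0 ?t + G1 ?t)\<bar> < G0 ?t + G1 ?t)"
      using B G_pos[OF t0] unfolding cprob_def by blast
    then show "whp M (\<lambda>n \<omega>. ?A n \<omega> * inverse (real (card (S n \<omega>)) / real (p n)) = fdp (S n \<omega>) (S0 n \<omega>))"
    proof (rule whp_mono)
      fix n \<omega> assume "\<bar>real (card (S n \<omega>)) / real (p n) - (G0 ?t + G1 ?t)\<bar> < G0 ?t + G1 ?t"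
      then have "real (card (S n \<omega>)) / real (p n) > 0" by linarith
      then have c: "card (S n \<omega>) > 0" "p n > 0" by (auto simp: zero_less_divide_iff)
      have "S n \<omega> \<inter> S0 n \<omega> = {j. j < p n \<and> (j \<in> S0 n \<omega> \<and> j \<in> S n \<omega>)}" by (auto dest: S_less)
      then have "fdp (S n \<omega>) (S0 n \<omega>) = real (card {j. j < p n \<and> (j \<in> S0 n \<omega> \<and> j \<in> S n \<omega>)}) / real (card (S n \<omega>))"
        using c by (simp add: fdp_def max_def)
      then show "?A n \<omega> * inverse (real (card (S n \<omega>)) / real (p n)) = fdp (S n \<omega>) (S0 n \<omega>)"
        using c by simp
    qed
  qed
qed

end

end

section \<open>Asymptotically normal means\<close>

lemma (in prob_space) indep_vars_pair:
  assumes "indep_vars M' X I" "j \<in> I" "k \<in> I" "j \<noteq> k"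
  shows "indep_var (M' j) (X j) (M' k) (X k)"
proof -
  have "indep_var (PiM {j} M') (\<lambda>\<omega>. restrict (\<lambda>i. X i \<omega>) {j}) (PiM {k} M') (\<lambda>\<omega>. restrict (\<lambda>i. X i \<omega>) {k})"
    using assms by (intro indep_var_restrict[OF assms(1)]) auto
  then have "indep_var (M' j) ((\<lambda>f. f j) \<circ> (\<lambda>\<omega>. restrict (\<lambda>i. X i \<omega>) {j})) (M' k) ((\<lambda>f. f k) \<circ> (\<lambda>\<omega>. restrict (\<lambda>i. X i \<omega>) {k}))"
    by (rule indep_var_compose) auto
  then show ?thesis by (simp add: comp_def)
qed

lemma (in prob_space) abs_prob_diff_le:
  assumes "A \<in> events" "B \<in> events" "C \<in> events" "A - B \<subseteq> C" "B - A \<subseteq> C"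
  shows "\<bar>prob A - prob B\<bar> \<le> prob C"
proof -
  have "prob A \<le> prob (B \<union> C)" "prob B \<le> prob (A \<union> C)"
    using assms by (auto intro!: finite_measure_mono)
  moreover have "prob (B \<union> C) \<le> prob B + prob C" "prob (A \<union> C) \<le> prob A + prob C"
    using assms by (auto intro!: measure_Un_le)
  ultimately show ?thesis by linarith
qed

text \<open>The law of large numbers needs bounds uniform in the indices, whereas convergence in
  probability speaks of one sequence. A sequence running through violating index pairs would
  contradict convergence.\<close>

lemma uniform_from_sequences:
  fixes f :: "nat \<Rightarrow> nat \<Rightarrow> nat \<Rightarrow> real"
  assumes seq: "\<And>jj kk. \<forall>\<^sub>F n in sequentially. V n (jj n) (kk n) \<Longrightarrow> (\<lambda>n. f n (jj n) (kk n)) \<longlonglongrightarrow> a"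
    and ex: "\<forall>\<^sub>F n in sequentially. \<exists>j k. V n j k" and "e > 0"
  shows "\<forall>\<^sub>F n in sequentially. \<forall>j k. V n j k \<longrightarrow> \<bar>f n j k - a\<bar> \<le> e"
proof -
  define bad where "bad n jk \<longleftrightarrow> V n (fst jk) (snd jk) \<and> \<bar>f n (fst jk) (snd jk) - a\<bar> > e" for n jk
  define c where "c n = (if \<exists>jk. bad n jk then SOME jk. bad n jk else SOME jk. V n (fst jk) (snd jk))" for n
  have c1: "bad n (c n)" if "bad n jk" for n jk
  proof -
    have e: "\<exists>jk. bad n jk" using that by blast
    show ?thesis unfolding c_def if_P[OF e] by (rule someI_ex[OF e])
  qed
  have "\<forall>\<^sub>F n in sequentially. V n (fst (c n)) (snd (c n))"
    using ex
  proof eventually_elim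
    case (elim n)
    show ?case
    proof (cases "\<exists>jk. bad n jk")
      case True
      then show ?thesis using c1 unfolding bad_def by blast
    next
      case False
      from elim have "\<exists>jk. V n (fst jk) (snd jk)" by auto
      from someI_ex[OF this] show ?thesis unfolding c_def if_not_P[OF False] .
    qed
  qed
  then have "(\<lambda>n. f n (fst (c n)) (snd (c n))) \<longlonglongrightarrow> a" by (rule seq)
  then have "\<forall>\<^sub>F n in sequentially. dist (f n (fst (c n)) (snd (c n))) a < e"
    using \<open>e > 0\<close> by (rule tendstoD)
  then show ?thesis
  proof eventually_elim
    case (elim n)
    have "\<bar>f n j k - a\<bar> \<le> e" if "V n j k" for j k
    proof (rule ccontr)
      assume "\<not> \<bar>f n j k - a\<bar> \<le> e"
      with that have "bad n (j, k)" by (simp add: bad_def)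
      from c1[OF this] elim show False by (simp add: bad_def dist_real_def)
    qed
    then show ?case by blast
  qed
qed

locale means_profile =
  fixes pi_mu :: "real measure"
  assumes prob_pi: "prob_space pi_mu"
    and sets_pi[measurable_cong]: "sets pi_mu = sets borel"
    and zero_pos: "measure pi_mu {0} > 0" and nonzero_pos: "measure pi_mu (- {0}) > 0"
begin

definition joint :: "(real \<times> real) measure" where "joint = pi_mu \<Otimes>\<^sub>M Nm"

definition tail :: "real set \<Rightarrow> real set \<Rightarrow> real" where
  "tail E K = measure joint {x. fst x \<in> E \<and> fst x + snd x \<in> K}"

sublocale Pi: prob_space pi_mu by (rule prob_pi)

lemma sets_joint[measurable_cong]: "sets joint = sets (borel \<Otimes>\<^sub>M borel)"
  unfolding joint_def by (intro sets_pair_measure_cong sets_pi sets_Nm)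

lemma space_pi[simp]: "space pi_mu = UNIV"
  using sets_eq_imp_space_eq[OF sets_pi] by simp

lemma space_joint[simp]: "space joint = UNIV"
  by (simp add: joint_def space_pair_measure)

lemma prob_space_joint: "prob_space joint"
  unfolding joint_def by (intro prob_space_pair prob_pi prob_space_Nm)

interpretation J: prob_space joint by (rule prob_space_joint)

lemma sets_strip[measurable]:
  assumes [measurable]: "E \<in> sets borel" "K \<in> sets borel"
  shows "{x. fst x \<in> E \<and> fst x + snd x \<in> K} \<in> sets (borel \<Otimes>\<^sub>M borel :: (real \<times> real) measure)"
proof -
  have "{x \<in> space (borel \<Otimes>\<^sub>M borel :: (real \<times> real) measure). fst x \<in> E \<and> fst x + snd x \<in> K} \<in> sets (borel \<Otimes>\<^sub>M borel)"
    by measurable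
  then show ?thesis by (simp add: space_pair_measure)
qed

text \<open>Given the mean, the strip is an interval of length \<open>2 * d\<close> for the normal
  variable. The bound therefore holds for every \<open>pi_mu\<close>, atoms included.\<close>

lemma strip_le:
  assumes "d \<ge> 0"
  shows "measure joint {x. \<bar>fst x + snd x - w\<bar> \<le> d} \<le> 2 * d"
proof -
  have "{x. \<bar>fst x + snd x - w\<bar> \<le> d} = {x \<in> space (borel \<Otimes>\<^sub>M borel :: (real \<times> real) measure). \<bar>fst x + snd x - w\<bar> \<le> d}"
    by (simp add: space_pair_measure)
  also have "\<dots> \<in> sets (borel \<Otimes>\<^sub>M borel)" by measurable
  finally have ms: "{x. \<bar>fst x + snd x - w\<bar> \<le> d} \<in> sets joint" by (simp add: sets_joint)
  have "emeasure joint {x. \<bar>fst x + snd x - w\<bar> \<le> d} =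
      (\<integral>\<^sup>+b. emeasure Nm (Pair b -` {x. \<bar>fst x + snd x - w\<bar> \<le> d}) \<partial>pi_mu)"
    using ms unfolding joint_def by (intro Nm.emeasure_pair_measure_alt)
  also have "\<dots> \<le> (\<integral>\<^sup>+b. ennreal (2 * d) \<partial>pi_mu)"
  proof (rule nn_integral_mono)
    fix b
    have "Pair b -` {x. \<bar>fst x + snd x - w\<bar> \<le> d} = {x. \<bar>x - (w - b)\<bar> \<le> d}" by (auto simp: algebra_simps)
    then show "emeasure Nm (Pair b -` {x. \<bar>fst x + snd x - w\<bar> \<le> d}) \<le> ennreal (2 * d)"
      using Nm_interval_le[OF assms, of "w - b"] by (simp add: Nm.emeasure_eq_measure ennreal_leI)
  qed
  also have "\<dots> = ennreal (2 * d)" by (simp add: Pi.emeasure_space_1[simplified space_pi])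
  finally show ?thesis using assms by (simp add: J.emeasure_eq_measure)
qed

lemma sets_strip_joint: "{x. \<bar>fst x + snd x - w\<bar> \<le> d} \<in> sets joint"
proof -
  have "{x. \<bar>fst x + snd x - w\<bar> \<le> d} = {x \<in> space (borel \<Otimes>\<^sub>M borel :: (real \<times> real) measure). \<bar>fst x + snd x - w\<bar> \<le> d}"
    by (simp add: space_pair_measure)
  also have "\<dots> \<in> sets (borel \<Otimes>\<^sub>M borel)" by measurable
  finally show ?thesis by (simp add: sets_joint)
qed

text \<open>The two sets disagree only within distance \<open>d\<close> of \<open>w\<close>, which
  is an event covered by \<open>strip_le\<close>.\<close>

lemma tail_lipschitz:
  assumes [measurable]: "E \<in> sets borel" "K \<in> sets borel" "K' \<in> sets borel"
    and "\<And>z. (z \<in> K) \<noteq> (z \<in> K') \<Longrightarrow> \<bar>z - w\<bar> \<le> d" "d \<ge> 0"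
  shows "\<bar>tail E K - tail E K'\<bar> \<le> 2 * d"
proof -
  have "\<bar>tail E K - tail E K'\<bar> \<le> measure joint {x. \<bar>fst x + snd x - w\<bar> \<le> d}"
    unfolding tail_def
    by (rule J.abs_prob_diff_le) (use assms(4) sets_strip_joint in \<open>auto simp: sets_joint\<close>)
  also have "\<dots> \<le> 2 * d" by (rule strip_le) fact
  finally show ?thesis .
qed

lemma continuous_lipschitz:
  assumes "\<And>w w'. \<bar>f w - f w'\<bar> \<le> 2 * \<bar>w - w'\<bar>"
  shows "continuous_on A (f :: real \<Rightarrow> real)"
proof -
  have "2-lipschitz_on A f"
    using assms by (intro lipschitz_onI) (auto simp: dist_real_def)
  then show ?thesis by (rule lipschitz_on_continuous_on)
qed

lemma tail_Times:
  assumes "E \<in> sets borel" "\<And>b. b \<in> E \<Longrightarrow> b = 0" "K \<in> sets borel"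
  shows "tail E K = measure pi_mu E * measure Nm K"
proof -
  have "{x. fst x \<in> E \<and> fst x + snd x \<in> K} = E \<times> K"
    using assms(2) by force
  then have "emeasure joint {x. fst x \<in> E \<and> fst x + snd x \<in> K} = emeasure pi_mu E * emeasure Nm K"
    unfolding joint_def using assms sets_pi by (simp add: Nm.emeasure_pair_measure_Times)
  then show ?thesis
    by (simp add: tail_def measure_def enn2real_mult)
qed

sublocale limit_profile "\<lambda>w. tail {0} {w..}" "\<lambda>w. tail (- {0}) {w..}" "\<lambda>w. tail UNIV {..- w}" "measure pi_mu (- {0})"
proof
  have l: "\<bar>tail E {w..} - tail E {w'..}\<bar> \<le> 2 * \<bar>w - w'\<bar>" if "E \<in> sets borel" for E w w'
    using that by (intro tail_lipschitz[where w = w]) auto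
  show "continuous_on {0..} (\<lambda>w. tail {0} {w..})" "continuous_on {0..} (\<lambda>w. tail (- {0}) {w..})"
    by (intro continuous_lipschitz l; simp)+
  have "\<bar>tail UNIV {..-w} - tail UNIV {..-w'}\<bar> \<le> 2 * \<bar>w - w'\<bar>" for w w'
    by (intro tail_lipschitz[where w = "-w"]) auto
  then show "continuous_on {0..} (\<lambda>w. tail UNIV {..- w})" by (rule continuous_lipschitz)
  fix w :: real
  have "0 < measure Nm {w<..<w+1}" by (rule Nm_interval_pos) simp
  also have "\<dots> \<le> measure Nm {w..}" by (intro Nm.finite_measure_mono) auto
  finally show "tail {0} {w..} > 0" using zero_pos by (subst tail_Times) auto
  show "tail (- {0}) {w..} \<ge> 0" by (simp add: tail_def)
  show "measure pi_mu (- {0}) > 0" by (rule nonzero_pos)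
next
  define D where "D = distr joint borel (\<lambda>x. fst x + snd x)"
  interpret D: real_distribution D
    unfolding D_def real_distribution_def real_distribution_axioms_def
    by (auto intro!: J.prob_space_distr)
  \<comment> \<open>The shift by 1 puts the closed half-line inside the open one that is the
    complement of the set measured by \<open>cdf\<close>.\<close>
  have le: "tail (- {0}) {w..} \<le> 1 - cdf D (w - 1)" for w
  proof -
    have "tail (- {0}) {w..} \<le> measure joint {x. fst x \<in> UNIV \<and> fst x + snd x \<in> {w - 1<..}}"
      unfolding tail_def by (intro J.finite_measure_mono) (use sets_strip[of UNIV "{w - 1<..}"] in \<open>auto simp: sets_joint\<close>)
    also have "\<dots> = measure D {w - 1<..}"
      unfolding D_def by (subst measure_distr) (auto intro!: arg_cong[where f="measure joint"])
    also have "{w - 1<..} = space D - {..w - 1}" by auto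
    also have "measure D (space D - {..w - 1}) = 1 - cdf D (w - 1)"
      by (subst D.prob_compl) (auto simp: cdf_def)
    finally show ?thesis .
  qed
  have "filterlim (\<lambda>w::real. -1 + w) at_top at_top"
    by (rule filterlim_tendsto_add_at_top[OF tendsto_const filterlim_ident])
  then have shift: "filterlim (\<lambda>w::real. w - 1) at_top at_top" by simp
  have "((\<lambda>w. 1 - cdf D (w - 1)) \<longlongrightarrow> 1 - 1) at_top"
    by (intro tendsto_diff tendsto_const filterlim_compose[OF D.cdf_lim_at_top_prob shift])
  then have lim: "((\<lambda>w. 1 - cdf D (w - 1)) \<longlongrightarrow> 0) at_top" by simp
  show "((\<lambda>w. tail (- {0}) {w..}) \<longlongrightarrow> 0) at_top"
  proof (rule tendsto_sandwich[OF _ _ tendsto_const lim])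
    show "\<forall>\<^sub>F w in at_top. 0 \<le> tail (- {0}) {w..}" by (simp add: tail_def)
    show "\<forall>\<^sub>F w in at_top. tail (- {0}) {w..} \<le> 1 - cdf D (w - 1)"
      by (intro always_eventually allI le)
  qed
qed

lemma tail_UNIV: "tail E UNIV = measure pi_mu E" if "E \<in> sets borel" for E
proof -
  have "{x::real\<times>real. fst x \<in> E \<and> fst x + snd x \<in> UNIV} = E \<times> UNIV" by auto
  then have "emeasure joint {x. fst x \<in> E \<and> fst x + snd x \<in> UNIV} = emeasure pi_mu E * emeasure Nm UNIV"
    unfolding joint_def using that sets_pi by (simp add: Nm.emeasure_pair_measure_Times)
  also have "emeasure Nm UNIV = 1" using Nm.emeasure_space_1 by simp
  finally show "tail E UNIV = measure pi_mu E" by (simp add: tail_def measure_def)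
qed

end

text \<open>The interface through which the limit theory sees a model. The law of the pair is exact
  and only the approximation of \<open>Z\<close> is asymptotic; the normal variables may change with
  the pair of variables considered.\<close>

locale asymptotic_means = prob_seq M + means_profile pi_mu
  for M :: "nat \<Rightarrow> 'a measure" and pi_mu :: "real measure" +
  fixes p :: "nat \<Rightarrow> nat" and Z mu :: "nat \<Rightarrow> 'a \<Rightarrow> nat \<Rightarrow> real"
  assumes p_top: "filterlim p at_top sequentially"
    and Z_meas: "\<forall>\<^sub>F n in sequentially. \<forall>j<p n. (\<lambda>\<omega>. Z n \<omega> j) \<in> borel_measurable (M n)"
    and mu_meas: "\<forall>\<^sub>F n in sequentially. \<forall>j<p n. (\<lambda>\<omega>. mu n \<omega> j) \<in> borel_measurable (M n)"
    and pairs: "\<And>jj kk. \<forall>\<^sub>F n in sequentially. jj n < p n \<and> kk n < p n \<and> jj n \<noteq> kk n \<Longrightarrow>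
      \<exists>h1 h2. (\<forall>\<^sub>F n in sequentially. h1 n \<in> borel_measurable (M n) \<and> h2 n \<in> borel_measurable (M n) \<and>
          distr (M n) ((borel \<Otimes>\<^sub>M borel) \<Otimes>\<^sub>M (borel \<Otimes>\<^sub>M borel))
            (\<lambda>\<omega>. ((mu n \<omega> (jj n), h1 n \<omega>), (mu n \<omega> (kk n), h2 n \<omega>))) = joint \<Otimes>\<^sub>M joint) \<and>
        cprob M (\<lambda>n \<omega>. Z n \<omega> (jj n) - mu n \<omega> (jj n) - h1 n \<omega>) 0 \<and>
        cprob M (\<lambda>n \<omega>. Z n \<omega> (kk n) - mu n \<omega> (kk n) - h2 n \<omega>) 0"
begin

text \<open>A boundary point \<open>w0\<close> lies between any point of \<open>K\<close> and any
  point outside. This form treats \<open>{w..}\<close>, \<open>{..w}\<close> and \<open>UNIV\<close>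
  alike.\<close>

definition half_line :: "real set \<Rightarrow> bool" where
  "half_line K \<longleftrightarrow> K \<in> sets borel \<and> (\<exists>w0. \<forall>z z'. (z \<in> K) \<noteq> (z' \<in> K) \<longrightarrow> \<bar>z' - w0\<bar> \<le> \<bar>z - z'\<bar>)"

lemma half_line_simps[simp]: "half_line {w..}" "half_line {..w}" "half_line UNIV"
  unfolding half_line_def by (auto intro!: exI[of _ w])

definition ev :: "real set \<Rightarrow> real set \<Rightarrow> nat \<Rightarrow> nat \<Rightarrow> 'a set" where
  "ev E K n j = {\<omega> \<in> space (M n). mu n \<omega> j \<in> E \<and> Z n \<omega> j \<in> K}"

lemma ev_sets:
  assumes "E \<in> sets borel" "K \<in> sets borel"
  shows "\<forall>\<^sub>F n in sequentially. \<forall>j<p n. ev E K n j \<in> sets (M n)"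
  using Z_meas mu_meas
proof (eventually_elim, intro allI impI)
  fix n j assume "\<forall>j<p n. (\<lambda>\<omega>. Z n \<omega> j) \<in> borel_measurable (M n)" "\<forall>j<p n. (\<lambda>\<omega>. mu n \<omega> j) \<in> borel_measurable (M n)" "j < p n"
  then have [measurable]: "(\<lambda>\<omega>. Z n \<omega> j) \<in> borel_measurable (M n)" "(\<lambda>\<omega>. mu n \<omega> j) \<in> borel_measurable (M n)"
    by auto
  note [measurable] = assms
  show "ev E K n j \<in> sets (M n)" unfolding ev_def by measurable
qed

text \<open>Replacing \<open>Z\<close> by \<open>mu + h\<close> alters an event only where the
  approximation is bad or where \<open>mu + h\<close> falls within \<open>d\<close> of the boundary.
  The first has small probability by assumption, the second by \<open>strip_le\<close>; for the
  replaced events the probability is an exact product.\<close>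

lemma pair_prob:
  assumes E[measurable]: "E \<in> sets borel" "E' \<in> sets borel" and K: "half_line K" "half_line K'"
    and v: "\<forall>\<^sub>F n in sequentially. jj n < p n \<and> kk n < p n \<and> jj n \<noteq> kk n"
  shows "(\<lambda>n. measure (M n) (ev E K n (jj n) \<inter> ev E' K' n (kk n))) \<longlonglongrightarrow> tail E K * tail E' K'"
proof (rule tendstoI)
  fix e :: real assume e: "e > 0"
  \<comment> \<open>The four exceptional sets cost \<open>d + d + 2 * d + 2 * d = 6 * d\<close>,
    which is below \<open>e\<close>.\<close>
  define d where "d = e / 16"
  have d: "d > 0" using e by (simp add: d_def)
  have Km[measurable]: "K \<in> sets borel" "K' \<in> sets borel" using K by (auto simp: half_line_def)
  obtain w0 where w0: "\<And>z z'. (z \<in> K) \<noteq> (z' \<in> K) \<Longrightarrow> \<bar>z' - w0\<bar> \<le> \<bar>z - z'\<bar>"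
    using K(1) unfolding half_line_def by blast
  obtain w1 where w1: "\<And>z z'. (z \<in> K') \<noteq> (z' \<in> K') \<Longrightarrow> \<bar>z' - w1\<bar> \<le> \<bar>z - z'\<bar>"
    using K(2) unfolding half_line_def by blast
  from pairs[OF v] obtain h1 h2 where h:
    "\<forall>\<^sub>F n in sequentially. h1 n \<in> borel_measurable (M n) \<and> h2 n \<in> borel_measurable (M n) \<and>
          distr (M n) ((borel \<Otimes>\<^sub>M borel) \<Otimes>\<^sub>M (borel \<Otimes>\<^sub>M borel))
            (\<lambda>\<omega>. ((mu n \<omega> (jj n), h1 n \<omega>), (mu n \<omega> (kk n), h2 n \<omega>))) = joint \<Otimes>\<^sub>M joint"
    "cprob M (\<lambda>n \<omega>. Z n \<omega> (jj n) - mu n \<omega> (jj n) - h1 n \<omega>) 0"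
    "cprob M (\<lambda>n \<omega>. Z n \<omega> (kk n) - mu n \<omega> (kk n) - h2 n \<omega>) 0" by blast
  have N1: "\<forall>\<^sub>F n in sequentially. \<exists>N\<in>sets (M n). measure (M n) N \<le> d \<and>
      (\<forall>\<omega>\<in>space (M n) - N. \<bar>Z n \<omega> (jj n) - mu n \<omega> (jj n) - h1 n \<omega>\<bar> < d)"
    using h(2) d unfolding cprob_def whp_def by auto
  have N2: "\<forall>\<^sub>F n in sequentially. \<exists>N\<in>sets (M n). measure (M n) N \<le> d \<and>
      (\<forall>\<omega>\<in>space (M n) - N. \<bar>Z n \<omega> (kk n) - mu n \<omega> (kk n) - h2 n \<omega>\<bar> < d)"
    using h(3) d unfolding cprob_def whp_def by auto
  show "\<forall>\<^sub>F n in sequentially. dist (measure (M n) (ev E K n (jj n) \<inter> ev E' K' n (kk n))) (tail E K * tail E' K') < e"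
    using h(1) N1 N2 ev_prob v mu_meas ev_sets[OF E(1) Km(1)] ev_sets[OF E(2) Km(2)]
  proof eventually_elim
    case (elim n)
    interpret prob_space "M n" by (fact elim(4))
    interpret J: prob_space joint by (rule prob_space_joint)
    let ?j = "jj n" and ?k = "kk n"
    let ?D = "\<lambda>\<omega>. ((mu n \<omega> ?j, h1 n \<omega>), (mu n \<omega> ?k, h2 n \<omega>))"
    have [measurable]: "h1 n \<in> borel_measurable (M n)" "h2 n \<in> borel_measurable (M n)"
      "(\<lambda>\<omega>. mu n \<omega> ?j) \<in> borel_measurable (M n)" "(\<lambda>\<omega>. mu n \<omega> ?k) \<in> borel_measurable (M n)"
      using elim by auto
    have law: "measure (M n) {\<omega> \<in> space (M n). (mu n \<omega> ?j, h1 n \<omega>) \<in> A \<and> (mu n \<omega> ?k, h2 n \<omega>) \<in> B} = measure joint A * measure joint B"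
      if "A \<in> sets joint" "B \<in> sets joint" for A B
    proof -
      have AB: "A \<in> sets (borel \<Otimes>\<^sub>M borel)" "B \<in> sets (borel \<Otimes>\<^sub>M borel)" using that by (auto simp: sets_joint)
      have "measure (M n) {\<omega> \<in> space (M n). (mu n \<omega> ?j, h1 n \<omega>) \<in> A \<and> (mu n \<omega> ?k, h2 n \<omega>) \<in> B}
          = measure (distr (M n) ((borel \<Otimes>\<^sub>M borel) \<Otimes>\<^sub>M (borel \<Otimes>\<^sub>M borel)) ?D) (A \<times> B)"
        using AB by (subst measure_distr) (auto intro!: arg_cong[where f="measure (M n)"])
      also have "\<dots> = measure (joint \<Otimes>\<^sub>M joint) (A \<times> B)" using elim(1) by simp
      also have "\<dots> = measure joint A * measure joint B"
        using that by (simp add: measure_def J.emeasure_pair_measure_Times enn2real_mult)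
      finally show ?thesis .
    qed
    have J1: "measure joint UNIV = 1" using prob_space.prob_space[OF prob_space_joint] by simp
    have UJ: "UNIV \<in> sets joint" using sets.top[of joint] by simp
    from elim(2) obtain N1 where N1: "N1 \<in> sets (M n)" "measure (M n) N1 \<le> d"
      "\<And>\<omega>. \<omega> \<in> space (M n) - N1 \<Longrightarrow> \<bar>Z n \<omega> ?j - mu n \<omega> ?j - h1 n \<omega>\<bar> < d" by blast
    from elim(3) obtain N2 where N2: "N2 \<in> sets (M n)" "measure (M n) N2 \<le> d"
      "\<And>\<omega>. \<omega> \<in> space (M n) - N2 \<Longrightarrow> \<bar>Z n \<omega> ?k - mu n \<omega> ?k - h2 n \<omega>\<bar> < d" by blast
    define B where "B = {\<omega> \<in> space (M n). (mu n \<omega> ?j, h1 n \<omega>) \<in> {x. fst x \<in> E \<and> fst x + snd x \<in> K}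
        \<and> (mu n \<omega> ?k, h2 n \<omega>) \<in> {x. fst x \<in> E' \<and> fst x + snd x \<in> K'}}"
    define C1 where "C1 = {\<omega> \<in> space (M n). (mu n \<omega> ?j, h1 n \<omega>) \<in> {x. \<bar>fst x + snd x - w0\<bar> \<le> d} \<and> (mu n \<omega> ?k, h2 n \<omega>) \<in> UNIV}"
    define C2 where "C2 = {\<omega> \<in> space (M n). (mu n \<omega> ?j, h1 n \<omega>) \<in> UNIV \<and> (mu n \<omega> ?k, h2 n \<omega>) \<in> {x. \<bar>fst x + snd x - w1\<bar> \<le> d}}"
    have B: "measure (M n) B = tail E K * tail E' K'"
      unfolding B_def tail_def by (rule law) (auto simp: sets_joint)
    have C1: "measure (M n) C1 \<le> 2 * d"
      using law[OF sets_strip_joint UJ, of w0 d] strip_le[of d w0] d J1 by (simp add: C1_def)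
    have C2: "measure (M n) C2 \<le> 2 * d"
      using law[OF UJ sets_strip_joint, of w1 d] strip_le[of d w1] d J1 by (simp add: C2_def)
    have Bs[measurable]: "B \<in> sets (M n)" unfolding B_def by simp
    have Cs[measurable]: "C1 \<in> sets (M n)" "C2 \<in> sets (M n)" unfolding C1_def C2_def by simp_all
    let ?A = "ev E K n ?j \<inter> ev E' K' n ?k"
    have As: "?A \<in> sets (M n)" using elim by auto
    have sub1: "\<omega> \<in> C1" if "\<omega> \<in> space (M n) - N1" "(Z n \<omega> ?j \<in> K) \<noteq> (mu n \<omega> ?j + h1 n \<omega> \<in> K)" for \<omega>
      using w0[OF that(2)] N1(3)[OF that(1)] that(1) by (auto simp: C1_def)
    have sub2: "\<omega> \<in> C2" if "\<omega> \<in> space (M n) - N2" "(Z n \<omega> ?k \<in> K') \<noteq> (mu n \<omega> ?k + h2 n \<omega> \<in> K')" for \<omega>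
      using w1[OF that(2)] N2(3)[OF that(1)] that(1) by (auto simp: C2_def)
    have "\<bar>measure (M n) ?A - measure (M n) B\<bar> \<le> measure (M n) (N1 \<union> N2 \<union> (C1 \<union> C2))"
    proof (rule abs_prob_diff_le)
      show "?A - B \<subseteq> N1 \<union> N2 \<union> (C1 \<union> C2)" using sub1 sub2 unfolding ev_def B_def by fastforce
      show "B - ?A \<subseteq> N1 \<union> N2 \<union> (C1 \<union> C2)" using sub1 sub2 unfolding ev_def B_def by fastforce
    qed (use As N1(1) N2(1) in auto)
    also have "\<dots> \<le> (measure (M n) N1 + measure (M n) N2) + (measure (M n) C1 + measure (M n) C2)"
      using N1(1) N2(1) by (intro measure_Un_le[THEN order_trans] add_mono measure_Un_le) auto
    also have "\<dots> \<le> 6 * d" using N1(2) N2(2) C1 C2 by linarith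
    also have "\<dots> < e" using e by (simp add: d_def)
    finally show ?case using B by (simp add: dist_real_def)
  qed
qed

lemma p_ge_2: "\<forall>\<^sub>F n in sequentially. p n \<ge> 2"
  using filterlim_at_top[THEN iffD1, OF p_top] by blast

lemma count_limit:
  assumes E[measurable]: "E \<in> sets borel" and K: "half_line K"
  shows "cprob M (\<lambda>n \<omega>. real (card {j. j < p n \<and> (mu n \<omega> j \<in> E \<and> Z n \<omega> j \<in> K)}) / real (p n)) (tail E K)"
proof -
  have Km: "K \<in> sets borel" using K by (auto simp: half_line_def)
  define Y where "Y n j = (indicator (ev E K n j) :: 'a \<Rightarrow> real)" for n j
  define V where "V n j k \<longleftrightarrow> j < p n \<and> k < p n \<and> j \<noteq> k" for n j k
  have exV: "\<forall>\<^sub>F n in sequentially. \<exists>j k. V n j k"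
    using p_ge_2 by eventually_elim (rule exI[of _ 0], rule exI[of _ 1], simp add: V_def)
  have "cprob M (\<lambda>n \<omega>. (\<Sum>j<p n. Y n j \<omega>) / real (p n)) (tail E K)"
  proof (rule lln_pairs[OF p_top])
    show "\<forall>\<^sub>F n in sequentially. \<forall>j<p n. Y n j \<in> borel_measurable (M n)"
      using ev_sets[OF E Km] by eventually_elim (auto simp: Y_def)
    show "\<forall>\<^sub>F n in sequentially. \<forall>j<p n. AE \<omega> in M n. \<bar>Y n j \<omega>\<bar> \<le> 1"
      by (auto simp: Y_def indicator_def)
  next
    fix e :: real assume e: "e > 0"
    \<comment> \<open>First moments are pair probabilities with the sure event for the second
      variable, since \<open>tail UNIV UNIV = 1\<close>.\<close>
    have "\<forall>\<^sub>F n in sequentially. \<forall>j k. V n j k \<longrightarrow> \<bar>measure (M n) (ev E K n j \<inter> ev UNIV UNIV n k) - tail E K\<bar> \<le> e"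
      using pair_prob[OF E _ K, of UNIV UNIV] e exV tail_UNIV[of UNIV] Pi.prob_space
      by (intro uniform_from_sequences[where V=V]) (simp_all add: V_def)
    then show "\<forall>\<^sub>F n in sequentially. \<forall>j<p n. \<bar>(\<integral>\<omega>. Y n j \<omega> \<partial>M n) - tail E K\<bar> \<le> e"
      using ev_sets[OF E Km] p_ge_2
    proof (eventually_elim, intro allI impI)
      fix n j assume a: "\<forall>j k. V n j k \<longrightarrow> \<bar>measure (M n) (ev E K n j \<inter> ev UNIV UNIV n k) - tail E K\<bar> \<le> e"
        and s: "\<forall>j<p n. ev E K n j \<in> sets (M n)" and p2: "2 \<le> p n" and j: "j < p n"
      have V: "V n j (if j = 0 then 1 else 0)" using p2 j by (auto simp: V_def)
      have "(\<integral>\<omega>. Y n j \<omega> \<partial>M n) = measure (M n) (ev E K n j)"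
        using s j sets.sets_into_space[of "ev E K n j" "M n"] by (simp add: Y_def Int_absorb2)
      also have "ev E K n j = ev E K n j \<inter> ev UNIV UNIV n (if j = 0 then 1 else 0)"
        by (auto simp: ev_def)
      finally show "\<bar>(\<integral>\<omega>. Y n j \<omega> \<partial>M n) - tail E K\<bar> \<le> e" using a V by simp
    qed
  next
    fix e :: real assume e: "e > 0"
    have "\<forall>\<^sub>F n in sequentially. \<forall>j k. V n j k \<longrightarrow> \<bar>measure (M n) (ev E K n j \<inter> ev E K n k) - (tail E K)\<^sup>2\<bar> \<le> e"
      using pair_prob[OF E E K K] e exV
      by (intro uniform_from_sequences[where V=V]) (simp_all add: V_def power2_eq_square)
    then show "\<forall>\<^sub>F n in sequentially. \<forall>j<p n. \<forall>k<p n. j \<noteq> k \<longrightarrow>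
        \<bar>(\<integral>\<omega>. Y n j \<omega> * Y n k \<omega> \<partial>M n) - (tail E K)\<^sup>2\<bar> \<le> e"
      using ev_sets[OF E Km]
    proof (eventually_elim, intro allI impI)
      fix n j k assume a: "\<forall>j k. V n j k \<longrightarrow> \<bar>measure (M n) (ev E K n j \<inter> ev E K n k) - (tail E K)\<^sup>2\<bar> \<le> e"
        and s: "\<forall>j<p n. ev E K n j \<in> sets (M n)" and jk: "j < p n" "k < p n" "j \<noteq> k"
      have "ev E K n j \<inter> ev E K n k \<in> sets (M n)" using s jk by auto
      moreover have "(\<lambda>\<omega>. Y n j \<omega> * Y n k \<omega>) = indicator (ev E K n j \<inter> ev E K n k)"
        by (simp add: Y_def indicator_inter_arith fun_eq_iff)
      ultimately have "(\<integral>\<omega>. Y n j \<omega> * Y n k \<omega> \<partial>M n) = measure (M n) (ev E K n j \<inter> ev E K n k)"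
        using sets.sets_into_space[of "ev E K n j \<inter> ev E K n k" "M n"]
        by (simp only: Bochner_Integration.integral_indicator Int_absorb2)
      then show "\<bar>(\<integral>\<omega>. Y n j \<omega> * Y n k \<omega> \<partial>M n) - (tail E K)\<^sup>2\<bar> \<le> e"
        using a jk by (simp add: V_def)
    qed
  qed
  then show ?thesis
  proof (rule cprob_cong')
    show "\<forall>\<^sub>F n in sequentially. \<forall>\<omega>\<in>space (M n). (\<Sum>j<p n. Y n j \<omega>) / real (p n) =
        real (card {j. j < p n \<and> (mu n \<omega> j \<in> E \<and> Z n \<omega> j \<in> K)}) / real (p n)"
    proof (intro always_eventually allI ballI)
      fix n \<omega> assume "\<omega> \<in> space (M n)"
      then have "(\<Sum>j<p n. Y n j \<omega>) = (\<Sum>j<p n. if mu n \<omega> j \<in> E \<and> Z n \<omega> j \<in> K then 1 else 0)"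
        by (intro sum.cong) (auto simp: Y_def ev_def indicator_def)
      then show "(\<Sum>j<p n. Y n j \<omega>) / real (p n) =
          real (card {j. j < p n \<and> (mu n \<omega> j \<in> E \<and> Z n \<omega> j \<in> K)}) / real (p n)"
        by (simp only: card_real_sum)
    qed
  qed
qed

lemma empirical_limits:
  assumes S0: "\<And>n \<omega> j. j < p n \<Longrightarrow> j \<in> S0 n \<omega> \<longleftrightarrow> mu n \<omega> j = 0"
  shows "empirical_limits M (\<lambda>w. tail {0} {w..}) (\<lambda>w. tail (- {0}) {w..}) (\<lambda>w. tail UNIV {..- w})
    (measure pi_mu (- {0})) p Z S0"
proof (intro empirical_limits.intro empirical_limits_axioms.intro p_top prob_seq_axioms limit_profile_axioms)
  fix w :: real
  show "cprob M (\<lambda>n \<omega>. real (card {j. j < p n \<and> (j \<in> S0 n \<omega> \<and> w \<le> Z n \<omega> j)}) / real (p n)) (tail {0} {w..})"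
    using count_limit[of "{0}" "{w..}"] by (simp add: S0 cong: conj_cong)
  show "cprob M (\<lambda>n \<omega>. real (card {j. j < p n \<and> (j \<notin> S0 n \<omega> \<and> w \<le> Z n \<omega> j)}) / real (p n)) (tail (- {0}) {w..})"
    using count_limit[of "- {0}" "{w..}"] by (simp add: S0 cong: conj_cong)
  show "cprob M (\<lambda>n \<omega>. real (card {j. j < p n \<and> Z n \<omega> j \<le> - w}) / real (p n)) (tail UNIV {..- w})"
    using count_limit[of UNIV "{..- w}"] by simp
  show "cprob M (\<lambda>n \<omega>. real (card {j. j < p n \<and> j \<notin> S0 n \<omega>}) / real (p n)) (measure pi_mu (- {0}))"
    using count_limit[of "- {0}" UNIV] by (simp add: S0 tail_UNIV cong: conj_cong)
qed

end

section \<open>The normal means model as an instance of asymptotically normal means\<close>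

context means_profile
begin

lemma normal_means_eq: "normal_means pi_mu m = PiM {..<m} (\<lambda>_. joint)"
  by (simp add: normal_means_def joint_def)

lemma prob_space_normal_means: "prob_space (normal_means pi_mu m)"
  unfolding normal_means_eq by (intro prob_space_PiM prob_space_joint)

lemma normal_means_meas[measurable]:
  assumes "j < m"
  shows "(\<lambda>\<omega>. \<omega> j) \<in> measurable (normal_means pi_mu m) (borel \<Otimes>\<^sub>M borel)"
proof -
  have "(\<lambda>\<omega>. \<omega> j) \<in> measurable (normal_means pi_mu m) joint"
    unfolding normal_means_eq using assms by (intro measurable_component_singleton) simp
  then show ?thesis by (simp add: measurable_cong_sets[OF refl sets_joint])
qed

lemma normal_means_pair_law:
  assumes "j < m" "k < m" "j \<noteq> k"
  shows "distr (normal_means pi_mu m) ((borel \<Otimes>\<^sub>M borel) \<Otimes>\<^sub>M (borel \<Otimes>\<^sub>M borel)) (\<lambda>\<omega>. (\<omega> j, \<omega> k)) = joint \<Otimes>\<^sub>M joint"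
proof -
  let ?P = "PiM {..<m} (\<lambda>_. joint)"
  interpret PP: prob_space ?P by (intro prob_space_PiM prob_space_joint)
  have comp: "distr ?P joint (\<lambda>\<omega>. \<omega> i) = joint" if "i < m" for i
    using that prob_space_joint by (intro distr_PiM_component) auto
  have "distr ?P ?P (\<lambda>x. \<lambda>i\<in>{..<m}. x i) = distr ?P ?P (\<lambda>x. x)"
    by (intro distr_cong refl) (auto simp: space_PiM fun_eq_iff restrict_def PiE_def extensional_def)
  also have "\<dots> = ?P" by simp
  also have "?P = PiM {..<m} (\<lambda>i. distr ?P joint (\<lambda>\<omega>. \<omega> i))"
    by (intro PiM_cong refl) (simp add: comp)
  finally have "PP.indep_vars (\<lambda>_. joint) (\<lambda>i \<omega>. \<omega> i) {..<m}"
    using assms by (subst PP.indep_vars_iff_distr_eq_PiM') auto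
  from PP.indep_vars_pair[OF this, of j k] assms
  have "PP.indep_var joint (\<lambda>\<omega>. \<omega> j) joint (\<lambda>\<omega>. \<omega> k)" by simp
  then have "distr ?P (joint \<Otimes>\<^sub>M joint) (\<lambda>\<omega>. (\<omega> j, \<omega> k)) = joint \<Otimes>\<^sub>M joint"
    unfolding PP.indep_var_distribution_eq using comp assms by simp
  moreover have "distr ?P (joint \<Otimes>\<^sub>M joint) (\<lambda>\<omega>. (\<omega> j, \<omega> k)) =
      distr ?P ((borel \<Otimes>\<^sub>M borel) \<Otimes>\<^sub>M (borel \<Otimes>\<^sub>M borel)) (\<lambda>\<omega>. (\<omega> j, \<omega> k))"
    by (intro distr_cong refl sets_pair_measure_cong sets_joint)
  ultimately show ?thesis by (simp add: normal_means_eq)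
qed

text \<open>The noise coordinate itself serves as \<open>h\<close>, and the approximation error is
  0.\<close>

lemma asymptotic_means_normal_means:
  "asymptotic_means (normal_means pi_mu) pi_mu (\<lambda>m. m) (\<lambda>m \<omega> j. fst (\<omega> j) + snd (\<omega> j)) (\<lambda>m \<omega> j. fst (\<omega> j))"
proof (intro asymptotic_means.intro means_profile_axioms)
  show ps: "prob_seq (normal_means pi_mu)"
    by (simp add: prob_seq_def prob_space_normal_means)
  interpret ps: prob_seq "normal_means pi_mu" by (rule ps)
  show "asymptotic_means_axioms (normal_means pi_mu) pi_mu (\<lambda>m. m) (\<lambda>m \<omega> j. fst (\<omega> j) + snd (\<omega> j)) (\<lambda>m \<omega> j. fst (\<omega> j))"
  proof
    show "filterlim (\<lambda>m. m) at_top sequentially" by (rule filterlim_ident)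
    show "\<forall>\<^sub>F n in sequentially. \<forall>j<n. (\<lambda>\<omega>. fst (\<omega> j) + snd (\<omega> j)) \<in> borel_measurable (normal_means pi_mu n)"
      by (intro always_eventually allI impI) measurable
    show "\<forall>\<^sub>F n in sequentially. \<forall>j<n. (\<lambda>\<omega>. fst (\<omega> j)) \<in> borel_measurable (normal_means pi_mu n)"
      by (intro always_eventually allI impI) measurable
    fix jj kk :: "nat \<Rightarrow> nat"
    assume v: "\<forall>\<^sub>F n in sequentially. jj n < n \<and> kk n < n \<and> jj n \<noteq> kk n"
    show "\<exists>h1 h2. (\<forall>\<^sub>F n in sequentially. h1 n \<in> borel_measurable (normal_means pi_mu n) \<and> h2 n \<in> borel_measurable (normal_means pi_mu n) \<and>
          distr (normal_means pi_mu n) ((borel \<Otimes>\<^sub>M borel) \<Otimes>\<^sub>M (borel \<Otimes>\<^sub>M borel))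
            (\<lambda>\<omega>. ((fst (\<omega> (jj n)), h1 n \<omega>), (fst (\<omega> (kk n)), h2 n \<omega>))) = joint \<Otimes>\<^sub>M joint) \<and>
        cprob (normal_means pi_mu) (\<lambda>n \<omega>. fst (\<omega> (jj n)) + snd (\<omega> (jj n)) - fst (\<omega> (jj n)) - h1 n \<omega>) 0 \<and>
        cprob (normal_means pi_mu) (\<lambda>n \<omega>. fst (\<omega> (kk n)) + snd (\<omega> (kk n)) - fst (\<omega> (kk n)) - h2 n \<omega>) 0"
    proof (rule exI[of _ "\<lambda>n \<omega>. snd (\<omega> (jj n))"], rule exI[of _ "\<lambda>n \<omega>. snd (\<omega> (kk n))"], intro conjI)
      show "\<forall>\<^sub>F n in sequentially. (\<lambda>\<omega>. snd (\<omega> (jj n))) \<in> borel_measurable (normal_means pi_mu n) \<and>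
        (\<lambda>\<omega>. snd (\<omega> (kk n))) \<in> borel_measurable (normal_means pi_mu n) \<and>
          distr (normal_means pi_mu n) ((borel \<Otimes>\<^sub>M borel) \<Otimes>\<^sub>M (borel \<Otimes>\<^sub>M borel))
            (\<lambda>\<omega>. ((fst (\<omega> (jj n)), snd (\<omega> (jj n))), (fst (\<omega> (kk n)), snd (\<omega> (kk n))))) = joint \<Otimes>\<^sub>M joint"
        using v
      proof eventually_elim
        case (elim n)
        then have [measurable]: "(\<lambda>\<omega>. \<omega> (jj n)) \<in> measurable (normal_means pi_mu n) (borel \<Otimes>\<^sub>M borel)"
          "(\<lambda>\<omega>. \<omega> (kk n)) \<in> measurable (normal_means pi_mu n) (borel \<Otimes>\<^sub>M borel)" by auto
        show ?case using normal_means_pair_law[of "jj n" n "kk n"] elim by simp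
      qed
    qed (use ps.cprob_const[of 0] in \<open>simp_all add: algebra_simps\<close>)
  qed
qed

end

section \<open>Effective means from asymptotic normality\<close>

lemma (in prob_seq) whp_of_measure_tendsto_1:
  assumes "(\<lambda>n. measure (M n) {\<omega> \<in> space (M n). Q n \<omega>}) \<longlonglongrightarrow> 1"
  shows "whp M Q"
proof (rule whpI_bound)
  \<comment> \<open>Measurability of the event comes for free: \<open>measure\<close> is 0 on
    non-measurable sets, so a positive value implies it.\<close>
  have "\<forall>\<^sub>F n in sequentially. 0 < measure (M n) {\<omega> \<in> space (M n). Q n \<omega>}"
    using assms by (rule order_tendstoD) simp
  then have ms: "\<forall>\<^sub>F n in sequentially. {\<omega> \<in> space (M n). Q n \<omega>} \<in> sets (M n)"
    by eventually_elim (metis less_irrefl measure_notin_sets)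
  have eq: "{\<omega> \<in> space (M n). \<not> Q n \<omega>} = space (M n) - {\<omega> \<in> space (M n). Q n \<omega>}" for n by auto
  show "\<forall>\<^sub>F n in sequentially. {\<omega> \<in> space (M n). \<not> Q n \<omega>} \<in> sets (M n)"
    using ms unfolding eq by eventually_elim auto
  show "\<forall>\<^sub>F n in sequentially. measure (M n) {\<omega> \<in> space (M n). \<not> Q n \<omega>} \<le> 1 - measure (M n) {\<omega> \<in> space (M n). Q n \<omega>}"
    using ms ev_prob unfolding eq by eventually_elim (simp add: prob_space.prob_compl)
  show "(\<lambda>n. 1 - measure (M n) {\<omega> \<in> space (M n). Q n \<omega>}) \<longlonglongrightarrow> 0"
    using tendsto_diff[OF tendsto_const assms, of 1] by simp
qed

context means_profile
begin

interpretation NM: asymptotic_means "normal_means pi_mu" pi_mu "\<lambda>m. m"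
  "\<lambda>m \<omega> j. fst (\<omega> j) + snd (\<omega> j)" "\<lambda>m \<omega> j. fst (\<omega> j)"
  by (rule asymptotic_means_normal_means)

interpretation NE: empirical_limits "normal_means pi_mu" "\<lambda>w. tail {0} {w..}" "\<lambda>w. tail (- {0}) {w..}"
  "\<lambda>w. tail UNIV {..- w}" "measure pi_mu (- {0})" "\<lambda>m. m" "\<lambda>m \<omega> j. fst (\<omega> j) + snd (\<omega> j)" means_nulls
  by (rule NM.empirical_limits) (simp add: means_nulls_def)

lemma Phi_meas: "Phi \<in> borel_measurable borel"
  by (intro borel_measurable_continuous_onI continuous_at_imp_continuous_on ballI isCont_Phi)

lemma measurable_means_pval: "j < m \<Longrightarrow> (\<lambda>\<omega>. means_pval \<omega> j) \<in> borel_measurable (normal_means pi_mu m)"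
  unfolding means_pval_def using normal_means_meas[of j m]
  by (intro borel_measurable_diff borel_measurable_const measurable_compose[OF _ Phi_meas]) measurable

lemma measurable_adapt_means:
  "(\<lambda>\<omega>. realized_power m (adapt tmax q m (means_pval \<omega>)) (means_nulls m \<omega>)) \<in> borel_measurable (normal_means pi_mu m)"
  "(\<lambda>\<omega>. fdp (adapt tmax q m (means_pval \<omega>)) (means_nulls m \<omega>)) \<in> borel_measurable (normal_means pi_mu m)"
proof -
  have a: "Measurable.pred (normal_means pi_mu m) (\<lambda>\<omega>. j \<in> adapt tmax q m (means_pval \<omega>))" if "j < m" for j
    using that by (intro measurable_adapt measurable_means_pval)
  have b: "Measurable.pred (normal_means pi_mu m) (\<lambda>\<omega>. j \<in> means_nulls m \<omega>)" if "j < m" for j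
    using that normal_means_meas[OF that] unfolding means_nulls_def by simp
  show "(\<lambda>\<omega>. realized_power m (adapt tmax q m (means_pval \<omega>)) (means_nulls m \<omega>)) \<in> borel_measurable (normal_means pi_mu m)"
    by (intro measurable_realized_power a b)
  show "(\<lambda>\<omega>. fdp (adapt tmax q m (means_pval \<omega>)) (means_nulls m \<omega>)) \<in> borel_measurable (normal_means pi_mu m)"
    by (intro measurable_fdp[where p=m] a b) (auto simp: adapt_def)
qed

lemma adapt_half_limits:
  assumes "q \<notin> touching_levels"
  shows "cprob (normal_means pi_mu) (\<lambda>m \<omega>. realized_power m (adapt (1/2) q m (means_pval \<omega>)) (means_nulls m \<omega>)) (power_lim q)"
    and "power_lim q > 0 \<Longrightarrow>
      cprob (normal_means pi_mu) (\<lambda>m \<omega>. fdp (adapt (1/2) q m (means_pval \<omega>)) (means_nulls m \<omega>)) (fdp_lim q)"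
proof -
  show "cprob (normal_means pi_mu) (\<lambda>m \<omega>. realized_power m (adapt (1/2) q m (means_pval \<omega>)) (means_nulls m \<omega>)) (power_lim q)"
    by (rule NE.power_limit[OF assms threshold_rule_adapt])
  assume "power_lim q > 0"
  then have "crosses q" by (auto simp: power_lim_def split: if_splits)
  then show "cprob (normal_means pi_mu) (\<lambda>m \<omega>. fdp (adapt (1/2) q m (means_pval \<omega>)) (means_nulls m \<omega>)) (fdp_lim q)"
    by (rule NE.fdp_limit[OF assms threshold_rule_adapt])
qed

text \<open>If no admissible threshold exceeds 1/2, both ranges have the same admissible set and
  hence the same rejections. The limits are transferred on this event.\<close>

lemma adapt_one_limits:
  assumes "q \<notin> touching_levels" "adapt_le_half q pi_mu"
  shows "cprob (normal_means pi_mu) (\<lambda>m \<omega>. realized_power m (adapt 1 q m (means_pval \<omega>)) (means_nulls m \<omega>)) (power_lim q)"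
    and "power_lim q > 0 \<Longrightarrow>
      cprob (normal_means pi_mu) (\<lambda>m \<omega>. fdp (adapt 1 q m (means_pval \<omega>)) (means_nulls m \<omega>)) (fdp_lim q)"
proof -
  have w: "whp (normal_means pi_mu) (\<lambda>m \<omega>. adapt_admissible 1 q m (means_pval \<omega>) \<subseteq> {0..1/2})"
    using assms(2) unfolding adapt_le_half_def by (rule NM.whp_of_measure_tendsto_1)
  have eq: "adapt 1 q m pv = adapt (1/2) q m pv" if "adapt_admissible 1 q m pv \<subseteq> {0..1/2}" for m pv
  proof -
    have "adapt_admissible 1 q m pv = adapt_admissible (1/2) q m pv"
      using that unfolding adapt_admissible_def by auto
    then show ?thesis by (simp add: adapt_def)
  qed
  show "cprob (normal_means pi_mu) (\<lambda>m \<omega>. realized_power m (adapt 1 q m (means_pval \<omega>)) (means_nulls m \<omega>)) (power_lim q)"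
    by (rule NM.cprob_cong[OF adapt_half_limits(1)[OF assms(1)]], rule NM.whp_mono[OF w]) (simp add: eq)
  assume "power_lim q > 0"
  show "cprob (normal_means pi_mu) (\<lambda>m \<omega>. fdp (adapt 1 q m (means_pval \<omega>)) (means_nulls m \<omega>)) (fdp_lim q)"
    by (rule NM.cprob_cong[OF adapt_half_limits(2)[OF assms(1)]], fact, rule NM.whp_mono[OF w]) (simp add: eq)
qed

end

context asymptotic_means
begin

text \<open>Both procedures have the limits \<open>power_lim q\<close> and \<open>fdp_lim q\<close>,
  which depend only on \<open>pi_mu\<close> and \<open>q\<close>. Positive limiting power implies
  \<open>crosses q\<close>, and this is what gives the limit of the false discovery
  proportion.\<close>

lemma one_sided_effective_knockoff:
  assumes S0: "\<And>n \<omega> j. j < p n \<Longrightarrow> j \<in> S0 n \<omega> \<longleftrightarrow> mu n \<omega> j = 0"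
    and c: "\<And>n. c n > 0" and Z: "\<And>n \<omega> j. Z n \<omega> j = c n * W n \<omega> j"
    and q: "q \<notin> touching_levels"
  shows "one_sided_effective M p (\<lambda>n \<omega>. knockoff_filter q (p n) (W n \<omega>)) S0 (adapt (1/2) q) pi_mu"
    and "adapt_le_half q pi_mu \<Longrightarrow>
      one_sided_effective M p (\<lambda>n \<omega>. knockoff_filter q (p n) (W n \<omega>)) S0 (adapt 1 q) pi_mu"
proof -
  interpret E: empirical_limits M "\<lambda>w. tail {0} {w..}" "\<lambda>w. tail (- {0}) {w..}"
    "\<lambda>w. tail UNIV {..- w}" "measure pi_mu (- {0})" p Z S0
    by (rule empirical_limits) (rule S0)
  interpret NM: prob_seq "normal_means pi_mu"
    by (simp add: prob_seq_def prob_space_normal_means)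
  let ?S = "\<lambda>n \<omega>. knockoff_filter q (p n) (W n \<omega>)"
  have rule: "threshold_rule q (p n) (Z n \<omega>) (?S n \<omega>)" for n \<omega>
  proof -
    have "Z n \<omega> = (\<lambda>j. c n * W n \<omega> j)" by (simp add: Z fun_eq_iff)
    then show ?thesis using threshold_rule_knockoff_filter[OF c] by simp
  qed
  have mS: "\<forall>\<^sub>F n in sequentially. \<forall>j<p n. Measurable.pred (M n) (\<lambda>\<omega>. j \<in> ?S n \<omega>)"
    using Z_meas
  proof (eventually_elim, intro allI impI)
    fix n j assume Zm: "\<forall>j<p n. (\<lambda>\<omega>. Z n \<omega> j) \<in> borel_measurable (M n)" and j: "j < p n"
    have "(\<lambda>\<omega>. W n \<omega> j) \<in> borel_measurable (M n)" if "j < p n" for j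
    proof -
      have "(\<lambda>\<omega>. Z n \<omega> j / c n) \<in> borel_measurable (M n)" using Zm that by (intro borel_measurable_divide) auto
      then show ?thesis using c[of n] by (simp add: Z)
    qed
    then show "Measurable.pred (M n) (\<lambda>\<omega>. j \<in> ?S n \<omega>)" using j by (intro measurable_knockoff_filter)
  qed
  have mS0: "\<forall>\<^sub>F n in sequentially. \<forall>j<p n. Measurable.pred (M n) (\<lambda>\<omega>. j \<in> S0 n \<omega>)"
    using mu_meas
  proof (eventually_elim, intro allI impI)
    fix n j assume a: "\<forall>j<p n. (\<lambda>\<omega>. mu n \<omega> j) \<in> borel_measurable (M n)" and j: "j < p n"
    then have [measurable]: "(\<lambda>\<omega>. mu n \<omega> j) \<in> borel_measurable (M n)" by simp
    show "Measurable.pred (M n) (\<lambda>\<omega>. j \<in> S0 n \<omega>)" using j by (simp add: S0)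
  qed
  have pw: "converges_in_prob M (\<lambda>n \<omega>. realized_power (p n) (?S n \<omega>) (S0 n \<omega>)) (power_lim q)"
  proof (rule converges_in_probI[OF E.power_limit[OF q rule]])
    show "\<forall>\<^sub>F n in sequentially. (\<lambda>\<omega>. realized_power (p n) (?S n \<omega>) (S0 n \<omega>)) \<in> borel_measurable (M n)"
      using mS mS0 by eventually_elim (rule measurable_realized_power, auto)
  qed
  have fd: "converges_in_prob M (\<lambda>n \<omega>. fdp (?S n \<omega>) (S0 n \<omega>)) (fdp_lim q)" if "power_lim q > 0"
  proof (rule converges_in_probI[OF E.fdp_limit[OF q rule]])
    show "crosses q" using that by (auto simp: power_lim_def split: if_splits)
    have sub: "?S n \<omega> \<subseteq> {..<p n}" for n \<omega> by (auto simp: knockoff_filter_def)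
    show "\<forall>\<^sub>F n in sequentially. (\<lambda>\<omega>. fdp (?S n \<omega>) (S0 n \<omega>)) \<in> borel_measurable (M n)"
      using mS mS0 by eventually_elim (rule measurable_fdp[OF _ _ sub], auto)
  qed
  show "one_sided_effective M p ?S S0 (adapt (1/2) q) pi_mu"
    unfolding one_sided_effective_def
    by (intro exI[of _ "power_lim q"] conjI pw impI exI[of _ "fdp_lim q"] fd
        NM.converges_in_probI adapt_half_limits q always_eventually allI measurable_adapt_means)
  show "one_sided_effective M p ?S S0 (adapt 1 q) pi_mu" if "adapt_le_half q pi_mu"
    unfolding one_sided_effective_def
    by (intro exI[of _ "power_lim q"] conjI pw impI exI[of _ "fdp_lim q"] fd that
        NM.converges_in_probI adapt_one_limits q always_eventually allI measurable_adapt_means)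
qed

end

section \<open>Linear and quadratic forms in independent normal variables\<close>

context prob_space
begin

lemma std_normal_moments:
  assumes X: "distributed M lborel X std_normal_density"
  shows "integrable M (\<lambda>\<omega>. X \<omega> ^ k)" "expectation X = 0" "expectation (\<lambda>\<omega>. (X \<omega>)\<^sup>2) = 1"
    "expectation (\<lambda>\<omega>. X \<omega> ^ 3) = 0" "expectation (\<lambda>\<omega>. X \<omega> ^ 4) = 3"
proof -
  show "integrable M (\<lambda>\<omega>. X \<omega> ^ k)"
    using distributed_integrable[OF X, of "\<lambda>x. x ^ k"] integrable_std_normal_moment[of k] by simp
  have E: "expectation (\<lambda>\<omega>. X \<omega> ^ k) = (\<integral>x. std_normal_density x * x ^ k \<partial>lborel)" for k
    using distributed_integral[OF X, of "\<lambda>x. x ^ k"] by simp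
  show "expectation X = 0" by (rule standard_normal_distributed_expectation[OF X])
  show "expectation (\<lambda>\<omega>. (X \<omega>)\<^sup>2) = 1" using integral_std_normal_moment_even[of 1] by (simp add: E)
  show "expectation (\<lambda>\<omega>. X \<omega> ^ 3) = 0" using integral_std_normal_moment_odd[of 1] by (simp add: E)
  show "expectation (\<lambda>\<omega>. X \<omega> ^ 4) = 3" using integral_std_normal_moment_even[of 2]
    by (simp add: E fact_numeral)
qed

lemma distr_of_distributed:
  assumes "distributed M lborel X std_normal_density"
  shows "distr M borel X = Nm"
proof -
  have "distr M borel X = distr M lborel X" by (intro distr_cong) auto
  also have "\<dots> = Nm" by (rule distributed_distr_eq_density[OF assms])
  finally show ?thesis .
qed

lemma linear_form_normal:
  assumes K: "finite K" and ind: "indep_vars (\<lambda>_. borel) x K"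
    and x: "\<And>s. s \<in> K \<Longrightarrow> distributed M lborel (x s) std_normal_density"
    and V: "(\<Sum>s\<in>K. (c s)\<^sup>2) = V" "V > 0"
  shows "distributed M lborel (\<lambda>\<omega>. \<Sum>s\<in>K. c s * x s \<omega>) (normal_density 0 (sqrt V))"
proof -
  \<comment> \<open>The sum rule for normal variables requires positive standard deviations, so the
    zero coefficients are dropped.\<close>
  define K' where "K' = {s\<in>K. c s \<noteq> 0}"
  have K': "finite K'" "K' \<subseteq> K" using K by (auto simp: K'_def)
  have V': "(\<Sum>s\<in>K'. (c s)\<^sup>2) = V"
    unfolding V(1)[symmetric] K'_def using K by (intro sum.mono_neutral_left) auto
  then have ne: "K' \<noteq> {}" using V(2) by auto
  have "indep_vars (\<lambda>_. borel) (\<lambda>s \<omega>. c s * x s \<omega>) K'"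
    by (rule indep_vars_compose2[OF indep_vars_subset[OF ind K'(2)], of "\<lambda>s y. c s * y" "\<lambda>_. borel"]) simp
  moreover have "distributed M lborel (\<lambda>\<omega>. c s * x s \<omega>) (normal_density 0 \<bar>c s\<bar>)" if "s \<in> K'" for s
    using normal_density_affine[OF x, of s "c s" 0] that K'(2) by (auto simp: K'_def)
  ultimately have "distributed M lborel (\<lambda>\<omega>. \<Sum>s\<in>K'. c s * x s \<omega>)
      (normal_density (\<Sum>s\<in>K'. 0) (sqrt (\<Sum>s\<in>K'. \<bar>c s\<bar>\<^sup>2)))"
    using K' ne by (intro sum_indep_normal) (auto simp: K'_def)
  moreover have "(\<Sum>s\<in>K'. c s * x s \<omega>) = (\<Sum>s\<in>K. c s * x s \<omega>)" for \<omega>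
    unfolding K'_def using K by (intro sum.mono_neutral_left) auto
  ultimately show ?thesis using V' by simp
qed

lemma indep_var_product:
  assumes ind: "indep_var S X T Y" and f: "f \<in> borel_measurable S" and g: "g \<in> borel_measurable T"
    and i: "integrable M (\<lambda>\<omega>. f (X \<omega>) :: real)" "integrable M (\<lambda>\<omega>. g (Y \<omega>) :: real)"
  shows "integrable M (\<lambda>\<omega>. f (X \<omega>) * g (Y \<omega>))"
    and "expectation (\<lambda>\<omega>. f (X \<omega>) * g (Y \<omega>)) = expectation (\<lambda>\<omega>. f (X \<omega>)) * expectation (\<lambda>\<omega>. g (Y \<omega>))"
proof -
  have ind: "indep_var borel (\<lambda>\<omega>. f (X \<omega>)) borel (\<lambda>\<omega>. g (Y \<omega>))"
    using indep_var_compose[OF ind f g] by (simp add: comp_def)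
  show "integrable M (\<lambda>\<omega>. f (X \<omega>) * g (Y \<omega>))" by (rule indep_var_integrable[OF ind i])
  show "expectation (\<lambda>\<omega>. f (X \<omega>) * g (Y \<omega>)) = expectation (\<lambda>\<omega>. f (X \<omega>)) * expectation (\<lambda>\<omega>. g (Y \<omega>))"
    by (rule indep_var_lebesgue_integral[OF ind i])
qed

lemma linear_form_second_moment:
  assumes K: "finite K" and ind: "indep_vars (\<lambda>_. borel) x K"
    and x: "\<And>s. s \<in> K \<Longrightarrow> distributed M lborel (x s) std_normal_density"
  shows "integrable M (\<lambda>\<omega>. (\<Sum>s\<in>K. c s * x s \<omega>)\<^sup>2)"
    and "expectation (\<lambda>\<omega>. (\<Sum>s\<in>K. c s * x s \<omega>)\<^sup>2) = (\<Sum>s\<in>K. (c s)\<^sup>2)"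
proof -
  let ?V = "\<Sum>s\<in>K. (c s)\<^sup>2"
  have "integrable M (\<lambda>\<omega>. (\<Sum>s\<in>K. c s * x s \<omega>)\<^sup>2) \<and> expectation (\<lambda>\<omega>. (\<Sum>s\<in>K. c s * x s \<omega>)\<^sup>2) = ?V"
  proof (cases "?V = 0")
    case True
    then have "c s = 0" if "s \<in> K" for s
      using that K by (simp add: sum_nonneg_eq_0_iff)
    then have "(\<Sum>s\<in>K. c s * x s \<omega>) = 0" for \<omega> by simp
    then show ?thesis using True by simp
  next
    case False
    then have V: "?V > 0" using sum_nonneg[of K "\<lambda>s. (c s)\<^sup>2"] by simp
    have D: "distributed M lborel (\<lambda>\<omega>. \<Sum>s\<in>K. c s * x s \<omega>) (normal_density 0 (sqrt ?V))"
      by (rule linear_form_normal[OF K ind x refl V])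
    have i: "integrable M (\<lambda>\<omega>. (\<Sum>s\<in>K. c s * x s \<omega>)\<^sup>2)"
      using distributed_integrable[OF D, of "\<lambda>x. x\<^sup>2"] integrable_normal_moment[of "sqrt ?V" 0 2] V by simp
    have E: "expectation (\<lambda>\<omega>. \<Sum>s\<in>K. c s * x s \<omega>) = 0"
      by (rule normal_distributed_expectation[OF _ D]) (use V in simp)
    have "variance (\<lambda>\<omega>. \<Sum>s\<in>K. c s * x s \<omega>) = (sqrt ?V)\<^sup>2"
      by (rule normal_distributed_variance[OF _ D]) (use V in simp)
    with E i V show ?thesis by simp
  qed
  then show "integrable M (\<lambda>\<omega>. (\<Sum>s\<in>K. c s * x s \<omega>)\<^sup>2)"
    "expectation (\<lambda>\<omega>. (\<Sum>s\<in>K. c s * x s \<omega>)\<^sup>2) = ?V" by blast+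
qed

text \<open>Adding one variable \<open>x u\<close> adds \<open>x u\<close> times a linear form in
  the earlier ones and a multiple of \<open>(x u)\<^sup>2 - 1\<close>. The cross terms have mean 0
  by independence and the vanishing of \<open>E x\<close>, \<open>E (x\<^sup>2 - 1)\<close> and
  \<open>E (x * (x\<^sup>2 - 1))\<close>. The constant 2 is the variance of
  \<open>x\<^sup>2\<close>.\<close>

lemma quadratic_form_variance:
  assumes K: "finite K" and ind: "indep_vars (\<lambda>_. borel) x K"
    and x: "\<And>s. s \<in> K \<Longrightarrow> distributed M lborel (x s) std_normal_density"
  shows "integrable M (\<lambda>\<omega>. ((\<Sum>s\<in>K. \<Sum>t\<in>K. Q s t * x s \<omega> * x t \<omega>) - (\<Sum>s\<in>K. Q s s))\<^sup>2) \<and>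
    expectation (\<lambda>\<omega>. ((\<Sum>s\<in>K. \<Sum>t\<in>K. Q s t * x s \<omega> * x t \<omega>) - (\<Sum>s\<in>K. Q s s))\<^sup>2)
      \<le> 2 * (\<Sum>s\<in>K. \<Sum>t\<in>K. (Q s t)\<^sup>2)"
  using K ind x
proof (induction K rule: finite_induct)
  case empty
  show ?case by simp
next
  case (insert u K)
  let ?S = "\<lambda>\<omega>. (\<Sum>s\<in>K. \<Sum>t\<in>K. Q s t * x s \<omega> * x t \<omega>) - (\<Sum>s\<in>K. Q s s)"
  let ?c = "\<lambda>t. Q u t + Q t u"
  let ?L = "\<lambda>\<omega>. \<Sum>t\<in>K. ?c t * x t \<omega>"
  let ?q = "Q u u"
  have indK: "indep_vars (\<lambda>_. borel) x K" by (rule indep_vars_subset[OF insert.prems(1)]) auto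
  have xK: "distributed M lborel (x s) std_normal_density" if "s \<in> K" for s using insert.prems(2) that by simp
  have xu: "distributed M lborel (x u) std_normal_density" using insert.prems(2) by simp
  have IH: "integrable M (\<lambda>\<omega>. (?S \<omega>)\<^sup>2)" "expectation (\<lambda>\<omega>. (?S \<omega>)\<^sup>2) \<le> 2 * (\<Sum>s\<in>K. \<Sum>t\<in>K. (Q s t)\<^sup>2)"
    using insert.IH[OF indK xK] by auto
  have L: "integrable M (\<lambda>\<omega>. (?L \<omega>)\<^sup>2)" "expectation (\<lambda>\<omega>. (?L \<omega>)\<^sup>2) = (\<Sum>t\<in>K. (?c t)\<^sup>2)"
    using linear_form_second_moment[OF insert.hyps(1) indK xK, of ?c] by auto
  have [measurable]: "x s \<in> borel_measurable M" if "s \<in> insert u K" for s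
    using insert.prems(1) that by (auto simp: indep_vars_def)
  have mK: "(\<lambda>\<omega>. x s \<omega>) \<in> borel_measurable M" if "s \<in> K" for s using that by simp
  have mS: "?S \<in> borel_measurable M"
    by (intro borel_measurable_diff borel_measurable_sum borel_measurable_times borel_measurable_const mK)
  have mL: "?L \<in> borel_measurable M"
    by (intro borel_measurable_sum borel_measurable_times borel_measurable_const mK)
  have iS: "integrable M ?S"
    by (rule square_integrable_imp_integrable[OF mS IH(1)])
  have iL: "integrable M ?L"
    by (rule square_integrable_imp_integrable[OF mL L(1)])
  have iSL: "integrable M (\<lambda>\<omega>. ?S \<omega> * ?L \<omega>)"
  proof (rule Bochner_Integration.integrable_bound[OF Bochner_Integration.integrable_add[OF IH(1) L(1)]])
    show "(\<lambda>\<omega>. ?S \<omega> * ?L \<omega>) \<in> borel_measurable M" by (intro borel_measurable_times mS mL)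
    have "\<bar>a * b\<bar> \<le> \<bar>a\<^sup>2 + b\<^sup>2\<bar>" for a b :: real
    proof -
      have "2 * (\<bar>a\<bar> * \<bar>b\<bar>) \<le> a\<^sup>2 + b\<^sup>2" using sum_squares_bound[of "\<bar>a\<bar>" "\<bar>b\<bar>"] by simp
      moreover have "0 \<le> \<bar>a\<bar> * \<bar>b\<bar>" by simp
      ultimately have "\<bar>a\<bar> * \<bar>b\<bar> \<le> a\<^sup>2 + b\<^sup>2" by linarith
      then show ?thesis by (simp add: abs_mult)
    qed
    then show "AE \<omega> in M. norm (?S \<omega> * ?L \<omega>) \<le> norm ((?S \<omega>)\<^sup>2 + (?L \<omega>)\<^sup>2)" by simp
  qed
  have rest: "indep_var (PiM {u} (\<lambda>_. borel)) (\<lambda>\<omega>. restrict (\<lambda>i. x i \<omega>) {u}) (PiM K (\<lambda>_. borel)) (\<lambda>\<omega>. restrict (\<lambda>i. x i \<omega>) K)"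
    using insert.hyps by (intro indep_var_restrict[OF insert.prems(1)]) auto
  let ?fS = "\<lambda>v. (\<Sum>s\<in>K. \<Sum>t\<in>K. Q s t * v s * v t) - (\<Sum>s\<in>K. Q s s)"
  let ?fL = "\<lambda>v. \<Sum>t\<in>K. ?c t * v t"
  have mfS: "?fS \<in> borel_measurable (PiM K (\<lambda>_. borel))" by measurable
  have mfL: "?fL \<in> borel_measurable (PiM K (\<lambda>_. borel))" by measurable
  have rS: "?fS (restrict (\<lambda>i. x i \<omega>) K) = ?S \<omega>" and rL: "?fL (restrict (\<lambda>i. x i \<omega>) K) = ?L \<omega>" for \<omega>
    by (auto intro!: sum.cong)
  note mom = std_normal_moments[OF xu]
  have ix: "integrable M (x u)" using mom(1)[of 1] by simp
  have p2: "integrable M (\<lambda>\<omega>. (x u \<omega>)\<^sup>2)" by (rule mom(1))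
  have p21: "integrable M (\<lambda>\<omega>. (x u \<omega>)\<^sup>2 - 1)" "expectation (\<lambda>\<omega>. (x u \<omega>)\<^sup>2 - 1) = 0"
    using p2 mom(3) by (auto simp: prob_space)
  have p22: "integrable M (\<lambda>\<omega>. ((x u \<omega>)\<^sup>2 - 1)\<^sup>2)" "expectation (\<lambda>\<omega>. ((x u \<omega>)\<^sup>2 - 1)\<^sup>2) = 2"
  proof -
    have eq: "(y\<^sup>2 - 1)\<^sup>2 = y ^ 4 - 2 * y\<^sup>2 + 1" for y :: real by algebra
    show "integrable M (\<lambda>\<omega>. ((x u \<omega>)\<^sup>2 - 1)\<^sup>2)" "expectation (\<lambda>\<omega>. ((x u \<omega>)\<^sup>2 - 1)\<^sup>2) = 2"
      unfolding eq using mom(1)[of 4] p2 mom(3,5) by (auto simp: prob_space)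
  qed
  have p3: "integrable M (\<lambda>\<omega>. x u \<omega> * ((x u \<omega>)\<^sup>2 - 1))" "expectation (\<lambda>\<omega>. x u \<omega> * ((x u \<omega>)\<^sup>2 - 1)) = 0"
  proof -
    have eq: "y * (y\<^sup>2 - 1) = y ^ 3 - y" for y :: real by algebra
    show "integrable M (\<lambda>\<omega>. x u \<omega> * ((x u \<omega>)\<^sup>2 - 1))" "expectation (\<lambda>\<omega>. x u \<omega> * ((x u \<omega>)\<^sup>2 - 1)) = 0"
      unfolding eq using mom(1)[of 3] ix mom(2,4) by auto
  qed
  have t1: "integrable M (\<lambda>\<omega>. (x u \<omega>)\<^sup>2 * (?L \<omega>)\<^sup>2)" "expectation (\<lambda>\<omega>. (x u \<omega>)\<^sup>2 * (?L \<omega>)\<^sup>2) = (\<Sum>t\<in>K. (?c t)\<^sup>2)"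
    using indep_var_product[OF rest, of "\<lambda>y. (y u)\<^sup>2" "\<lambda>v. (?fL v)\<^sup>2"] mfL p2 L mom(3) by (simp_all only: rL) simp_all
  have t2: "integrable M (\<lambda>\<omega>. x u \<omega> * (?S \<omega> * ?L \<omega>))" "expectation (\<lambda>\<omega>. x u \<omega> * (?S \<omega> * ?L \<omega>)) = 0"
    using indep_var_product[OF rest, of "\<lambda>y. y u" "\<lambda>v. ?fS v * ?fL v"] mfL mfS ix iSL mom(2) by (simp_all only: rL rS) simp_all
  have t3: "integrable M (\<lambda>\<omega>. ((x u \<omega>)\<^sup>2 - 1) * ?S \<omega>)" "expectation (\<lambda>\<omega>. ((x u \<omega>)\<^sup>2 - 1) * ?S \<omega>) = 0"
    using indep_var_product[OF rest, of "\<lambda>y. (y u)\<^sup>2 - 1" "?fS"] mfS p21 iS by (simp_all only: rS) simp_all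
  have t4: "integrable M (\<lambda>\<omega>. (x u \<omega> * ((x u \<omega>)\<^sup>2 - 1)) * ?L \<omega>)" "expectation (\<lambda>\<omega>. (x u \<omega> * ((x u \<omega>)\<^sup>2 - 1)) * ?L \<omega>) = 0"
    using indep_var_product[OF rest, of "\<lambda>y. y u * ((y u)\<^sup>2 - 1)" "?fL"] mfL p3 iL by (simp_all only: rL) simp_all
  let ?S' = "\<lambda>\<omega>. (\<Sum>s\<in>insert u K. \<Sum>t\<in>insert u K. Q s t * x s \<omega> * x t \<omega>) - (\<Sum>s\<in>insert u K. Q s s)"
  have S': "?S' \<omega> = ?S \<omega> + x u \<omega> * ?L \<omega> + ?q * ((x u \<omega>)\<^sup>2 - 1)" for \<omega>
    using insert.hyps by (simp add: sum.distrib sum_distrib_left algebra_simps power2_eq_square)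
  have sq: "(a + y * l + q * (y\<^sup>2 - 1))\<^sup>2 = a\<^sup>2 + y\<^sup>2 * l\<^sup>2 + q\<^sup>2 * (y\<^sup>2 - 1)\<^sup>2
      + 2 * (y * (a * l)) + (2 * q) * ((y\<^sup>2 - 1) * a) + (2 * q) * ((y * (y\<^sup>2 - 1)) * l)" for a y l q :: real
    by (simp add: power2_eq_square algebra_simps)
  have int: "integrable M (\<lambda>\<omega>. (?S' \<omega>)\<^sup>2)"
    unfolding S' sq by (intro Bochner_Integration.integrable_add integrable_mult_right IH(1) t1 t2 t3 t4 p22)
  have "expectation (\<lambda>\<omega>. (?S' \<omega>)\<^sup>2) = expectation (\<lambda>\<omega>. (?S \<omega>)\<^sup>2) + (\<Sum>t\<in>K. (?c t)\<^sup>2) + ?q\<^sup>2 * 2"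
    unfolding S' sq using IH(1) t1 t2 t3 t4 p22 by simp
  also have "\<dots> \<le> 2 * (\<Sum>s\<in>K. \<Sum>t\<in>K. (Q s t)\<^sup>2) + (\<Sum>t\<in>K. 2 * (Q u t)\<^sup>2 + 2 * (Q t u)\<^sup>2) + ?q\<^sup>2 * 2"
  proof -
    \<comment> \<open>\<open>Q\<close> is not assumed symmetric: the coefficient of
      \<open>x u * x t\<close> is \<open>Q u t + Q t u\<close>, and its square is bounded by the two
      squares separately.\<close>
    have "(a + b)\<^sup>2 \<le> 2 * a\<^sup>2 + 2 * b\<^sup>2" for a b :: real
      using sum_squares_bound[of a b] by (simp add: power2_sum)
    then show ?thesis by (intro add_mono IH(2) sum_mono) auto
  qed
  also have "\<dots> = 2 * (\<Sum>s\<in>insert u K. \<Sum>t\<in>insert u K. (Q s t)\<^sup>2)"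
    using insert.hyps by (simp add: sum.distrib sum_distrib_left)
  finally show ?case using int by blast
qed

text \<open>Conditioning on \<open>Y\<close> by Fubini: a bound that holds for every fixed value of
  \<open>Y\<close> survives integration.\<close>

lemma indep_prob_le:
  assumes ind: "indep_var S X T Y" and A: "A \<in> sets (S \<Otimes>\<^sub>M T)" and e: "e \<ge> 0"
    and le: "\<And>y. y \<in> space T \<Longrightarrow> prob {\<omega>\<in>space M. (X \<omega>, y) \<in> A} \<le> e"
  shows "prob {\<omega>\<in>space M. (X \<omega>, Y \<omega>) \<in> A} \<le> e"
proof -
  have [measurable]: "X \<in> measurable M S" "Y \<in> measurable M T"
    and eq: "distr M S X \<Otimes>\<^sub>M distr M T Y = distr M (S \<Otimes>\<^sub>M T) (\<lambda>x. (X x, Y x))"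
    using ind by (auto simp: indep_var_distribution_eq)
  interpret X: prob_space "distr M S X" by (rule prob_space_distr) simp
  interpret Y: prob_space "distr M T Y" by (rule prob_space_distr) simp
  interpret XY: pair_prob_space "distr M S X" "distr M T Y" ..
  have sl: "(\<lambda>x. (x, y)) -` A \<in> sets S" for y
    by (rule sets_Pair2[OF A])
  have "emeasure M {\<omega>\<in>space M. (X \<omega>, Y \<omega>) \<in> A} = emeasure (distr M (S \<Otimes>\<^sub>M T) (\<lambda>x. (X x, Y x))) A"
    using A by (subst emeasure_distr) (auto intro!: arg_cong[where f="emeasure M"])
  also have "\<dots> = emeasure (distr M S X \<Otimes>\<^sub>M distr M T Y) A" by (simp only: eq)
  also have "\<dots> = (\<integral>\<^sup>+y. emeasure (distr M S X) ((\<lambda>x. (x, y)) -` A) \<partial>distr M T Y)"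
    by (rule XY.emeasure_pair_measure_alt2) (use A in simp)
  also have "\<dots> \<le> (\<integral>\<^sup>+y. ennreal e \<partial>distr M T Y)"
  proof (rule nn_integral_mono)
    fix y assume "y \<in> space (distr M T Y)"
    then have y: "y \<in> space T" by simp
    have "emeasure (distr M S X) ((\<lambda>x. (x, y)) -` A) = emeasure M {\<omega>\<in>space M. (X \<omega>, y) \<in> A}"
      using sl by (subst emeasure_distr) (auto intro!: arg_cong[where f="emeasure M"])
    also have "\<dots> \<le> ennreal e" using le[OF y] by (simp add: emeasure_eq_measure ennreal_leI)
    finally show "emeasure (distr M S X) ((\<lambda>x. (x, y)) -` A) \<le> ennreal e" .
  qed
  also have "\<dots> = ennreal e" using Y.emeasure_space_1 by simp
  finally show ?thesis using e by (simp add: emeasure_eq_measure)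
qed

text \<open>Conditioning on the variables indexed by \<open>L\<close> fixes the coefficients of the form.\<close>

lemma conditional_quadratic_form:
  fixes x :: "'i \<Rightarrow> 'a \<Rightarrow> real"
  assumes I: "finite I" and ind: "indep_vars (\<lambda>_. borel) x I"
    and KL: "K \<subseteq> I" "L \<subseteq> I" "K \<inter> L = {}"
    and x: "\<And>s. s \<in> K \<Longrightarrow> distributed M lborel (x s) std_normal_density"
    and Q: "\<And>s t. (\<lambda>y. Q y s t) \<in> borel_measurable (PiM L (\<lambda>_. borel))"
    and R: "\<And>\<omega>. \<omega> \<in> space M \<Longrightarrow> R \<omega> = restrict (\<lambda>i. x i \<omega>) L"
    and t: "t > 0" and V: "V \<ge> 0"
  shows "prob {\<omega>\<in>space M. 2 * (\<Sum>s\<in>K. \<Sum>u\<in>K. (Q (R \<omega>) s u)\<^sup>2) \<le> V \<and>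
      t \<le> \<bar>(\<Sum>s\<in>K. \<Sum>u\<in>K. Q (R \<omega>) s u * x s \<omega> * x u \<omega>) - (\<Sum>s\<in>K. Q (R \<omega>) s s)\<bar>} \<le> V / t\<^sup>2"
proof -
  let ?PK = "PiM K (\<lambda>_. borel) :: ('i \<Rightarrow> real) measure" and ?PL = "PiM L (\<lambda>_. borel) :: ('i \<Rightarrow> real) measure"
  let ?RK = "\<lambda>\<omega>. restrict (\<lambda>i. x i \<omega>) K" and ?RL = "\<lambda>\<omega>. restrict (\<lambda>i. x i \<omega>) L"
  have fK: "finite K" using I KL(1) finite_subset by blast
  define A where "A = {z \<in> space (?PK \<Otimes>\<^sub>M ?PL). 2 * (\<Sum>s\<in>K. \<Sum>u\<in>K. (Q (snd z) s u)\<^sup>2) \<le> V \<and>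
      t \<le> \<bar>(\<Sum>s\<in>K. \<Sum>u\<in>K. Q (snd z) s u * fst z s * fst z u) - (\<Sum>s\<in>K. Q (snd z) s s)\<bar>}"
  have [measurable]: "(\<lambda>z. Q (snd z) s u) \<in> borel_measurable (?PK \<Otimes>\<^sub>M ?PL)" for s u
    by (rule measurable_compose[OF measurable_snd Q])
  have [measurable]: "(\<lambda>z. fst z s) \<in> borel_measurable (?PK \<Otimes>\<^sub>M ?PL)" if "s \<in> K" for s
    by (rule measurable_compose[OF measurable_fst measurable_component_singleton[OF that]])
  have A: "A \<in> sets (?PK \<Otimes>\<^sub>M ?PL)" unfolding A_def by measurable
  have indKL: "indep_var ?PK ?RK ?PL ?RL" by (rule indep_var_restrict[OF ind KL(3,1,2)])
  have mx: "x s \<in> borel_measurable M" if "s \<in> K" for s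
    using ind KL(1) that by (auto simp: indep_vars_def)
  have "prob {\<omega>\<in>space M. (?RK \<omega>, ?RL \<omega>) \<in> A} \<le> V / t\<^sup>2"
  proof (rule indep_prob_le[OF indKL A])
    show "0 \<le> V / t\<^sup>2" using V by simp
    fix y assume y: "y \<in> space ?PL"
    let ?q = "\<lambda>\<omega>. (\<Sum>s\<in>K. \<Sum>u\<in>K. Q y s u * x s \<omega> * x u \<omega>) - (\<Sum>s\<in>K. Q y s s)"
    have eq: "{\<omega>\<in>space M. (?RK \<omega>, y) \<in> A} = {\<omega>\<in>space M. 2 * (\<Sum>s\<in>K. \<Sum>u\<in>K. (Q y s u)\<^sup>2) \<le> V \<and> t \<le> \<bar>?q \<omega>\<bar>}"
      unfolding A_def using y by (auto simp: space_pair_measure space_PiM)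
    show "prob {\<omega>\<in>space M. (?RK \<omega>, y) \<in> A} \<le> V / t\<^sup>2"
    \<comment> \<open>The bound on the coefficients involves only the fixed values \<open>y\<close>.
      Where it fails the event is empty, and elsewhere Chebyshev's inequality applies.\<close>
    proof (cases "2 * (\<Sum>s\<in>K. \<Sum>u\<in>K. (Q y s u)\<^sup>2) \<le> V")
      case False
      then have "{\<omega>\<in>space M. (?RK \<omega>, y) \<in> A} = {}" unfolding eq by simp
      then show ?thesis using V by (simp only: measure_empty) simp
    next
      case True
      note q = quadratic_form_variance[OF fK indep_vars_subset[OF ind KL(1)] x, of "Q y"]
      have le: "t \<le> \<bar>z\<bar> \<longleftrightarrow> t\<^sup>2 \<le> z\<^sup>2" for z
        using t abs_le_square_iff[of t z] by auto
      have "prob {\<omega>\<in>space M. (?RK \<omega>, y) \<in> A} = prob {\<omega>\<in>space M. t\<^sup>2 \<le> (?q \<omega>)\<^sup>2}"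
        unfolding eq using True by (simp add: le)
      also have "\<dots> \<le> expectation (\<lambda>\<omega>. (?q \<omega>)\<^sup>2) / t\<^sup>2"
        using integral_Markov_inequality_measure[OF conjunct1[OF q], of "space M" "t\<^sup>2"] t by simp
      also have "\<dots> \<le> V / t\<^sup>2"
        using q True by (intro divide_right_mono) auto
      finally show ?thesis .
    qed
  qed
  moreover have "{\<omega>\<in>space M. 2 * (\<Sum>s\<in>K. \<Sum>u\<in>K. (Q (R \<omega>) s u)\<^sup>2) \<le> V \<and>
      t \<le> \<bar>(\<Sum>s\<in>K. \<Sum>u\<in>K. Q (R \<omega>) s u * x s \<omega> * x u \<omega>) - (\<Sum>s\<in>K. Q (R \<omega>) s s)\<bar>}
      = {\<omega>\<in>space M. (?RK \<omega>, ?RL \<omega>) \<in> A}"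
    unfolding A_def by (auto simp: space_pair_measure space_PiM R)
  ultimately show ?thesis by simp
qed

text \<open>If the conditional law given \<open>Y\<close> is the same for every value of
  \<open>Y\<close>, it is also the unconditional law, and the variable is independent of
  \<open>Y\<close>. This yields exact normality for projections on random directions.\<close>

lemma distr_of_constant_law:
  assumes ind: "indep_var S X T Y" and f[measurable]: "f \<in> borel_measurable (S \<Otimes>\<^sub>M T)"
    and law: "\<And>y. y \<in> space T \<Longrightarrow> distr M borel (\<lambda>\<omega>. f (X \<omega>, y)) = D"
    and g[measurable]: "g \<in> measurable T T'"
  shows "distr M (borel \<Otimes>\<^sub>M T') (\<lambda>\<omega>. (f (X \<omega>, Y \<omega>), g (Y \<omega>))) = D \<Otimes>\<^sub>M distr M T' (\<lambda>\<omega>. g (Y \<omega>))"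
proof -
  have [measurable]: "X \<in> measurable M S" "Y \<in> measurable M T"
    and eq: "distr M S X \<Otimes>\<^sub>M distr M T Y = distr M (S \<Otimes>\<^sub>M T) (\<lambda>x. (X x, Y x))"
    using ind by (auto simp: indep_var_distribution_eq)
  interpret X: prob_space "distr M S X" by (rule prob_space_distr) simp
  interpret Y: prob_space "distr M T Y" by (rule prob_space_distr) simp
  interpret XY: pair_prob_space "distr M S X" "distr M T Y" ..
  obtain y0 where y0: "y0 \<in> space T" using not_empty measurable_space[of Y M T] by fastforce
  have m0: "(\<lambda>\<omega>. f (X \<omega>, y)) \<in> borel_measurable M" if [measurable]: "y \<in> space T" for y by measurable
  have D: "prob_space D" using law[OF y0] prob_space_distr[OF m0[OF y0]] by simp
  interpret D: prob_space D by (rule D)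
  have sD[measurable_cong]: "sets D = sets borel" using law[OF y0] by (metis sets_distr)
  have rect: "emeasure M {\<omega>\<in>space M. f (X \<omega>, Y \<omega>) \<in> A \<and> Y \<omega> \<in> B} = emeasure D A * emeasure (distr M T Y) B"
    if [measurable]: "A \<in> sets borel" "B \<in> sets T" for A B
  proof -
    let ?C = "{z \<in> space (S \<Otimes>\<^sub>M T). f z \<in> A \<and> snd z \<in> B}"
    have C: "?C \<in> sets (S \<Otimes>\<^sub>M T)" by measurable
    have "emeasure M {\<omega>\<in>space M. f (X \<omega>, Y \<omega>) \<in> A \<and> Y \<omega> \<in> B} = emeasure (distr M (S \<Otimes>\<^sub>M T) (\<lambda>x. (X x, Y x))) ?C"
      using C measurable_space[of X M S] measurable_space[of Y M T]
      by (subst emeasure_distr) (auto intro!: arg_cong[where f="emeasure M"] simp: space_pair_measure)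
    also have "\<dots> = emeasure (distr M S X \<Otimes>\<^sub>M distr M T Y) ?C" by (simp only: eq)
    also have "\<dots> = (\<integral>\<^sup>+y. emeasure (distr M S X) ((\<lambda>x. (x, y)) -` ?C) \<partial>distr M T Y)"
      by (rule XY.emeasure_pair_measure_alt2) (use C in simp)
    also have "\<dots> = (\<integral>\<^sup>+y. emeasure D A * indicator B y \<partial>distr M T Y)"
    proof (rule nn_integral_cong)
      fix y assume "y \<in> space (distr M T Y)"
      then have y: "y \<in> space T" by simp
      show "emeasure (distr M S X) ((\<lambda>x. (x, y)) -` ?C) = emeasure D A * indicator B y"
      proof (cases "y \<in> B")
        case True
        have "emeasure (distr M S X) ((\<lambda>x. (x, y)) -` ?C) = emeasure M {\<omega>\<in>space M. f (X \<omega>, y) \<in> A}"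
          using sets_Pair2[OF C] True y measurable_space[of X M S]
          by (subst emeasure_distr) (auto intro!: arg_cong[where f="emeasure M"] simp: space_pair_measure)
        also have "\<dots> = emeasure (distr M borel (\<lambda>\<omega>. f (X \<omega>, y))) A"
          using m0[OF y] by (subst emeasure_distr) (auto intro!: arg_cong[where f="emeasure M"])
        finally show ?thesis using True law[OF y] by simp
      next
        case False
        then show ?thesis by simp
      qed
    qed
    also have "\<dots> = emeasure D A * emeasure (distr M T Y) B"
      by (subst nn_integral_cmult_indicator) auto
    finally show ?thesis .
  qed
  interpret gY: prob_space "distr M T' (\<lambda>\<omega>. g (Y \<omega>))" by (rule prob_space_distr) measurable
  show ?thesis
  proof (rule pair_measure_eqI[symmetric])
    show "sigma_finite_measure D" "sigma_finite_measure (distr M T' (\<lambda>\<omega>. g (Y \<omega>)))"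
      by (intro prob_space_imp_sigma_finite D gY.prob_space_axioms)+
    show "sets (D \<Otimes>\<^sub>M distr M T' (\<lambda>\<omega>. g (Y \<omega>))) = sets (distr M (borel \<Otimes>\<^sub>M T') (\<lambda>\<omega>. (f (X \<omega>, Y \<omega>), g (Y \<omega>))))"
      by (simp add: sD cong: sets_pair_measure_cong)
    fix A B assume "A \<in> sets D" "B \<in> sets (distr M T' (\<lambda>\<omega>. g (Y \<omega>)))"
    then have [measurable]: "A \<in> sets borel" "B \<in> sets T'" by (auto simp: sD)
    define B' where "B' = g -` B \<inter> space T"
    have B'[measurable]: "B' \<in> sets T" unfolding B'_def by measurable
    have "emeasure (distr M T' (\<lambda>\<omega>. g (Y \<omega>))) B = emeasure (distr M T Y) B'"
      using measurable_space[of Y M T] unfolding B'_def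
      by (subst (1 2) emeasure_distr) (auto intro!: arg_cong[where f="emeasure M"])
    moreover have "emeasure (distr M (borel \<Otimes>\<^sub>M T') (\<lambda>\<omega>. (f (X \<omega>, Y \<omega>), g (Y \<omega>)))) (A \<times> B)
        = emeasure M {\<omega>\<in>space M. f (X \<omega>, Y \<omega>) \<in> A \<and> Y \<omega> \<in> B'}"
      using measurable_space[of Y M T] unfolding B'_def
      by (subst emeasure_distr) (auto intro!: arg_cong[where f="emeasure M"])
    ultimately show "emeasure D A * emeasure (distr M T' (\<lambda>\<omega>. g (Y \<omega>))) B
        = emeasure (distr M (borel \<Otimes>\<^sub>M T') (\<lambda>\<omega>. (f (X \<omega>, Y \<omega>), g (Y \<omega>)))) (A \<times> B)"
      using rect[of A B'] by simp
  qed
qed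

end

text \<open>Repeated Fubini. Peeling off one normal variable after the other in
  \<open>pair_law\<close> leaves the factors in the order of the left-hand side.\<close>

lemma distr_shuffle:
  assumes A: "prob_space A" "sets A = sets borel" and N: "prob_space N" "sets N = sets borel"
  shows "distr (N \<Otimes>\<^sub>M (N \<Otimes>\<^sub>M (A \<Otimes>\<^sub>M A))) ((borel \<Otimes>\<^sub>M borel) \<Otimes>\<^sub>M (borel \<Otimes>\<^sub>M borel))
      (\<lambda>z. ((fst (snd (snd z)), fst z), (snd (snd (snd z)), fst (snd z)))) =
    (A \<Otimes>\<^sub>M N) \<Otimes>\<^sub>M (A \<Otimes>\<^sub>M (N :: real measure))" (is "?D = ?R")
proof (rule measure_eqI)
  note [measurable_cong] = A(2) N(2)
  interpret A: prob_space A by (rule A)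
  interpret N: prob_space N by (rule N)
  interpret AA: prob_space "A \<Otimes>\<^sub>M A" by (intro prob_space_pair A)
  interpret AN: prob_space "A \<Otimes>\<^sub>M N" by (intro prob_space_pair A N)
  interpret NAA: prob_space "N \<Otimes>\<^sub>M (A \<Otimes>\<^sub>M A)" by (intro prob_space_pair A N)
  interpret PA: pair_sigma_finite A N by unfold_locales
  show "sets ?D = sets ?R"
    by (simp add: A(2) N(2) cong: sets_pair_measure_cong)
  fix C assume "C \<in> sets ?D"
  then have C[measurable]: "C \<in> sets ((borel \<Otimes>\<^sub>M borel) \<Otimes>\<^sub>M (borel \<Otimes>\<^sub>M borel))" by simp
  let ?T = "\<lambda>z. ((fst (snd (snd z)), fst z), (snd (snd (snd z)), fst (snd z)))"
  let ?f = "\<lambda>g1 h1 g2 h2. indicator C ((g1, h1), (g2, h2)) :: ennreal"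
  have "emeasure ?D C = (\<integral>\<^sup>+z. indicator C z \<partial>?D)" by simp
  also have "\<dots> = (\<integral>\<^sup>+z. indicator C (?T z) \<partial>(N \<Otimes>\<^sub>M (N \<Otimes>\<^sub>M (A \<Otimes>\<^sub>M A))))"
    by (rule nn_integral_distr) measurable
  also have "\<dots> = (\<integral>\<^sup>+h1. \<integral>\<^sup>+w. ?f (fst (snd w)) h1 (snd (snd w)) (fst w) \<partial>(N \<Otimes>\<^sub>M (A \<Otimes>\<^sub>M A)) \<partial>N)"
    by (subst NAA.nn_integral_fst[symmetric]) auto
  also have "\<dots> = (\<integral>\<^sup>+h1. \<integral>\<^sup>+h2. \<integral>\<^sup>+v. ?f (fst v) h1 (snd v) h2 \<partial>(A \<Otimes>\<^sub>M A) \<partial>N \<partial>N)"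
    by (intro nn_integral_cong, subst AA.nn_integral_fst[symmetric]) auto
  also have "\<dots> = (\<integral>\<^sup>+h1. \<integral>\<^sup>+h2. \<integral>\<^sup>+g1. \<integral>\<^sup>+g2. ?f g1 h1 g2 h2 \<partial>A \<partial>A \<partial>N \<partial>N)"
    by (intro nn_integral_cong, subst A.nn_integral_fst[symmetric]) auto
  also have "\<dots> = (\<integral>\<^sup>+h1. \<integral>\<^sup>+g1. \<integral>\<^sup>+h2. \<integral>\<^sup>+g2. ?f g1 h1 g2 h2 \<partial>A \<partial>N \<partial>A \<partial>N)"
    by (intro nn_integral_cong, subst PA.Fubini') auto
  also have "\<dots> = (\<integral>\<^sup>+h1. \<integral>\<^sup>+g1. \<integral>\<^sup>+g2. \<integral>\<^sup>+h2. ?f g1 h1 g2 h2 \<partial>N \<partial>A \<partial>A \<partial>N)"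
    by (intro nn_integral_cong, subst PA.Fubini') auto
  also have "\<dots> = (\<integral>\<^sup>+g1. \<integral>\<^sup>+h1. \<integral>\<^sup>+g2. \<integral>\<^sup>+h2. ?f g1 h1 g2 h2 \<partial>N \<partial>A \<partial>N \<partial>A)"
    by (subst PA.Fubini') auto
  also have "\<dots> = (\<integral>\<^sup>+g1. \<integral>\<^sup>+h1. \<integral>\<^sup>+v. ?f g1 h1 (fst v) (snd v) \<partial>(A \<Otimes>\<^sub>M N) \<partial>N \<partial>A)"
    by (intro nn_integral_cong, subst N.nn_integral_fst[symmetric]) auto
  also have "\<dots> = (\<integral>\<^sup>+w. \<integral>\<^sup>+v. ?f (fst w) (snd w) (fst v) (snd v) \<partial>(A \<Otimes>\<^sub>M N) \<partial>(A \<Otimes>\<^sub>M N))"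
    by (subst N.nn_integral_fst[symmetric]) auto
  also have "\<dots> = (\<integral>\<^sup>+z. indicator C z \<partial>?R)"
    by (subst AN.nn_integral_fst[symmetric]) auto
  also have "\<dots> = emeasure ?R C" by simp
  finally show "emeasure ?D C = emeasure ?R C" .
qed

text \<open>On the product space a coordinate outside \<open>L\<close> is constantly
  \<open>undefined\<close>. This removes the index side conditions from all later measurability
  proofs.\<close>

lemma measurable_coordinate[measurable]:
  "(\<lambda>y. y s) \<in> borel_measurable (PiM L (\<lambda>_. borel :: real measure))"
proof (cases "s \<in> L")
  case True
  then show ?thesis by (rule measurable_component_singleton)
next
  case False
  then have "(\<lambda>y. y s) \<in> borel_measurable (PiM L (\<lambda>_. borel :: real measure)) \<longleftrightarrow>
      (\<lambda>y. undefined :: real) \<in> borel_measurable (PiM L (\<lambda>_. borel :: real measure))"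
    by (intro measurable_cong) (auto simp: space_PiM PiE_def extensional_def)
  then show ?thesis by simp
qed

lemma measurable_restrict_coord:
  assumes "L' \<subseteq> L"
  shows "(\<lambda>y. restrict y L') \<in> measurable (PiM L (\<lambda>_. borel :: real measure)) (PiM L' (\<lambda>_. borel))"
  by (rule measurable_restrict_subset[OF assms])

text \<open>The two forms may share their random coefficients and are still independent. Given the
  data on \<open>K2\<close> and \<open>L\<close>, the first form is standard normal; given the data
  on \<open>L\<close>, so is the second. Neither conditional law depends on the values given, and
  \<open>b1\<close>, \<open>b2\<close> belong to \<open>L\<close>.\<close>

lemma (in prob_space) pair_law:
  fixes x :: "'i \<Rightarrow> 'a \<Rightarrow> real"
  assumes ind: "indep_vars (\<lambda>_. borel) x I" and I: "finite I"
    and sub: "K1 \<subseteq> I" "K2 \<subseteq> I" "L \<subseteq> I" and disj: "K1 \<inter> K2 = {}" "K1 \<inter> L = {}" "K2 \<inter> L = {}"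
    and x: "\<And>s. s \<in> K1 \<union> K2 \<Longrightarrow> distributed M lborel (x s) std_normal_density"
    and c1: "\<And>s. (\<lambda>y. c1 y s) \<in> borel_measurable (PiM L (\<lambda>_. borel))"
      "\<And>y. y \<in> space (PiM L (\<lambda>_. borel)) \<Longrightarrow> (\<Sum>s\<in>K1. (c1 y s)\<^sup>2) = 1"
    and c2: "\<And>s. (\<lambda>y. c2 y s) \<in> borel_measurable (PiM L (\<lambda>_. borel))"
      "\<And>y. y \<in> space (PiM L (\<lambda>_. borel)) \<Longrightarrow> (\<Sum>s\<in>K2. (c2 y s)\<^sup>2) = 1"
    and b: "b1 \<in> L" "b2 \<in> L" "b1 \<noteq> b2"
    and law: "distr M borel (\<lambda>\<omega>. a * x b1 \<omega>) = D" "distr M borel (\<lambda>\<omega>. a * x b2 \<omega>) = D"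
  shows "distr M ((borel \<Otimes>\<^sub>M borel) \<Otimes>\<^sub>M (borel \<Otimes>\<^sub>M borel))
      (\<lambda>\<omega>. ((a * x b1 \<omega>, \<Sum>s\<in>K1. c1 (restrict (\<lambda>i. x i \<omega>) L) s * x s \<omega>),
           (a * x b2 \<omega>, \<Sum>s\<in>K2. c2 (restrict (\<lambda>i. x i \<omega>) L) s * x s \<omega>)))
    = (D \<Otimes>\<^sub>M Nm) \<Otimes>\<^sub>M (D \<Otimes>\<^sub>M Nm)"
proof -
  let ?P = "\<lambda>J. PiM J (\<lambda>_. borel) :: ('i \<Rightarrow> real) measure"
  let ?R = "\<lambda>J \<omega>. restrict (\<lambda>i. x i \<omega>) J"
  have mx: "x s \<in> borel_measurable M" if "s \<in> I" for s using ind that by (auto simp: indep_vars_def)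
  have fK: "finite K1" "finite K2" using sub I finite_subset by blast+
  define h1 where "h1 \<omega> = (\<Sum>s\<in>K1. c1 (?R L \<omega>) s * x s \<omega>)" for \<omega>
  define h2 where "h2 \<omega> = (\<Sum>s\<in>K2. c2 (?R L \<omega>) s * x s \<omega>)" for \<omega>
  have mR: "?R J \<in> measurable M (?P J)" if "J \<subseteq> I" for J
    using mx that by (intro measurable_restrict) auto
  have mh1[measurable]: "h1 \<in> borel_measurable M" unfolding h1_def
    using sub mx by (intro borel_measurable_sum borel_measurable_times measurable_compose[OF mR c1(1)]) auto
  have mh2[measurable]: "h2 \<in> borel_measurable M" unfolding h2_def
    using sub mx by (intro borel_measurable_sum borel_measurable_times measurable_compose[OF mR c2(1)]) auto
  have mb[measurable]: "x b1 \<in> borel_measurable M" "x b2 \<in> borel_measurable M" using mx b sub by auto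
  have pD: "prob_space D" using law(1) prob_space_distr[of "\<lambda>\<omega>. a * x b1 \<omega>" borel] mb by simp
  have sD: "sets D = sets borel" using law(1) by (metis sets_distr)
  have normal: "distr M borel (\<lambda>\<omega>. \<Sum>s\<in>K. c s * ?R K \<omega> s) = Nm"
    if "K = K1 \<or> K = K2" "(\<Sum>s\<in>K. (c s)\<^sup>2) = 1" for K c
  proof -
    have K: "finite K" "K \<subseteq> I" using that fK sub by auto
    have "distributed M lborel (\<lambda>\<omega>. \<Sum>s\<in>K. c s * x s \<omega>) (normal_density 0 (sqrt 1))"
      using that x by (intro linear_form_normal K indep_vars_subset[OF ind K(2)]) auto
    then have "distr M borel (\<lambda>\<omega>. \<Sum>s\<in>K. c s * x s \<omega>) = Nm" by (intro distr_of_distributed) simp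
    moreover have "(\<Sum>s\<in>K. c s * ?R K \<omega> s) = (\<Sum>s\<in>K. c s * x s \<omega>)" for \<omega> by (intro sum.cong) auto
    ultimately show ?thesis by simp
  qed

  let ?B = "borel \<Otimes>\<^sub>M (borel \<Otimes>\<^sub>M borel) :: (real \<times> real \<times> real) measure"
  let ?f1 = "\<lambda>z. \<Sum>s\<in>K1. c1 (restrict (snd z) L) s * fst z s"
  let ?g1 = "\<lambda>y. (\<Sum>s\<in>K2. c2 (restrict y L) s * y s, (a * y b1, a * y b2))"
  have i1: "indep_var (?P K1) (?R K1) (?P (K2 \<union> L)) (?R (K2 \<union> L))"
    using sub disj by (intro indep_var_restrict[OF ind]) auto
  have mr: "(\<lambda>y. restrict y L) \<in> measurable (?P (K2 \<union> L)) (?P L)"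
    by (rule measurable_restrict_coord) auto
  have mf1: "?f1 \<in> borel_measurable (?P K1 \<Otimes>\<^sub>M ?P (K2 \<union> L))"
    by (intro borel_measurable_sum borel_measurable_times
        measurable_compose[OF measurable_compose[OF measurable_snd mr] c1(1)]) measurable
  have mg1: "?g1 \<in> measurable (?P (K2 \<union> L)) ?B"
    by (intro measurable_Pair borel_measurable_sum borel_measurable_times measurable_compose[OF mr c2(1)]) measurable
  have l1: "distr M borel (\<lambda>\<omega>. ?f1 (?R K1 \<omega>, y)) = Nm" if "y \<in> space (?P (K2 \<union> L))" for y
    using normal[of K1 "c1 (restrict y L)"] c1(2) that by (auto simp: space_PiM)
  have "distr M (borel \<Otimes>\<^sub>M ?B) (\<lambda>\<omega>. (?f1 (?R K1 \<omega>, ?R (K2 \<union> L) \<omega>), ?g1 (?R (K2 \<union> L) \<omega>)))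
      = Nm \<Otimes>\<^sub>M distr M ?B (\<lambda>\<omega>. ?g1 (?R (K2 \<union> L) \<omega>))"
    by (rule distr_of_constant_law[OF i1 mf1 l1 mg1])
  moreover have "?f1 (?R K1 \<omega>, ?R (K2 \<union> L) \<omega>) = h1 \<omega>" "?g1 (?R (K2 \<union> L) \<omega>) = (h2 \<omega>, (a * x b1 \<omega>, a * x b2 \<omega>))" for \<omega>
  proof -
    have "restrict (?R (K2 \<union> L) \<omega>) L = ?R L \<omega>" by (auto simp: restrict_def fun_eq_iff)
    then show "?f1 (?R K1 \<omega>, ?R (K2 \<union> L) \<omega>) = h1 \<omega>" "?g1 (?R (K2 \<union> L) \<omega>) = (h2 \<omega>, (a * x b1 \<omega>, a * x b2 \<omega>))"
      using b by (auto simp: h1_def h2_def intro!: sum.cong)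
  qed
  ultimately have e1: "distr M (borel \<Otimes>\<^sub>M ?B) (\<lambda>\<omega>. (h1 \<omega>, (h2 \<omega>, (a * x b1 \<omega>, a * x b2 \<omega>))))
      = Nm \<Otimes>\<^sub>M distr M ?B (\<lambda>\<omega>. (h2 \<omega>, (a * x b1 \<omega>, a * x b2 \<omega>)))" by (simp only:)

  let ?f2 = "\<lambda>z. \<Sum>s\<in>K2. c2 (snd z) s * fst z s"
  let ?g2 = "\<lambda>y. (a * y b1, a * y b2)"
  have i2: "indep_var (?P K2) (?R K2) (?P L) (?R L)"
    using sub disj by (intro indep_var_restrict[OF ind]) auto
  have mf2: "?f2 \<in> borel_measurable (?P K2 \<Otimes>\<^sub>M ?P L)"
    by (intro borel_measurable_sum borel_measurable_times measurable_compose[OF measurable_snd c2(1)]) measurable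
  have mg2: "?g2 \<in> measurable (?P L) (borel \<Otimes>\<^sub>M borel)" by measurable
  have l2: "distr M borel (\<lambda>\<omega>. ?f2 (?R K2 \<omega>, y)) = Nm" if "y \<in> space (?P L)" for y
    using normal[of K2 "c2 y"] c2(2) that by auto
  have "distr M (borel \<Otimes>\<^sub>M (borel \<Otimes>\<^sub>M borel)) (\<lambda>\<omega>. (?f2 (?R K2 \<omega>, ?R L \<omega>), ?g2 (?R L \<omega>)))
      = Nm \<Otimes>\<^sub>M distr M (borel \<Otimes>\<^sub>M borel) (\<lambda>\<omega>. ?g2 (?R L \<omega>))"
    by (rule distr_of_constant_law[OF i2 mf2 l2 mg2])
  moreover have "?f2 (?R K2 \<omega>, ?R L \<omega>) = h2 \<omega>" "?g2 (?R L \<omega>) = (a * x b1 \<omega>, a * x b2 \<omega>)" for \<omega>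
    using b by (auto simp: h2_def intro!: sum.cong)
  ultimately have e2: "distr M ?B (\<lambda>\<omega>. (h2 \<omega>, (a * x b1 \<omega>, a * x b2 \<omega>)))
      = Nm \<Otimes>\<^sub>M distr M (borel \<Otimes>\<^sub>M borel) (\<lambda>\<omega>. (a * x b1 \<omega>, a * x b2 \<omega>))" by (simp only:)

  have "indep_var borel (x b1) borel (x b2)"
    using b sub by (intro indep_vars_pair[OF ind]) auto
  then have "indep_var borel ((\<lambda>y. a * y) \<circ> x b1) borel ((\<lambda>y. a * y) \<circ> x b2)"
    by (rule indep_var_compose) auto
  then have e3: "distr M (borel \<Otimes>\<^sub>M borel) (\<lambda>\<omega>. (a * x b1 \<omega>, a * x b2 \<omega>)) = D \<Otimes>\<^sub>M D"
    using law by (simp add: indep_var_distribution_eq comp_def)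

  have "distr M ((borel \<Otimes>\<^sub>M borel) \<Otimes>\<^sub>M (borel \<Otimes>\<^sub>M borel)) (\<lambda>\<omega>. ((a * x b1 \<omega>, h1 \<omega>), (a * x b2 \<omega>, h2 \<omega>)))
    = distr (distr M (borel \<Otimes>\<^sub>M ?B) (\<lambda>\<omega>. (h1 \<omega>, (h2 \<omega>, (a * x b1 \<omega>, a * x b2 \<omega>)))))
        ((borel \<Otimes>\<^sub>M borel) \<Otimes>\<^sub>M (borel \<Otimes>\<^sub>M borel))
        (\<lambda>z. ((fst (snd (snd z)), fst z), (snd (snd (snd z)), fst (snd z))))"
    by (subst distr_distr) (auto simp: comp_def)
  also have "\<dots> = (D \<Otimes>\<^sub>M Nm) \<Otimes>\<^sub>M (D \<Otimes>\<^sub>M Nm)"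
    unfolding e1 e2 e3 by (rule distr_shuffle[OF pD sD prob_space_Nm sets_Nm])
  finally show ?thesis unfolding h1_def h2_def .
qed

section \<open>The standardized data of the linear model\<close>

text \<open>The entry \<open>col p i k\<close> is the \<open>i\<close>-th entry of column \<open>k\<close>: columns below \<open>p\<close> belong to the
  design, columns from \<open>p\<close> to \<open>2 * p - 1\<close> to its knockoff copy, and column \<open>2 * p\<close> is the noise.\<close>

type_synonym index = "(nat \<times> nat) + (nat \<times> nat) + nat + nat"

definition col :: "nat \<Rightarrow> nat \<Rightarrow> nat \<Rightarrow> index" where
  "col p i k = (if k < p then Inl (i, k) else if k < 2 * p then Inr (Inl (i, k - p)) else Inr (Inr (Inl i)))"

abbreviation coef :: "nat \<Rightarrow> index" where "coef l \<equiv> Inr (Inr (Inr l))"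

fun row_of :: "index \<Rightarrow> nat" where
  "row_of (Inl (i, j)) = i" | "row_of (Inr (Inl (i, j))) = i" | "row_of (Inr (Inr (Inl i))) = i" | "row_of (Inr (Inr (Inr l))) = l"

text \<open>The inverse of \<open>col\<close> in the column. The coefficients get
  \<open>Suc (2 * p)\<close>, which is no column.\<close>

fun col_of :: "nat \<Rightarrow> index \<Rightarrow> nat" where
  "col_of p (Inl (i, j)) = j" | "col_of p (Inr (Inl (i, j))) = p + j" | "col_of p (Inr (Inr (Inl i))) = 2 * p" | "col_of p (Inr (Inr (Inr l))) = Suc (2 * p)"

lemma row_of_col[simp]: "row_of (col p i k) = i"
  by (simp add: col_def)

lemma col_of_col: "k \<le> 2 * p \<Longrightarrow> col_of p (col p i k) = k"
  by (simp add: col_def)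

lemma col_neq_coef[simp]: "col p i k \<noteq> coef l" "coef l \<noteq> col p i k"
  by (simp_all add: col_def)

definition block :: "nat \<Rightarrow> nat \<Rightarrow> nat set \<Rightarrow> index set" where
  "block n p F = (\<lambda>(i, k). col p i k) ` ({..<n} \<times> F)"

lemma col_in_block: "F \<subseteq> {..2 * p} \<Longrightarrow> k \<le> 2 * p \<Longrightarrow> col p i k \<in> block n p F \<longleftrightarrow> i < n \<and> k \<in> F"
proof
  assume F: "F \<subseteq> {..2 * p}" "k \<le> 2 * p" and "col p i k \<in> block n p F"
  then obtain i' k' where "i' < n" "k' \<in> F" and e: "col p i k = col p i' k'" by (auto simp: block_def)
  moreover have "i = i'" using arg_cong[OF e, of row_of] by simp
  moreover have "k = k'" using arg_cong[OF e, of "col_of p"] F \<open>k' \<in> F\<close> by (auto simp: col_of_col)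
  ultimately show "i < n \<and> k \<in> F" by simp
qed (auto simp: block_def)

lemma finite_block: "finite F \<Longrightarrow> finite (block n p F)"
  by (simp add: block_def)

lemma block_Int: "F \<subseteq> {..2 * p} \<Longrightarrow> G \<subseteq> {..2 * p} \<Longrightarrow> F \<inter> G = {} \<Longrightarrow> block n p F \<inter> block n p G = {}"
proof (rule ccontr)
  assume a: "F \<subseteq> {..2 * p}" "G \<subseteq> {..2 * p}" "F \<inter> G = {}" "block n p F \<inter> block n p G \<noteq> {}"
  then obtain s where s: "s \<in> block n p F" "s \<in> block n p G" by auto
  from s(1) obtain i k where ik: "s = col p i k" "k \<in> F" by (auto simp: block_def)
  then have "k \<in> G" using a(1) s(2) col_in_block[OF a(2), of k i n] by auto
  then show False using ik a(3) by auto
qed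

lemma sum_block:
  assumes "F \<subseteq> {..2 * p}"
  shows "(\<Sum>s\<in>block n p F. f s) = (\<Sum>k\<in>F. \<Sum>i<n. f (col p i k) :: real)"
proof -
  have "inj_on (\<lambda>(i, k). col p i k) ({..<n} \<times> F)"
  proof (rule inj_onI, clarsimp)
    fix i k i' k' assume k: "k \<in> F" "k' \<in> F" and e: "col p i k = col p i' k'"
    have "i = i'" using arg_cong[OF e, of row_of] by simp
    moreover have "k \<le> 2 * p" "k' \<le> 2 * p" using k assms by auto
    then have "k = k'" using arg_cong[OF e, of "col_of p"] by (simp add: col_of_col)
    ultimately show "i = i' \<and> k = k'" by simp
  qed
  then have "(\<Sum>s\<in>block n p F. f s) = (\<Sum>(i, k)\<in>{..<n} \<times> F. f (col p i k))"
    unfolding block_def by (subst sum.reindex) (auto intro!: sum.cong)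
  also have "\<dots> = (\<Sum>i<n. \<Sum>k\<in>F. f (col p i k))" by (simp add: sum.cartesian_product)
  also have "\<dots> = (\<Sum>k\<in>F. \<Sum>i<n. f (col p i k))" by (rule sum.swap)
  finally show ?thesis .
qed

text \<open>The zero vector is sent to the first basis vector, so that the norm is 1 for every
  argument when \<open>n \<ge> 1\<close>, as \<open>pair_law\<close> demands of the
  coefficients.\<close>

definition unit_vec :: "nat \<Rightarrow> (nat \<Rightarrow> real) \<Rightarrow> nat \<Rightarrow> real" where
  "unit_vec n w i = (if (\<Sum>i<n. (w i)\<^sup>2) = 0 then (if i = 0 then 1 else 0) else w i / sqrt (\<Sum>i<n. (w i)\<^sup>2))"

lemma unit_vec_norm:
  assumes "n \<ge> 1" shows "(\<Sum>i<n. (unit_vec n w i)\<^sup>2) = 1"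
proof (cases "(\<Sum>i<n. (w i)\<^sup>2) = 0")
  case True
  then have "(\<Sum>i<n. (unit_vec n w i)\<^sup>2) = (\<Sum>i<n. if i = 0 then 1 else 0)"
    by (intro sum.cong) (auto simp: unit_vec_def)
  also have "\<dots> = 1" using assms by simp
  finally show ?thesis .
next
  case False
  have "(\<Sum>i<n. (unit_vec n w i)\<^sup>2) = (\<Sum>i<n. (w i)\<^sup>2) / (sqrt (\<Sum>i<n. (w i)\<^sup>2))\<^sup>2"
    using False by (simp add: unit_vec_def power_divide sum_divide_distrib)
  also have "(sqrt (\<Sum>i<n. (w i)\<^sup>2))\<^sup>2 = (\<Sum>i<n. (w i)\<^sup>2)" by (intro real_sqrt_pow2 sum_nonneg) simp
  finally show ?thesis using False by simp
qed

lemma unit_vec_scale: "i < n \<Longrightarrow> w i = sqrt (\<Sum>i<n. (w i)\<^sup>2) * unit_vec n w i"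
proof (cases "(\<Sum>i<n. (w i)\<^sup>2) = 0")
  case True
  assume "i < n"
  with True have "w i = 0" by (simp add: sum_nonneg_eq_0_iff)
  then show ?thesis using True by simp
qed (simp add: unit_vec_def)

lemma unit_vec_cong: "(\<And>i. i < n \<Longrightarrow> w i = w' i) \<Longrightarrow> i < n \<Longrightarrow> unit_vec n w i = unit_vec n w' i"
  by (simp add: unit_vec_def)

lemma measurable_unit_vec:
  assumes [measurable]: "\<And>i. (\<lambda>y. w y i) \<in> borel_measurable N"
  shows "(\<lambda>y. unit_vec n (w y) i) \<in> borel_measurable N"
  unfolding unit_vec_def by measurable

locale std_model = knockoff_linear_model M n p X Xt eps beta sigma nu
  for M :: "'a measure" and n p X Xt eps beta sigma nu +
  assumes sigma_pos: "sigma > 0" and n_pos: "n \<ge> 1"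
begin

text \<open>After division by \<open>sigma\<close> the noise is one more standard normal column, and
  the scaled coefficients have the law \<open>nu\<close> for every \<open>n\<close>.\<close>

definition dat :: "index \<Rightarrow> 'a \<Rightarrow> real" where
  "dat s \<omega> = (case s of Inl (i, j) \<Rightarrow> X \<omega> i j | Inr (Inl (i, j)) \<Rightarrow> Xt \<omega> i j
    | Inr (Inr (Inl i)) \<Rightarrow> eps \<omega> i / sigma | Inr (Inr (Inr l)) \<Rightarrow> sqrt (real n) * beta \<omega> l)"

definition C :: "'a \<Rightarrow> nat \<Rightarrow> nat \<Rightarrow> real" where
  "C \<omega> i k = dat (col p i k) \<omega>"

definition idx :: "index set" where
  "idx = block n p {..2 * p} \<union> coef ` {..<p}"

lemma C_simps: "k < p \<Longrightarrow> C \<omega> i k = X \<omega> i k" "k < p \<Longrightarrow> C \<omega> i (k + p) = Xt \<omega> i k" "C \<omega> i (2 * p) = eps \<omega> i / sigma"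
  "p \<le> k \<Longrightarrow> k < 2 * p \<Longrightarrow> C \<omega> i k = Xt \<omega> i (k - p)"
  by (auto simp: C_def dat_def col_def)

lemma idx_eq: "idx = ({..<n} \<times> {..<p}) <+> (({..<n} \<times> {..<p}) <+> ({..<n} <+> {..<p}))"
proof (intro equalityI subsetI)
  fix s assume "s \<in> idx"
  then show "s \<in> ({..<n} \<times> {..<p}) <+> (({..<n} \<times> {..<p}) <+> ({..<n} <+> {..<p}))"
    by (auto simp: idx_def block_def col_def split: if_splits)
next
  fix s :: index
  assume "s \<in> ({..<n} \<times> {..<p}) <+> (({..<n} \<times> {..<p}) <+> ({..<n} <+> {..<p}))"
  then consider (a) i j where "s = Inl (i, j)" "i < n" "j < p" | (b) i j where "s = Inr (Inl (i, j))" "i < n" "j < p"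
    | (c) i where "s = Inr (Inr (Inl i))" "i < n" | (d) l where "s = coef l" "l < p" by auto
  then show "s \<in> idx"
  proof cases
    case a
    then have "s = (\<lambda>(i, k). col p i k) (i, j)" by (simp add: col_def)
    with a show ?thesis unfolding idx_def block_def by (intro UnI1) (rule image_eqI[where x="(i, j)"], auto)
  next
    case b
    then have "s = (\<lambda>(i, k). col p i k) (i, j + p)" by (simp add: col_def)
    with b show ?thesis unfolding idx_def block_def by (intro UnI1) (rule image_eqI[where x="(i, j + p)"], auto)
  next
    case c
    then have "s = (\<lambda>(i, k). col p i k) (i, 2 * p)" by (simp add: col_def)
    with c show ?thesis unfolding idx_def block_def by (intro UnI1) (rule image_eqI[where x="(i, 2 * p)"], auto)
  next
    case d
    then show ?thesis by (simp add: idx_def)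
  qed
qed

lemma finite_idx: "finite idx" by (simp add: idx_eq)

lemma block_idx: "F \<subseteq> {..2 * p} \<Longrightarrow> block n p F \<subseteq> idx"
  by (auto simp: idx_def block_def)

lemma coef_idx: "l < p \<Longrightarrow> coef l \<in> idx" by (simp add: idx_def)

lemma dat_indep: "indep_vars (\<lambda>_. borel) dat idx"
proof -
  define g :: "index \<Rightarrow> real \<Rightarrow> real" where "g s y = (case s of Inl _ \<Rightarrow> y | Inr (Inl _) \<Rightarrow> y
    | Inr (Inr (Inl i)) \<Rightarrow> y / sigma | Inr (Inr (Inr l)) \<Rightarrow> sqrt (real n) * y)" for s y
  have g: "g s \<in> borel_measurable borel" for s
  proof -
    consider a where "s = Inl a" | a where "s = Inr (Inl a)" | a where "s = Inr (Inr (Inl a))" | a where "s = coef a"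
      by (metis sum.exhaust)
    then have "(\<lambda>y. g s y) \<in> borel_measurable borel" by cases (simp_all add: g_def)
    then show ?thesis by simp
  qed
  have "indep_vars (\<lambda>_. borel) (\<lambda>s \<omega>. g s ((case_sum (\<lambda>(i, j) \<omega>. X \<omega> i j)
           (case_sum (\<lambda>(i, j) \<omega>. Xt \<omega> i j) (case_sum (\<lambda>i \<omega>. eps \<omega> i) (\<lambda>j \<omega>. beta \<omega> j)))) s \<omega>)) idx"
    unfolding idx_eq by (rule indep_vars_compose2[OF independent]) (rule g)
  moreover have "(\<lambda>s \<omega>. g s ((case_sum (\<lambda>(i, j) \<omega>. X \<omega> i j)
           (case_sum (\<lambda>(i, j) \<omega>. Xt \<omega> i j) (case_sum (\<lambda>i \<omega>. eps \<omega> i) (\<lambda>j \<omega>. beta \<omega> j)))) s \<omega>)) = dat"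
    by (auto simp: fun_eq_iff g_def dat_def split: sum.split)
  ultimately show ?thesis by simp
qed

lemma dat_meas: "s \<in> idx \<Longrightarrow> dat s \<in> borel_measurable M"
  using dat_indep by (auto simp: indep_vars_def)

lemma C_meas: "i < n \<Longrightarrow> k \<le> 2 * p \<Longrightarrow> (\<lambda>\<omega>. C \<omega> i k) \<in> borel_measurable M"
  unfolding C_def by (rule dat_meas) (auto simp: idx_def block_def)

lemma beta_meas: "l < p \<Longrightarrow> (\<lambda>\<omega>. beta \<omega> l) \<in> borel_measurable M"
proof -
  assume "l < p"
  then have "(\<lambda>\<omega>. dat (coef l) \<omega> / sqrt (real n)) \<in> borel_measurable M"
    using dat_meas[OF coef_idx] by simp
  then show ?thesis using n_pos by (simp add: dat_def)
qed

lemma dat_normal: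
  assumes "s \<in> block n p {..2 * p}"
  shows "distributed M lborel (dat s) std_normal_density"
proof -
  from assms obtain i k where s: "s = col p i k" "i < n" "k \<le> 2 * p" by (auto simp: block_def)
  consider "k < p" | "p \<le> k" "k < 2 * p" | "k = 2 * p" using s(3) by linarith
  then show ?thesis
  proof cases
    case 1
    then show ?thesis using design[OF s(2) 1] by (simp add: s(1) col_def dat_def[abs_def])
  next
    case 2
    then show ?thesis using knockoff[of i "k - p"] s(2) by (simp add: s(1) col_def dat_def[abs_def])
  next
    case 3
    have "distributed M lborel (\<lambda>\<omega>. 0 + (1 / sigma) * eps \<omega> i) (normal_density (0 + (1 / sigma) * 0) (\<bar>1 / sigma\<bar> * sigma))"
      using sigma_pos by (intro normal_density_affine noise s(2)) auto
    then show ?thesis using sigma_pos 3 by (simp add: s(1) col_def dat_def[abs_def])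
  qed
qed

lemma dat_coef_law: "l < p \<Longrightarrow> distr M borel (dat (coef l)) = nu"
  using coefficients[of l] by (simp add: dat_def[abs_def])

lemma restrict_dat_col:
  assumes "F \<subseteq> {..2 * p}" "block n p F \<subseteq> L" "i < n" "k \<in> F"
  shows "restrict (\<lambda>s. dat s \<omega>) L (col p i k) = C \<omega> i k"
  using assms by (auto simp: C_def block_def)

text \<open>The form becomes a quadratic form on the joint block of the columns \<open>k\<close> and
  \<open>l\<close> whose matrix couples only entries of column \<open>k\<close> with entries of
  column \<open>l\<close>. Its diagonal meets these positions only if \<open>k = l\<close>, hence
  the trace term.\<close>

lemma bilinear_form_bound:
  assumes kl: "k \<le> 2 * p" "l \<le> 2 * p" and L: "L \<subseteq> idx" "block n p {k, l} \<inter> L = {}"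
    and Pf: "\<And>i i'. (\<lambda>y. Pf y i i') \<in> borel_measurable (PiM L (\<lambda>_. borel))"
    and P: "\<And>\<omega> i i'. \<omega> \<in> space M \<Longrightarrow> i < n \<Longrightarrow> i' < n \<Longrightarrow> P \<omega> i i' = Pf (restrict (\<lambda>s. dat s \<omega>) L) i i'"
    and t: "t > 0" and V: "V \<ge> 0"
  shows "prob {\<omega>\<in>space M. 2 * (\<Sum>i<n. \<Sum>i'<n. (P \<omega> i i')\<^sup>2) \<le> V \<and>
      t \<le> \<bar>(\<Sum>i<n. \<Sum>i'<n. P \<omega> i i' * C \<omega> i k * C \<omega> i' l) - (if k = l then \<Sum>i<n. P \<omega> i i else 0)\<bar>} \<le> V / t\<^sup>2"
proof -
  let ?K = "block n p {k, l}"
  have F: "{k, l} \<subseteq> {..2 * p}" using kl by auto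
  define Q where "Q y s u = (if col_of p s = k \<and> col_of p u = l then Pf y (row_of s) (row_of u) else 0)" for y s u
  let ?R = "\<lambda>\<omega>. restrict (\<lambda>s. dat s \<omega>) L"
  have b: "prob {\<omega>\<in>space M. 2 * (\<Sum>s\<in>?K. \<Sum>u\<in>?K. (Q (?R \<omega>) s u)\<^sup>2) \<le> V \<and>
      t \<le> \<bar>(\<Sum>s\<in>?K. \<Sum>u\<in>?K. Q (?R \<omega>) s u * dat s \<omega> * dat u \<omega>) - (\<Sum>s\<in>?K. Q (?R \<omega>) s s)\<bar>} \<le> V / t\<^sup>2"
  proof (rule conditional_quadratic_form[where Q=Q and R="?R" and K="?K" and L=L, OF finite_idx dat_indep _ L _ _ _ t V])
    show "?K \<subseteq> idx" by (rule block_idx[OF F])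
    show "distributed M lborel (dat s) std_normal_density" if "s \<in> ?K" for s
      using that F by (intro dat_normal) (auto simp: block_def)
    show "(\<lambda>y. Q y s u) \<in> borel_measurable (PiM L (\<lambda>_. borel))" for s u
      unfolding Q_def using Pf by simp
  qed simp
  have red: "(\<Sum>s\<in>?K. \<Sum>u\<in>?K. (if col_of p s = k \<and> col_of p u = l then f s u else 0)) = (\<Sum>i<n. \<Sum>i'<n. f (col p i k) (col p i' l))"
    for f :: "index \<Rightarrow> index \<Rightarrow> real"
  proof -
    have "(\<Sum>s\<in>?K. \<Sum>u\<in>?K. (if col_of p s = k \<and> col_of p u = l then f s u else 0))
        = (\<Sum>k'\<in>{k, l}. \<Sum>i<n. \<Sum>l'\<in>{k, l}. \<Sum>i'<n. (if k' = k \<and> l' = l then f (col p i k') (col p i' l') else 0))"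
      unfolding sum_block[OF F] using kl by (intro sum.cong refl) (auto simp: col_of_col)
    also have "\<dots> = (\<Sum>i<n. \<Sum>i'<n. f (col p i k) (col p i' l))"
      by (cases "k = l") simp_all
    finally show ?thesis .
  qed
  have q1: "(\<Sum>s\<in>?K. \<Sum>u\<in>?K. (Q y s u)\<^sup>2) = (\<Sum>i<n. \<Sum>i'<n. (Pf y i i')\<^sup>2)" for y
  proof -
    have "(Q y s u)\<^sup>2 = (if col_of p s = k \<and> col_of p u = l then (Pf y (row_of s) (row_of u))\<^sup>2 else 0)" for s u
      by (simp add: Q_def)
    then show ?thesis using red[of "\<lambda>s u. (Pf y (row_of s) (row_of u))\<^sup>2"] by simp
  qed
  have q2: "(\<Sum>s\<in>?K. \<Sum>u\<in>?K. Q y s u * dat s \<omega> * dat u \<omega>) = (\<Sum>i<n. \<Sum>i'<n. Pf y i i' * C \<omega> i k * C \<omega> i' l)" for y \<omega>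
    using red[of "\<lambda>s u. Pf y (row_of s) (row_of u) * dat s \<omega> * dat u \<omega>"]
    by (simp add: Q_def C_def if_distrib if_distribR cong: if_cong)
  have q3: "(\<Sum>s\<in>?K. Q y s s) = (if k = l then \<Sum>i<n. Pf y i i else 0)" for y
    using kl by (auto simp: sum_block[OF F] col_of_col Q_def)
  have "(\<Sum>s\<in>?K. \<Sum>u\<in>?K. (Q (?R \<omega>) s u)\<^sup>2) = (\<Sum>i<n. \<Sum>i'<n. (P \<omega> i i')\<^sup>2)"
    "(\<Sum>s\<in>?K. \<Sum>u\<in>?K. Q (?R \<omega>) s u * dat s \<omega> * dat u \<omega>) = (\<Sum>i<n. \<Sum>i'<n. P \<omega> i i' * C \<omega> i k * C \<omega> i' l)"
    "(\<Sum>s\<in>?K. Q (?R \<omega>) s s) = (if k = l then \<Sum>i<n. P \<omega> i i else 0)" if "\<omega> \<in> space M" for \<omega>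
    unfolding q1 q2 q3 using P[OF that] by simp_all
  then have "{\<omega>\<in>space M. 2 * (\<Sum>s\<in>?K. \<Sum>u\<in>?K. (Q (?R \<omega>) s u)\<^sup>2) \<le> V \<and>
      t \<le> \<bar>(\<Sum>s\<in>?K. \<Sum>u\<in>?K. Q (?R \<omega>) s u * dat s \<omega> * dat u \<omega>) - (\<Sum>s\<in>?K. Q (?R \<omega>) s s)\<bar>}
    = {\<omega>\<in>space M. 2 * (\<Sum>i<n. \<Sum>i'<n. (P \<omega> i i')\<^sup>2) \<le> V \<and>
      t \<le> \<bar>(\<Sum>i<n. \<Sum>i'<n. P \<omega> i i' * C \<omega> i k * C \<omega> i' l) - (if k = l then \<Sum>i<n. P \<omega> i i else 0)\<bar>}"
    by (intro Collect_cong conj_cong refl) (simp_all only:)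
  with b show ?thesis by simp
qed

text \<open>This still contains the noise and all coefficients, those of \<open>j\<close> and
  \<open>k\<close> included, so that the means belong to the data on which one conditions.\<close>

definition others :: "nat \<Rightarrow> nat \<Rightarrow> index set" where
  "others j k = idx - block n p {j, k, j + p, k + p}"

definition proj_diff :: "('a \<Rightarrow> nat \<Rightarrow> real) \<Rightarrow> nat \<Rightarrow> 'a \<Rightarrow> real" where
  "proj_diff w j \<omega> = (\<Sum>i<n. unit_vec n (w \<omega>) i * (C \<omega> i j - C \<omega> i (j + p))) / sqrt 2"

lemma proj_diff_law:
  assumes jk: "j < p" "k < p" "j \<noteq> k"
    and wv: "\<And>i. (\<lambda>y. wv y i) \<in> borel_measurable (PiM (others j k) (\<lambda>_. borel))"
    and w: "\<And>\<omega> i. \<omega> \<in> space M \<Longrightarrow> i < n \<Longrightarrow> w \<omega> i = wv (restrict (\<lambda>s. dat s \<omega>) (others j k)) i"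
  shows "proj_diff w j \<in> borel_measurable M \<and> proj_diff w k \<in> borel_measurable M \<and>
    distr M ((borel \<Otimes>\<^sub>M borel) \<Otimes>\<^sub>M (borel \<Otimes>\<^sub>M borel))
      (\<lambda>\<omega>. ((a * (sqrt (real n) * beta \<omega> j), proj_diff w j \<omega>), (a * (sqrt (real n) * beta \<omega> k), proj_diff w k \<omega>)))
    = (distr nu borel (\<lambda>b. a * b) \<Otimes>\<^sub>M Nm) \<Otimes>\<^sub>M (distr nu borel (\<lambda>b. a * b) \<Otimes>\<^sub>M Nm)"
proof -
  let ?L = "others j k" and ?K = "\<lambda>j. block n p {j, j + p}"
  \<comment> \<open>The sign distinguishes the design column from its knockoff copy, and each of the
    two contributes 1/2 to the squared norm.\<close>
  define c where "c j y s = (if col_of p s = j then 1 else -1) * unit_vec n (wv y) (row_of s) / sqrt 2" for j y s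
  let ?R = "\<lambda>\<omega>. restrict (\<lambda>s. dat s \<omega>) ?L"
  have F: "{l, l + p} \<subseteq> {..2 * p}" if "l < p" for l using that by auto
  have p0: "p > 0" using jk by simp
  have cm: "(\<lambda>y. c l y s) \<in> borel_measurable (PiM ?L (\<lambda>_. borel))" for l s
    unfolding c_def by (intro borel_measurable_divide borel_measurable_times borel_measurable_const measurable_unit_vec wv)
  have c1: "(\<Sum>s\<in>?K l. (c l y s)\<^sup>2) = 1" if "l < p" for l y
  proof -
    have "(\<Sum>s\<in>?K l. (c l y s)\<^sup>2) = (\<Sum>i<n. (unit_vec n (wv y) i)\<^sup>2 / 2) + (\<Sum>i<n. (unit_vec n (wv y) i)\<^sup>2 / 2)"
      using that p0 by (simp add: sum_block[OF F[OF that]] c_def col_of_col power_divide power_mult_distrib)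
    also have "\<dots> = 1" using unit_vec_norm[OF n_pos] by (simp flip: sum_divide_distrib)
    finally show ?thesis .
  qed
  have h: "(\<Sum>s\<in>?K l. c l (?R \<omega>) s * dat s \<omega>) = proj_diff w l \<omega>" if "l < p" "\<omega> \<in> space M" for l \<omega>
  proof -
    have u: "unit_vec n (wv (?R \<omega>)) i = unit_vec n (w \<omega>) i" if "i < n" for i
      using that w \<open>\<omega> \<in> space M\<close> by (intro unit_vec_cong) auto
    have "(\<Sum>s\<in>?K l. c l (?R \<omega>) s * dat s \<omega>) =
        (\<Sum>i<n. unit_vec n (w \<omega>) i / sqrt 2 * C \<omega> i l) + (\<Sum>i<n. - (unit_vec n (w \<omega>) i / sqrt 2 * C \<omega> i (l + p)))"
      using that p0 u by (simp add: sum_block[OF F[OF that(1)]] c_def col_of_col C_def)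
    then show ?thesis
      by (simp add: proj_diff_def sum_divide_distrib sum.distrib[symmetric] algebra_simps diff_divide_distrib)
  qed
  have mR: "?R \<in> measurable M (PiM ?L (\<lambda>_. borel))"
    using dat_meas by (intro measurable_restrict) (auto simp: others_def)
  have wm: "(\<lambda>\<omega>. w \<omega> i) \<in> borel_measurable M" if "i < n" for i
  proof -
    have "(\<lambda>\<omega>. wv (?R \<omega>) i) \<in> borel_measurable M" by (rule measurable_compose[OF mR wv])
    then show ?thesis using w[OF _ that] by (simp cong: measurable_cong)
  qed
  have mp: "proj_diff w l \<in> borel_measurable M" if "l < p" for l
  proof -
    have "(\<lambda>\<omega>. \<Sum>s\<in>?K l. c l (?R \<omega>) s * dat s \<omega>) \<in> borel_measurable M"
      using block_idx[OF F[OF that]]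
      by (intro borel_measurable_sum borel_measurable_times measurable_compose[OF mR cm] dat_meas) auto
    then show ?thesis using h[OF that] by (simp cong: measurable_cong)
  qed
  have nu_law: "distr M borel (\<lambda>\<omega>. a * dat (coef l) \<omega>) = distr nu borel (\<lambda>b. a * b)" if "l < p" for l
    unfolding dat_coef_law[OF that, symmetric] using dat_meas[OF coef_idx[OF that]]
    by (subst distr_distr) (auto simp: comp_def)
  have coefL: "coef l \<in> ?L" if "l < p" for l
    using that by (auto simp: others_def coef_idx block_def)
  have "distr M ((borel \<Otimes>\<^sub>M borel) \<Otimes>\<^sub>M (borel \<Otimes>\<^sub>M borel))
      (\<lambda>\<omega>. ((a * dat (coef j) \<omega>, \<Sum>s\<in>?K j. c j (?R \<omega>) s * dat s \<omega>), (a * dat (coef k) \<omega>, \<Sum>s\<in>?K k. c k (?R \<omega>) s * dat s \<omega>)))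
    = (distr nu borel (\<lambda>b. a * b) \<Otimes>\<^sub>M Nm) \<Otimes>\<^sub>M (distr nu borel (\<lambda>b. a * b) \<Otimes>\<^sub>M Nm)"
  proof (rule pair_law[OF dat_indep finite_idx])
    show "?K j \<subseteq> idx" "?K k \<subseteq> idx" by (intro block_idx F jk)+
    show "?K j \<inter> ?K k = {}" using jk by (intro block_Int F) auto
    show "?K j \<inter> ?L = {}" "?K k \<inter> ?L = {}" by (auto simp: others_def block_def)
    show "distributed M lborel (dat s) std_normal_density" if "s \<in> ?K j \<union> ?K k" for s
      using that F[OF jk(1)] F[OF jk(2)] by (intro dat_normal) (auto simp: block_def)
  qed (use jk cm c1 coefL nu_law in \<open>auto simp: others_def\<close>)
  also have "distr M ((borel \<Otimes>\<^sub>M borel) \<Otimes>\<^sub>M (borel \<Otimes>\<^sub>M borel))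
      (\<lambda>\<omega>. ((a * dat (coef j) \<omega>, \<Sum>s\<in>?K j. c j (?R \<omega>) s * dat s \<omega>), (a * dat (coef k) \<omega>, \<Sum>s\<in>?K k. c k (?R \<omega>) s * dat s \<omega>)))
    = distr M ((borel \<Otimes>\<^sub>M borel) \<Otimes>\<^sub>M (borel \<Otimes>\<^sub>M borel))
      (\<lambda>\<omega>. ((a * (sqrt (real n) * beta \<omega> j), proj_diff w j \<omega>), (a * (sqrt (real n) * beta \<omega> k), proj_diff w k \<omega>)))"
    by (intro distr_cong refl) (simp add: h jk, simp add: dat_def)
  finally show ?thesis using mp jk by blast
qed

end

section \<open>The response without two variables, and empirical covariances of columns\<close>

context std_model
begin

definition remainder :: "nat \<Rightarrow> nat \<Rightarrow> 'a \<Rightarrow> nat \<Rightarrow> real" where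
  "remainder j k \<omega> i = (\<Sum>l\<in>{..<p} - {j, k}. X \<omega> i l * beta \<omega> l) + eps \<omega> i"

text \<open>The variance of each entry of \<open>remainder\<close> given the coefficients.\<close>

definition remainder_var :: "nat \<Rightarrow> nat \<Rightarrow> 'a \<Rightarrow> real" where
  "remainder_var j k \<omega> = sigma\<^sup>2 + (\<Sum>l\<in>{..<p} - {j, k}. (beta \<omega> l)\<^sup>2)"

definition gram :: "nat \<Rightarrow> nat \<Rightarrow> 'a \<Rightarrow> real" where
  "gram a b \<omega> = (\<Sum>i<n. C \<omega> i a * C \<omega> i b) / real n"

lemma response_eq:
  assumes "j < p" "k < p" "j \<noteq> k"
  shows "response p (X \<omega>) (beta \<omega>) (eps \<omega>) i = remainder j k \<omega> i + X \<omega> i j * beta \<omega> j + X \<omega> i k * beta \<omega> k"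
proof -
  have "{..<p} = insert j (insert k ({..<p} - {j, k}))" using assms by auto
  then have "(\<Sum>l<p. X \<omega> i l * beta \<omega> l) = (\<Sum>l\<in>insert j (insert k ({..<p} - {j, k})). X \<omega> i l * beta \<omega> l)" by simp
  then show ?thesis using assms by (simp add: response_def remainder_def)
qed

text \<open>The three terms are the normal part, the mean, and the disturbance by the other removed
  variable. In the limit the first difference of \<open>gram\<close> is 1 and the second is
  0.\<close>

lemma marginal_cov_diff:
  assumes "j < p" "k < p" "j \<noteq> k"
  shows "(\<Sum>i<n. X \<omega> i j * response p (X \<omega>) (beta \<omega>) (eps \<omega>) i) / real n
      - (\<Sum>i<n. Xt \<omega> i j * response p (X \<omega>) (beta \<omega>) (eps \<omega>) i) / real n
    = sqrt (\<Sum>i<n. (remainder j k \<omega> i)\<^sup>2) * sqrt 2 * proj_diff (remainder j k) j \<omega> / real n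
      + beta \<omega> j * (gram j j \<omega> - gram (j + p) j \<omega>) + beta \<omega> k * (gram j k \<omega> - gram (j + p) k \<omega>)"
proof -
  let ?D = "\<lambda>i. C \<omega> i j - C \<omega> i (j + p)"
  have "(\<Sum>i<n. X \<omega> i j * response p (X \<omega>) (beta \<omega>) (eps \<omega>) i) - (\<Sum>i<n. Xt \<omega> i j * response p (X \<omega>) (beta \<omega>) (eps \<omega>) i)
     = (\<Sum>i<n. ?D i * (remainder j k \<omega> i + C \<omega> i j * beta \<omega> j + C \<omega> i k * beta \<omega> k))"
    using assms by (simp add: C_simps response_eq[OF assms] sum_subtractf[symmetric] algebra_simps)
  also have "\<dots> = (\<Sum>i<n. ?D i * remainder j k \<omega> i) + (\<Sum>i<n. ?D i * C \<omega> i j) * beta \<omega> j + (\<Sum>i<n. ?D i * C \<omega> i k) * beta \<omega> k"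
    unfolding sum_distrib_right sum.distrib[symmetric] by (intro sum.cong refl) (simp add: algebra_simps)
  also have "(\<Sum>i<n. ?D i * remainder j k \<omega> i) = sqrt (\<Sum>i<n. (remainder j k \<omega> i)\<^sup>2) * (\<Sum>i<n. unit_vec n (remainder j k \<omega>) i * ?D i)"
    unfolding sum_distrib_left by (intro sum.cong refl) (subst unit_vec_scale[of _ n "remainder j k \<omega>"], auto)
  also have "(\<Sum>i<n. unit_vec n (remainder j k \<omega>) i * ?D i) = sqrt 2 * proj_diff (remainder j k) j \<omega>"
    by (simp add: proj_diff_def)
  finally have "(\<Sum>i<n. X \<omega> i j * response p (X \<omega>) (beta \<omega>) (eps \<omega>) i) / real n - (\<Sum>i<n. Xt \<omega> i j * response p (X \<omega>) (beta \<omega>) (eps \<omega>) i) / real n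
    = (sqrt (\<Sum>i<n. (remainder j k \<omega> i)\<^sup>2) * (sqrt 2 * proj_diff (remainder j k) j \<omega>)
      + (\<Sum>i<n. ?D i * C \<omega> i j) * beta \<omega> j + (\<Sum>i<n. ?D i * C \<omega> i k) * beta \<omega> k) / real n"
    by (simp add: diff_divide_distrib[symmetric])
  then show ?thesis
    by (simp add: gram_def add_divide_distrib diff_divide_distrib[symmetric] sum_subtractf[symmetric] algebra_simps)
qed

text \<open>The identity matrix in \<open>bilinear_form_bound\<close>; it depends on no data, so
  \<open>L = {}\<close>.\<close>

lemma gram_bound:
  assumes ab: "a \<le> 2 * p" "b \<le> 2 * p" and d: "d > 0"
  shows "{\<omega>\<in>space M. \<not> \<bar>gram a b \<omega> - (if a = b then 1 else 0)\<bar> < d} \<in> events"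
    and "prob {\<omega>\<in>space M. \<not> \<bar>gram a b \<omega> - (if a = b then 1 else 0)\<bar> < d} \<le> 2 / d\<^sup>2 / real n"
proof -
  have [measurable]: "(\<lambda>\<omega>. C \<omega> i a) \<in> borel_measurable M" "(\<lambda>\<omega>. C \<omega> i b) \<in> borel_measurable M" if "i < n" for i
    using that ab C_meas by auto
  have [measurable]: "gram a b \<in> borel_measurable M" unfolding gram_def by measurable
  show "{\<omega>\<in>space M. \<not> \<bar>gram a b \<omega> - (if a = b then 1 else 0)\<bar> < d} \<in> events" by measurable
  let ?P = "\<lambda>(\<omega>::'a) i i'. if i = i' then 1 else (0::real)"
  let ?Pf = "\<lambda>(y::index \<Rightarrow> real) i i'. if i = i' then 1 else (0::real)"
  have n: "real n > 0" using n_pos by simp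
  have "prob {\<omega>\<in>space M. 2 * (\<Sum>i<n. \<Sum>i'<n. (?P \<omega> i i')\<^sup>2) \<le> 2 * real n \<and>
      d * real n \<le> \<bar>(\<Sum>i<n. \<Sum>i'<n. ?P \<omega> i i' * C \<omega> i a * C \<omega> i' b) - (if a = b then \<Sum>i<n. ?P \<omega> i i else 0)\<bar>}
      \<le> 2 * real n / (d * real n)\<^sup>2"
    by (rule bilinear_form_bound[where Pf="?Pf" and L="{}", OF ab]) (use d n in auto)
  moreover have "d * real n \<le> \<bar>(\<Sum>i<n. \<Sum>i'<n. ?P \<omega> i i' * C \<omega> i a * C \<omega> i' b) - (if a = b then \<Sum>i<n. ?P \<omega> i i else 0)\<bar>
      \<longleftrightarrow> \<not> \<bar>gram a b \<omega> - (if a = b then 1 else 0)\<bar> < d" for \<omega>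
  proof -
    have "(\<Sum>i<n. \<Sum>i'<n. ?P \<omega> i i' * C \<omega> i a * C \<omega> i' b) = (\<Sum>i<n. \<Sum>i'<n. if i' = i then C \<omega> i a * C \<omega> i' b else 0)"
      by (intro sum.cong refl) auto
    also have "\<dots> = gram a b \<omega> * real n" using n by (simp add: gram_def)
    finally have "(\<Sum>i<n. \<Sum>i'<n. ?P \<omega> i i' * C \<omega> i a * C \<omega> i' b) - (if a = b then \<Sum>i<n. ?P \<omega> i i else 0)
        = (gram a b \<omega> - (if a = b then 1 else 0)) * real n" by (simp add: algebra_simps)
    then have "\<bar>(\<Sum>i<n. \<Sum>i'<n. ?P \<omega> i i' * C \<omega> i a * C \<omega> i' b) - (if a = b then \<Sum>i<n. ?P \<omega> i i else 0)\<bar>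
        = \<bar>gram a b \<omega> - (if a = b then 1 else 0)\<bar> * real n" by (simp only: abs_mult abs_of_nat)
    then show ?thesis using n mult_le_cancel_right_pos[OF n] by (simp only: not_less)
  qed
  moreover have "2 * (\<Sum>i<n. \<Sum>i'<n. (?P \<omega> i i')\<^sup>2) \<le> 2 * real n" for \<omega>
    by (simp add: if_distrib[of "\<lambda>x. x\<^sup>2"] cong: if_cong)
  ultimately have "prob {\<omega>\<in>space M. \<not> \<bar>gram a b \<omega> - (if a = b then 1 else 0)\<bar> < d} \<le> 2 * real n / (d * real n)\<^sup>2"
    by (simp only: simp_thms)
  also have "\<dots> = 2 / d\<^sup>2 / real n" using n d by (simp add: power2_eq_square field_simps)
  finally show "prob {\<omega>\<in>space M. \<not> \<bar>gram a b \<omega> - (if a = b then 1 else 0)\<bar> < d} \<le> 2 / d\<^sup>2 / real n" .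
qed

lemma row_quadratic:
  "(\<Sum>a\<in>block n p {..2 * p}. \<Sum>b\<in>block n p {..2 * p}. if row_of a = row_of b then F a * F b else 0)
    = (\<Sum>i<n. (\<Sum>c\<le>2 * p. F (col p i c) :: real)\<^sup>2)"
proof -
  have "(\<Sum>a\<in>block n p {..2 * p}. \<Sum>b\<in>block n p {..2 * p}. if row_of a = row_of b then F a * F b else 0)
    = (\<Sum>c\<le>2 * p. \<Sum>i<n. \<Sum>c'\<le>2 * p. \<Sum>i'<n. if i = i' then F (col p i c) * F (col p i' c') else 0)"
    by (simp add: sum_block cong: if_cong)
  also have "\<dots> = (\<Sum>c\<le>2 * p. \<Sum>i<n. \<Sum>c'\<le>2 * p. F (col p i c) * F (col p i c'))"
    by (intro sum.cong refl) simp
  also have "\<dots> = (\<Sum>i<n. \<Sum>c\<le>2 * p. \<Sum>c'\<le>2 * p. F (col p i c) * F (col p i c'))"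
    by (rule sum.swap)
  finally show ?thesis by (simp add: power2_eq_square sum_product)
qed

lemma sum_columns:
  "(\<Sum>c\<le>2 * p. if c = 2 * p then A else if c < p \<and> c \<notin> {j, k} then B c else (0::real)) = A + (\<Sum>l\<in>{..<p} - {j, k}. B l)"
proof -
  have "{..2 * p} = insert (2 * p) {..<2 * p}" by auto
  then have "(\<Sum>c\<le>2 * p. if c = 2 * p then A else if c < p \<and> c \<notin> {j, k} then B c else 0)
    = A + (\<Sum>c<2 * p. if c = 2 * p then A else if c < p \<and> c \<notin> {j, k} then B c else 0)" by simp
  also have "(\<Sum>c<2 * p. if c = 2 * p then A else if c < p \<and> c \<notin> {j, k} then B c else 0)
    = (\<Sum>c<2 * p. if c < p \<and> c \<notin> {j, k} then B c else 0)" by (intro sum.cong) auto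
  also have "\<dots> = (\<Sum>l\<in>{..<2 * p} \<inter> {c. c < p \<and> c \<notin> {j, k}}. B l)" by (simp add: sum.If_cases)
  also have "{..<2 * p} \<inter> {c. c < p \<and> c \<notin> {j, k}} = {..<p} - {j, k}" by auto
  finally show ?thesis .
qed

text \<open>Given the coefficients, each entry of the remainder is a linear form \<open>u\<close> in
  its row of the data. The squared norm is then a quadratic form with one block \<open>u u^T\<close>
  per row, of trace \<open>real n * remainder_var\<close> and squared Frobenius norm
  \<open>real n * remainder_var\<^sup>2\<close>.\<close>

lemma remainder_bound:
  assumes t: "t > 0" and V: "V \<ge> 0"
  shows "prob {\<omega>\<in>space M. 2 * (real n * (remainder_var j k \<omega>)\<^sup>2) \<le> V \<and>
      t \<le> \<bar>(\<Sum>i<n. (remainder j k \<omega> i)\<^sup>2) - real n * remainder_var j k \<omega>\<bar>} \<le> V / t\<^sup>2"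
proof -
  let ?K = "block n p {..2 * p}" and ?L = "coef ` {..<p}"
  let ?R = "\<lambda>\<omega>. restrict (\<lambda>s. dat s \<omega>) ?L"
  define u where "u y c = (if c = 2 * p then sigma else if c < p \<and> c \<notin> {j, k} then y (coef c) / sqrt (real n) else 0)" for y c
  define Q where "Q y s t = (if row_of s = row_of t then u y (col_of p s) * u y (col_of p t) else 0)" for y s t
  have um: "(\<lambda>y. u y c) \<in> borel_measurable (PiM ?L (\<lambda>_. borel))" for c
    unfolding u_def by measurable
  have b: "prob {\<omega>\<in>space M. 2 * (\<Sum>s\<in>?K. \<Sum>t\<in>?K. (Q (?R \<omega>) s t)\<^sup>2) \<le> V \<and>
      t \<le> \<bar>(\<Sum>s\<in>?K. \<Sum>t\<in>?K. Q (?R \<omega>) s t * dat s \<omega> * dat t \<omega>) - (\<Sum>s\<in>?K. Q (?R \<omega>) s s)\<bar>} \<le> V / t\<^sup>2"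
  proof (rule conditional_quadratic_form[where Q=Q and R="?R" and K="?K" and L="?L", OF finite_idx dat_indep _ _ _ _ _ _ t V])
    show "?K \<subseteq> idx" "?L \<subseteq> idx" by (auto simp: idx_def)
    show "?K \<inter> ?L = {}" by (auto simp: block_def)
    show "distributed M lborel (dat s) std_normal_density" if "s \<in> ?K" for s by (rule dat_normal[OF that])
    show "(\<lambda>y. Q y s t) \<in> borel_measurable (PiM ?L (\<lambda>_. borel))" for s t
      unfolding Q_def using um by simp
  qed simp
  have u: "u (?R \<omega>) c = (if c = 2 * p then sigma else if c < p \<and> c \<notin> {j, k} then beta \<omega> c else 0)" for \<omega> c
    using n_pos by (simp add: u_def dat_def)
  have u2: "(\<Sum>c\<le>2 * p. (u (?R \<omega>) c)\<^sup>2) = remainder_var j k \<omega>" for \<omega>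
  proof -
    have "(\<Sum>c\<le>2 * p. (u (?R \<omega>) c)\<^sup>2) = (\<Sum>c\<le>2 * p. if c = 2 * p then sigma\<^sup>2 else if c < p \<and> c \<notin> {j, k} then (beta \<omega> c)\<^sup>2 else 0)"
      by (intro sum.cong refl) (simp add: u)
    then show ?thesis by (simp only: sum_columns remainder_var_def)
  qed
  have uC: "(\<Sum>c\<le>2 * p. u (?R \<omega>) c * C \<omega> i c) = remainder j k \<omega> i" for \<omega> i
  proof -
    have "(\<Sum>c\<le>2 * p. u (?R \<omega>) c * C \<omega> i c) = (\<Sum>c\<le>2 * p. if c = 2 * p then eps \<omega> i else if c < p \<and> c \<notin> {j, k} then X \<omega> i c * beta \<omega> c else 0)"
      using sigma_pos by (intro sum.cong refl) (simp add: u C_simps)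
    then show ?thesis by (simp only: sum_columns remainder_def)
  qed
  have q1: "(\<Sum>s\<in>?K. \<Sum>t\<in>?K. (Q (?R \<omega>) s t)\<^sup>2) = real n * (remainder_var j k \<omega>)\<^sup>2" for \<omega>
  proof -
    have "(Q (?R \<omega>) s t)\<^sup>2 = (if row_of s = row_of t then (u (?R \<omega>) (col_of p s))\<^sup>2 * (u (?R \<omega>) (col_of p t))\<^sup>2 else 0)" for s t
      by (simp add: Q_def power_mult_distrib)
    then have "(\<Sum>s\<in>?K. \<Sum>t\<in>?K. (Q (?R \<omega>) s t)\<^sup>2) = (\<Sum>i<n. (\<Sum>c\<le>2 * p. (u (?R \<omega>) (col_of p (col p i c)))\<^sup>2)\<^sup>2)"
      using row_quadratic[of "\<lambda>s. (u (?R \<omega>) (col_of p s))\<^sup>2"] by simp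
    also have "\<dots> = (\<Sum>i<n. (\<Sum>c\<le>2 * p. (u (?R \<omega>) c)\<^sup>2)\<^sup>2)"
      by (intro sum.cong refl arg_cong[where f="\<lambda>x. x\<^sup>2"]) (simp add: col_of_col)
    finally show ?thesis by (simp add: u2)
  qed
  have q2: "(\<Sum>s\<in>?K. \<Sum>t\<in>?K. Q (?R \<omega>) s t * dat s \<omega> * dat t \<omega>) = (\<Sum>i<n. (remainder j k \<omega> i)\<^sup>2)" for \<omega>
  proof -
    have "Q (?R \<omega>) s t * dat s \<omega> * dat t \<omega> =
        (if row_of s = row_of t then (u (?R \<omega>) (col_of p s) * dat s \<omega>) * (u (?R \<omega>) (col_of p t) * dat t \<omega>) else 0)" for s t
      by (simp add: Q_def)
    then have "(\<Sum>s\<in>?K. \<Sum>t\<in>?K. Q (?R \<omega>) s t * dat s \<omega> * dat t \<omega>)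
      = (\<Sum>i<n. (\<Sum>c\<le>2 * p. u (?R \<omega>) (col_of p (col p i c)) * dat (col p i c) \<omega>)\<^sup>2)"
      using row_quadratic[of "\<lambda>s. u (?R \<omega>) (col_of p s) * dat s \<omega>"] by simp
    also have "\<dots> = (\<Sum>i<n. (\<Sum>c\<le>2 * p. u (?R \<omega>) c * C \<omega> i c)\<^sup>2)"
      by (intro sum.cong refl arg_cong[where f="\<lambda>x. x\<^sup>2"]) (simp add: col_of_col C_def)
    finally show ?thesis by (simp add: uC)
  qed
  have q3: "(\<Sum>s\<in>?K. Q (?R \<omega>) s s) = real n * remainder_var j k \<omega>" for \<omega>
  proof -
    have "(\<Sum>s\<in>?K. Q (?R \<omega>) s s) = (\<Sum>c\<le>2 * p. \<Sum>i<n. (u (?R \<omega>) (col_of p (col p i c)))\<^sup>2)"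
      by (simp add: sum_block Q_def power2_eq_square)
    also have "\<dots> = (\<Sum>c\<le>2 * p. real n * (u (?R \<omega>) c)\<^sup>2)"
      by (intro sum.cong refl) (simp add: col_of_col)
    finally show ?thesis by (simp add: sum_distrib_left[symmetric] u2)
  qed
  show ?thesis using b unfolding q1 q2 q3 .
qed

lemma remainder_meas:
  assumes "i < n"
  shows "(\<lambda>\<omega>. remainder j k \<omega> i) \<in> borel_measurable M"
proof -
  have "(\<lambda>\<omega>. X \<omega> i l) \<in> borel_measurable M" if "l < p" for l
    using C_meas[OF assms, of l] that by (simp add: C_simps)
  moreover have "(\<lambda>\<omega>. eps \<omega> i) \<in> borel_measurable M"
  proof -
    have "(\<lambda>\<omega>. sigma * C \<omega> i (2 * p)) \<in> borel_measurable M" using C_meas[OF assms, of "2 * p"] by simp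
    then show ?thesis using sigma_pos by (simp add: C_simps)
  qed
  ultimately show ?thesis unfolding remainder_def
    by (intro borel_measurable_add borel_measurable_sum borel_measurable_times beta_meas) auto
qed

lemma remainder_var_meas: "remainder_var j k \<in> borel_measurable M"
  unfolding remainder_var_def
  by (intro borel_measurable_add borel_measurable_sum borel_measurable_power beta_meas borel_measurable_const) auto

lemma proj_diff_remainder_law:
  assumes jk: "j < p" "k < p" "j \<noteq> k"
  shows "proj_diff (remainder j k) j \<in> borel_measurable M \<and> proj_diff (remainder j k) k \<in> borel_measurable M \<and>
    distr M ((borel \<Otimes>\<^sub>M borel) \<Otimes>\<^sub>M (borel \<Otimes>\<^sub>M borel))
      (\<lambda>\<omega>. ((a * (sqrt (real n) * beta \<omega> j), proj_diff (remainder j k) j \<omega>), (a * (sqrt (real n) * beta \<omega> k), proj_diff (remainder j k) k \<omega>)))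
    = (distr nu borel (\<lambda>b. a * b) \<Otimes>\<^sub>M Nm) \<Otimes>\<^sub>M (distr nu borel (\<lambda>b. a * b) \<Otimes>\<^sub>M Nm)"
proof (rule proj_diff_law[OF jk])
  \<comment> \<open>The remainder written in standardized data; it avoids the four columns of
    \<open>j\<close> and \<open>k\<close>.\<close>
  define wv where "wv y i = (\<Sum>l\<in>{..<p} - {j, k}. y (col p i l) * (y (coef l) / sqrt (real n))) + sigma * y (col p i (2 * p))" for y :: "index \<Rightarrow> real" and i
  show "(\<lambda>y. wv y i) \<in> borel_measurable (PiM (others j k) (\<lambda>_. borel))" for i
    unfolding wv_def by measurable
  fix \<omega> i assume i: "i < n"
  have o: "col p i l \<in> others j k" if "l \<in> {..2 * p} - {j, k, j + p, k + p}" for l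
  proof -
    have "col p i l \<in> idx" using that i by (auto simp: idx_def block_def)
    moreover have "col p i l \<notin> block n p {j, k, j + p, k + p}"
      using that jk by (subst col_in_block) auto
    ultimately show ?thesis by (simp add: others_def)
  qed
  have oc: "coef l \<in> others j k" if "l < p" for l using that by (auto simp: others_def coef_idx block_def)
  have "wv (restrict (\<lambda>s. dat s \<omega>) (others j k)) i
      = (\<Sum>l\<in>{..<p} - {j, k}. C \<omega> i l * (dat (coef l) \<omega> / sqrt (real n))) + sigma * C \<omega> i (2 * p)"
    unfolding wv_def using jk by (intro arg_cong2[where f="(+)"] sum.cong refl) (auto simp: o oc C_def)
  also have "\<dots> = remainder j k \<omega> i"
    unfolding remainder_def using n_pos sigma_pos
    by (intro arg_cong2[where f="(+)"] sum.cong refl) (auto simp: C_simps dat_def)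
  finally show "remainder j k \<omega> i = wv (restrict (\<lambda>s. dat s \<omega>) (others j k)) i" by simp
qed

lemma coef_expectation:
  assumes "l < p" "f \<in> borel_measurable borel"
  shows "expectation (\<lambda>\<omega>. f (sqrt (real n) * beta \<omega> l) :: real) = (\<integral>x. f x \<partial>nu)"
proof -
  have "expectation (\<lambda>\<omega>. f (dat (coef l) \<omega>)) = (\<integral>x. f x \<partial>nu)"
    using assms(2) dat_meas[OF coef_idx[OF assms(1)]] unfolding dat_coef_law[OF assms(1), symmetric]
    by (subst integral_distr) auto
  then show ?thesis by (simp add: dat_def)
qed

lemma coef_AE:
  assumes "l < p" "AE x in nu. \<bar>x\<bar> \<le> K"
  shows "AE \<omega> in M. \<bar>sqrt (real n) * beta \<omega> l\<bar> \<le> K"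
proof -
  have "AE \<omega> in M. \<bar>dat (coef l) \<omega>\<bar> \<le> K"
    using assms(2) dat_meas[OF coef_idx[OF assms(1)]] unfolding dat_coef_law[OF assms(1), symmetric]
    by (subst (asm) AE_distr_iff) auto
  then show ?thesis by (simp add: dat_def)
qed

lemma coef_indep:
  assumes "l < p" "l' < p" "l \<noteq> l'"
  shows "indep_var borel (\<lambda>\<omega>. sqrt (real n) * beta \<omega> l) borel (\<lambda>\<omega>. sqrt (real n) * beta \<omega> l')"
  using indep_vars_pair[OF dat_indep coef_idx[OF assms(1)] coef_idx[OF assms(2)]] assms(3)
  by (simp add: dat_def[abs_def])

end

lemma (in prob_space) normal_marginals:
  fixes f g h1 h2 :: "'a \<Rightarrow> real"
  assumes [measurable]: "f \<in> borel_measurable M" "g \<in> borel_measurable M" "h1 \<in> borel_measurable M" "h2 \<in> borel_measurable M"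
    and D: "prob_space D" "sets D = sets borel"
    and law: "distr M ((borel \<Otimes>\<^sub>M borel) \<Otimes>\<^sub>M (borel \<Otimes>\<^sub>M borel)) (\<lambda>\<omega>. ((f \<omega>, h1 \<omega>), (g \<omega>, h2 \<omega>)))
      = (D \<Otimes>\<^sub>M Nm) \<Otimes>\<^sub>M (D \<Otimes>\<^sub>M Nm)"
  shows "distr M borel h1 = Nm" "distr M borel h2 = Nm"
proof -
  interpret D: prob_space D by (rule D)
  interpret DN: prob_space "D \<Otimes>\<^sub>M Nm" by (intro prob_space_pair D prob_space_Nm)
  have sp: "space D = UNIV" using sets_eq_imp_space_eq[OF D(2)] by simp
  have s1: "sets (D \<Otimes>\<^sub>M Nm) = sets (borel \<Otimes>\<^sub>M borel)" by (intro sets_pair_measure_cong D sets_Nm)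
  have r: "emeasure (D \<Otimes>\<^sub>M Nm) (UNIV \<times> A) = emeasure Nm A" if "A \<in> sets borel" for A
    using that D.emeasure_space_1 sets.top[of D] by (subst Nm.emeasure_pair_measure_Times) (auto simp: sp)
  have u: "emeasure (D \<Otimes>\<^sub>M Nm) UNIV = 1" "UNIV \<in> sets (D \<Otimes>\<^sub>M Nm)"
    using DN.emeasure_space_1 sets.top[of "D \<Otimes>\<^sub>M Nm"] by (auto simp: space_pair_measure sp)
  have t: "UNIV \<times> A \<in> sets (D \<Otimes>\<^sub>M Nm)" if "A \<in> sets borel" for A
    using that sets.top[of D] by (intro pair_measureI) (auto simp: sp)
  have U: "UNIV \<in> sets (borel \<Otimes>\<^sub>M borel :: (real \<times> real) measure)"
    using sets.top[of "borel \<Otimes>\<^sub>M borel :: (real \<times> real) measure"] by (simp add: space_pair_measure)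
  have ms: "(UNIV \<times> A) \<times> UNIV \<in> sets ((borel \<Otimes>\<^sub>M borel) \<Otimes>\<^sub>M (borel \<Otimes>\<^sub>M borel) :: ((real \<times> real) \<times> (real \<times> real)) measure)"
    "UNIV \<times> (UNIV \<times> A) \<in> sets ((borel \<Otimes>\<^sub>M borel) \<Otimes>\<^sub>M (borel \<Otimes>\<^sub>M borel) :: ((real \<times> real) \<times> (real \<times> real)) measure)"
    if "A \<in> sets borel" for A
    using that U by (auto intro!: pair_measureI)
  let ?F = "\<lambda>\<omega>. ((f \<omega>, h1 \<omega>), (g \<omega>, h2 \<omega>))"
  show "distr M borel h1 = Nm"
  proof (rule measure_eqI)
    fix A assume "A \<in> sets (distr M borel h1)"
    then have A: "A \<in> sets borel" by simp
    have "emeasure (distr M borel h1) A = emeasure (distr M ((borel \<Otimes>\<^sub>M borel) \<Otimes>\<^sub>M (borel \<Otimes>\<^sub>M borel)) ?F) ((UNIV \<times> A) \<times> UNIV)"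
      using ms[OF A] A by (subst (1 2) emeasure_distr) (auto intro!: arg_cong[where f="emeasure M"])
    also have "\<dots> = emeasure Nm A"
      unfolding law using t[OF A] u r[OF A] by (subst DN.emeasure_pair_measure_Times) auto
    finally show "emeasure (distr M borel h1) A = emeasure Nm A" .
  qed simp
  show "distr M borel h2 = Nm"
  proof (rule measure_eqI)
    fix A assume "A \<in> sets (distr M borel h2)"
    then have A: "A \<in> sets borel" by simp
    have "emeasure (distr M borel h2) A = emeasure (distr M ((borel \<Otimes>\<^sub>M borel) \<Otimes>\<^sub>M (borel \<Otimes>\<^sub>M borel)) ?F) (UNIV \<times> (UNIV \<times> A))"
      using ms[OF A] A by (subst (1 2) emeasure_distr) (auto intro!: arg_cong[where f="emeasure M"])
    also have "\<dots> = emeasure Nm A"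
      unfolding law using t[OF A] u r[OF A] by (subst DN.emeasure_pair_measure_Times) auto
    finally show "emeasure (distr M borel h2) A = emeasure Nm A" .
  qed simp
qed

lemma (in prob_seq) tight_normal:
  assumes "\<forall>\<^sub>F n in sequentially. Y n \<in> borel_measurable (M n) \<and> distr (M n) borel (Y n) = Nm"
  shows "tight_seq M Y"
proof (rule tight_second_moment)
  have *: "\<forall>\<^sub>F n in sequentially. integrable (M n) (\<lambda>\<omega>. (Y n \<omega>)\<^sup>2) \<and> (\<integral>\<omega>. (Y n \<omega>)\<^sup>2 \<partial>M n) \<le> 1"
    using assms ev_prob
  proof eventually_elim
    case (elim n)
    then interpret prob_space "M n" by simp
    have "distr (M n) lborel (Y n) = distr (M n) borel (Y n)" by (intro distr_cong) auto
    then have "distributed (M n) lborel (Y n) std_normal_density"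
      using elim by (simp add: distributed_def)
    from std_normal_moments[OF this] show ?case by simp
  qed
  show "\<forall>\<^sub>F n in sequentially. integrable (M n) (\<lambda>\<omega>. (Y n \<omega>)\<^sup>2)" using * by eventually_elim blast
  show "\<forall>\<^sub>F n in sequentially. (\<integral>\<omega>. (Y n \<omega>)\<^sup>2 \<partial>M n) \<le> 1" using * by eventually_elim blast
  show "\<forall>\<^sub>F n in sequentially. Y n \<in> borel_measurable (M n)" using assms by eventually_elim blast
qed

section \<open>Marginal covariance statistic\<close>

locale model_seq =
  fixes M :: "nat \<Rightarrow> 'a measure" and p :: "nat \<Rightarrow> nat"
    and X Xt :: "nat \<Rightarrow> 'a \<Rightarrow> nat \<Rightarrow> nat \<Rightarrow> real" and eps beta :: "nat \<Rightarrow> 'a \<Rightarrow> nat \<Rightarrow> real"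
    and kappa sigma :: real and nu :: "real measure" and K :: real
  assumes kappa_pos: "kappa > 0" and ratio: "(\<lambda>n. real (p n) / real n) \<longlonglongrightarrow> kappa"
    and sigma_pos: "sigma > 0"
    and nu: "prob_space nu" "sets nu = sets borel" "AE x in nu. \<bar>x\<bar> \<le> K"
    and model: "\<And>n. n \<ge> 1 \<Longrightarrow>
      knockoff_linear_model (M n) n (p n) (X n) (Xt n) (eps n) (beta n) sigma nu"
begin

lemma std: "n \<ge> 1 \<Longrightarrow> std_model (M n) n (p n) (X n) (Xt n) (eps n) (beta n) sigma nu"
  using model sigma_pos by (simp add: std_model_def std_model_axioms_def)

sublocale prob_seq M
proof
  show "\<forall>\<^sub>F n in sequentially. prob_space (M n)"
    using eventually_ge_at_top[of 1] by eventually_elim (use model in \<open>auto simp: knockoff_linear_model_def\<close>)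
qed

abbreviation "gramS n \<equiv> std_model.gram n (p n) (X n) (Xt n) (eps n) (beta n) sigma"
abbreviation "remS n \<equiv> std_model.remainder (p n) (X n) (eps n) (beta n)"
abbreviation "remvarS n \<equiv> std_model.remainder_var (p n) (beta n) sigma"
abbreviation "projS n \<equiv> std_model.proj_diff n (p n) (X n) (Xt n) (eps n) (beta n) sigma"

lemma n_top: "filterlim (\<lambda>n. real n) at_top sequentially" by (rule filterlim_real_sequentially)

lemma inverse_n: "(\<lambda>n. c / real n) \<longlonglongrightarrow> 0"
  by (intro tendsto_divide_0[OF tendsto_const] filterlim_at_top_imp_at_infinity n_top)

lemma p_real_top: "filterlim (\<lambda>n. real (p n)) at_top sequentially"
proof -
  have "filterlim (\<lambda>n. real (p n) / real n * real n) at_top sequentially"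
    by (rule filterlim_tendsto_pos_mult_at_top[OF ratio kappa_pos n_top])
  moreover have "\<forall>\<^sub>F n in sequentially. real (p n) / real n * real n = real (p n)"
    using eventually_ge_at_top[of 1] by eventually_elim simp
  ultimately show ?thesis by (simp cong: filterlim_cong)
qed

lemma p_top: "filterlim p at_top sequentially"
  unfolding filterlim_at_top
proof
  fix Z :: nat
  have "\<forall>\<^sub>F n in sequentially. real Z \<le> real (p n)" using p_real_top unfolding filterlim_at_top by blast
  then show "\<forall>\<^sub>F n in sequentially. Z \<le> p n" by eventually_elim simp
qed

text \<open>\<open>E\<close> fixes, for all large \<open>n\<close>, whether the two columns
  coincide, so that the limit is one constant.\<close>

lemma gram_limit:
  assumes "\<forall>\<^sub>F n in sequentially. a n \<le> 2 * p n \<and> b n \<le> 2 * p n \<and> (a n = b n \<longleftrightarrow> E)"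
  shows "cprob M (\<lambda>n. gramS n (a n) (b n)) (if E then 1 else 0)"
  unfolding cprob_def
proof (intro allI impI)
  fix d :: real assume d: "d > 0"
  show "whp M (\<lambda>n \<omega>. \<bar>gramS n (a n) (b n) \<omega> - (if E then 1 else 0)\<bar> < d)"
  proof (rule whpI_bound[OF _ _ inverse_n[of "2 / d\<^sup>2"]])
    show "\<forall>\<^sub>F n in sequentially. {\<omega> \<in> space (M n). \<not> \<bar>gramS n (a n) (b n) \<omega> - (if E then 1 else 0)\<bar> < d} \<in> sets (M n)"
      using assms eventually_ge_at_top[of 1]
    proof eventually_elim
      case (elim n)
      then have e: "(if E then 1 else 0) = (if a n = b n then 1 else (0::real))" by auto
      show ?case unfolding e using elim by (intro std_model.gram_bound(1)[OF std] d) auto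
    qed
    show "\<forall>\<^sub>F n in sequentially. measure (M n) {\<omega> \<in> space (M n). \<not> \<bar>gramS n (a n) (b n) \<omega> - (if E then 1 else 0)\<bar> < d} \<le> 2 / d\<^sup>2 / real n"
      using assms eventually_ge_at_top[of 1]
    proof eventually_elim
      case (elim n)
      then have e: "(if E then 1 else 0) = (if a n = b n then 1 else (0::real))" by auto
      show ?case unfolding e using elim by (intro std_model.gram_bound(2)[OF std] d) auto
    qed
  qed
qed

lemma coef_bounded:
  assumes "\<forall>\<^sub>F n in sequentially. jj n < p n"
  shows "whp M (\<lambda>n \<omega>. \<bar>sqrt (real n) * beta n \<omega> (jj n)\<bar> \<le> K)"
  by (rule whp_AE) (use assms eventually_ge_at_top[of 1] in eventually_elim, rule std_model.coef_AE[OF std _ nu(3)])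

lemma tight_coef:
  assumes "\<forall>\<^sub>F n in sequentially. jj n < p n"
  shows "tight_seq M (\<lambda>n \<omega>. sqrt (real n) * beta n \<omega> (jj n))"
  by (rule tight_bounded[OF coef_bounded[OF assms]])

definition m2 :: real where "m2 = (\<integral>x. x\<^sup>2 \<partial>nu)"

lemma m2_nonneg: "m2 \<ge> 0" unfolding m2_def by simp

text \<open>The scaled coefficients are independent with a common bounded law. Their mean square
  tends to \<open>m2\<close>, and the factor \<open>p n / n\<close> supplies
  \<open>kappa\<close>.\<close>

lemma coef_square_sum: "cprob M (\<lambda>n \<omega>. \<Sum>l<p n. (beta n \<omega> l)\<^sup>2) (kappa * m2)"
proof -
  let ?b = "\<lambda>n l \<omega>. sqrt (real n) * beta n \<omega> l"
  have sq: "(\<lambda>x::real. x\<^sup>2) \<in> borel_measurable borel" by measurable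
  have bm: "(\<lambda>\<omega>. ?b n l \<omega>) \<in> borel_measurable (M n)" if "n \<ge> 1" "l < p n" for n l
    using std_model.beta_meas[OF std] that by simp
  have bAE: "AE \<omega> in M n. \<bar>(?b n l \<omega>)\<^sup>2\<bar> \<le> K\<^sup>2" if "n \<ge> 1" "l < p n" for n l
    using std_model.coef_AE[OF std[OF that(1)] that(2) nu(3)]
  proof eventually_elim
    case (elim \<omega>)
    then have "\<bar>?b n l \<omega>\<bar>\<^sup>2 \<le> K\<^sup>2" by (intro power_mono) auto
    then show ?case by simp
  qed
  have i: "integrable (M n) (\<lambda>\<omega>. (?b n l \<omega>)\<^sup>2)" if "n \<ge> 1" "l < p n" for n l
  proof -
    interpret std_model "M n" n "p n" "X n" "Xt n" "eps n" "beta n" sigma nu by (rule std[OF that(1)])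
    show ?thesis using bAE[OF that] bm[OF that] by (intro integrable_const_bound[of _ "K\<^sup>2"]) auto
  qed
  have E: "(\<integral>\<omega>. (?b n l \<omega>)\<^sup>2 \<partial>M n) = m2" if "n \<ge> 1" "l < p n" for n l
    using std_model.coef_expectation[OF std[OF that(1)] that(2) sq] by (simp add: m2_def)
  have EE: "(\<integral>\<omega>. (?b n l \<omega>)\<^sup>2 * (?b n l' \<omega>)\<^sup>2 \<partial>M n) = m2\<^sup>2" if "n \<ge> 1" "l < p n" "l' < p n" "l \<noteq> l'" for n l l'
  proof -
    interpret std_model "M n" n "p n" "X n" "Xt n" "eps n" "beta n" sigma nu by (rule std[OF that(1)])
    show ?thesis
      using indep_var_product(2)[OF coef_indep[OF that(2,3,4)] sq sq i[OF that(1,2)] i[OF that(1,3)]] E[OF that(1,2)] E[OF that(1,3)]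
      by (simp add: power2_eq_square)
  qed
  have L: "cprob M (\<lambda>n \<omega>. (\<Sum>l<p n. (?b n l \<omega>)\<^sup>2) / real (p n)) m2"
  proof (rule lln_pairs[OF p_top, of "\<lambda>n l \<omega>. (?b n l \<omega>)\<^sup>2" "K\<^sup>2"])
    show "\<forall>\<^sub>F n in sequentially. \<forall>l<p n. (\<lambda>\<omega>. (?b n l \<omega>)\<^sup>2) \<in> borel_measurable (M n)"
      using eventually_ge_at_top[of 1] by eventually_elim (use bm in auto)
    show "\<forall>\<^sub>F n in sequentially. \<forall>l<p n. AE \<omega> in M n. \<bar>(?b n l \<omega>)\<^sup>2\<bar> \<le> K\<^sup>2"
      using eventually_ge_at_top[of 1] by eventually_elim (use bAE in blast)
    fix e :: real assume "e > 0"
    show "\<forall>\<^sub>F n in sequentially. \<forall>l<p n. \<bar>(\<integral>\<omega>. (?b n l \<omega>)\<^sup>2 \<partial>M n) - m2\<bar> \<le> e"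
      using eventually_ge_at_top[of 1] by eventually_elim (use E \<open>e > 0\<close> in simp)
    show "\<forall>\<^sub>F n in sequentially. \<forall>l<p n. \<forall>l'<p n. l \<noteq> l' \<longrightarrow> \<bar>(\<integral>\<omega>. (?b n l \<omega>)\<^sup>2 * (?b n l' \<omega>)\<^sup>2 \<partial>M n) - m2\<^sup>2\<bar> \<le> e"
      using eventually_ge_at_top[of 1] by eventually_elim (use EE \<open>e > 0\<close> in simp)
  qed
  have "cprob M (\<lambda>n \<omega>. real (p n) / real n * ((\<Sum>l<p n. (?b n l \<omega>)\<^sup>2) / real (p n))) (kappa * m2)"
    by (intro cprob_mult cprob_tendsto ratio L)
  then show ?thesis
  proof (rule cprob_cong')
    have "\<forall>\<^sub>F n in sequentially. 1 \<le> p n" using filterlim_at_top[THEN iffD1, OF p_top] by blast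
    then show "\<forall>\<^sub>F n in sequentially. \<forall>\<omega>\<in>space (M n).
        real (p n) / real n * ((\<Sum>l<p n. (?b n l \<omega>)\<^sup>2) / real (p n)) = (\<Sum>l<p n. (beta n \<omega> l)\<^sup>2)"
      using eventually_ge_at_top[of 1]
      by eventually_elim (simp add: power_mult_distrib sum_distrib_left[symmetric])
  qed
qed

abbreviation valid :: "(nat \<Rightarrow> nat) \<Rightarrow> (nat \<Rightarrow> nat) \<Rightarrow> bool" where
  "valid jj kk \<equiv> \<forall>\<^sub>F n in sequentially. jj n < p n \<and> kk n < p n \<and> jj n \<noteq> kk n"

text \<open>A single squared coefficient is bounded by \<open>K\<^sup>2 / n\<close>, so omitting two
  of them does not affect the limit of the sum.\<close>

lemma remvar_limit:
  assumes v: "valid jj kk"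
  shows "cprob M (\<lambda>n. remvarS n (jj n) (kk n)) (sigma\<^sup>2 + kappa * m2)"
proof -
  have small: "cprob M (\<lambda>n \<omega>. (1 / real n) * (sqrt (real n) * beta n \<omega> (ll n))\<^sup>2) 0" if "\<forall>\<^sub>F n in sequentially. ll n < p n" for ll
  proof -
    have "tight_seq M (\<lambda>n \<omega>. (sqrt (real n) * beta n \<omega> (ll n))\<^sup>2)"
    proof (rule tight_bounded[OF whp_mono[OF coef_bounded[OF that]]])
      fix n \<omega> assume "\<bar>sqrt (real n) * beta n \<omega> (ll n)\<bar> \<le> K"
      then have "\<bar>sqrt (real n) * beta n \<omega> (ll n)\<bar>\<^sup>2 \<le> K\<^sup>2" by (intro power_mono) auto
      then show "\<bar>(sqrt (real n) * beta n \<omega> (ll n))\<^sup>2\<bar> \<le> K\<^sup>2" by simp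
    qed
    then show ?thesis by (intro cprob_mult_tight cprob_tendsto inverse_n)
  qed
  have "cprob M (\<lambda>n \<omega>. sigma\<^sup>2 + ((\<Sum>l<p n. (beta n \<omega> l)\<^sup>2) - (1 / real n) * (sqrt (real n) * beta n \<omega> (jj n))\<^sup>2
      - (1 / real n) * (sqrt (real n) * beta n \<omega> (kk n))\<^sup>2)) (sigma\<^sup>2 + (kappa * m2 - 0 - 0))"
    using v by (intro cprob_add cprob_diff cprob_const coef_square_sum small) (auto elim: eventually_mono)
  then have "cprob M (\<lambda>n \<omega>. sigma\<^sup>2 + ((\<Sum>l<p n. (beta n \<omega> l)\<^sup>2) - (1 / real n) * (sqrt (real n) * beta n \<omega> (jj n))\<^sup>2
      - (1 / real n) * (sqrt (real n) * beta n \<omega> (kk n))\<^sup>2)) (sigma\<^sup>2 + kappa * m2)" by simp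
  then show ?thesis
  proof (rule cprob_cong')
    show "\<forall>\<^sub>F n in sequentially. \<forall>\<omega>\<in>space (M n). sigma\<^sup>2 + ((\<Sum>l<p n. (beta n \<omega> l)\<^sup>2) - (1 / real n) * (sqrt (real n) * beta n \<omega> (jj n))\<^sup>2
      - (1 / real n) * (sqrt (real n) * beta n \<omega> (kk n))\<^sup>2) = remvarS n (jj n) (kk n) \<omega>"
      using v eventually_ge_at_top[of 1]
    proof (eventually_elim, intro ballI)
      fix n \<omega> assume jk: "jj n < p n \<and> kk n < p n \<and> jj n \<noteq> kk n" and n: "1 \<le> n"
      have "{..<p n} = insert (jj n) (insert (kk n) ({..<p n} - {jj n, kk n}))" using jk by auto
      then have "(\<Sum>l<p n. (beta n \<omega> l)\<^sup>2) = (\<Sum>l\<in>insert (jj n) (insert (kk n) ({..<p n} - {jj n, kk n})). (beta n \<omega> l)\<^sup>2)" by simp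
      also have "\<dots> = (beta n \<omega> (jj n))\<^sup>2 + ((beta n \<omega> (kk n))\<^sup>2 + (\<Sum>l\<in>{..<p n} - {jj n, kk n}. (beta n \<omega> l)\<^sup>2))"
        using jk by simp
      finally show "sigma\<^sup>2 + ((\<Sum>l<p n. (beta n \<omega> l)\<^sup>2) - (1 / real n) * (sqrt (real n) * beta n \<omega> (jj n))\<^sup>2
          - (1 / real n) * (sqrt (real n) * beta n \<omega> (kk n))\<^sup>2) = remvarS n (jj n) (kk n) \<omega>"
        using n by (simp add: std_model.remainder_var_def[OF std] power_mult_distrib)
    qed
  qed
qed

lemma remainder_limit:
  assumes v: "valid jj kk"
  shows "cprob M (\<lambda>n \<omega>. (\<Sum>i<n. (remS n (jj n) (kk n) \<omega> i)\<^sup>2) / real n) (sigma\<^sup>2 + kappa * m2)"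
proof -
  let ?T = "sigma\<^sup>2 + kappa * m2"
  let ?S = "\<lambda>n \<omega>. \<Sum>i<n. (remS n (jj n) (kk n) \<omega> i)\<^sup>2" and ?v = "\<lambda>n. remvarS n (jj n) (kk n)"
  have T0: "?T \<ge> 0" using kappa_pos m2_nonneg by simp
  have "cprob M (\<lambda>n \<omega>. ?S n \<omega> / real n - ?v n \<omega>) 0"
    unfolding cprob_def
  proof (intro allI impI)
    fix d :: real assume d: "d > 0"
    \<comment> \<open>\<open>remainder_bound\<close> needs a deterministic bound on the conditional
      variance; \<open>?T + 1\<close> is one with probability tending to 1.\<close>
    let ?V = "\<lambda>n. 2 * (real n * (?T + 1)\<^sup>2)"
    have w1: "whp M (\<lambda>n \<omega>. \<not> (2 * (real n * (?v n \<omega>)\<^sup>2) \<le> ?V n \<and> d * real n \<le> \<bar>?S n \<omega> - real n * ?v n \<omega>\<bar>))"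
    proof (rule whpI_bound[OF _ _ inverse_n[of "2 * (?T + 1)\<^sup>2 / d\<^sup>2"]])
      show "\<forall>\<^sub>F n in sequentially. {\<omega> \<in> space (M n). \<not> \<not> (2 * (real n * (?v n \<omega>)\<^sup>2) \<le> ?V n \<and> d * real n \<le> \<bar>?S n \<omega> - real n * ?v n \<omega>\<bar>)} \<in> sets (M n)"
        using eventually_ge_at_top[of 1]
      proof eventually_elim
        case (elim n)
        have [measurable]: "?v n \<in> borel_measurable (M n)" by (rule std_model.remainder_var_meas[OF std[OF elim]])
        have [measurable]: "?S n \<in> borel_measurable (M n)"
          by (intro borel_measurable_sum borel_measurable_power std_model.remainder_meas[OF std[OF elim]]) auto
        show ?case by measurable
      qed
      show "\<forall>\<^sub>F n in sequentially. measure (M n) {\<omega> \<in> space (M n). \<not> \<not> (2 * (real n * (?v n \<omega>)\<^sup>2) \<le> ?V n \<and> d * real n \<le> \<bar>?S n \<omega> - real n * ?v n \<omega>\<bar>)}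
          \<le> 2 * (?T + 1)\<^sup>2 / d\<^sup>2 / real n"
        using eventually_ge_at_top[of 1]
      proof eventually_elim
        case (elim n)
        have "measure (M n) {\<omega> \<in> space (M n). (2 * (real n * (?v n \<omega>)\<^sup>2) \<le> ?V n \<and> d * real n \<le> \<bar>?S n \<omega> - real n * ?v n \<omega>\<bar>)}
          \<le> ?V n / (d * real n)\<^sup>2"
          using elim d by (intro std_model.remainder_bound[OF std[OF elim]]) auto
        also have "\<dots> = 2 * (?T + 1)\<^sup>2 / d\<^sup>2 / real n" using elim d by (simp add: power2_eq_square field_simps)
        finally show ?case by simp
      qed
    qed
    have w2: "whp M (\<lambda>n \<omega>. \<bar>?v n \<omega> - ?T\<bar> < 1)" using remvar_limit[OF v] unfolding cprob_def by simp
    have w3: "whp M (\<lambda>n \<omega>. ?v n \<omega> \<ge> 0)"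
    proof (rule whp_always)
      show "\<forall>\<^sub>F n in sequentially. \<forall>\<omega>\<in>space (M n). 0 \<le> ?v n \<omega>"
        using eventually_ge_at_top[of 1]
        by eventually_elim (simp add: std_model.remainder_var_def[OF std] sum_nonneg)
    qed
    have w4: "whp M (\<lambda>n \<omega>. n \<ge> 1)" by (rule whp_always) (use eventually_ge_at_top[of 1] in eventually_elim, simp)
    show "whp M (\<lambda>n \<omega>. \<bar>?S n \<omega> / real n - ?v n \<omega> - 0\<bar> < d)"
    proof (rule whp_mono[OF whp_conj[OF w1 whp_conj[OF w2 whp_conj[OF w3 w4]]]])
      fix n \<omega>
      assume a: "\<not> (2 * (real n * (?v n \<omega>)\<^sup>2) \<le> ?V n \<and> d * real n \<le> \<bar>?S n \<omega> - real n * ?v n \<omega>\<bar>) \<and>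
        \<bar>?v n \<omega> - ?T\<bar> < 1 \<and> 0 \<le> ?v n \<omega> \<and> 1 \<le> n"
      then have n: "real n > 0" by simp
      have "?v n \<omega> \<le> ?T + 1" using a by linarith
      then have "(?v n \<omega>)\<^sup>2 \<le> (?T + 1)\<^sup>2" using a by (intro power_mono) auto
      then have "2 * (real n * (?v n \<omega>)\<^sup>2) \<le> ?V n" using n by (simp add: mult_left_mono)
      then have lt: "\<bar>?S n \<omega> - real n * ?v n \<omega>\<bar> < d * real n" using a by linarith
      have "?S n \<omega> / real n - ?v n \<omega> - 0 = (?S n \<omega> - real n * ?v n \<omega>) / real n" using n by (simp add: field_simps)
      then have "\<bar>?S n \<omega> / real n - ?v n \<omega> - 0\<bar> = \<bar>?S n \<omega> - real n * ?v n \<omega>\<bar> / real n" by simp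
      also have "\<dots> < d" using lt n by (simp add: divide_less_eq)
      finally show "\<bar>?S n \<omega> / real n - ?v n \<omega> - 0\<bar> < d" .
    qed
  qed
  from cprob_add[OF this remvar_limit[OF v]] show ?thesis by simp
qed

lemma valid_swap: "valid jj kk \<Longrightarrow> valid kk jj"
  by (auto elim: eventually_mono)

definition cov_diff :: "nat \<Rightarrow> 'a \<Rightarrow> nat \<Rightarrow> real" where
  "cov_diff n \<omega> j = (\<Sum>i<n. X n \<omega> i j * response (p n) (X n \<omega>) (beta n \<omega>) (eps n \<omega>) i) / real n
      - (\<Sum>i<n. Xt n \<omega> i j * response (p n) (X n \<omega>) (beta n \<omega>) (eps n \<omega>) i) / real n"

lemma remainder_commute: "n \<ge> 1 \<Longrightarrow> remS n j k = remS n k j"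
  by (simp add: std_model.remainder_def[OF std] fun_eq_iff insert_commute)

text \<open>The scale is chosen so that
  \<open>s * sqrt 2 * sqrt (sigma\<^sup>2 + kappa * m2) = 1\<close>. After the main terms cancel,
  each summand is a factor tending to 0 times a tight factor.\<close>

lemma cov_diff_limit:
  assumes v: "valid jj kk" and s: "s = 1 / sqrt (2 * (sigma\<^sup>2 + kappa * m2))"
    and tight: "tight_seq M (\<lambda>n. projS n (remS n (jj n) (kk n)) (jj n))"
  shows "cprob M (\<lambda>n \<omega>. s * sqrt (real n) * cov_diff n \<omega> (jj n) - s * (sqrt (real n) * beta n \<omega> (jj n))
      - projS n (remS n (jj n) (kk n)) (jj n) \<omega>) 0"
proof -
  let ?T = "sigma\<^sup>2 + kappa * m2"
  let ?R = "\<lambda>n \<omega>. (\<Sum>i<n. (remS n (jj n) (kk n) \<omega> i)\<^sup>2) / real n"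
  let ?h = "\<lambda>n. projS n (remS n (jj n) (kk n)) (jj n)"
  let ?g = "\<lambda>n. gramS n" and ?b = "\<lambda>n \<omega> l. sqrt (real n) * beta n \<omega> l"
  have T: "?T > 0" using sigma_pos kappa_pos m2_nonneg by (simp add: add_pos_nonneg)
  have vj: "\<forall>\<^sub>F n in sequentially. jj n < p n" "\<forall>\<^sub>F n in sequentially. kk n < p n"
    using v by (auto elim: eventually_mono)
  have A: "cprob M (\<lambda>n \<omega>. s * sqrt 2 * sqrt (?R n \<omega>) - 1) 0"
  proof -
    have "cprob M (\<lambda>n \<omega>. s * sqrt 2 * sqrt (?R n \<omega>) - 1) (s * sqrt 2 * sqrt ?T - 1)"
      by (intro cprob_diff cprob_cmult cprob_const cprob_isCont[OF remainder_limit[OF v]] isCont_real_sqrt)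
    moreover have "1 / sqrt (2 * t) * sqrt 2 * sqrt t = 1" if "t > 0" for t using that by (simp add: real_sqrt_mult)
    then have "s * sqrt 2 * sqrt ?T = 1" unfolding s using T by blast
    ultimately show ?thesis by simp
  qed
  have g1: "cprob M (\<lambda>n. ?g n (jj n) (jj n)) 1"
    by (rule gram_limit[where E=True, simplified], rule eventually_mono[OF v]) auto
  have g2: "cprob M (\<lambda>n. ?g n (jj n + p n) (jj n)) 0"
    by (rule gram_limit[where E=False, simplified], rule eventually_mono[OF v]) auto
  have g3: "cprob M (\<lambda>n. ?g n (jj n) (kk n)) 0"
    by (rule gram_limit[where E=False, simplified], rule eventually_mono[OF v]) auto
  have g4: "cprob M (\<lambda>n. ?g n (jj n + p n) (kk n)) 0"
    by (rule gram_limit[where E=False, simplified], rule eventually_mono[OF v]) auto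
  have B: "cprob M (\<lambda>n \<omega>. ?g n (jj n) (jj n) \<omega> - ?g n (jj n + p n) (jj n) \<omega> - 1) 0"
    using cprob_diff[OF cprob_diff[OF g1 g2] cprob_const[of 1]] by simp
  have C: "cprob M (\<lambda>n \<omega>. ?g n (jj n) (kk n) \<omega> - ?g n (jj n + p n) (kk n) \<omega>) 0"
    using cprob_diff[OF g3 g4] by simp
  have "cprob M (\<lambda>n \<omega>. (s * sqrt 2 * sqrt (?R n \<omega>) - 1) * ?h n \<omega>
      + s * ((?g n (jj n) (jj n) \<omega> - ?g n (jj n + p n) (jj n) \<omega> - 1) * ?b n \<omega> (jj n))
      + s * ((?g n (jj n) (kk n) \<omega> - ?g n (jj n + p n) (kk n) \<omega>) * ?b n \<omega> (kk n))) (0 + s * 0 + s * 0)"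
    by (intro cprob_add cprob_cmult cprob_mult_tight A B C tight tight_coef vj)
  then have "cprob M (\<lambda>n \<omega>. (s * sqrt 2 * sqrt (?R n \<omega>) - 1) * ?h n \<omega>
      + s * ((?g n (jj n) (jj n) \<omega> - ?g n (jj n + p n) (jj n) \<omega> - 1) * ?b n \<omega> (jj n))
      + s * ((?g n (jj n) (kk n) \<omega> - ?g n (jj n + p n) (kk n) \<omega>) * ?b n \<omega> (kk n))) 0" by simp
  then show ?thesis
  proof (rule cprob_cong')
    show "\<forall>\<^sub>F n in sequentially. \<forall>\<omega>\<in>space (M n). (s * sqrt 2 * sqrt (?R n \<omega>) - 1) * ?h n \<omega>
      + s * ((?g n (jj n) (jj n) \<omega> - ?g n (jj n + p n) (jj n) \<omega> - 1) * ?b n \<omega> (jj n))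
      + s * ((?g n (jj n) (kk n) \<omega> - ?g n (jj n + p n) (kk n) \<omega>) * ?b n \<omega> (kk n))
      = s * sqrt (real n) * cov_diff n \<omega> (jj n) - s * (sqrt (real n) * beta n \<omega> (jj n)) - ?h n \<omega>"
      using v eventually_ge_at_top[of 1]
    proof (eventually_elim, intro ballI)
      fix n \<omega> assume jk: "jj n < p n \<and> kk n < p n \<and> jj n \<noteq> kk n" and n: "1 \<le> n"
      have D: "cov_diff n \<omega> (jj n) = sqrt (\<Sum>i<n. (remS n (jj n) (kk n) \<omega> i)\<^sup>2) * sqrt 2 * ?h n \<omega> / real n
        + beta n \<omega> (jj n) * (?g n (jj n) (jj n) \<omega> - ?g n (jj n + p n) (jj n) \<omega>)
        + beta n \<omega> (kk n) * (?g n (jj n) (kk n) \<omega> - ?g n (jj n + p n) (kk n) \<omega>)"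
        unfolding cov_diff_def by (rule std_model.marginal_cov_diff[OF std[OF n]]) (use jk in auto)
      have R: "sqrt (real n) * (sqrt (\<Sum>i<n. (remS n (jj n) (kk n) \<omega> i)\<^sup>2) * sqrt 2 * y / real n) = sqrt 2 * sqrt (?R n \<omega>) * y" for y
      proof -
        have "sqrt (real n) * z / real n = z / sqrt (real n)" for z
          using n by (simp add: field_simps)
        from this[of "sqrt (\<Sum>i<n. (remS n (jj n) (kk n) \<omega> i)\<^sup>2) * sqrt 2 * y"] show ?thesis
          by (simp add: real_sqrt_divide mult_ac)
      qed
      show "(s * sqrt 2 * sqrt (?R n \<omega>) - 1) * ?h n \<omega>
      + s * ((?g n (jj n) (jj n) \<omega> - ?g n (jj n + p n) (jj n) \<omega> - 1) * ?b n \<omega> (jj n))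
      + s * ((?g n (jj n) (kk n) \<omega> - ?g n (jj n + p n) (kk n) \<omega>) * ?b n \<omega> (kk n))
      = s * sqrt (real n) * cov_diff n \<omega> (jj n) - s * (sqrt (real n) * beta n \<omega> (jj n)) - ?h n \<omega>"
        unfolding D distrib_left mult.assoc[of s "sqrt (real n)"] R by (simp add: algebra_simps)
    qed
  qed
qed

end

section \<open>Projections and least squares\<close>

definition ip :: "nat \<Rightarrow> (nat \<Rightarrow> real) \<Rightarrow> (nat \<Rightarrow> real) \<Rightarrow> real" where
  "ip n u v = (\<Sum>i<n. u i * v i)"

definition mv :: "nat \<Rightarrow> (nat \<Rightarrow> nat \<Rightarrow> real) \<Rightarrow> (nat \<Rightarrow> real) \<Rightarrow> nat \<Rightarrow> real" where
  "mv n P v i = (\<Sum>l<n. P i l * v l)"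

text \<open>The orthogonal projection onto the complement of the span of a list of vectors. The value
  \<open>x / 0 = 0\<close> makes a vector without effect if it depends linearly on the preceding ones.\<close>

fun resid :: "nat \<Rightarrow> (nat \<Rightarrow> real) list \<Rightarrow> nat \<Rightarrow> nat \<Rightarrow> real" where
  "resid n [] = (\<lambda>i k. if i = k then 1 else 0)"
| "resid n (c # cs) = (let P = resid n cs; u = mv n P c in (\<lambda>i k. P i k - u i * u k / ip n u u))"

lemma ip_commute: "ip n u v = ip n v u"
  by (simp add: ip_def mult.commute)

lemma ip_nonneg: "ip n u u \<ge> 0"
  by (simp add: ip_def sum_nonneg)

lemma ip_self_eq_0: "ip n u u = 0 \<Longrightarrow> i < n \<Longrightarrow> u i = 0"
  unfolding ip_def by (subst (asm) sum_nonneg_eq_0_iff) auto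

lemma ip_add_right: "ip n u (\<lambda>i. v i + w i) = ip n u v + ip n u w"
  by (simp add: ip_def sum.distrib algebra_simps)

lemma ip_diff_right: "ip n u (\<lambda>i. v i - w i) = ip n u v - ip n u w"
  by (simp add: ip_def sum_subtractf algebra_simps)

lemma ip_sum_right: "ip n u (\<lambda>i. \<Sum>k\<in>F. a k * v k i) = (\<Sum>k\<in>F. a k * ip n u (v k))"
proof -
  have "ip n u (\<lambda>i. \<Sum>k\<in>F. a k * v k i) = (\<Sum>i<n. \<Sum>k\<in>F. u i * (a k * v k i))"
    by (simp add: ip_def sum_distrib_left)
  also have "\<dots> = (\<Sum>k\<in>F. \<Sum>i<n. u i * (a k * v k i))" by (rule sum.swap)
  also have "\<dots> = (\<Sum>k\<in>F. a k * ip n u (v k))"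
    unfolding ip_def sum_distrib_left by (intro sum.cong refl) (simp add: mult_ac)
  finally show ?thesis .
qed

lemma ip_cong: "(\<And>i. i < n \<Longrightarrow> u i = u' i) \<Longrightarrow> (\<And>i. i < n \<Longrightarrow> v i = v' i) \<Longrightarrow> ip n u v = ip n u' v'"
  by (simp add: ip_def)

lemma mv_cong: "(\<And>l. l < n \<Longrightarrow> v l = v' l) \<Longrightarrow> mv n P v = mv n P v'"
  by (simp add: mv_def fun_eq_iff)

lemma mv_diff: "mv n P (\<lambda>i. v i - w i) i = mv n P v i - mv n P w i"
  by (simp add: mv_def sum_subtractf algebra_simps)

lemma mv_sum: "mv n P (\<lambda>i. \<Sum>k\<in>F. a k * v k i) i = (\<Sum>k\<in>F. a k * mv n P (v k) i)"
  using ip_sum_right[of n "P i" a v F] by (simp add: ip_def mv_def)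

lemma ip_mv_sym:
  assumes "\<And>i k. P i k = P k i"
  shows "ip n (mv n P u) v = ip n u (mv n P v)"
proof -
  have "ip n (mv n P u) v = (\<Sum>i<n. \<Sum>l<n. P i l * u l * v i)"
    by (simp add: ip_def mv_def sum_distrib_right)
  also have "\<dots> = (\<Sum>l<n. \<Sum>i<n. P i l * u l * v i)" by (rule sum.swap)
  also have "\<dots> = ip n u (mv n P v)"
    unfolding ip_def mv_def sum_distrib_left
    by (intro sum.cong refl) (subst assms, simp add: mult_ac)
  finally show ?thesis .
qed

lemma resid_sym: "resid n cs i k = resid n cs k i"
  by (induction cs arbitrary: i k) (auto simp: Let_def mult.commute)

lemma resid_cong:
  assumes "list_all2 (\<lambda>c c'. \<forall>i<n. c i = c' i) cs cs'"
  shows "resid n cs = resid n cs'"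
  using assms
proof (induction rule: list_all2_induct)
  case (Cons c cs c' cs')
  then have "mv n (resid n cs) c = mv n (resid n cs') c'" by (simp add: mv_def fun_eq_iff)
  then show ?case using Cons by (simp add: Let_def)
qed simp

lemma mv_resid_Cons:
  "mv n (resid n (c # cs)) v i = mv n (resid n cs) v i -
    mv n (resid n cs) c i * (ip n (mv n (resid n cs) c) v / ip n (mv n (resid n cs) c) (mv n (resid n cs) c))"
proof -
  define u where "u = mv n (resid n cs) c"
  define q where "q = ip n u u"
  have "mv n (resid n (c # cs)) v i = (\<Sum>l<n. (resid n cs i l - u i * u l / q) * v l)"
    by (simp add: Let_def u_def[symmetric] q_def[symmetric]) (simp add: mv_def)
  also have "\<dots> = (\<Sum>l<n. resid n cs i l * v l) - u i * ((\<Sum>l<n. u l * v l) / q)"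
    unfolding sum_distrib_left sum_divide_distrib sum_subtractf[symmetric]
    by (intro sum.cong refl) (simp add: left_diff_distrib)
  finally show ?thesis by (simp add: u_def q_def mv_def[of n "resid n cs" v] ip_def[of n _ v])
qed

text \<open>Gram-Schmidt: the new direction \<open>u\<close> already lies in the range of the old
  projection, and subtracting its component makes the result orthogonal to \<open>u\<close>.\<close>

lemma mv_resid_idem:
  assumes "i < n"
  shows "mv n (resid n cs) (mv n (resid n cs) v) i = mv n (resid n cs) v i"
  using assms
proof (induction cs arbitrary: v i)
  case Nil
  have "mv n (\<lambda>i k. if i = k then 1 else 0) v i = v i" if "i < n" for v i
    using that by (simp add: mv_def if_distrib[of "\<lambda>x. x * _"] cong: if_cong)
  then show ?case using Nil by simp
next
  case (Cons c cs)
  let ?P = "resid n cs"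
  define u where "u = mv n ?P c"
  define q where "q = ip n u u"
  have Pu: "mv n ?P u l = u l" if "l < n" for l using Cons.IH[OF that] by (simp add: u_def)
  have st: "mv n (resid n (c # cs)) w l = mv n ?P w l - u l * (ip n u w / q)" for w l
    using mv_resid_Cons by (simp add: u_def q_def)
  let ?w = "mv n (resid n (c # cs)) v"
  have w: "?w = (\<lambda>l. mv n ?P v l - u l * (ip n u v / q))" using st by (simp add: fun_eq_iff)
  have a: "mv n ?P ?w i = mv n ?P v i - u i * (ip n u v / q)"
  proof -
    have "mv n ?P ?w i = mv n ?P (mv n ?P v) i - mv n ?P (\<lambda>l. u l * (ip n u v / q)) i" unfolding w by (rule mv_diff)
    also have "mv n ?P (\<lambda>l. u l * y) i = mv n ?P u i * y" for y
      unfolding mv_def sum_distrib_right by (simp add: mult_ac)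
    finally show ?thesis using Cons Pu by simp
  qed
  \<comment> \<open>If \<open>q = 0\<close> the correction is a division by 0 and hence 0, so both
    cases leave nothing to subtract.\<close>
  have b: "ip n u ?w = 0 \<or> q = 0"
  proof -
    have "ip n u ?w = ip n u (mv n ?P v) - ip n u (\<lambda>l. u l * (ip n u v / q))" unfolding w by (rule ip_diff_right)
    also have "ip n u (mv n ?P v) = ip n (mv n ?P u) v" by (rule ip_mv_sym[symmetric]) (rule resid_sym)
    also have "\<dots> = ip n u v" by (rule ip_cong) (auto simp: Pu)
    also have "ip n u (\<lambda>l. u l * y) = q * y" for y
      unfolding ip_def q_def sum_distrib_right by (simp add: mult_ac)
    finally show ?thesis by auto
  qed
  have "mv n (resid n (c # cs)) ?w i = mv n ?P ?w i - u i * (ip n u ?w / q)" by (rule st)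
  also have "\<dots> = mv n ?P ?w i" using b by auto
  also have "\<dots> = ?w i" using a st by simp
  finally show ?case .
qed

lemma ip_resid: "ip n v (mv n (resid n cs) v) = ip n (mv n (resid n cs) v) (mv n (resid n cs) v)"
proof -
  have "ip n (mv n (resid n cs) v) (mv n (resid n cs) v) = ip n v (mv n (resid n cs) (mv n (resid n cs) v))"
    by (rule ip_mv_sym) (rule resid_sym)
  also have "\<dots> = ip n v (mv n (resid n cs) v)" by (rule ip_cong) (auto simp: mv_resid_idem)
  finally show ?thesis by simp
qed

lemma mv_resid_member:
  assumes "c \<in> set cs" "i < n"
  shows "mv n (resid n cs) c i = 0"
  using assms
proof (induction cs arbitrary: i)
  case (Cons c' cs)
  let ?P = "resid n cs"
  define u where "u = mv n ?P c'"
  have st: "mv n (resid n (c' # cs)) c i = mv n ?P c i - u i * (ip n u c / ip n u u)"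
    using mv_resid_Cons by (simp add: u_def)
  show ?case
  proof (cases "c \<in> set cs")
    case True
    then have z: "mv n ?P c l = 0" if "l < n" for l using Cons.IH that by blast
    have "ip n u c = ip n c' (mv n ?P c)" unfolding u_def by (rule ip_mv_sym) (rule resid_sym)
    also have "\<dots> = 0" using z by (simp add: ip_def)
    finally show ?thesis using st z Cons.prems by simp
  next
    case False
    then have c: "c = c'" using Cons.prems by simp
    have "ip n u c = ip n u u" using ip_resid[of n c cs] by (simp add: u_def c ip_commute)
    \<comment> \<open>If \<open>ip n u u = 0\<close>, no direction is removed, but then
      \<open>c\<close> already has residual 0.\<close>
    then show ?thesis using st ip_self_eq_0[of n u i] Cons.prems by (cases "ip n u u = 0") (auto simp: u_def c)
  qed
qed simp

lemma mv_resid_orthogonal: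
  assumes "\<And>c. c \<in> set cs \<Longrightarrow> ip n c v = 0" "i < n"
  shows "mv n (resid n cs) v i = v i"
  using assms
proof (induction cs arbitrary: i)
  case Nil
  then show ?case by (simp add: mv_def if_distrib[of "\<lambda>x. x * _"] cong: if_cong)
next
  case (Cons c cs)
  let ?P = "resid n cs"
  define u where "u = mv n ?P c"
  have IH: "mv n ?P v l = v l" if "l < n" for l using Cons.IH Cons.prems(1) that by simp
  have "ip n u v = ip n c (mv n ?P v)" unfolding u_def by (rule ip_mv_sym) (rule resid_sym)
  also have "\<dots> = ip n c v" by (rule ip_cong) (auto simp: IH)
  also have "\<dots> = 0" using Cons.prems by simp
  finally show ?case using mv_resid_Cons[of n c cs v i] IH Cons.prems by (simp add: u_def)
qed

lemma resid_span:
  "\<exists>a. \<forall>i<n. v i - mv n (resid n cs) v i = (\<Sum>t<length cs. a t * (cs ! t) i)"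
proof (induction cs arbitrary: v)
  case Nil
  then show ?case by (simp add: mv_def if_distrib[of "\<lambda>x. x * _"] cong: if_cong)
next
  case (Cons c cs)
  let ?P = "resid n cs"
  define l where "l = ip n (mv n ?P c) v / ip n (mv n ?P c) (mv n ?P c)"
  obtain a where a: "\<forall>i<n. v i - mv n ?P v i = (\<Sum>t<length cs. a t * (cs ! t) i)" using Cons by blast
  obtain b where b: "\<forall>i<n. c i - mv n ?P c i = (\<Sum>t<length cs. b t * (cs ! t) i)" using Cons by blast
  \<comment> \<open>The projection of \<open>v\<close> gains \<open>l\<close> times the residual of
    \<open>c\<close>, that is \<open>l * c\<close> minus \<open>l\<close> times the expansion of the
    fitted part of \<open>c\<close>.\<close>
  define d where "d t = (case t of 0 \<Rightarrow> l | Suc t \<Rightarrow> a t - l * b t)" for t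
  have "v i - mv n (resid n (c # cs)) v i = (\<Sum>t<length (c # cs). d t * ((c # cs) ! t) i)" if i: "i < n" for i
  proof -
    have "v i - mv n (resid n (c # cs)) v i = (v i - mv n ?P v i) + l * (c i - (c i - mv n ?P c i))"
      using mv_resid_Cons[of n c cs v i] by (simp add: l_def mult.commute)
    also have "\<dots> = (\<Sum>t<length cs. a t * (cs ! t) i) + l * (c i - (\<Sum>t<length cs. b t * (cs ! t) i))"
      using a b i by simp
    also have "\<dots> = l * c i + (\<Sum>t<length cs. (a t - l * b t) * (cs ! t) i)"
      by (simp add: left_diff_distrib right_diff_distrib sum_subtractf sum_distrib_left mult_ac)
    also have "\<dots> = (\<Sum>t<Suc (length cs). d t * ((c # cs) ! t) i)"
      by (subst sum.lessThan_Suc_shift) (simp add: d_def)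
    finally show ?thesis by simp
  qed
  then show ?case by blast
qed

text \<open>For a symmetric idempotent matrix the squared norm of row \<open>i\<close> is the entry
  \<open>(i, i)\<close> of its square, thus of the matrix itself.\<close>

lemma resid_frobenius: "(\<Sum>i<n. \<Sum>k<n. (resid n cs i k)\<^sup>2) = (\<Sum>i<n. resid n cs i i)"
proof (rule sum.cong[OF refl])
  fix i assume "i \<in> {..<n}"
  then have i: "i < n" by simp
  define e where "e l = (if l = i then 1 else (0::real))" for l
  have e: "mv n (resid n cs) e k = resid n cs k i" for k
    using i by (simp add: mv_def e_def if_distrib[of "\<lambda>x. _ * x"] cong: if_cong)
  have "(\<Sum>k<n. (resid n cs i k)\<^sup>2) = (\<Sum>k<n. resid n cs i k * mv n (resid n cs) e k)"
    unfolding e by (intro sum.cong refl) (subst resid_sym[of n cs _ i], simp add: power2_eq_square)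
  also have "\<dots> = mv n (resid n cs) (mv n (resid n cs) e) i" by (simp add: mv_def[of n _ _ i])
  also have "\<dots> = resid n cs i i" using mv_resid_idem[OF i] e by simp
  finally show "(\<Sum>k<n. (resid n cs i k)\<^sup>2) = resid n cs i i" .
qed

lemma resid_trace_Cons:
  "(\<Sum>i<n. resid n (c # cs) i i) = (\<Sum>i<n. resid n cs i i) -
    (if ip n c (mv n (resid n cs) c) = 0 then 0 else 1)"
  using ip_resid[of n c cs]
  by (simp add: Let_def sum_subtractf sum_divide_distrib[symmetric] ip_def[of n "mv n (resid n cs) c" "mv n (resid n cs) c"])

text \<open>Each vector lowers the trace by at most 1. It is 0 or 1 according to whether the vector
  depends on the preceding ones.\<close>

lemma resid_trace_ge: "real n - real (length cs) \<le> (\<Sum>i<n. resid n cs i i)"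
proof (induction cs)
  case (Cons c cs)
  then show ?case unfolding resid_trace_Cons by simp
qed simp

lemma measurable_resid:
  assumes "\<And>k i. k \<in> set ks \<Longrightarrow> i < n \<Longrightarrow> (\<lambda>y. f y k i) \<in> borel_measurable N"
  shows "(\<lambda>y. resid n (map (f y) ks) i l) \<in> borel_measurable N"
  using assms
proof (induction ks arbitrary: i l)
  case (Cons k ks)
  have R: "(\<lambda>y. resid n (map (f y) ks) i l) \<in> borel_measurable N" for i l
    by (rule Cons.IH) (use Cons.prems in auto)
  have m: "(\<lambda>y. mv n (resid n (map (f y) ks)) (f y k) i) \<in> borel_measurable N" for i
    unfolding mv_def using Cons.prems by (intro borel_measurable_sum borel_measurable_times R) auto
  define u where "u y = mv n (resid n (map (f y) ks)) (f y k)" for y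
  have [measurable]: "(\<lambda>y. u y i) \<in> borel_measurable N" for i using m by (simp add: u_def)
  have [measurable]: "(\<lambda>y. resid n (map (f y) ks) i l) \<in> borel_measurable N" by (rule R)
  have "(\<lambda>y. resid n (map (f y) (k # ks)) i l) = (\<lambda>y. resid n (map (f y) ks) i l - u y i * u y l / (\<Sum>i<n. u y i * u y i))"
    by (simp add: Let_def ip_def u_def)
  also have "\<dots> \<in> borel_measurable N" by measurable
  finally show ?case .
qed simp

section \<open>Schur complements and the least squares problem\<close>

context
  fixes n d :: nat and A :: "nat \<Rightarrow> nat \<Rightarrow> real"
begin

definition cl :: "nat \<Rightarrow> nat \<Rightarrow> real" where "cl k i = A i k"

definition rest_proj :: "nat \<Rightarrow> nat \<Rightarrow> nat \<Rightarrow> real" where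
  "rest_proj k = resid n (map cl [l\<leftarrow>[0..<d]. l \<noteq> k])"

text \<open>The squared distance of column \<open>k\<close> from the span of the other columns; it
  is a Schur complement of the Gram matrix.\<close>

definition schur :: "nat \<Rightarrow> real" where
  "schur k = ip n (cl k) (mv n (rest_proj k) (cl k))"

text \<open>Linear independence in terms of \<open>schur\<close>. In this form it is a measurable
  condition on the design and can be proved almost surely column by column.\<close>

definition full_rank :: bool where "full_rank \<longleftrightarrow> (\<forall>k<d. schur k \<noteq> 0)"

lemma rss_ip: "rss n d A y b = ip n (\<lambda>i. y i - (\<Sum>k<d. b k * cl k i)) (\<lambda>i. y i - (\<Sum>k<d. b k * cl k i))"
  by (simp add: rss_def ip_def cl_def power2_eq_square mult.commute)

lemma normal_equations:
  assumes "is_least_squares n d A y b" "k < d"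
  shows "ip n (cl k) (\<lambda>i. y i - (\<Sum>l<d. b l * cl l i)) = 0"
proof -
  let ?r = "\<lambda>i. y i - (\<Sum>l<d. b l * cl l i)"
  define g where "g = ip n (cl k) ?r"
  define c where "c = ip n (cl k) (cl k)"
  have min: "ip n ?r ?r \<le> ip n ?r ?r - 2 * t * g + t\<^sup>2 * c" for t
  proof -
    define b' where "b' l = b l + (if l = k then t else 0)" for l
    have "(\<Sum>l<d. b' l * cl l i) = (\<Sum>l<d. b l * cl l i) + t * cl k i" for i
      using assms(2) by (simp add: b'_def distrib_right sum.distrib if_distrib[of "\<lambda>x. x * _"] cong: if_cong)
    then have "rss n d A y b' = ip n (\<lambda>i. ?r i - t * cl k i) (\<lambda>i. ?r i - t * cl k i)"
      by (simp add: rss_ip algebra_simps)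
    also have "\<dots> = (\<Sum>i<n. ?r i * ?r i - 2 * t * (cl k i * ?r i) + t\<^sup>2 * (cl k i * cl k i))"
      unfolding ip_def by (intro sum.cong refl) (simp add: power2_eq_square algebra_simps)
    also have "\<dots> = ip n ?r ?r - 2 * t * g + t\<^sup>2 * c"
      by (simp add: ip_def g_def c_def sum.distrib sum_subtractf sum_distrib_left)
    finally have e: "rss n d A y b' = ip n ?r ?r - 2 * t * g + t\<^sup>2 * c" .
    have "rss n d A y b \<le> rss n d A y b'" using assms(1) by (simp add: is_least_squares_def)
    then show ?thesis unfolding e by (simp only: rss_ip)
  qed
  have c0: "c \<ge> 0" by (simp add: c_def ip_nonneg)
  \<comment> \<open>The step along column \<open>k\<close> that would nearly minimize the quadratic;
    adding 1 to \<open>c\<close> covers a zero column. The inequality \<open>min\<close> then forces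
    \<open>t\<^sup>2 * (c + 2) \<le> 0\<close>.\<close>
  define t where "t = g / (c + 1)"
  have g: "g = t * (c + 1)" using c0 by (simp add: t_def)
  have "2 * t * g \<le> t\<^sup>2 * c" using min[of t] by linarith
  then have "t\<^sup>2 * (c + 2) \<le> 0" unfolding g by (simp add: power2_eq_square algebra_simps)
  then have "t\<^sup>2 \<le> 0" using c0 by (simp add: mult_le_0_iff)
  then have "g = 0" using g by simp
  then show ?thesis by (simp add: g_def)
qed

text \<open>\<open>resid_span\<close> supplies coefficients whose fit leaves exactly the projected
  response as residual. This residual is orthogonal to every column, so Pythagoras gives minimality,
  also without full rank.\<close>

lemma least_squares_exists: "\<exists>b. is_least_squares n d A y b"
proof -
  let ?P = "resid n (map cl [0..<d])"
  obtain a where a: "\<forall>i<n. y i - mv n ?P y i = (\<Sum>t<length (map cl [0..<d]). a t * (map cl [0..<d] ! t) i)"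
    using resid_span by blast
  define b where "b k = (if k < d then a k else 0)" for k
  have r: "y i - (\<Sum>k<d. b k * cl k i) = mv n ?P y i" if "i < n" for i
    using a that by (simp add: b_def algebra_simps)
  have orth: "ip n (cl k) (mv n ?P y) = 0" if "k < d" for k
  proof -
    have "ip n (cl k) (mv n ?P y) = ip n (mv n ?P (cl k)) y" by (rule ip_mv_sym[symmetric]) (rule resid_sym)
    also have "\<dots> = 0" using mv_resid_member[of "cl k" "map cl [0..<d]"] that by (simp add: ip_def)
    finally show ?thesis .
  qed
  have "rss n d A y b \<le> rss n d A y b'" for b'
  proof -
    define e where "e i = (\<Sum>k<d. (b k - b' k) * cl k i)" for i
    have r': "y i - (\<Sum>k<d. b' k * cl k i) = mv n ?P y i + e i" if "i < n" for i
      using r[OF that] by (simp add: e_def left_diff_distrib sum_subtractf)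
    have "rss n d A y b' = ip n (\<lambda>i. mv n ?P y i + e i) (\<lambda>i. mv n ?P y i + e i)"
      unfolding rss_ip by (rule ip_cong) (auto simp: r')
    also have "\<dots> = ip n (mv n ?P y) (mv n ?P y) + 2 * ip n (mv n ?P y) e + ip n e e"
      by (simp add: ip_def sum.distrib algebra_simps sum_distrib_left)
    also have "ip n (mv n ?P y) e = (\<Sum>k<d. (b k - b' k) * ip n (mv n ?P y) (cl k))"
      unfolding e_def by (rule ip_sum_right)
    also have "\<dots> = 0" using orth by (simp add: ip_commute)
    finally have "rss n d A y b' = ip n (mv n ?P y) (mv n ?P y) + ip n e e" by simp
    moreover have "rss n d A y b = ip n (mv n ?P y) (mv n ?P y)"
      unfolding rss_ip by (rule ip_cong) (auto simp: r)
    ultimately show ?thesis using ip_nonneg[of n e] by simp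
  qed
  then show ?thesis by (intro exI[of _ b]) (auto simp: is_least_squares_def b_def)
qed

lemma rest_proj_other: "l < d \<Longrightarrow> l \<noteq> k \<Longrightarrow> i < n \<Longrightarrow> mv n (rest_proj k) (cl l) i = 0"
  unfolding rest_proj_def by (rule mv_resid_member) auto

text \<open>The Frisch-Waugh-Lovell identity: \<open>rest_proj k\<close> annihilates all other
  columns and keeps the residual, which is orthogonal to column \<open>k\<close>.\<close>

lemma least_squares_coefficient:
  assumes b: "is_least_squares n d A y b" and k: "k < d"
  shows "ip n (cl k) (mv n (rest_proj k) y) = b k * schur k"
proof -
  let ?r = "\<lambda>i. y i - (\<Sum>l<d. b l * cl l i)"
  have r: "mv n (rest_proj k) ?r i = ?r i" if "i < n" for i
    unfolding rest_proj_def using normal_equations[OF b] that by (intro mv_resid_orthogonal) auto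
  have "mv n (rest_proj k) (\<lambda>i. \<Sum>l<d. b l * cl l i) i = b k * mv n (rest_proj k) (cl k) i" if "i < n" for i
  proof -
    have "mv n (rest_proj k) (\<lambda>i. \<Sum>l<d. b l * cl l i) i = (\<Sum>l<d. b l * mv n (rest_proj k) (cl l) i)" by (rule mv_sum)
    also have "\<dots> = (\<Sum>l<d. if l = k then b l * mv n (rest_proj k) (cl l) i else 0)"
      using that by (intro sum.cong refl) (simp add: rest_proj_other)
    finally show ?thesis using k by simp
  qed
  then have "mv n (rest_proj k) y i = ?r i + b k * mv n (rest_proj k) (cl k) i" if "i < n" for i
    using r[OF that] mv_diff[of n "rest_proj k" y "\<lambda>i. \<Sum>l<d. b l * cl l i" i] that by simp
  then have "ip n (cl k) (mv n (rest_proj k) y) = ip n (cl k) (\<lambda>i. ?r i + b k * mv n (rest_proj k) (cl k) i)"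
    by (intro ip_cong) auto
  also have "\<dots> = ip n (cl k) ?r + ip n (cl k) (\<lambda>i. b k * mv n (rest_proj k) (cl k) i)" by (rule ip_add_right)
  also have "ip n (cl k) ?r = 0" by (rule normal_equations[OF b k])
  also have "ip n (cl k) (\<lambda>i. b k * mv n (rest_proj k) (cl k) i) = b k * schur k"
    by (simp add: schur_def ip_def sum_distrib_left mult_ac)
  finally show ?thesis by simp
qed

lemma schur_0_dependent:
  assumes "k < d" "schur k = 0"
  shows "\<exists>a. a k = -1 \<and> (\<forall>l\<ge>d. a l = 0) \<and> (\<forall>i<n. (\<Sum>l<d. a l * cl l i) = 0)"
proof -
  let ?ks = "[l\<leftarrow>[0..<d]. l \<noteq> k]"
  have z: "mv n (rest_proj k) (cl k) i = 0" if "i < n" for i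
    using assms(2) that unfolding schur_def rest_proj_def ip_resid by (rule ip_self_eq_0)
  obtain a where a: "\<forall>i<n. cl k i - mv n (rest_proj k) (cl k) i = (\<Sum>t<length (map cl ?ks). a t * (map cl ?ks ! t) i)"
    unfolding rest_proj_def using resid_span by blast
  \<comment> \<open>\<open>resid_span\<close> numbers the coefficients by position in the list;
    \<open>inv\<close> translates a column into its position.\<close>
  define inv where "inv l = (THE t. t < length ?ks \<and> ?ks ! t = l)" for l
  have dk: "distinct ?ks" by simp
  have inv: "inv (?ks ! t) = t" if "t < length ?ks" for t
    unfolding inv_def using that dk by (intro the_equality) (auto simp: nth_eq_iff_index_eq)
  define b where "b l = (if l = k then -1 else if l < d then a (inv l) else 0)" for l
  have "(\<Sum>l<d. b l * cl l i) = 0" if i: "i < n" for i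
  proof -
    have "(\<Sum>t<length ?ks. a t * cl (?ks ! t) i) = (\<Sum>t<length ?ks. a (inv (?ks ! t)) * cl (?ks ! t) i)"
      by (intro sum.cong refl) (simp add: inv)
    also have "\<dots> = (\<Sum>l\<in>set ?ks. a (inv l) * cl l i)"
      by (rule sum.reindex_bij_betw[OF bij_betw_nth[OF dk refl refl], where g="\<lambda>l. a (inv l) * cl l i"])
    also have "set ?ks = {..<d} - {k}" by auto
    finally have "(\<Sum>l\<in>{..<d} - {k}. a (inv l) * cl l i) = cl k i" using a z i by simp
    moreover have "(\<Sum>l<d. b l * cl l i) = b k * cl k i + (\<Sum>l\<in>{..<d} - {k}. b l * cl l i)"
      using assms(1) by (subst sum.remove[of _ k]) auto
    moreover have "(\<Sum>l\<in>{..<d} - {k}. b l * cl l i) = (\<Sum>l\<in>{..<d} - {k}. a (inv l) * cl l i)"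
      by (intro sum.cong) (auto simp: b_def)
    ultimately show ?thesis by (simp add: b_def)
  qed
  then show ?thesis using assms(1) by (intro exI[of _ b]) (auto simp: b_def)
qed

text \<open>With full rank, \<open>least_squares_coefficient\<close> determines every coefficient.
  Otherwise adding the vanishing combination from \<open>schur_0_dependent\<close>, whose entry at
  \<open>k\<close> is -1, produces a second minimizer.\<close>

lemma unique_least_squares_iff: "(\<exists>!b. is_least_squares n d A y b) \<longleftrightarrow> full_rank"
proof
  assume u: "\<exists>!b. is_least_squares n d A y b"
  then obtain b where b: "is_least_squares n d A y b" by blast
  show full_rank
    unfolding full_rank_def
  proof (intro allI impI notI)
    fix k assume "k < d" "schur k = 0"
    then obtain a where a: "a k = -1" "\<forall>l\<ge>d. a l = 0" "\<forall>i<n. (\<Sum>l<d. a l * cl l i) = 0"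
      using schur_0_dependent by blast
    define b' where "b' l = b l + a l" for l
    have "(\<Sum>l<d. b' l * cl l i) = (\<Sum>l<d. b l * cl l i)" if "i < n" for i
      using a(3) that by (simp add: b'_def distrib_right sum.distrib)
    then have "rss n d A y b' = rss n d A y b" unfolding rss_ip by (intro ip_cong) auto
    then have "is_least_squares n d A y b'" using b a(2) by (auto simp: is_least_squares_def b'_def)
    then have e: "b' = b" using u b by blast
    show False using a(1) fun_cong[OF e, of k] by (simp add: b'_def)
  qed
next
  assume f: full_rank
  obtain b where b: "is_least_squares n d A y b" using least_squares_exists by blast
  show "\<exists>!b. is_least_squares n d A y b"
  proof (rule ex1I[of _ b])
    show "is_least_squares n d A y b" by (rule b)
    fix b' assume b': "is_least_squares n d A y b'"
    show "b' = b"
    proof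
      fix k
      show "b' k = b k"
      proof (cases "k < d")
        case True
        then have "b' k * schur k = b k * schur k"
          using least_squares_coefficient[OF b True] least_squares_coefficient[OF b' True] by simp
        then show ?thesis using f True by (simp add: full_rank_def)
      next
        case False
        then show ?thesis using b b' by (simp add: is_least_squares_def)
      qed
    qed
  qed
qed

lemma least_squares_is: "full_rank \<Longrightarrow> is_least_squares n d A y (least_squares n d A y)"
  unfolding least_squares_def using unique_least_squares_iff[of y] by (simp add: theI')

text \<open>An explicit expression, including the default 0, from which the measurability of the
  estimator is read off.\<close>

lemma least_squares_formula:
  "least_squares n d A y k = (if full_rank \<and> k < d then ip n (cl k) (mv n (rest_proj k) y) / schur k else 0)"
proof (cases full_rank)
  case True
  then have b: "is_least_squares n d A y (least_squares n d A y)" by (rule least_squares_is)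
  show ?thesis
  proof (cases "k < d")
    case k: True
    then show ?thesis using least_squares_coefficient[OF b k] True by (simp add: full_rank_def)
  next
    case False
    then show ?thesis using b by (simp add: is_least_squares_def)
  qed
next
  case False
  then show ?thesis unfolding least_squares_def using unique_least_squares_iff[of y] by simp
qed

text \<open>Every column lowers the trace by exactly 1: a column with residual 0 after some of the
  others also has residual 0 after all of them, which \<open>full_rank\<close> forbids.\<close>

lemma resid_trace_full_rank:
  assumes f: full_rank and "distinct ks" "set ks \<subseteq> {..<d}"
  shows "(\<Sum>i<n. resid n (map cl ks) i i) = real n - real (length ks)"
  using assms(2,3)
proof (induction ks)
  case (Cons k ks)
  let ?P = "resid n (map cl ks)"
  have "ip n (cl k) (mv n ?P (cl k)) \<noteq> 0"
  proof
    assume z: "ip n (cl k) (mv n ?P (cl k)) = 0"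
    then have z: "mv n ?P (cl k) i = 0" if "i < n" for i using that unfolding ip_resid by (rule ip_self_eq_0)
    obtain a where a: "\<forall>i<n. cl k i - mv n ?P (cl k) i = (\<Sum>t<length (map cl ks). a t * (map cl ks ! t) i)"
      using resid_span by blast
    then have c: "cl k i = (\<Sum>t<length ks. a t * cl (ks ! t) i)" if "i < n" for i using z that by simp
    have "mv n (rest_proj k) (cl k) i = 0" if "i < n" for i
    proof -
      have "mv n (rest_proj k) (cl k) i = mv n (rest_proj k) (\<lambda>i. \<Sum>t<length ks. a t * cl (ks ! t) i) i"
        by (rule fun_cong[OF mv_cong[OF c]])
      also have "\<dots> = (\<Sum>t<length ks. a t * mv n (rest_proj k) (cl (ks ! t)) i)" by (rule mv_sum)
      also have "\<dots> = 0"
      proof (rule sum.neutral, rule ballI)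
        fix t assume "t \<in> {..<length ks}"
        then have "ks ! t \<in> set ks" by simp
        then have "ks ! t < d" "ks ! t \<noteq> k" using Cons.prems by auto
        then show "a t * mv n (rest_proj k) (cl (ks ! t)) i = 0" using rest_proj_other that by simp
      qed
      finally show ?thesis .
    qed
    then have "schur k = 0" by (simp add: schur_def ip_def)
    then show False using f Cons.prems by (simp add: full_rank_def)
  qed
  then show ?case using Cons resid_trace_Cons[of n "cl k" "map cl ks"] by simp
qed simp

end

text \<open>No inverse matrix is formed. With \<open>B\<close> the largest unknown in absolute
  value, each \<open>x f\<close> is within \<open>card F * d * B \<le> B / 2\<close> of
  \<open>r f / m\<close>. Hence \<open>B \<le> rho + B / 2\<close>, and
  \<open>B \<le> 2 * rho\<close> is put back into this estimate.\<close>

lemma near_identity_system: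
  fixes G :: "'f \<Rightarrow> 'f \<Rightarrow> real"
  assumes F: "finite F" "F \<noteq> {}" and m: "m > 0"
    and sys: "\<And>f. f \<in> F \<Longrightarrow> r f = (\<Sum>l\<in>F. G f l * x l)"
    and G: "\<And>f l. f \<in> F \<Longrightarrow> l \<in> F \<Longrightarrow> \<bar>G f l / m - (if f = l then 1 else 0)\<bar> \<le> d"
    and d: "real (card F) * d \<le> 1 / 2" and rho: "\<And>f. f \<in> F \<Longrightarrow> \<bar>r f / m\<bar> \<le> rho" and f: "f \<in> F"
  shows "\<bar>x f - r f / m\<bar> \<le> 2 * real (card F) * d * rho"
proof -
  define B where "B = Max ((\<lambda>l. \<bar>x l\<bar>) ` F)"
  have B: "\<bar>x l\<bar> \<le> B" if "l \<in> F" for l unfolding B_def using F(1) that by (intro Max_ge) auto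
  have B0: "B \<ge> 0" using B[OF f] by linarith
  have d0: "d \<ge> 0" using G[OF f f] by linarith
  have dev: "\<bar>x f - r f / m\<bar> \<le> real (card F) * d * B" if f: "f \<in> F" for f
  proof -
    have "(\<Sum>l\<in>F. (if f = l then 1 else 0) * x l) = x f"
      using F(1) f by (simp add: if_distrib[of "\<lambda>y. y * _"] cong: if_cong)
    moreover have "r f / m = (\<Sum>l\<in>F. G f l / m * x l)" unfolding sys[OF f] by (simp add: sum_divide_distrib)
    ultimately have "r f / m - x f = (\<Sum>l\<in>F. (G f l / m - (if f = l then 1 else 0)) * x l)"
      by (simp add: left_diff_distrib sum_subtractf)
    then have "\<bar>r f / m - x f\<bar> \<le> (\<Sum>l\<in>F. \<bar>(G f l / m - (if f = l then 1 else 0)) * x l\<bar>)"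
      using sum_abs[of "\<lambda>l. (G f l / m - (if f = l then 1 else 0)) * x l" F] by simp
    then have "\<bar>x f - r f / m\<bar> \<le> (\<Sum>l\<in>F. \<bar>(G f l / m - (if f = l then 1 else 0)) * x l\<bar>)"
      by (simp only: abs_minus_commute)
    also have "\<dots> \<le> (\<Sum>l\<in>F. d * B)"
      using G[OF f] B d0 unfolding abs_mult by (intro sum_mono mult_mono) auto
    finally show ?thesis by simp
  qed
  have "B \<in> (\<lambda>l. \<bar>x l\<bar>) ` F" unfolding B_def using F by (intro Max_in) auto
  then obtain l where l: "l \<in> F" "B = \<bar>x l\<bar>" by blast
  have "real (card F) * d * B \<le> 1 / 2 * B" using d B0 by (rule mult_right_mono)
  then have "B \<le> rho + 1 / 2 * B" using dev[OF l(1)] rho[OF l(1)] l(2) by linarith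
  then have "B \<le> 2 * rho" by simp
  then have "real (card F) * d * B \<le> real (card F) * d * (2 * rho)" using d0 by (intro mult_left_mono) auto
  then show ?thesis using dev[OF f] by simp
qed

section \<open>Ordinary least squares statistic\<close>

lemma (in prob_space) distributed_atom:
  fixes Y :: "'a \<Rightarrow> real"
  assumes D: "distributed M lborel Y f"
  shows "prob {\<omega>\<in>space M. Y \<omega> = a} = 0"
proof -
  have m[measurable]: "Y \<in> borel_measurable M" using distributed_measurable[OF D] by simp
  have "emeasure M {\<omega>\<in>space M. Y \<omega> = a} = emeasure (distr M lborel Y) {a}"
    by (subst emeasure_distr) (auto intro!: arg_cong[where f="emeasure M"])
  also have "\<dots> = emeasure (density lborel f) {a}" by (simp add: distributed_distr_eq_density[OF D])
  also have "\<dots> = (\<integral>\<^sup>+x. f x * indicator {a} x \<partial>lborel)"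
    using distributed_borel_measurable[OF D] by (intro emeasure_density) auto
  also have "\<dots> = 0" by (rule nn_integral_null_set) auto
  finally show ?thesis by (simp add: measure_def)
qed

lemma measurable_ip_mv:
  assumes "\<And>i. i < n \<Longrightarrow> (\<lambda>\<omega>. u \<omega> i) \<in> borel_measurable N" "\<And>i l. (\<lambda>\<omega>. P \<omega> i l) \<in> borel_measurable N"
    and "\<And>i. i < n \<Longrightarrow> (\<lambda>\<omega>. v \<omega> i) \<in> borel_measurable N"
  shows "(\<lambda>\<omega>. ip n (u \<omega>) (mv n (P \<omega>) (v \<omega>))) \<in> borel_measurable N"
  unfolding ip_def mv_def using assms by (intro borel_measurable_sum borel_measurable_times) auto

section \<open>The least squares system for four columns at a fixed sample size\<close>

context std_model
begin

definition design_all :: "'a \<Rightarrow> nat \<Rightarrow> nat \<Rightarrow> real" where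
  "design_all \<omega> i k = (if k < p then X \<omega> i k else Xt \<omega> i (k - p))"

lemma cl_design: "k < 2 * p \<Longrightarrow> cl (design_all \<omega>) k = (\<lambda>i. C \<omega> i k)"
  by (auto simp: fun_eq_iff cl_def design_all_def C_simps)

definition full :: "'a \<Rightarrow> bool" where "full \<omega> \<longleftrightarrow> full_rank n (2 * p) (design_all \<omega>)"

lemma map_cl: "set ks \<subseteq> {..<2 * p} \<Longrightarrow> map (cl (design_all \<omega>)) ks = map (\<lambda>k i. C \<omega> i k) ks"
  by (auto simp: cl_design)

lemma resid_restrict:
  assumes "set ks \<subseteq> {..<2 * p}" "block n p (set ks) \<subseteq> L"
  shows "resid n (map (\<lambda>k i. C \<omega> i k) ks) = resid n (map (\<lambda>k i. restrict (\<lambda>s. dat s \<omega>) L (col p i k)) ks)"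
  using assms by (intro resid_cong) (auto simp: list_all2_conv_all_nth C_def block_def subset_eq)

lemma resid_C_meas:
  assumes "set ks \<subseteq> {..<2 * p}"
  shows "(\<lambda>\<omega>. resid n (map (\<lambda>k i. C \<omega> i k) ks) i l) \<in> borel_measurable M"
  using assms by (intro measurable_resid C_meas) auto

lemma schur_eq:
  assumes "k < 2 * p"
  shows "schur n (2 * p) (design_all \<omega>) k =
    ip n (\<lambda>i. C \<omega> i k) (mv n (resid n (map (\<lambda>k i. C \<omega> i k) [l\<leftarrow>[0..<2 * p]. l \<noteq> k])) (\<lambda>i. C \<omega> i k))"
  using assms unfolding schur_def rest_proj_def by (subst map_cl) (auto simp: cl_design)

lemma schur_meas: "k < 2 * p \<Longrightarrow> (\<lambda>\<omega>. schur n (2 * p) (design_all \<omega>) k) \<in> borel_measurable M"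
proof -
  assume k: "k < 2 * p"
  then show ?thesis
    unfolding schur_eq[OF k] by (intro measurable_ip_mv resid_C_meas C_meas) auto
qed

lemma full_meas: "Measurable.pred M full"
proof -
  have "Measurable.pred M (\<lambda>\<omega>. \<forall>k\<in>{..<2 * p}. schur n (2 * p) (design_all \<omega>) k \<noteq> 0)"
  proof (rule pred_intros_finite(3))
    fix k assume "k \<in> {..<2 * p}"
    then have [measurable]: "(\<lambda>\<omega>. schur n (2 * p) (design_all \<omega>) k) \<in> borel_measurable M" by (intro schur_meas) auto
    show "Measurable.pred M (\<lambda>\<omega>. schur n (2 * p) (design_all \<omega>) k \<noteq> 0)" by measurable
  qed simp
  moreover have "full = (\<lambda>\<omega>. \<forall>k\<in>{..<2 * p}. schur n (2 * p) (design_all \<omega>) k \<noteq> 0)"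
    by (auto simp: fun_eq_iff full_def full_rank_def)
  ultimately show ?thesis by (simp only:)
qed

text \<open>With the other columns fixed, the projection has positive trace and so a nonzero
  diagonal entry \<open>(i, i)\<close>. A zero Schur complement would make coordinate
  \<open>i\<close> of the projected column vanish, but this coordinate is a nondegenerate normal
  variable.\<close>

lemma schur_nonzero:
  assumes k: "k < 2 * p" and np: "2 * p \<le> n"
  shows "AE \<omega> in M. schur n (2 * p) (design_all \<omega>) k \<noteq> 0"
proof -
  let ?ks = "[l\<leftarrow>[0..<2 * p]. l \<noteq> k]"
  let ?K = "block n p {k}" and ?L = "block n p (set ?ks)"
  let ?PK = "PiM ?K (\<lambda>_. borel) :: (index \<Rightarrow> real) measure" and ?PL = "PiM ?L (\<lambda>_. borel) :: (index \<Rightarrow> real) measure"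
  let ?RK = "\<lambda>\<omega>. restrict (\<lambda>s. dat s \<omega>) ?K" and ?RL = "\<lambda>\<omega>. restrict (\<lambda>s. dat s \<omega>) ?L"
  let ?R = "\<lambda>y. resid n (map (\<lambda>l i. y (col p i l)) ?ks)" and ?c = "\<lambda>(x::index \<Rightarrow> real) i. x (col p i k)"
  have sub: "{k} \<subseteq> {..2 * p}" "set ?ks \<subseteq> {..2 * p}" using k by auto
  have ind: "indep_var ?PK ?RK ?PL ?RL"
    using block_idx[OF sub(1)] block_idx[OF sub(2)] block_Int[OF sub] by (intro indep_var_restrict[OF dat_indep]) auto
  define q where "q z = ip n (?c (fst z)) (mv n (?R (snd z)) (?c (fst z)))" for z
  have qm: "q \<in> borel_measurable (?PK \<Otimes>\<^sub>M ?PL)"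
    unfolding q_def[abs_def]
    by (intro measurable_ip_mv measurable_resid measurable_compose[OF measurable_fst measurable_coordinate]
        measurable_compose[OF measurable_snd measurable_coordinate])
  define B where "B = {z \<in> space (?PK \<Otimes>\<^sub>M ?PL). q z = 0}"
  have B: "B \<in> sets (?PK \<Otimes>\<^sub>M ?PL)" unfolding B_def using qm by measurable
  have kC: "?RK \<omega> (col p i k) = C \<omega> i k" if "i < n" for \<omega> i
    using that k by (intro restrict_dat_col[OF sub(1)]) auto
  have "prob {\<omega>\<in>space M. (?RK \<omega>, ?RL \<omega>) \<in> B} \<le> 0"
  proof (rule indep_prob_le[OF ind B])
    fix y :: "index \<Rightarrow> real"
    let ?P = "?R y"
    \<comment> \<open>Column \<open>k\<close> is left out, so the trace is at least
      \<open>n - 2 * p + 1\<close>, which is positive even if \<open>2 * p = n\<close>.\<close>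
    have "real (length ?ks) \<le> real (2 * p) - 1"
    proof -
      have "length ?ks = card (set ?ks)" by (simp add: distinct_card[symmetric])
      also have "set ?ks = {..<2 * p} - {k}" by auto
      also have "card \<dots> = 2 * p - 1" using k by simp
      finally show ?thesis using k by linarith
    qed
    then have "0 < (\<Sum>i<n. ?P i i)"
      using resid_trace_ge[of n "map (\<lambda>l i. y (col p i l)) ?ks"] np by simp
    have "\<exists>i<n. ?P i i \<noteq> 0"
    proof (rule ccontr)
      assume "\<not> (\<exists>i<n. ?P i i \<noteq> 0)"
      then have "(\<Sum>i<n. ?P i i) = 0" by (intro sum.neutral) auto
      with \<open>0 < (\<Sum>i<n. ?P i i)\<close> show False by simp
    qed
    then obtain i where i: "i < n" "?P i i \<noteq> 0" by blast
    define V where "V = (\<Sum>s\<in>?K. (?P i (row_of s))\<^sup>2)"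
    have V: "V > 0"
    proof -
      have "0 < (?P i i)\<^sup>2" using i by simp
      also have "(?P i i)\<^sup>2 \<le> (\<Sum>l<n. (?P i l)\<^sup>2)" using i(1) by (intro member_le_sum) auto
      also have "\<dots> = V" unfolding V_def sum_block[OF sub(1)] by simp
      finally show ?thesis .
    qed
    define U where "U \<omega> = (\<Sum>s\<in>?K. ?P i (row_of s) * dat s \<omega>)" for \<omega>
    have D: "distributed M lborel U (normal_density 0 (sqrt V))"
      unfolding U_def[abs_def] using sub k by (intro linear_form_normal finite_block indep_vars_subset[OF dat_indep block_idx[OF sub(1)]] V_def[symmetric] V dat_normal)
        (auto simp: block_def)
    have "{\<omega>\<in>space M. (?RK \<omega>, y) \<in> B} \<subseteq> {\<omega>\<in>space M. U \<omega> = 0}"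
    proof safe
      fix \<omega> assume "\<omega> \<in> space M" "(?RK \<omega>, y) \<in> B"
      then have "ip n (?c (?RK \<omega>)) (mv n ?P (?c (?RK \<omega>))) = 0" by (simp add: B_def q_def)
      then have "mv n ?P (?c (?RK \<omega>)) i = 0" using i(1) unfolding ip_resid by (rule ip_self_eq_0)
      moreover have "mv n ?P (?c (?RK \<omega>)) i = mv n ?P (\<lambda>l. C \<omega> l k) i"
        by (rule fun_cong[OF mv_cong]) (rule kC)
      moreover have "U \<omega> = mv n ?P (\<lambda>l. C \<omega> l k) i"
        unfolding U_def sum_block[OF sub(1)] mv_def C_def by simp
      ultimately show "U \<omega> = 0" by (simp only:)
    qed
    then have "prob {\<omega>\<in>space M. (?RK \<omega>, y) \<in> B} \<le> prob {\<omega>\<in>space M. U \<omega> = 0}"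
    proof (rule finite_measure_mono)
      have [measurable]: "U \<in> borel_measurable M" using distributed_measurable[OF D] by simp
      show "{\<omega>\<in>space M. U \<omega> = 0} \<in> events" by measurable
    qed
    also have "\<dots> = 0" by (rule distributed_atom[OF D])
    finally show "prob {\<omega>\<in>space M. (?RK \<omega>, y) \<in> B} \<le> 0" .
  qed simp
  moreover have "{\<omega>\<in>space M. (?RK \<omega>, ?RL \<omega>) \<in> B} = {\<omega>\<in>space M. schur n (2 * p) (design_all \<omega>) k = 0}"
  proof -
    have R: "?R (?RL \<omega>) = resid n (map (\<lambda>k i. C \<omega> i k) ?ks)" for \<omega>
      by (rule resid_restrict[symmetric]) auto
    have "(?RK \<omega>, ?RL \<omega>) \<in> space (?PK \<Otimes>\<^sub>M ?PL)" for \<omega> by (simp add: space_pair_measure space_PiM)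
    moreover have "ip n (?c (?RK \<omega>)) (mv n (?R (?RL \<omega>)) (?c (?RK \<omega>))) = schur n (2 * p) (design_all \<omega>) k" for \<omega>
    proof -
      have "mv n (?R (?RL \<omega>)) (?c (?RK \<omega>)) = mv n (?R (?RL \<omega>)) (\<lambda>i. C \<omega> i k)"
        by (rule mv_cong) (rule kC)
      then have "ip n (?c (?RK \<omega>)) (mv n (?R (?RL \<omega>)) (?c (?RK \<omega>)))
          = ip n (?c (?RK \<omega>)) (mv n (?R (?RL \<omega>)) (\<lambda>i. C \<omega> i k))" by (simp only:)
      also have "\<dots> = ip n (\<lambda>i. C \<omega> i k) (mv n (?R (?RL \<omega>)) (\<lambda>i. C \<omega> i k))"
        by (rule ip_cong) (rule kC, assumption, rule refl)
      finally show ?thesis unfolding schur_eq[OF k] R .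
    qed
    ultimately show ?thesis unfolding B_def q_def by simp
  qed
  ultimately have "prob {\<omega>\<in>space M. schur n (2 * p) (design_all \<omega>) k = 0} = 0"
    by (simp add: measure_le_0_iff)
  moreover have [measurable]: "(\<lambda>\<omega>. schur n (2 * p) (design_all \<omega>) k) \<in> borel_measurable M" by (rule schur_meas[OF k])
  ultimately show ?thesis
    by (intro AE_I[where N="{\<omega>\<in>space M. schur n (2 * p) (design_all \<omega>) k = 0}"]) (auto simp: emeasure_eq_measure)
qed

lemma full_AE:
  assumes "2 * p \<le> n" shows "AE \<omega> in M. full \<omega>"
proof -
  have "AE \<omega> in M. \<forall>k\<in>{..<2 * p}. schur n (2 * p) (design_all \<omega>) k \<noteq> 0"
    using schur_nonzero[OF _ assms] by (intro AE_finite_allI) auto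
  then show ?thesis by eventually_elim (auto simp: full_def full_rank_def)
qed

definition four :: "nat \<Rightarrow> nat \<Rightarrow> nat set" where "four j k = {j, k, j + p, k + p}"

definition rest_list :: "nat \<Rightarrow> nat \<Rightarrow> nat list" where "rest_list j k = [l\<leftarrow>[0..<2 * p]. l \<notin> four j k]"

definition R :: "nat \<Rightarrow> nat \<Rightarrow> 'a \<Rightarrow> nat \<Rightarrow> nat \<Rightarrow> real" where
  "R j k \<omega> = resid n (map (\<lambda>l i. C \<omega> i l) (rest_list j k))"

definition bil :: "nat \<Rightarrow> nat \<Rightarrow> nat \<Rightarrow> nat \<Rightarrow> 'a \<Rightarrow> real" where
  "bil j k a b \<omega> = ip n (\<lambda>i. C \<omega> i a) (mv n (R j k \<omega>) (\<lambda>i. C \<omega> i b))"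

text \<open>The trace of \<open>R j k\<close> under full rank: \<open>n\<close> minus the
  \<open>2 * p - 4\<close> columns projected out.\<close>

definition dof :: real where "dof = real n - 2 * real p + 4"

lemma rest_list_sub: "set (rest_list j k) \<subseteq> {..<2 * p}"
  by (auto simp: rest_list_def)

lemma length_rest_list:
  assumes "j < p" "k < p" "j \<noteq> k"
  shows "real (length (rest_list j k)) = 2 * real p - 4" and "2 \<le> p"
proof -
  show "2 \<le> p" using assms by linarith
  have "length (rest_list j k) = card (set (rest_list j k))" by (simp add: rest_list_def distinct_card[symmetric])
  also have "set (rest_list j k) = {..<2 * p} - four j k" by (auto simp: rest_list_def)
  also have "card \<dots> = 2 * p - card (four j k)"
    using assms by (subst card_Diff_subset) (auto simp: four_def)
  also have "card (four j k) = 4" using assms by (simp add: four_def)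
  finally show "real (length (rest_list j k)) = 2 * real p - 4" using \<open>2 \<le> p\<close> by linarith
qed

lemma R_trace:
  assumes "j < p" "k < p" "j \<noteq> k" "full \<omega>"
  shows "(\<Sum>i<n. R j k \<omega> i i) = dof" "(\<Sum>i<n. \<Sum>l<n. (R j k \<omega> i l)\<^sup>2) = dof"
proof -
  have "(\<Sum>i<n. resid n (map (cl (design_all \<omega>)) (rest_list j k)) i i) = real n - real (length (rest_list j k))"
    using assms(4) rest_list_sub unfolding full_def by (intro resid_trace_full_rank) (auto simp: rest_list_def)
  then show t: "(\<Sum>i<n. R j k \<omega> i i) = dof"
    unfolding R_def map_cl[OF rest_list_sub] length_rest_list(1)[OF assms(1-3)] dof_def by simp
  show "(\<Sum>i<n. \<Sum>l<n. (R j k \<omega> i l)\<^sup>2) = dof"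
    using t unfolding R_def resid_frobenius .
qed

lemma R_meas: "(\<lambda>\<omega>. R j k \<omega> i l) \<in> borel_measurable M"
  unfolding R_def by (rule resid_C_meas[OF rest_list_sub])

lemma bil_meas:
  assumes "a \<le> 2 * p" "b \<le> 2 * p" shows "bil j k a b \<in> borel_measurable M"
  unfolding bil_def[abs_def] using assms by (intro measurable_ip_mv R_meas C_meas)

text \<open>\<open>R j k\<close> depends only on the projected columns. Almost surely the design has
  full rank, and then trace and squared Frobenius norm both equal \<open>dof\<close>, so the
  constraint in \<open>bilinear_form_bound\<close> holds with \<open>V = 2 * dof\<close>. The event
  without full rank is included at no cost.\<close>

lemma bil_bound:
  assumes jk: "j < p" "k < p" "j \<noteq> k" and np: "2 * p \<le> n"
    and ab: "a \<in> insert (2 * p) (four j k)" "b \<in> insert (2 * p) (four j k)" and t: "t > 0"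
  shows "{\<omega>\<in>space M. \<not> full \<omega> \<or> t \<le> \<bar>bil j k a b \<omega> - (if a = b then dof else 0)\<bar>} \<in> events"
    and "prob {\<omega>\<in>space M. \<not> full \<omega> \<or> t \<le> \<bar>bil j k a b \<omega> - (if a = b then dof else 0)\<bar>} \<le> 2 * dof / t\<^sup>2"
proof -
  have ab2: "a \<le> 2 * p" "b \<le> 2 * p" using ab jk by (auto simp: four_def)
  note [measurable] = full_meas bil_meas[OF ab2]
  show "{\<omega>\<in>space M. \<not> full \<omega> \<or> t \<le> \<bar>bil j k a b \<omega> - (if a = b then dof else 0)\<bar>} \<in> events" by measurable
  have dof: "dof > 0" using np unfolding dof_def by linarith
  let ?L = "block n p (set (rest_list j k))"
  let ?Pf = "\<lambda>y. resid n (map (\<lambda>l i. y (col p i l)) (rest_list j k))"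
  let ?bad = "{\<omega>\<in>space M. 2 * (\<Sum>i<n. \<Sum>i'<n. (R j k \<omega> i i')\<^sup>2) \<le> 2 * dof \<and>
      t \<le> \<bar>(\<Sum>i<n. \<Sum>i'<n. R j k \<omega> i i' * C \<omega> i a * C \<omega> i' b) - (if a = b then \<Sum>i<n. R j k \<omega> i i else 0)\<bar>}"
  have sub: "set (rest_list j k) \<subseteq> {..2 * p}" using rest_list_sub by fastforce
  have b: "prob ?bad \<le> 2 * dof / t\<^sup>2"
  proof (rule bilinear_form_bound[where L="?L" and Pf="?Pf", OF ab2 block_idx[OF sub]])
    show "block n p {a, b} \<inter> ?L = {}"
      using ab ab2 by (intro block_Int sub) (auto simp: rest_list_def)
    show "(\<lambda>y. ?Pf y i i') \<in> borel_measurable (PiM ?L (\<lambda>_. borel))" for i i'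
      by (intro measurable_resid measurable_coordinate)
    show "R j k \<omega> i i' = ?Pf (restrict (\<lambda>s. dat s \<omega>) ?L) i i'" for \<omega> i i'
      unfolding R_def by (subst resid_restrict[OF rest_list_sub order_refl]) simp
  qed (use t dof in auto)
  have bilsum: "bil j k a b \<omega> = (\<Sum>i<n. \<Sum>i'<n. R j k \<omega> i i' * C \<omega> i a * C \<omega> i' b)" for \<omega>
    by (simp add: bil_def ip_def mv_def sum_distrib_left mult_ac)
  have "prob {\<omega>\<in>space M. \<not> full \<omega> \<or> t \<le> \<bar>bil j k a b \<omega> - (if a = b then dof else 0)\<bar>} \<le> prob ?bad"
  proof (rule finite_measure_mono_AE)
    show "?bad \<in> events"
    proof -
      have [measurable]: "(\<lambda>\<omega>. C \<omega> i a) \<in> borel_measurable M" "(\<lambda>\<omega>. C \<omega> i b) \<in> borel_measurable M" if "i < n" for i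
        using that ab2 C_meas by auto
      have [measurable]: "(\<lambda>\<omega>. R j k \<omega> i l) \<in> borel_measurable M" for i l by (rule R_meas)
      show ?thesis by measurable
    qed
    show "AE x in M. x \<in> {\<omega>\<in>space M. \<not> full \<omega> \<or> t \<le> \<bar>bil j k a b \<omega> - (if a = b then dof else 0)\<bar>} \<longrightarrow> x \<in> ?bad"
      using full_AE[OF np]
    proof eventually_elim
      case (elim \<omega>)
      then show ?case using R_trace[OF jk elim] unfolding bilsum by (auto split: if_splits)
    qed
  qed
  with b show "prob {\<omega>\<in>space M. \<not> full \<omega> \<or> t \<le> \<bar>bil j k a b \<omega> - (if a = b then dof else 0)\<bar>} \<le> 2 * dof / t\<^sup>2" by simp
qed

definition ols_coef :: "'a \<Rightarrow> nat \<Rightarrow> real" where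
  "ols_coef \<omega> = least_squares n (2 * p) (design_all \<omega>) (response p (X \<omega>) (beta \<omega>) (eps \<omega>))"

definition ols_err :: "'a \<Rightarrow> nat \<Rightarrow> real" where
  "ols_err \<omega> l = ols_coef \<omega> l - (if l < p then beta \<omega> l else 0)"

text \<open>The residual is \<open>sigma\<close> times the noise column minus the error combination
  of all columns. Applying \<open>R j k\<close> keeps this residual, which is orthogonal to every
  column, and removes all columns except four; pairing with column \<open>f\<close> gives its normal
  equation.\<close>

lemma ols_system:
  assumes jk: "j < p" "k < p" "j \<noteq> k" and f: "f \<in> four j k" and full: "full \<omega>"
  shows "sigma * bil j k f (2 * p) \<omega> = (\<Sum>l\<in>four j k. bil j k f l \<omega> * ols_err \<omega> l)"
proof -
  let ?y = "response p (X \<omega>) (beta \<omega>) (eps \<omega>)" and ?A = "design_all \<omega>" and ?R = "R j k \<omega>"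
  let ?x = "ols_err \<omega>" and ?e = "\<lambda>i. C \<omega> i (2 * p)" and ?c = "\<lambda>l i. C \<omega> i l"
  have fsub: "four j k \<subseteq> {..<2 * p}" using jk by (auto simp: four_def)
  have ls: "is_least_squares n (2 * p) ?A ?y (ols_coef \<omega>)"
    unfolding ols_coef_def using full unfolding full_def by (rule least_squares_is)
  define r where "r i = ?y i - (\<Sum>l<2 * p. ols_coef \<omega> l * cl ?A l i)" for i
  have r: "r i = sigma * ?e i - (\<Sum>l<2 * p. ?x l * ?c l i)" for i
  proof -
    have "(\<Sum>l<2 * p. ?x l * ?c l i) = (\<Sum>l<2 * p. ols_coef \<omega> l * ?c l i) - (\<Sum>l<2 * p. (if l < p then beta \<omega> l else 0) * ?c l i)"
      by (simp add: ols_err_def left_diff_distrib sum_subtractf)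
    also have "(\<Sum>l<2 * p. (if l < p then beta \<omega> l else 0) * ?c l i) = (\<Sum>l<p. X \<omega> i l * beta \<omega> l)"
    proof -
      have "(\<Sum>l<2 * p. (if l < p then beta \<omega> l else 0) * ?c l i) = (\<Sum>l<2 * p. if l < p then X \<omega> i l * beta \<omega> l else 0)"
        by (intro sum.cong refl) (simp add: C_simps)
      also have "\<dots> = (\<Sum>l\<in>{..<2 * p} \<inter> {l. l < p}. X \<omega> i l * beta \<omega> l)" by (simp add: sum.If_cases)
      also have "{..<2 * p} \<inter> {l. l < p} = {..<p}" by auto
      finally show ?thesis .
    qed
    moreover have "(\<Sum>l<2 * p. ols_coef \<omega> l * cl ?A l i) = (\<Sum>l<2 * p. ols_coef \<omega> l * ?c l i)"
      by (intro sum.cong refl) (simp add: cl_design)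
    moreover have "sigma * ?e i = eps \<omega> i" using sigma_pos by (simp add: C_simps)
    ultimately show ?thesis unfolding r_def response_def by simp
  qed
  have orth: "ip n (?c l) r = 0" if "l < 2 * p" for l
    using normal_equations[OF ls that] unfolding r_def[symmetric] by (simp add: cl_design[OF that])
  have Rr: "mv n ?R r i = r i" if "i < n" for i
    unfolding R_def using orth rest_list_sub that by (intro mv_resid_orthogonal) auto
  have Rc: "mv n ?R (?c l) i = 0" if "l < 2 * p" "l \<notin> four j k" "i < n" for l i
    unfolding R_def using that by (intro mv_resid_member) (auto simp: rest_list_def)
  have "mv n ?R r i = sigma * mv n ?R ?e i - (\<Sum>l\<in>four j k. ?x l * mv n ?R (?c l) i)" if i: "i < n" for i
  proof -
    have "mv n ?R r i = mv n ?R (\<lambda>i. sigma * ?e i) i - mv n ?R (\<lambda>i. \<Sum>l<2 * p. ?x l * ?c l i) i"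
      unfolding r[abs_def] by (rule mv_diff)
    also have "mv n ?R (\<lambda>i. \<Sum>l<2 * p. ?x l * ?c l i) i = (\<Sum>l<2 * p. ?x l * mv n ?R (?c l) i)" by (rule mv_sum)
    also have "\<dots> = (\<Sum>l\<in>four j k. ?x l * mv n ?R (?c l) i)"
      using fsub Rc i by (intro sum.mono_neutral_right) auto
    also have "mv n ?R (\<lambda>i. sigma * ?e i) i = sigma * mv n ?R ?e i"
      by (simp add: mv_def sum_distrib_left mult_ac)
    finally show ?thesis .
  qed
  then have "ip n (?c f) r = ip n (?c f) (\<lambda>i. sigma * mv n ?R ?e i - (\<Sum>l\<in>four j k. ?x l * mv n ?R (?c l) i))"
    using Rr by (intro ip_cong) auto
  also have "\<dots> = ip n (?c f) (\<lambda>i. sigma * mv n ?R ?e i) - ip n (?c f) (\<lambda>i. \<Sum>l\<in>four j k. ?x l * mv n ?R (?c l) i)"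
    by (rule ip_diff_right)
  also have "ip n (?c f) (\<lambda>i. \<Sum>l\<in>four j k. ?x l * mv n ?R (?c l) i) = (\<Sum>l\<in>four j k. ?x l * bil j k f l \<omega>)"
    unfolding bil_def by (rule ip_sum_right)
  also have "ip n (?c f) (\<lambda>i. sigma * mv n ?R ?e i) = sigma * bil j k f (2 * p) \<omega>"
    by (simp add: bil_def ip_def sum_distrib_left mult_ac)
  finally show ?thesis using orth[of f] f fsub by (auto simp: mult.commute)
qed

definition proj_noise :: "nat \<Rightarrow> nat \<Rightarrow> 'a \<Rightarrow> nat \<Rightarrow> real" where
  "proj_noise j k \<omega> i = mv n (R j k \<omega>) (\<lambda>i. C \<omega> i (2 * p)) i"

text \<open>The norm of the projected noise is
  \<open>sqrt (bil j k (2 * p) (2 * p) \<omega>)\<close>, because \<open>R j k\<close> is symmetric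
  and idempotent.\<close>

lemma bil_diff:
  "bil j k l (2 * p) \<omega> - bil j k (l + p) (2 * p) \<omega>
    = sqrt (bil j k (2 * p) (2 * p) \<omega>) * sqrt 2 * proj_diff (proj_noise j k) l \<omega>"
proof -
  have n2: "(\<Sum>i<n. (proj_noise j k \<omega> i)\<^sup>2) = bil j k (2 * p) (2 * p) \<omega>"
    unfolding bil_def R_def ip_resid by (simp add: proj_noise_def R_def ip_def power2_eq_square)
  have "bil j k l (2 * p) \<omega> - bil j k (l + p) (2 * p) \<omega> = (\<Sum>i<n. (C \<omega> i l - C \<omega> i (l + p)) * proj_noise j k \<omega> i)"
    by (simp add: bil_def ip_def proj_noise_def sum_subtractf left_diff_distrib)
  also have "\<dots> = (\<Sum>i<n. sqrt (bil j k (2 * p) (2 * p) \<omega>) * (unit_vec n (proj_noise j k \<omega>) i * (C \<omega> i l - C \<omega> i (l + p))))"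
    by (intro sum.cong refl) (subst unit_vec_scale[of _ n "proj_noise j k \<omega>"], auto simp: n2)
  also have "\<dots> = sqrt (bil j k (2 * p) (2 * p) \<omega>) * (\<Sum>i<n. unit_vec n (proj_noise j k \<omega>) i * (C \<omega> i l - C \<omega> i (l + p)))"
    by (simp add: sum_distrib_left)
  also have "(\<Sum>i<n. unit_vec n (proj_noise j k \<omega>) i * (C \<omega> i l - C \<omega> i (l + p))) = sqrt 2 * proj_diff (proj_noise j k) l \<omega>"
    by (simp add: proj_diff_def)
  finally show ?thesis by simp
qed

lemma proj_noise_law:
  assumes jk: "j < p" "k < p" "j \<noteq> k"
  shows "proj_diff (proj_noise j k) j \<in> borel_measurable M \<and> proj_diff (proj_noise j k) k \<in> borel_measurable M \<and>
    distr M ((borel \<Otimes>\<^sub>M borel) \<Otimes>\<^sub>M (borel \<Otimes>\<^sub>M borel))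
      (\<lambda>\<omega>. ((a * (sqrt (real n) * beta \<omega> j), proj_diff (proj_noise j k) j \<omega>), (a * (sqrt (real n) * beta \<omega> k), proj_diff (proj_noise j k) k \<omega>)))
    = (distr nu borel (\<lambda>b. a * b) \<Otimes>\<^sub>M Nm) \<Otimes>\<^sub>M (distr nu borel (\<lambda>b. a * b) \<Otimes>\<^sub>M Nm)"
proof (rule proj_diff_law[OF jk])
  define Rf where "Rf y = resid n (map (\<lambda>l i. y (col p i l)) (rest_list j k))" for y :: "index \<Rightarrow> real"
  define wv where "wv y i = (\<Sum>l<n. Rf y i l * y (col p l (2 * p)))" for y i
  have [measurable]: "(\<lambda>y. Rf y i l) \<in> borel_measurable (PiM (others j k) (\<lambda>_. borel))" for i l
    unfolding Rf_def by (intro measurable_resid measurable_coordinate)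
  show "(\<lambda>y. wv y i) \<in> borel_measurable (PiM (others j k) (\<lambda>_. borel))" for i
    unfolding wv_def by measurable
  have in_others: "col p i l \<in> others j k" if "i < n" "l \<le> 2 * p" "l \<notin> four j k" for i l
  proof -
    have "col p i l \<in> idx" using that by (auto simp: idx_def block_def)
    moreover have "col p i l \<notin> block n p {j, k, j + p, k + p}"
      using that jk by (subst col_in_block) (auto simp: four_def)
    ultimately show ?thesis by (simp add: others_def)
  qed
  fix \<omega> i assume i: "i < n"
  have "block n p (set (rest_list j k)) \<subseteq> others j k"
    using in_others by (auto simp: block_def rest_list_def)
  then have "Rf (restrict (\<lambda>s. dat s \<omega>) (others j k)) = R j k \<omega>"
    unfolding Rf_def R_def by (intro resid_restrict[symmetric] rest_list_sub)
  moreover have "2 * p \<notin> four j k" using jk by (auto simp: four_def)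
  then have "restrict (\<lambda>s. dat s \<omega>) (others j k) (col p l (2 * p)) = C \<omega> l (2 * p)" if "l < n" for l
    using in_others[OF that] by (simp add: C_def)
  ultimately show "proj_noise j k \<omega> i = wv (restrict (\<lambda>s. dat s \<omega>) (others j k)) i"
    unfolding proj_noise_def wv_def mv_def by simp
qed

lemma ols_coef_meas:
  assumes l: "l < 2 * p"
  shows "(\<lambda>\<omega>. ols_coef \<omega> l) \<in> borel_measurable M"
proof -
  let ?ks = "[k\<leftarrow>[0..<2 * p]. k \<noteq> l]"
  have eq: "ols_coef \<omega> l = (if full \<omega> then ip n (\<lambda>i. C \<omega> i l) (mv n (resid n (map (\<lambda>k i. C \<omega> i k) ?ks))
      (response p (X \<omega>) (beta \<omega>) (eps \<omega>))) / schur n (2 * p) (design_all \<omega>) l else 0)" for \<omega>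
  proof -
    have "rest_proj n (2 * p) (design_all \<omega>) l = resid n (map (\<lambda>k i. C \<omega> i k) ?ks)"
      unfolding rest_proj_def by (subst map_cl) auto
    then show ?thesis
      unfolding ols_coef_def least_squares_formula using l by (simp add: full_def cl_design)
  qed
  have rm: "(\<lambda>\<omega>. response p (X \<omega>) (beta \<omega>) (eps \<omega>) i) \<in> borel_measurable M" if i: "i < n" for i
  proof -
    have "response p (X \<omega>) (beta \<omega>) (eps \<omega>) i = (\<Sum>k<p. C \<omega> i k * beta \<omega> k) + sigma * C \<omega> i (2 * p)" for \<omega>
      using sigma_pos by (simp add: response_def C_simps)
    moreover have "(\<lambda>\<omega>. (\<Sum>k<p. C \<omega> i k * beta \<omega> k) + sigma * C \<omega> i (2 * p)) \<in> borel_measurable M"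
      using i by (intro borel_measurable_add borel_measurable_sum borel_measurable_times C_meas beta_meas borel_measurable_const) auto
    ultimately show ?thesis by (simp only:)
  qed
  define g where "g \<omega> = ip n (\<lambda>i. C \<omega> i l) (mv n (resid n (map (\<lambda>k i. C \<omega> i k) ?ks))
      (response p (X \<omega>) (beta \<omega>) (eps \<omega>)))" for \<omega>
  define h where "h \<omega> = schur n (2 * p) (design_all \<omega>) l" for \<omega>
  have [measurable]: "g \<in> borel_measurable M"
    unfolding g_def[abs_def] using l by (intro measurable_ip_mv resid_C_meas C_meas rm) auto
  have [measurable]: "h \<in> borel_measurable M" unfolding h_def[abs_def] by (rule schur_meas[OF l])
  note [measurable] = full_meas
  have "(\<lambda>\<omega>. ols_coef \<omega> l) = (\<lambda>\<omega>. if full \<omega> then g \<omega> / h \<omega> else 0)"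
    unfolding eq g_def h_def ..
  also have "\<dots> \<in> borel_measurable M" by measurable
  finally show ?thesis .
qed

end

section \<open>Asymptotics of the four-column system\<close>

context model_seq
begin

abbreviation "bilS n \<equiv> std_model.bil n (p n) (X n) (Xt n) (eps n) (beta n) sigma"
abbreviation "fullS n \<equiv> std_model.full n (p n) (X n) (Xt n)"
abbreviation "errS n \<equiv> std_model.ols_err n (p n) (X n) (Xt n) (eps n) (beta n)"
abbreviation "olsS n \<equiv> std_model.ols_coef n (p n) (X n) (Xt n) (eps n) (beta n)"
abbreviation "noiseS n \<equiv> std_model.proj_noise n (p n) (X n) (Xt n) (eps n) (beta n) sigma"

definition dofS :: "nat \<Rightarrow> real" where "dofS n = real n - 2 * real (p n) + 4"

lemma dof_eq: "n \<ge> 1 \<Longrightarrow> std_model.dof n (p n) = dofS n"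
  by (simp add: std_model.dof_def[OF std] dofS_def)

text \<open>Fixed labels for columns that move with \<open>n\<close>: 0 to 3 are the two variables
  and their copies, 4 is the noise. Limits can thus be stated for fixed label pairs.\<close>

definition sel :: "(nat \<Rightarrow> nat) \<Rightarrow> (nat \<Rightarrow> nat) \<Rightarrow> nat \<Rightarrow> nat \<Rightarrow> nat" where
  "sel jj kk n t = (if t = 0 then jj n else if t = 1 then kk n else if t = 2 then jj n + p n
     else if t = 3 then kk n + p n else 2 * p n)"

lemma sel_inj:
  assumes "jj n < p n \<and> kk n < p n \<and> jj n \<noteq> kk n" "t \<le> 4" "u \<le> 4"
  shows "sel jj kk n t = sel jj kk n u \<longleftrightarrow> t = u"
  using assms unfolding sel_def by (auto simp: le_Suc_eq numeral_eq_Suc)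

lemma sel_four:
  assumes "n \<ge> 1"
  shows "std_model.four (p n) (jj n) (kk n) = sel jj kk n ` {..<4}"
proof -
  have "{..<4} = {0, 1, 2, 3 :: nat}" by auto
  then show ?thesis by (auto simp: std_model.four_def[OF std[OF assms]] sel_def)
qed

lemma sel_mem:
  assumes "n \<ge> 1" "t \<le> 4"
  shows "sel jj kk n t \<in> insert (2 * p n) (std_model.four (p n) (jj n) (kk n))"
proof (cases "t = 4")
  case True
  then show ?thesis by (simp add: sel_def)
next
  case False
  then show ?thesis using assms by (auto simp: sel_four[OF assms(1)])
qed

lemma bilS_bound:
  assumes n: "n \<ge> 1" and vn: "jj n < p n \<and> kk n < p n \<and> jj n \<noteq> kk n" and np: "2 * p n \<le> n"
    and tu: "t \<le> 4" "u \<le> 4" and T: "T > 0"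
  shows "{\<omega>\<in>space (M n). \<not> fullS n \<omega> \<or> T \<le> \<bar>bilS n (jj n) (kk n) (sel jj kk n t) (sel jj kk n u) \<omega> - (if t = u then dofS n else 0)\<bar>} \<in> sets (M n)"
    and "measure (M n) {\<omega>\<in>space (M n). \<not> fullS n \<omega> \<or> T \<le> \<bar>bilS n (jj n) (kk n) (sel jj kk n t) (sel jj kk n u) \<omega> - (if t = u then dofS n else 0)\<bar>} \<le> 2 * dofS n / T\<^sup>2"
proof -
  have e: "(if sel jj kk n t = sel jj kk n u then dofS n else 0) = (if t = u then dofS n else 0)"
    using sel_inj[of jj n kk, OF vn tu] by simp
  have jk: "jj n < p n" "kk n < p n" "jj n \<noteq> kk n" using vn by auto
  note b = std_model.bil_bound[OF std[OF n] jk np sel_mem[where jj=jj and kk=kk, OF n tu(1)]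
      sel_mem[where jj=jj and kk=kk, OF n tu(2)] T, unfolded dof_eq[OF n] e]
  show "{\<omega>\<in>space (M n). \<not> fullS n \<omega> \<or> T \<le> \<bar>bilS n (jj n) (kk n) (sel jj kk n t) (sel jj kk n u) \<omega> - (if t = u then dofS n else 0)\<bar>} \<in> sets (M n)"
    by (rule b(1))
  show "measure (M n) {\<omega>\<in>space (M n). \<not> fullS n \<omega> \<or> T \<le> \<bar>bilS n (jj n) (kk n) (sel jj kk n t) (sel jj kk n u) \<omega> - (if t = u then dofS n else 0)\<bar>} \<le> 2 * dofS n / T\<^sup>2"
    by (rule b(2))
qed

context
  assumes kappa_half: "kappa < 1/2"
begin

lemma dof_ratio: "(\<lambda>n. dofS n / real n) \<longlonglongrightarrow> 1 - 2 * kappa"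
proof -
  have "(\<lambda>n. 1 - 2 * (real (p n) / real n) + 4 / real n) \<longlonglongrightarrow> 1 - 2 * kappa + 0"
    by (intro tendsto_add tendsto_diff tendsto_mult tendsto_const ratio inverse_n)
  moreover have "\<forall>\<^sub>F n in sequentially. 1 - 2 * (real (p n) / real n) + 4 / real n = dofS n / real n"
    using eventually_ge_at_top[of 1] by eventually_elim (simp add: dofS_def field_simps)
  ultimately show ?thesis by (simp add: tendsto_cong)
qed

lemma dof_top: "filterlim dofS at_top sequentially"
proof -
  have "filterlim (\<lambda>n. dofS n / real n * real n) at_top sequentially"
    by (rule filterlim_tendsto_pos_mult_at_top[OF dof_ratio _ n_top]) (use kappa_half in simp)
  moreover have "\<forall>\<^sub>F n in sequentially. dofS n / real n * real n = dofS n"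
    using eventually_ge_at_top[of 1] by eventually_elim simp
  ultimately show ?thesis by (simp cong: filterlim_cong)
qed

lemma inverse_dof: "(\<lambda>n. c / dofS n) \<longlonglongrightarrow> 0"
  by (intro tendsto_divide_0[OF tendsto_const] filterlim_at_top_imp_at_infinity dof_top)

lemma good_n: "\<forall>\<^sub>F n in sequentially. n \<ge> 1 \<and> 2 * p n \<le> n \<and> dofS n > 0"
proof -
  have "\<forall>\<^sub>F n in sequentially. dofS n \<ge> 4" using dof_top unfolding filterlim_at_top by blast
  then show ?thesis using eventually_ge_at_top[of 1]
    by eventually_elim (auto simp: dofS_def)
qed

lemma whp_full: "whp M (\<lambda>n \<omega>. fullS n \<omega>)"
  by (rule whp_AE) (use good_n in eventually_elim, use std_model.full_AE[OF std] in blast)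

lemma bil_limit:
  assumes v: "valid jj kk" and tu: "t \<le> 4" "u \<le> 4"
  shows "cprob M (\<lambda>n \<omega>. bilS n (jj n) (kk n) (sel jj kk n t) (sel jj kk n u) \<omega> / dofS n) (if t = u then 1 else 0)"
  unfolding cprob_def
proof (intro allI impI)
  fix d :: real assume d: "d > 0"
  let ?b = "\<lambda>n. bilS n (jj n) (kk n) (sel jj kk n t) (sel jj kk n u)"
  have "whp M (\<lambda>n \<omega>. \<not> (\<not> fullS n \<omega> \<or> d * dofS n \<le> \<bar>?b n \<omega> - (if t = u then dofS n else 0)\<bar>))"
  proof (rule whpI_bound[OF _ _ inverse_dof[of "2 / d\<^sup>2"]])
    show "\<forall>\<^sub>F n in sequentially. {\<omega> \<in> space (M n). \<not> \<not> (\<not> fullS n \<omega> \<or> d * dofS n \<le> \<bar>?b n \<omega> - (if t = u then dofS n else 0)\<bar>)} \<in> sets (M n)"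
      using v good_n
    proof eventually_elim
      case (elim n)
      have "d * dofS n > 0" using d elim by simp
      then show ?case unfolding not_not using elim tu by (intro bilS_bound(1)) auto
    qed
    show "\<forall>\<^sub>F n in sequentially. measure (M n) {\<omega> \<in> space (M n). \<not> \<not> (\<not> fullS n \<omega> \<or> d * dofS n \<le> \<bar>?b n \<omega> - (if t = u then dofS n else 0)\<bar>)} \<le> 2 / d\<^sup>2 / dofS n"
      using v good_n
    proof eventually_elim
      case (elim n)
      have "measure (M n) {\<omega> \<in> space (M n). \<not> fullS n \<omega> \<or> d * dofS n \<le> \<bar>?b n \<omega> - (if t = u then dofS n else 0)\<bar>}
          \<le> 2 * dofS n / (d * dofS n)\<^sup>2"
        using d elim tu by (intro bilS_bound(2)) auto
      also have "\<dots> = 2 / d\<^sup>2 / dofS n" using elim d by (simp add: power2_eq_square)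
      finally show ?case by simp
    qed
  qed
  then show "whp M (\<lambda>n \<omega>. \<bar>?b n \<omega> / dofS n - (if t = u then 1 else 0)\<bar> < d)"
  proof (rule whp_mp)
    show "\<forall>\<^sub>F n in sequentially. \<forall>\<omega>\<in>space (M n). \<not> (\<not> fullS n \<omega> \<or> d * dofS n \<le> \<bar>?b n \<omega> - (if t = u then dofS n else 0)\<bar>)
        \<longrightarrow> \<bar>?b n \<omega> / dofS n - (if t = u then 1 else 0)\<bar> < d"
      using v good_n
    proof (eventually_elim, intro ballI impI)
      fix n \<omega> assume vn: "jj n < p n \<and> kk n < p n \<and> jj n \<noteq> kk n" and g: "1 \<le> n \<and> 2 * p n \<le> n \<and> 0 < dofS n"
        and a: "\<not> (\<not> fullS n \<omega> \<or> d * dofS n \<le> \<bar>?b n \<omega> - (if t = u then dofS n else 0)\<bar>)"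
      have e: "(if t = u then dofS n else 0) = (if t = u then 1 else 0) * dofS n" by simp
      have "?b n \<omega> / dofS n - (if t = u then 1 else 0) = (?b n \<omega> - (if t = u then 1 else 0) * dofS n) / dofS n"
        using g by (simp add: diff_divide_distrib)
      then have "\<bar>?b n \<omega> / dofS n - (if t = u then 1 else 0)\<bar> = \<bar>?b n \<omega> - (if t = u then 1 else 0) * dofS n\<bar> / dofS n"
        using g by (simp only: abs_divide) simp
      also have "\<dots> < d" using a g unfolding e by (simp add: divide_less_eq)
      finally show "\<bar>?b n \<omega> / dofS n - (if t = u then 1 else 0)\<bar> < d" .
    qed
  qed
qed

lemma tight_bil:
  assumes v: "valid jj kk" and t: "t < 4"
  shows "tight_seq M (\<lambda>n \<omega>. sqrt (real n) * (sigma * bilS n (jj n) (kk n) (sel jj kk n t) (2 * p n) \<omega> / dofS n))"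
  unfolding tight_seq_def
proof (intro allI impI)
  fix e :: real assume e: "e > 0"
  let ?b = "\<lambda>n. bilS n (jj n) (kk n) (sel jj kk n t) (2 * p n)"
  \<comment> \<open>A strict upper bound for the limit of \<open>n / dofS n\<close>.\<close>
  define c0 where "c0 = 1 / (1 - 2 * kappa) + 1"
  have c0: "c0 > 0" using kappa_half by (simp add: c0_def add_pos_pos)
  \<comment> \<open>Chosen so that the bound \<open>2 * dofS n / T\<^sup>2\<close>, with
    \<open>T\<close> the size of the bilinear form corresponding to \<open>L\<close>, is at most
    \<open>2 * sigma\<^sup>2 * c0 / L\<^sup>2 = e\<close>.\<close>
  define L where "L = sqrt (2 * sigma\<^sup>2 * c0 / e)"
  have L: "L > 0" "L\<^sup>2 = 2 * sigma\<^sup>2 * c0 / e" using c0 e sigma_pos by (auto simp: L_def)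
  have "(\<lambda>n. inverse (dofS n / real n)) \<longlonglongrightarrow> inverse (1 - 2 * kappa)"
    by (intro tendsto_inverse dof_ratio) (use kappa_half in simp)
  then have "\<forall>\<^sub>F n in sequentially. inverse (dofS n / real n) < c0"
    by (rule order_tendstoD) (simp add: c0_def inverse_eq_divide)
  then have "\<forall>\<^sub>F n in sequentially.
     \<exists>N\<in>sets (M n). measure (M n) N \<le> e \<and> (\<forall>\<omega>\<in>space (M n) - N. \<bar>sqrt (real n) * (sigma * ?b n \<omega> / dofS n)\<bar> \<le> L)"
    using v good_n
  proof eventually_elim
    case (elim n)
    then have n: "n \<ge> 1" and np: "2 * p n \<le> n" and dof: "dofS n > 0" and vn: "jj n < p n \<and> kk n < p n \<and> jj n \<noteq> kk n"
      and r: "real n / dofS n < c0" by simp_all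
    define T where "T = L * dofS n / (sqrt (real n) * sigma)"
    have T: "T > 0" using L dof n sigma_pos by (simp add: T_def)
    let ?N = "{\<omega>\<in>space (M n). \<not> fullS n \<omega> \<or> T \<le> \<bar>?b n \<omega> - (if t = 4 then dofS n else 0)\<bar>}"
    have s4: "sel jj kk n 4 = 2 * p n" by (simp add: sel_def)
    have N: "?N \<in> sets (M n)" "measure (M n) ?N \<le> 2 * dofS n / T\<^sup>2"
      using bilS_bound[where jj=jj and kk=kk and n=n and t=t and u=4 and T=T, OF n vn np _ _ T, unfolded s4] t by simp_all
    have "2 * dofS n / T\<^sup>2 = 2 * sigma\<^sup>2 * (real n / dofS n) / L\<^sup>2"
      using dof n by (simp add: T_def power_divide power_mult_distrib power2_eq_square[of "dofS n"] field_simps)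
    also have "\<dots> \<le> 2 * sigma\<^sup>2 * c0 / L\<^sup>2"
      using r by (intro divide_right_mono mult_left_mono) auto
    also have "\<dots> = e" using L e c0 sigma_pos by simp
    finally have "measure (M n) ?N \<le> e" using N(2) by simp
    moreover have "\<bar>sqrt (real n) * (sigma * ?b n \<omega> / dofS n)\<bar> \<le> L" if "\<omega> \<in> space (M n) - ?N" for \<omega>
    proof -
      have "\<bar>?b n \<omega>\<bar> < T" using that t by auto
      then have "\<bar>?b n \<omega>\<bar> * (sqrt (real n) * sigma) < L * dofS n"
        unfolding T_def using n sigma_pos by (simp add: less_divide_eq)
      then have "\<bar>?b n \<omega>\<bar> * (sqrt (real n) * sigma) / dofS n \<le> L" using dof by (simp add: divide_le_eq)
      moreover have "\<bar>sqrt (real n) * (sigma * ?b n \<omega> / dofS n)\<bar> = \<bar>?b n \<omega>\<bar> * (sqrt (real n) * sigma) / dofS n"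
        using dof sigma_pos by (simp add: abs_mult)
      ultimately show ?thesis by simp
    qed
    ultimately show ?case using N(1) by (intro bexI[of _ ?N]) auto
  qed
  with L(1) show "\<exists>K>0. \<forall>\<^sub>F n in sequentially.
     \<exists>N\<in>sets (M n). measure (M n) N \<le> e \<and> (\<forall>\<omega>\<in>space (M n) - N. \<bar>sqrt (real n) * (sigma * ?b n \<omega> / dofS n)\<bar> \<le> K)"
    by blast
qed

text \<open>By \<open>near_identity_system\<close> the error is at most
  \<open>2 * 4 * D * rho\<close>, where \<open>D\<close> adds up the deviations of the matrix from
  the identity and \<open>rho\<close> the absolute right-hand sides. \<open>D\<close> tends to 0 in
  probability, and \<open>sqrt n * rho\<close> is a sum of tight terms.\<close>

lemma ols_err_limit:
  assumes v: "valid jj kk" and t: "t < 4"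
  shows "cprob M (\<lambda>n \<omega>. sqrt (real n) * (errS n \<omega> (sel jj kk n t)
      - sigma * bilS n (jj n) (kk n) (sel jj kk n t) (2 * p n) \<omega> / dofS n)) 0"
proof -
  let ?s = "sel jj kk"
  let ?b = "\<lambda>n. bilS n (jj n) (kk n)"
  define D where "D n \<omega> = (\<Sum>t<4. \<Sum>u<4. \<bar>?b n (?s n t) (?s n u) \<omega> / dofS n - (if t = u then 1 else 0)\<bar>)" for n \<omega>
  define Y where "Y u n \<omega> = sqrt (real n) * (sigma * ?b n (?s n u) (2 * p n) \<omega> / dofS n)" for u n \<omega>
  have D0: "cprob M D 0"
  proof -
    have "cprob M (\<lambda>n \<omega>. \<bar>?b n (?s n t) (?s n u) \<omega> / dofS n - (if t = u then 1 else 0)\<bar>) 0" if "t < 4" "u < 4" for t u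
    proof -
      have "cprob M (\<lambda>n \<omega>. ?b n (?s n t) (?s n u) \<omega> / dofS n - (if t = u then 1 else 0)) 0"
        using cprob_diff[OF bil_limit[OF v, of t u] cprob_const[of "if t = u then 1 else 0"]] that by simp
      then show ?thesis by (rule cprob_abs_le) (rule whp_always, simp)
    qed
    then have "cprob M (\<lambda>n \<omega>. \<Sum>t<4. \<Sum>u<4. \<bar>?b n (?s n t) (?s n u) \<omega> / dofS n - (if t = u then 1 else 0)\<bar>) (\<Sum>t<4::nat. \<Sum>u<4::nat. 0)"
      by (intro cprob_sum) auto
    then show ?thesis by (simp add: D_def[abs_def])
  qed
  have "cprob M (\<lambda>n \<omega>. \<Sum>u<4. 8 * \<bar>D n \<omega> * Y u n \<omega>\<bar>) (\<Sum>u<4::nat. 8 * 0)"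
  proof (intro cprob_sum cprob_cmult)
    fix u :: nat assume "u \<in> {..<4}"
    then have "cprob M (\<lambda>n \<omega>. D n \<omega> * Y u n \<omega>) 0"
      unfolding Y_def by (intro cprob_mult_tight D0 tight_bil v) auto
    then show "cprob M (\<lambda>n \<omega>. \<bar>D n \<omega> * Y u n \<omega>\<bar>) 0" by (rule cprob_abs_le) (rule whp_always, simp)
  qed simp
  then have lim: "cprob M (\<lambda>n \<omega>. \<Sum>u<4. 8 * \<bar>D n \<omega> * Y u n \<omega>\<bar>) 0" by simp
  show ?thesis
  proof (rule cprob_abs_le[OF lim])
    \<comment> \<open>With four unknowns this is the smallness condition
      \<open>card F * d \<le> 1 / 2\<close>.\<close>
    have "whp M (\<lambda>n \<omega>. \<bar>D n \<omega> - 0\<bar> < 1/8)" by (rule D0[unfolded cprob_def, rule_format]) simp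
    from whp_conj[OF this whp_full]
    show "whp M (\<lambda>n \<omega>. \<bar>sqrt (real n) * (errS n \<omega> (?s n t) - sigma * ?b n (?s n t) (2 * p n) \<omega> / dofS n)\<bar>
        \<le> \<bar>\<Sum>u<4. 8 * \<bar>D n \<omega> * Y u n \<omega>\<bar>\<bar>)"
    proof (rule whp_mp)
      show "\<forall>\<^sub>F n in sequentially. \<forall>\<omega>\<in>space (M n). \<bar>D n \<omega> - 0\<bar> < 1/8 \<and> fullS n \<omega> \<longrightarrow>
        \<bar>sqrt (real n) * (errS n \<omega> (?s n t) - sigma * ?b n (?s n t) (2 * p n) \<omega> / dofS n)\<bar>
        \<le> \<bar>\<Sum>u<4. 8 * \<bar>D n \<omega> * Y u n \<omega>\<bar>\<bar>"
        using v good_n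
      proof (eventually_elim, intro ballI impI)
        fix n \<omega> assume vn: "jj n < p n \<and> kk n < p n \<and> jj n \<noteq> kk n" and g: "1 \<le> n \<and> 2 * p n \<le> n \<and> 0 < dofS n"
          and a: "\<bar>D n \<omega> - 0\<bar> < 1/8 \<and> fullS n \<omega>"
        have n: "n \<ge> 1" and dof: "dofS n > 0" using g by auto
        let ?F = "std_model.four (p n) (jj n) (kk n)"
        let ?r = "\<lambda>f. sigma * ?b n f (2 * p n) \<omega>"
        have F: "?F = ?s n ` {..<4}" by (rule sel_four[OF n])
        have inj: "inj_on (?s n) {..<4}" using sel_inj[of jj n kk, OF vn] by (auto intro!: inj_onI)
        have cF: "card ?F = 4" unfolding F by (simp add: card_image[OF inj])
        define rho where "rho = (\<Sum>u<4. \<bar>?r (?s n u) / dofS n\<bar>)"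
        have D1: "D n \<omega> \<ge> 0" unfolding D_def by (intro sum_nonneg) auto
        have "\<bar>errS n \<omega> (?s n t) - ?r (?s n t) / dofS n\<bar> \<le> 2 * real (card ?F) * D n \<omega> * rho"
        proof (rule near_identity_system[where G="\<lambda>f l. ?b n f l \<omega>", of ?F "dofS n" ?r])
          show "finite ?F" "?F \<noteq> {}" unfolding F by (auto simp: lessThan_empty_iff)
          show "0 < dofS n" by fact
          show "?r f = (\<Sum>l\<in>?F. ?b n f l \<omega> * errS n \<omega> l)" if "f \<in> ?F" for f
            using std_model.ols_system[OF std[OF n]] vn that a by blast
          show "\<bar>?b n f l \<omega> / dofS n - (if f = l then 1 else 0)\<bar> \<le> D n \<omega>" if fl: "f \<in> ?F" "l \<in> ?F" for f l
          proof -
            from fl obtain t u where tu: "f = ?s n t" "l = ?s n u" "t < 4" "u < 4" unfolding F by auto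
            have "\<bar>?b n (?s n t) (?s n u) \<omega> / dofS n - (if t = u then 1 else 0)\<bar>
                \<le> (\<Sum>u<4. \<bar>?b n (?s n t) (?s n u) \<omega> / dofS n - (if t = u then 1 else 0)\<bar>)"
              using tu by (intro member_le_sum[of u]) auto
            also have "\<dots> \<le> D n \<omega>"
              unfolding D_def using tu
              by (intro member_le_sum[of t "{..<4}" "\<lambda>t. \<Sum>u<4. \<bar>?b n (?s n t) (?s n u) \<omega> / dofS n - (if t = u then 1 else 0)\<bar>"] sum_nonneg) auto
            finally show ?thesis using sel_inj[of jj n kk t u, OF vn] tu by simp
          qed
          show "real (card ?F) * D n \<omega> \<le> 1 / 2" using a D1 by (simp add: cF)
          show "\<bar>?r f / dofS n\<bar> \<le> rho" if "f \<in> ?F" for f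
          proof -
            from that obtain u where u: "f = ?s n u" "u < 4" unfolding F by auto
            then show ?thesis unfolding rho_def
              by (simp only: u(1)) (intro member_le_sum[of u "{..<4}" "\<lambda>u. \<bar>?r (?s n u) / dofS n\<bar>"], auto)
          qed
          show "?s n t \<in> ?F" using t by (simp add: F)
        qed
        then have "sqrt (real n) * \<bar>errS n \<omega> (?s n t) - ?r (?s n t) / dofS n\<bar> \<le> sqrt (real n) * (8 * D n \<omega> * rho)"
          unfolding cF by (intro mult_left_mono) auto
        also have "\<dots> = (\<Sum>u<4. 8 * \<bar>D n \<omega> * Y u n \<omega>\<bar>)"
          unfolding rho_def Y_def sum_distrib_left using D1 by (intro sum.cong refl) (simp add: abs_mult)
        finally show "\<bar>sqrt (real n) * (errS n \<omega> (?s n t) - sigma * ?b n (?s n t) (2 * p n) \<omega> / dofS n)\<bar>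
          \<le> \<bar>\<Sum>u<4. 8 * \<bar>D n \<omega> * Y u n \<omega>\<bar>\<bar>"
          by (simp add: abs_mult)
      qed
    qed
  qed
qed

text \<open>Taking the difference of the two estimates leaves \<open>bil_diff\<close>, whose size is
  \<open>sigma * sqrt 2\<close> times the norm of the projected noise. Divided by
  \<open>dofS n\<close> and multiplied by \<open>sqrt n\<close>, this is about
  \<open>sigma * sqrt 2 / sqrt (1 - 2 * kappa)\<close>, the reciprocal of \<open>s\<close>. The
  labels \<open>t < 2\<close> are the two variables.\<close>

lemma ols_diff_limit:
  assumes v: "valid jj kk" and s: "s = sqrt (1 - 2 * kappa) / sqrt (2 * sigma\<^sup>2)" and t: "t < 2"
    and tight: "tight_seq M (\<lambda>n. projS n (noiseS n (jj n) (kk n)) (sel jj kk n t))"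
  shows "cprob M (\<lambda>n \<omega>. s * sqrt (real n) * (olsS n \<omega> (sel jj kk n t) - olsS n \<omega> (sel jj kk n t + p n))
      - s * (sqrt (real n) * beta n \<omega> (sel jj kk n t)) - projS n (noiseS n (jj n) (kk n)) (sel jj kk n t) \<omega>) 0"
proof -
  let ?l = "\<lambda>n. sel jj kk n t"
  let ?h = "\<lambda>n. projS n (noiseS n (jj n) (kk n)) (?l n)"
  let ?q = "\<lambda>n \<omega>. bilS n (jj n) (kk n) (2 * p n) (2 * p n) \<omega>"
  let ?r = "\<lambda>n \<omega> f. sigma * bilS n (jj n) (kk n) f (2 * p n) \<omega>"
  have t2: "sel jj kk n (t + 2) = ?l n + p n" for n using t by (auto simp: sel_def)
  have E1: "cprob M (\<lambda>n \<omega>. sqrt (real n) * (errS n \<omega> (?l n) - ?r n \<omega> (?l n) / dofS n)) 0"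
    using t by (intro ols_err_limit v) auto
  have E2: "cprob M (\<lambda>n \<omega>. sqrt (real n) * (errS n \<omega> (?l n + p n) - ?r n \<omega> (?l n + p n) / dofS n)) 0"
    unfolding t2[symmetric] by (rule ols_err_limit[OF v]) (use t in simp)
  have q: "cprob M (\<lambda>n \<omega>. ?q n \<omega> / dofS n) 1"
    using bil_limit[OF v, of 4 4] by (simp add: sel_def)
  have "(\<lambda>n. sqrt (inverse (dofS n / real n))) \<longlonglongrightarrow> sqrt (inverse (1 - 2 * kappa))"
    by (intro tendsto_real_sqrt tendsto_inverse dof_ratio) (use kappa_half in simp)
  then have "cprob M (\<lambda>n \<omega>. s * sigma * sqrt 2 * (sqrt (inverse (dofS n / real n)) * sqrt (?q n \<omega> / dofS n)) - 1)
      (s * sigma * sqrt 2 * (sqrt (inverse (1 - 2 * kappa)) * sqrt 1) - 1)"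
    by (intro cprob_diff cprob_cmult cprob_mult cprob_const cprob_tendsto cprob_isCont[OF q] isCont_real_sqrt)
  moreover have "s * sigma * sqrt 2 * (sqrt (inverse (1 - 2 * kappa)) * sqrt 1) = 1"
    using kappa_half sigma_pos by (simp add: s real_sqrt_mult real_sqrt_inverse)
  ultimately have A: "cprob M (\<lambda>n \<omega>. s * sigma * sqrt 2 * (sqrt (inverse (dofS n / real n)) * sqrt (?q n \<omega> / dofS n)) - 1) 0"
    by simp
  have "cprob M (\<lambda>n \<omega>. s * (sqrt (real n) * (errS n \<omega> (?l n) - ?r n \<omega> (?l n) / dofS n))
      - s * (sqrt (real n) * (errS n \<omega> (?l n + p n) - ?r n \<omega> (?l n + p n) / dofS n))
      + (s * sigma * sqrt 2 * (sqrt (inverse (dofS n / real n)) * sqrt (?q n \<omega> / dofS n)) - 1) * ?h n \<omega>) (s * 0 - s * 0 + 0)"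
    by (intro cprob_add cprob_diff cprob_cmult E1 E2 cprob_mult_tight A tight)
  then have "cprob M (\<lambda>n \<omega>. s * (sqrt (real n) * (errS n \<omega> (?l n) - ?r n \<omega> (?l n) / dofS n))
      - s * (sqrt (real n) * (errS n \<omega> (?l n + p n) - ?r n \<omega> (?l n + p n) / dofS n))
      + (s * sigma * sqrt 2 * (sqrt (inverse (dofS n / real n)) * sqrt (?q n \<omega> / dofS n)) - 1) * ?h n \<omega>) 0" by simp
  then show ?thesis
  proof (rule cprob_cong')
    show "\<forall>\<^sub>F n in sequentially. \<forall>\<omega>\<in>space (M n).
      s * (sqrt (real n) * (errS n \<omega> (?l n) - ?r n \<omega> (?l n) / dofS n))
      - s * (sqrt (real n) * (errS n \<omega> (?l n + p n) - ?r n \<omega> (?l n + p n) / dofS n))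
      + (s * sigma * sqrt 2 * (sqrt (inverse (dofS n / real n)) * sqrt (?q n \<omega> / dofS n)) - 1) * ?h n \<omega>
      = s * sqrt (real n) * (olsS n \<omega> (?l n) - olsS n \<omega> (?l n + p n)) - s * (sqrt (real n) * beta n \<omega> (?l n)) - ?h n \<omega>"
      using v good_n
    proof (eventually_elim, intro ballI)
      fix n \<omega> assume vn: "jj n < p n \<and> kk n < p n \<and> jj n \<noteq> kk n" and g: "1 \<le> n \<and> 2 * p n \<le> n \<and> 0 < dofS n"
      have n: "n \<ge> 1" and dof: "dofS n > 0" using g by auto
      have l: "?l n < p n" using vn t by (auto simp: sel_def)
      have e1: "errS n \<omega> (?l n) = olsS n \<omega> (?l n) - beta n \<omega> (?l n)" and e2: "errS n \<omega> (?l n + p n) = olsS n \<omega> (?l n + p n)"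
        using l by (simp_all add: std_model.ols_err_def[OF std[OF n]])
      have r: "?r n \<omega> (?l n) - ?r n \<omega> (?l n + p n) = sigma * (sqrt (?q n \<omega>) * sqrt 2 * ?h n \<omega>)"
        unfolding right_diff_distrib[symmetric] by (simp only: std_model.bil_diff[OF std[OF n]])
      have rt: "sqrt (inverse (dofS n / real n)) * sqrt (?q n \<omega> / dofS n) = sqrt (real n) * sqrt (?q n \<omega>) / dofS n"
      proof -
        have "sqrt (inverse (dofS n / real n)) * sqrt (?q n \<omega> / dofS n) = sqrt (real n) * sqrt (?q n \<omega>) / (sqrt (dofS n) * sqrt (dofS n))"
          by (simp add: real_sqrt_divide real_sqrt_inverse inverse_eq_divide)
        also have "sqrt (dofS n) * sqrt (dofS n) = dofS n" using dof by simp
        finally show ?thesis .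
      qed
      have "s * (sqrt (real n) * (errS n \<omega> (?l n) - ?r n \<omega> (?l n) / dofS n))
        - s * (sqrt (real n) * (errS n \<omega> (?l n + p n) - ?r n \<omega> (?l n + p n) / dofS n))
        = s * sqrt (real n) * (olsS n \<omega> (?l n) - olsS n \<omega> (?l n + p n)) - s * (sqrt (real n) * beta n \<omega> (?l n))
          - s * sqrt (real n) * ((?r n \<omega> (?l n) - ?r n \<omega> (?l n + p n)) / dofS n)"
        unfolding e1 e2 by (simp add: algebra_simps diff_divide_distrib)
      moreover have "s * sqrt (real n) * ((?r n \<omega> (?l n) - ?r n \<omega> (?l n + p n)) / dofS n)
        = s * sigma * sqrt 2 * (sqrt (inverse (dofS n / real n)) * sqrt (?q n \<omega> / dofS n)) * ?h n \<omega>"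
        unfolding r rt by simp
      ultimately show "s * (sqrt (real n) * (errS n \<omega> (?l n) - ?r n \<omega> (?l n) / dofS n))
      - s * (sqrt (real n) * (errS n \<omega> (?l n + p n) - ?r n \<omega> (?l n + p n) / dofS n))
      + (s * sigma * sqrt 2 * (sqrt (inverse (dofS n / real n)) * sqrt (?q n \<omega> / dofS n)) - 1) * ?h n \<omega>
      = s * sqrt (real n) * (olsS n \<omega> (?l n) - olsS n \<omega> (?l n + p n)) - s * (sqrt (real n) * beta n \<omega> (?l n)) - ?h n \<omega>"
        by (simp add: algebra_simps)
    qed
  qed
qed

end

section \<open>Effective means of the two statistics\<close>

abbreviation "pair_lawS s n h1 h2 j k \<equiv> h1 \<in> borel_measurable (M n) \<and> h2 \<in> borel_measurable (M n) \<and>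
    distr (M n) ((borel \<Otimes>\<^sub>M borel) \<Otimes>\<^sub>M (borel \<Otimes>\<^sub>M borel))
      (\<lambda>\<omega>. ((s * (sqrt (real n) * beta n \<omega> j), h1 \<omega>), (s * (sqrt (real n) * beta n \<omega> k), h2 \<omega>)))
    = (distr nu borel (\<lambda>b. s * b) \<Otimes>\<^sub>M Nm) \<Otimes>\<^sub>M (distr nu borel (\<lambda>b. s * b) \<Otimes>\<^sub>M Nm)"

text \<open>The joint law makes each \<open>h\<close> exactly standard normal, with second moment
  1.\<close>

lemma pair_law_tight:
  assumes v: "valid jj kk" and law: "\<forall>\<^sub>F n in sequentially. pair_lawS s n (h1 n) (h2 n) (jj n) (kk n)"
  shows "tight_seq M h1" "tight_seq M h2"
proof -
  have "(\<lambda>b. s * b) \<in> borel_measurable nu"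
    unfolding measurable_cong_sets[OF nu(2) refl] by (intro borel_measurable_continuous_onI continuous_intros)
  then have D: "prob_space (distr nu borel (\<lambda>b. s * b))" by (rule prob_space.prob_space_distr[OF nu(1)])
  have "\<forall>\<^sub>F n in sequentially. (h1 n \<in> borel_measurable (M n) \<and> distr (M n) borel (h1 n) = Nm) \<and>
      (h2 n \<in> borel_measurable (M n) \<and> distr (M n) borel (h2 n) = Nm)"
    using law v eventually_ge_at_top[of 1]
  proof eventually_elim
    case (elim n)
    interpret std_model "M n" n "p n" "X n" "Xt n" "eps n" "beta n" sigma nu by (rule std[OF elim(3)])
    have m: "(\<lambda>\<omega>. s * (sqrt (real n) * beta n \<omega> l)) \<in> borel_measurable (M n)" if "l < p n" for l
      by (intro borel_measurable_times borel_measurable_const beta_meas[OF that])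
    show ?case
      using normal_marginals[OF m m _ _ D sets_distr, of "jj n" "kk n" "h1 n" "h2 n"] elim by auto
  qed
  then show "tight_seq M h1" "tight_seq M h2"
    by (auto intro!: tight_normal elim: eventually_mono)
qed

text \<open>Tightness of the witnesses may be assumed, since their law implies it. The scale uses
  \<open>max n 1\<close> because \<open>one_sided_effective_knockoff\<close> asks for a positive
  factor at every \<open>n\<close>.\<close>

lemma asymptotic_meansI:
  assumes mp: "means_profile (distr nu borel (\<lambda>b. s * b))"
    and Dm: "\<forall>\<^sub>F n in sequentially. \<forall>j<p n. (\<lambda>\<omega>. D n \<omega> j) \<in> borel_measurable (M n)"
    and wit: "\<And>jj kk. valid jj kk \<Longrightarrow> \<exists>h1 h2. (\<forall>\<^sub>F n in sequentially. pair_lawS s n (h1 n) (h2 n) (jj n) (kk n)) \<and>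
        (tight_seq M h1 \<longrightarrow> cprob M (\<lambda>n \<omega>. s * sqrt (real n) * D n \<omega> (jj n) - s * (sqrt (real n) * beta n \<omega> (jj n)) - h1 n \<omega>) 0) \<and>
        (tight_seq M h2 \<longrightarrow> cprob M (\<lambda>n \<omega>. s * sqrt (real n) * D n \<omega> (kk n) - s * (sqrt (real n) * beta n \<omega> (kk n)) - h2 n \<omega>) 0)"
  shows "asymptotic_means M (distr nu borel (\<lambda>b. s * b)) p (\<lambda>n \<omega> j. s * sqrt (real (max n 1)) * D n \<omega> j)
    (\<lambda>n \<omega> j. s * (sqrt (real (max n 1)) * beta n \<omega> j))"
proof (intro asymptotic_means.intro prob_seq_axioms mp asymptotic_means_axioms.intro p_top)
  interpret mp: means_profile "distr nu borel (\<lambda>b. s * b)" by (rule mp)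
  have max: "max n 1 = n" if "n \<ge> 1" for n :: nat using that by simp
  show "\<forall>\<^sub>F n in sequentially. \<forall>j<p n. (\<lambda>\<omega>. s * sqrt (real (max n 1)) * D n \<omega> j) \<in> borel_measurable (M n)"
    using Dm by eventually_elim (auto intro!: borel_measurable_times)
  show "\<forall>\<^sub>F n in sequentially. \<forall>j<p n. (\<lambda>\<omega>. s * (sqrt (real (max n 1)) * beta n \<omega> j)) \<in> borel_measurable (M n)"
    using eventually_ge_at_top[of 1] 
    by eventually_elim (auto intro!: borel_measurable_times std_model.beta_meas[OF std])
  fix jj kk assume v: "valid jj kk"
  from wit[OF v] obtain h1 h2 where law: "\<forall>\<^sub>F n in sequentially. pair_lawS s n (h1 n) (h2 n) (jj n) (kk n)"
    and l1: "tight_seq M h1 \<Longrightarrow> cprob M (\<lambda>n \<omega>. s * sqrt (real n) * D n \<omega> (jj n) - s * (sqrt (real n) * beta n \<omega> (jj n)) - h1 n \<omega>) 0"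
    and l2: "tight_seq M h2 \<Longrightarrow> cprob M (\<lambda>n \<omega>. s * sqrt (real n) * D n \<omega> (kk n) - s * (sqrt (real n) * beta n \<omega> (kk n)) - h2 n \<omega>) 0"
    by blast
  show "\<exists>h1 h2. (\<forall>\<^sub>F n in sequentially. h1 n \<in> borel_measurable (M n) \<and> h2 n \<in> borel_measurable (M n) \<and>
          distr (M n) ((borel \<Otimes>\<^sub>M borel) \<Otimes>\<^sub>M (borel \<Otimes>\<^sub>M borel))
            (\<lambda>\<omega>. ((s * (sqrt (real (max n 1)) * beta n \<omega> (jj n)), h1 n \<omega>), (s * (sqrt (real (max n 1)) * beta n \<omega> (kk n)), h2 n \<omega>)))
          = mp.joint \<Otimes>\<^sub>M mp.joint) \<and>
        cprob M (\<lambda>n \<omega>. s * sqrt (real (max n 1)) * D n \<omega> (jj n) - s * (sqrt (real (max n 1)) * beta n \<omega> (jj n)) - h1 n \<omega>) 0 \<and>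
        cprob M (\<lambda>n \<omega>. s * sqrt (real (max n 1)) * D n \<omega> (kk n) - s * (sqrt (real (max n 1)) * beta n \<omega> (kk n)) - h2 n \<omega>) 0"
  proof (rule exI[of _ h1], rule exI[of _ h2], intro conjI)
    show "\<forall>\<^sub>F n in sequentially. h1 n \<in> borel_measurable (M n) \<and> h2 n \<in> borel_measurable (M n) \<and>
          distr (M n) ((borel \<Otimes>\<^sub>M borel) \<Otimes>\<^sub>M (borel \<Otimes>\<^sub>M borel))
            (\<lambda>\<omega>. ((s * (sqrt (real (max n 1)) * beta n \<omega> (jj n)), h1 n \<omega>), (s * (sqrt (real (max n 1)) * beta n \<omega> (kk n)), h2 n \<omega>)))
          = mp.joint \<Otimes>\<^sub>M mp.joint"
      using law eventually_ge_at_top[of 1] by eventually_elim (simp add: mp.joint_def max)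
    show "cprob M (\<lambda>n \<omega>. s * sqrt (real (max n 1)) * D n \<omega> (jj n) - s * (sqrt (real (max n 1)) * beta n \<omega> (jj n)) - h1 n \<omega>) 0"
      by (rule cprob_cong'[OF l1[OF pair_law_tight(1)[OF v law]]]) (use eventually_ge_at_top[of 1] in eventually_elim, simp add: max)
    show "cprob M (\<lambda>n \<omega>. s * sqrt (real (max n 1)) * D n \<omega> (kk n) - s * (sqrt (real (max n 1)) * beta n \<omega> (kk n)) - h2 n \<omega>) 0"
      by (rule cprob_cong'[OF l2[OF pair_law_tight(2)[OF v law]]]) (use eventually_ge_at_top[of 1] in eventually_elim, simp add: max)
  qed
qed

lemma cov_diff_meas:
  assumes "n \<ge> 1" "j < p n" shows "(\<lambda>\<omega>. cov_diff n \<omega> j) \<in> borel_measurable (M n)"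
proof -
  interpret std_model "M n" n "p n" "X n" "Xt n" "eps n" "beta n" sigma nu by (rule std[OF assms(1)])
  have x: "(\<lambda>\<omega>. X n \<omega> i l) \<in> borel_measurable (M n)" "(\<lambda>\<omega>. Xt n \<omega> i l) \<in> borel_measurable (M n)" if "i < n" "l < p n" for i l
    using C_meas[OF that(1), of l] C_meas[OF that(1), of "l + p n"] that by (simp_all add: C_simps)
  have e: "(\<lambda>\<omega>. eps n \<omega> i) \<in> borel_measurable (M n)" if "i < n" for i
  proof -
    have "(\<lambda>\<omega>. sigma * C \<omega> i (2 * p n)) \<in> borel_measurable (M n)" using C_meas[OF that, of "2 * p n"] by simp
    then show ?thesis using sigma_pos by (simp add: C_simps)
  qed
  show ?thesis
    unfolding cov_diff_def response_def using assms
    by (intro borel_measurable_diff borel_measurable_divide borel_measurable_sum borel_measurable_times borel_measurable_add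
        borel_measurable_const x e beta_meas) auto
qed

lemma asymptotic_means_cov:
  assumes "means_profile (distr nu borel (\<lambda>b. s * b))" and s: "s = 1 / sqrt (2 * (sigma\<^sup>2 + kappa * m2))"
  shows "asymptotic_means M (distr nu borel (\<lambda>b. s * b)) p (\<lambda>n \<omega> j. s * sqrt (real (max n 1)) * cov_diff n \<omega> j)
    (\<lambda>n \<omega> j. s * (sqrt (real (max n 1)) * beta n \<omega> j))"
proof (rule asymptotic_meansI[OF assms(1)])
  show "\<forall>\<^sub>F n in sequentially. \<forall>j<p n. (\<lambda>\<omega>. cov_diff n \<omega> j) \<in> borel_measurable (M n)"
    using eventually_ge_at_top[of 1] by eventually_elim (use cov_diff_meas in blast)
  fix jj kk assume v: "valid jj kk"
  \<comment> \<open>For \<open>kk\<close> the roles are exchanged so that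
    \<open>cov_diff_limit\<close> applies verbatim; the remainder itself is symmetric in the two
    variables.\<close>
  let ?h1 = "\<lambda>n. projS n (remS n (jj n) (kk n)) (jj n)" and ?h2 = "\<lambda>n. projS n (remS n (kk n) (jj n)) (kk n)"
  have "\<forall>\<^sub>F n in sequentially. pair_lawS s n (?h1 n) (?h2 n) (jj n) (kk n)"
    using v eventually_ge_at_top[of 1]
  proof eventually_elim
    case (elim n)
    then have "remS n (kk n) (jj n) = remS n (jj n) (kk n)" by (intro remainder_commute) simp
    then show ?case using std_model.proj_diff_remainder_law[OF std[OF elim(2)]] elim(1) by (simp only:) blast
  qed
  moreover have "cprob M (\<lambda>n \<omega>. s * sqrt (real n) * cov_diff n \<omega> (jj n) - s * (sqrt (real n) * beta n \<omega> (jj n)) - ?h1 n \<omega>) 0"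
    if "tight_seq M ?h1" by (rule cov_diff_limit[OF v s that])
  moreover have "cprob M (\<lambda>n \<omega>. s * sqrt (real n) * cov_diff n \<omega> (kk n) - s * (sqrt (real n) * beta n \<omega> (kk n)) - ?h2 n \<omega>) 0"
    if "tight_seq M ?h2" by (rule cov_diff_limit[OF valid_swap[OF v] s that])
  ultimately show "\<exists>h1 h2. (\<forall>\<^sub>F n in sequentially. pair_lawS s n (h1 n) (h2 n) (jj n) (kk n)) \<and>
        (tight_seq M h1 \<longrightarrow> cprob M (\<lambda>n \<omega>. s * sqrt (real n) * cov_diff n \<omega> (jj n) - s * (sqrt (real n) * beta n \<omega> (jj n)) - h1 n \<omega>) 0) \<and>
        (tight_seq M h2 \<longrightarrow> cprob M (\<lambda>n \<omega>. s * sqrt (real n) * cov_diff n \<omega> (kk n) - s * (sqrt (real n) * beta n \<omega> (kk n)) - h2 n \<omega>) 0)"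
    by (intro exI[of _ ?h1] exI[of _ ?h2] conjI impI)
qed

text \<open>Written out so that it unfolds to \<open>ols_stat\<close> for every \<open>n\<close>,
  whereas \<open>olsS\<close> describes the model only for \<open>n \<ge> 1\<close>.\<close>

definition ols_diff :: "nat \<Rightarrow> 'a \<Rightarrow> nat \<Rightarrow> real" where
  "ols_diff n \<omega> j =
    (let b = least_squares n (2 * p n) (\<lambda>i k. if k < p n then X n \<omega> i k else Xt n \<omega> i (k - p n))
        (response (p n) (X n \<omega>) (beta n \<omega>) (eps n \<omega>)) in b j - b (j + p n))"

lemma ols_diff_eq: "n \<ge> 1 \<Longrightarrow> ols_diff n \<omega> j = olsS n \<omega> j - olsS n \<omega> (j + p n)"
proof -
  assume n: "n \<ge> 1"
  have "std_model.design_all (p n) (X n) (Xt n) \<omega> = (\<lambda>i k. if k < p n then X n \<omega> i k else Xt n \<omega> i (k - p n))"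
    by (intro ext std_model.design_all_def[OF std[OF n]])
  then show ?thesis by (simp add: ols_diff_def std_model.ols_coef_def[OF std[OF n]] Let_def)
qed

lemma asymptotic_means_ols:
  assumes "means_profile (distr nu borel (\<lambda>b. s * b))" and kh: "kappa < 1/2" and s: "s = sqrt (1 - 2 * kappa) / sqrt (2 * sigma\<^sup>2)"
  shows "asymptotic_means M (distr nu borel (\<lambda>b. s * b)) p (\<lambda>n \<omega> j. s * sqrt (real (max n 1)) * ols_diff n \<omega> j)
    (\<lambda>n \<omega> j. s * (sqrt (real (max n 1)) * beta n \<omega> j))"
proof (rule asymptotic_meansI[OF assms(1)])
  show "\<forall>\<^sub>F n in sequentially. \<forall>j<p n. (\<lambda>\<omega>. ols_diff n \<omega> j) \<in> borel_measurable (M n)"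
    using eventually_ge_at_top[of 1]
  proof (eventually_elim, intro allI impI)
    fix n j assume "1 \<le> n" "j < p n"
    then show "(\<lambda>\<omega>. ols_diff n \<omega> j) \<in> borel_measurable (M n)"
      unfolding ols_diff_eq[OF \<open>1 \<le> n\<close>] by (intro borel_measurable_diff std_model.ols_coef_meas[OF std]) linarith+
  qed
  fix jj kk assume v: "valid jj kk"
  let ?h1 = "\<lambda>n. projS n (noiseS n (jj n) (kk n)) (jj n)" and ?h2 = "\<lambda>n. projS n (noiseS n (jj n) (kk n)) (kk n)"
  have "\<forall>\<^sub>F n in sequentially. pair_lawS s n (?h1 n) (?h2 n) (jj n) (kk n)"
    using v eventually_ge_at_top[of 1]
    by eventually_elim (use std_model.proj_noise_law[OF std] in blast)
  moreover have "cprob M (\<lambda>n \<omega>. s * sqrt (real n) * ols_diff n \<omega> (jj n) - s * (sqrt (real n) * beta n \<omega> (jj n)) - ?h1 n \<omega>) 0"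
    if "tight_seq M ?h1"
  proof -
    have "cprob M (\<lambda>n \<omega>. s * sqrt (real n) * (olsS n \<omega> (jj n) - olsS n \<omega> (jj n + p n)) - s * (sqrt (real n) * beta n \<omega> (jj n)) - ?h1 n \<omega>) 0"
      using ols_diff_limit[OF kh v s, of 0] that by (simp add: sel_def)
    then show ?thesis
      by (rule cprob_cong') (use eventually_ge_at_top[of 1] in eventually_elim, simp add: ols_diff_eq)
  qed
  moreover have "cprob M (\<lambda>n \<omega>. s * sqrt (real n) * ols_diff n \<omega> (kk n) - s * (sqrt (real n) * beta n \<omega> (kk n)) - ?h2 n \<omega>) 0"
    if "tight_seq M ?h2"
  proof -
    have "cprob M (\<lambda>n \<omega>. s * sqrt (real n) * (olsS n \<omega> (kk n) - olsS n \<omega> (kk n + p n)) - s * (sqrt (real n) * beta n \<omega> (kk n)) - ?h2 n \<omega>) 0"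
      using ols_diff_limit[OF kh v s, of 1] that by (simp add: sel_def)
    then show ?thesis
      by (rule cprob_cong') (use eventually_ge_at_top[of 1] in eventually_elim, simp add: ols_diff_eq)
  qed
  ultimately show "\<exists>h1 h2. (\<forall>\<^sub>F n in sequentially. pair_lawS s n (h1 n) (h2 n) (jj n) (kk n)) \<and>
        (tight_seq M h1 \<longrightarrow> cprob M (\<lambda>n \<omega>. s * sqrt (real n) * ols_diff n \<omega> (jj n) - s * (sqrt (real n) * beta n \<omega> (jj n)) - h1 n \<omega>) 0) \<and>
        (tight_seq M h2 \<longrightarrow> cprob M (\<lambda>n \<omega>. s * sqrt (real n) * ols_diff n \<omega> (kk n) - s * (sqrt (real n) * beta n \<omega> (kk n)) - h2 n \<omega>) 0)"
    by (intro exI[of _ ?h1] exI[of _ ?h2] conjI impI)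
qed

end

section \<open>Almost every level, and the law of the coefficients\<close>

lemma (in asymptotic_means) effective_knockoff_AE:
  assumes S0: "\<And>n \<omega> j. j < p n \<Longrightarrow> j \<in> S0 n \<omega> \<longleftrightarrow> mu n \<omega> j = 0"
    and c: "\<And>n. c n > 0" and Z: "\<And>n \<omega> j. Z n \<omega> j = c n * W n \<omega> j"
  shows "AE q in lborel. one_sided_effective M p (\<lambda>n \<omega>. knockoff_filter q (p n) (W n \<omega>)) S0 (adapt (1/2) q) pi_mu \<and>
    (adapt_le_half q pi_mu \<longrightarrow>
      one_sided_effective M p (\<lambda>n \<omega>. knockoff_filter q (p n) (W n \<omega>)) S0 (adapt 1 q) pi_mu)"
proof -
  \<comment> \<open>The only use of "almost every": a countable set of levels has Lebesgue measure
    0.\<close>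
  have "AE q in lborel. q \<notin> touching_levels"
    by (intro AE_not_in countable_imp_null_set_lborel countable_touching_levels)
  then show ?thesis
    by eventually_elim (use one_sided_effective_knockoff[of S0 c W, OF S0 c Z] in blast)
qed

lemma means_profile_scaled:
  assumes "prob_space nu" "sets nu = sets borel" "measure nu {0} > 0" "measure nu (- {0}) > 0" and s: "s > 0"
  shows "means_profile (distr nu borel (\<lambda>b. s * b :: real))"
proof (rule means_profile.intro)
  have m: "(\<lambda>b. s * b) \<in> borel_measurable nu"
    unfolding measurable_cong_sets[OF assms(2) refl] by (intro borel_measurable_continuous_onI continuous_intros)
  have sp: "space nu = UNIV" using sets_eq_imp_space_eq[OF assms(2)] by simp
  show "prob_space (distr nu borel (\<lambda>b. s * b))" by (rule prob_space.prob_space_distr[OF assms(1) m])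
  have "(\<lambda>b. s * b) -` {0} = {0}" "(\<lambda>b. s * b) -` (- {0}) = - {0}" using s by auto
  then show "measure (distr nu borel (\<lambda>b. s * b)) {0} > 0" "measure (distr nu borel (\<lambda>b. s * b)) (- {0}) > 0"
    using assms(3,4) by (simp_all add: measure_distr[OF m] sp)
qed simp

text \<open>The atom at 0 supplies nulls and the slab supplies non-nulls, both in positive
  proportion. The bound \<open>max C 0\<close> visibly covers the atom.\<close>

lemma spike_slab_facts:
  assumes g: "0 < g" "g < 1"
    and pi1: "prob_space pi1" "sets pi1 = sets borel" "AE x in pi1. \<bar>x\<bar> \<le> C" "measure pi1 {0} = 0"
  shows "prob_space (spike_slab g pi1)" "sets (spike_slab g pi1) = sets borel"
    "AE x in spike_slab g pi1. \<bar>x\<bar> \<le> max C 0"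
    "measure (spike_slab g pi1) {0} > 0" "measure (spike_slab g pi1) (- {0}) > 0"
proof -
  interpret pi1: prob_space pi1 by (rule pi1(1))
  have s: "(\<lambda>spike. if spike then return borel 0 else pi1)
      \<in> measurable (measure_pmf (bernoulli_pmf g)) (subprob_algebra (borel :: real measure))"
    using pi1 by (auto simp: space_subprob_algebra prob_space_imp_subprob_space prob_space_return)
  show sets: "sets (spike_slab g pi1) = sets borel"
    unfolding spike_slab_def by (rule sets_bind[of _ _ borel]) (use pi1 in auto)
  then have sp: "space (spike_slab g pi1) = UNIV" using sets_eq_imp_space_eq by fastforce
  have sp1: "space pi1 = UNIV" using sets_eq_imp_space_eq[OF pi1(2)] by simp
  note em = emeasure_spike_slab[OF less_imp_le[OF g(1)] less_imp_le[OF g(2)] pi1(1,2)]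
  have g1: "ennreal g + ennreal (1 - g) = 1" using g by (simp flip: ennreal_plus)
  show ps: "prob_space (spike_slab g pi1)"
    by (rule prob_spaceI) (use em[of UNIV] pi1.emeasure_space_1 g1 in \<open>simp add: sp sp1\<close>)
  interpret sl: prob_space "spike_slab g pi1" by (rule ps)
  have "emeasure pi1 {x. \<not> \<bar>x\<bar> \<le> C} = 0"
    using pi1(3) by (subst (asm) AE_iff_measurable[OF _ refl]) (auto simp: sp1 pi1(2))
  then have "emeasure pi1 {x. \<not> \<bar>x\<bar> \<le> max C 0} = 0"
    by (rule emeasure_eq_0[rotated]) (auto simp: pi1(2))
  then have "emeasure (spike_slab g pi1) {x. \<not> \<bar>x\<bar> \<le> max C 0} = 0" by (subst em) auto
  then show "AE x in spike_slab g pi1. \<bar>x\<bar> \<le> max C 0"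
    by (subst AE_iff_measurable[OF _ refl]) (auto simp: sp sets)
  have "emeasure (spike_slab g pi1) {0} = ennreal g"
    using pi1(4) by (subst em) (auto simp: pi1.emeasure_eq_measure)
  then have 0: "measure (spike_slab g pi1) {0} = g" using g by (simp add: measure_def)
  then show "measure (spike_slab g pi1) {0} > 0" using g by simp
  have "measure (spike_slab g pi1) (- {0}) = 1 - g"
    using sl.prob_compl[of "{0}"] 0 by (simp add: sets sp Compl_eq_Diff_UNIV)
  then show "measure (spike_slab g pi1) (- {0}) > 0" using g by simp
qed

theorem theorem6:
  fixes M :: "nat \<Rightarrow> 'a measure"
    and p :: "nat \<Rightarrow> nat"
    and X Xt :: "nat \<Rightarrow> 'a \<Rightarrow> nat \<Rightarrow> nat \<Rightarrow> real"
    and eps beta :: "nat \<Rightarrow> 'a \<Rightarrow> nat \<Rightarrow> real"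
    and kappa sigma g :: real
    and pi1 :: "real measure"
  assumes kappa: "kappa > 0" "(\<lambda>n. real (p n) / real n) \<longlonglongrightarrow> kappa"
    and sigma: "sigma > 0"
    and g: "0 < g" "g < 1"
    and pi1: "prob_space pi1" "sets pi1 = sets borel"
      "\<exists>C. AE x in pi1. \<bar>x\<bar> \<le> C" "measure pi1 {0} = 0"
    and model: "\<And>n. n \<ge> 1 \<Longrightarrow>
      knockoff_linear_model (M n) n (p n) (X n) (Xt n) (eps n) (beta n) sigma (spike_slab g pi1)"
  defines "B0 \<equiv> spike_slab g pi1"
  defines "selected \<equiv> (\<lambda>stat q n \<omega>.
      knockoffs stat (\<lambda>x y. x - y) q n (p n) (X n \<omega>) (Xt n \<omega>)
        (response (p n) (X n \<omega>) (beta n \<omega>) (eps n \<omega>)))"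
  defines "S0 \<equiv> (\<lambda>n \<omega>. nulls (p n) (beta n \<omega>))"
  defines "pi_mc \<equiv> distr B0 borel (\<lambda>b. 1 / sqrt (2 * (sigma\<^sup>2 + kappa * (\<integral>x. x\<^sup>2 \<partial>B0))) * b)"
  defines "pi_ols \<equiv> distr B0 borel (\<lambda>b. sqrt (1 - 2 * kappa) / sqrt (2 * sigma\<^sup>2) * b)"
  shows "AE q in lborel. 0 < q \<and> q < 1 \<longrightarrow>
    (one_sided_effective M p (selected marginal_cov_stat q) S0 (adapt (1/2) q) pi_mc \<and>
     (adapt_le_half q pi_mc \<longrightarrow>
       one_sided_effective M p (selected marginal_cov_stat q) S0 (adapt 1 q) pi_mc)) \<and>
    (kappa < 1/2 \<longrightarrow>
      one_sided_effective M p (selected ols_stat q) S0 (adapt (1/2) q) pi_ols \<and>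
      (adapt_le_half q pi_ols \<longrightarrow>
        one_sided_effective M p (selected ols_stat q) S0 (adapt 1 q) pi_ols))"
proof -
  from pi1(3) obtain C where C: "AE x in pi1. \<bar>x\<bar> \<le> C" by blast
  note ss = spike_slab_facts[OF g pi1(1,2) C pi1(4)]
  interpret model_seq M p X Xt eps beta kappa sigma B0 "max C 0"
    unfolding B0_def by (rule model_seq.intro[OF kappa sigma ss(1-3) model])
  note profile = means_profile_scaled[OF ss(1,2,4,5), folded B0_def]
  \<comment> \<open>A positive scale preserves zero, so nulls of the linear model correspond to mean
    0 in the normal means model.\<close>
  have S0: "j \<in> S0 n \<omega> \<longleftrightarrow> s * (sqrt (real (max n 1)) * beta n \<omega> j) = 0" if "s > 0" "j < p n" for s n \<omega> j
    using that by (auto simp: S0_def nulls_def)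
  have c: "s * sqrt (real (max n 1)) > 0" if "s > 0" for s and n :: nat using that by simp
  have m2: "m2 \<ge> 0" unfolding m2_def by simp
  have "AE q in lborel. one_sided_effective M p (selected marginal_cov_stat q) S0 (adapt (1/2) q) pi_mc \<and>
     (adapt_le_half q pi_mc \<longrightarrow> one_sided_effective M p (selected marginal_cov_stat q) S0 (adapt 1 q) pi_mc)"
  proof -
    define s where "s = 1 / sqrt (2 * (sigma\<^sup>2 + kappa * m2))"
    have s: "s > 0" unfolding s_def using kappa(1) sigma m2 by (simp add: add_pos_nonneg)
    interpret asymptotic_means M "distr B0 borel (\<lambda>b. s * b)" p "\<lambda>n \<omega> j. s * sqrt (real (max n 1)) * cov_diff n \<omega> j"
        "\<lambda>n \<omega> j. s * (sqrt (real (max n 1)) * beta n \<omega> j)"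
      by (rule asymptotic_means_cov[OF profile[OF s] s_def])
    have "selected marginal_cov_stat q = (\<lambda>n \<omega>. knockoff_filter q (p n) (cov_diff n \<omega>))" for q
      by (simp add: selected_def knockoffs_def marginal_cov_stat_def cov_diff_def[abs_def] fun_eq_iff)
    then show ?thesis
      using effective_knockoff_AE[OF S0[OF s] c[OF s] refl] by (simp add: pi_mc_def s_def m2_def)
  qed
  moreover have "AE q in lborel. one_sided_effective M p (selected ols_stat q) S0 (adapt (1/2) q) pi_ols \<and>
     (adapt_le_half q pi_ols \<longrightarrow> one_sided_effective M p (selected ols_stat q) S0 (adapt 1 q) pi_ols)" if k: "kappa < 1/2"
  proof -
    define s where "s = sqrt (1 - 2 * kappa) / sqrt (2 * sigma\<^sup>2)"
    have s: "s > 0" unfolding s_def using k sigma by simp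
    interpret asymptotic_means M "distr B0 borel (\<lambda>b. s * b)" p "\<lambda>n \<omega> j. s * sqrt (real (max n 1)) * ols_diff n \<omega> j"
        "\<lambda>n \<omega> j. s * (sqrt (real (max n 1)) * beta n \<omega> j)"
      by (rule asymptotic_means_ols[OF profile[OF s] k s_def])
    have "selected ols_stat q = (\<lambda>n \<omega>. knockoff_filter q (p n) (ols_diff n \<omega>))" for q
      by (simp add: selected_def knockoffs_def ols_stat_def ols_diff_def[abs_def] fun_eq_iff Let_def)
    then show ?thesis
      using effective_knockoff_AE[OF S0[OF s] c[OF s] refl] by (simp add: pi_ols_def s_def)
  qed
  \<comment> \<open>The condition on \<open>kappa\<close> does not involve \<open>q\<close>; the
    case split takes it out of the almost-everywhere statement.\<close>
  ultimately show ?thesis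
    by (cases "kappa < 1/2") (auto elim: eventually_elim2 eventually_mono)
qed

end
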